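(* Fix $d\in\mathbb{N}$ and $n\ge d$. Let $\xi_1,\dots,\xi_n$ be (possibly dependent) random vectors in $\mathbb{R}^d$, let $S_0=0$ and $S_i=\xi_1+\dots+\xi_i$ for $1\le i\le n$, and let $\mathcal{Q}_{n,d}=\mathrm{conv}(S_0,S_1,\dots,S_n)$. Assume: (Ex) for every permutation $\pi$ of $\{1,\dots,n\}$, $(\xi_{\pi(1)},\dots,\xi_{\pi(n)})$ has the same distribution as $(\xi_1,\dots,\xi_n)$; (GP) for all $1\le i_1<\dots<i_d\le n$, the probability that $S_{i_1},\dots,S_{i_d}$ are linearly dependent is $0$. Then for all $j\in\{0,\dots,d-1\}$ and $k\in\{j,\dots,d-1\}$, $$\mathbb{E}\sum_{F\in\mathcal{F}_j(\mathcal{Q}_{n,d})}\upsilon_k\big(T_F(\mathcal{Q}_{n,d})\big)=\frac{j!}{n!}\genfrac{[}{]}{0pt}{}{n+1}{k+1}\genfrac{\{}{\}}{0pt}{}{k+1}{j+1}.$$ In the remaining case $j\in\{0,\dots,d-1\}$ and $k=d$, $$\mathbb{E}\sum_{F\in\mathcal{F}_j(\mathcal{Q}_{n,d})}\upsilon_d\big(T_F(\mathcal{Q}_{n,d})\big)=\frac{j!}{n!}\sum_{s=0}^{\infty}(-1)^s\genfrac{[}{]}{0pt}{}{n+1}{d-s}\genfrac{\{}{\}}{0pt}{}{d-s}{j+1}=\frac{j!}{n!}\sum_{s=1}^{\infty}(-1)^{s+1}\genfrac{[}{]}{0pt}{}{n+1}{d+s}\genfrac{\{}{\}}{0pt}{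}{d+s}{j+1}.$$
   Context: $\mathbb{N}=\{1,2,\dots\}$. A polyhedral cone is the set of nonnegative linear combinations of finitely many vectors. The solid angle of a polyhedral cone $C$ is $\alpha(C)=\mathbb{P}[Z\in C]$ with $Z$ uniformly distributed on the unit sphere of the linear hull of $C$; $\alpha(C)=1$ if $C$ is a linear subspace (including $C=\{0\}$). For a polyhedral set $P\subset\mathbb{R}^d$ (finite intersection of closed half-spaces; polytopes and polyhedral cones are special cases), $\mathcal{F}_j(P)$ is the set of its $j$-dimensional faces ($P$ itself being a face). The tangent cone at a face $F$ is $T_F(P)=\{v\in\mathbb{R}^d: f_0+\varepsilon v\in P\text{ for some }\varepsilon>0\}$, where $f_0$ is any point of the relative interior of $F$. The normal cone is the polar cone $N_F(P)=\{w:\langle w,u\rangle\le 0\ \text{for all } u\in T_F(P)\}$. For a random polytope these objects are computed for each realization. The $k$-th conic intrinsic volume of a polyhedral cone $C\subset\mathbb{R}^d$, $k\in\{0,\dots,d\}$, is $\upsilon_k(C)=\sum_{F\in\mathcal{F}_k(C)}\alpha(F)\,\alpha(N_F(C))$. $\genfrac{[}{]}{0pt}{}{n}{m}$ is the (signless) Stirling number of the first kind (number of permutations of an $n$-element set with exactly $m$ cycles) and $\genfrac{\{}{\}}{0pt}{}{n}{m}$ the Stirling number of the second kind (number of partitions of an $n$-element set into $m$ non-empty subsets), for $n\in\mathbb{N}$, $m\in\{1,\dots,n\}$; both are $0$ for $n\in\mathbb{N}$ and $m\notin\{1,\dots,n\}$. A product $\genfrac{[}{]}{0pt}{}{n+1}{m}\genfrac{\{}{\}}{0pt}{}{m}{i}$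 with $m\le 0$ is $0$, so all sums are finite. *)

theory Defs
  imports "HOL-Probability.Probability" "HOL-Combinatorics.Stirling"
begin

section \<open>Uniform distribution on the unit sphere of a linear subspace\<close>

definition std_gaussian :: "'a::euclidean_space measure" where
  "std_gaussian =
     density lborel (\<lambda>x. ennreal (exp (- (norm x)\<^sup>2 / 2) / sqrt (2 * pi) ^ DIM('a)))"

text \<open>
  For a linear subspace \<open>L \<noteq> {0}\<close>, this is the uniform distribution on \<open>L \<inter> sphere 0 1\<close>: the
  orthogonal projection of a standard Gaussian vector to \<open>L\<close> (for a subspace,
  \<^const>\<open>closest_point\<close> is the orthogonal projection) is a standard Gaussian vector in \<open>L\<close>, and
  its direction \<open>sgn v = v /\<^sub>R norm v\<close> is uniformly distributed.  The lemmas
  \<open>prob_space_uniform_sphere\<close>, \<open>AE_uniform_sphere\<close> and \<open>uniform_sphere_invariant\<close> below state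
  the defining properties: it is the probability measure concentrated on the unit sphere of \<open>L\<close>
  that is invariant under all orthogonal transformations mapping \<open>L\<close> onto itself.
\<close>
definition uniform_sphere :: "'a::euclidean_space set \<Rightarrow> 'a measure" where
  "uniform_sphere L = distr std_gaussian borel (\<lambda>x. sgn (closest_point L x))"

lemma sets_std_gaussian [simp, measurable_cong]: "sets std_gaussian = sets borel"
  by (simp add: std_gaussian_def)

lemma prob_space_std_gaussian: "prob_space (std_gaussian :: 'a::euclidean_space measure)"
proof
  have prod: "exp (- (norm x)\<^sup>2 / 2) / sqrt (2 * pi) ^ DIM('a) =
      (\<Prod>b\<in>Basis. std_normal_density (x \<bullet> b))" for x :: 'a
  proof -
    have "(norm x)\<^sup>2 = (\<Sum>b\<in>Basis. (x \<bullet> b)\<^sup>2)"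
      unfolding power2_norm_eq_inner by (subst euclidean_inner) (simp add: power2_eq_square)
    then have "exp (- (norm x)\<^sup>2 / 2) = (\<Prod>b\<in>Basis. exp (- (x \<bullet> b)\<^sup>2 / 2))"
      by (simp add: sum_negf sum_divide_distrib flip: exp_sum)
    then show ?thesis
      by (simp add: std_normal_density_def prod_dividef power_one_over prod.distrib)
  qed
  have one: "(\<integral>\<^sup>+ x. ennreal (std_normal_density x) \<partial>lborel) = 1"
    using prob_space.emeasure_space_1[OF prob_space_normal_density[of 1 0]]
    by (simp add: emeasure_density)
  have "emeasure std_gaussian (space std_gaussian :: 'a set) =
      (\<integral>\<^sup>+ (x::'a). (\<Prod>b\<in>Basis. ennreal (std_normal_density (x \<bullet> b))) \<partial>lborel)"
    unfolding std_gaussian_def prod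
    by (simp add: emeasure_density prod_ennreal)
  also have "\<dots> = (\<Prod>b\<in>(Basis :: 'a set). \<integral>\<^sup>+ x. ennreal (std_normal_density x) \<partial>lborel)"
    by (rule nn_integral_lborel_prod) auto
  finally show "emeasure std_gaussian (space std_gaussian :: 'a set) = 1"
    by (simp add: one)
qed

lemma lborel_distr_orthogonal:
  fixes f :: "'a::euclidean_space \<Rightarrow> 'a"
  assumes f: "orthogonal_transformation f"
  shows "distr lborel borel f = lborel"
proof (rule measure_eqI)
  have lin: "linear f"
    using f by (rule orthogonal_transformation_linear)
  have [measurable]: "f \<in> borel_measurable borel"
    by (intro borel_measurable_continuous_onI linear_continuous_on lin[unfolded linear_conv_bounded_linear])
  obtain g where g: "\<And>y. f (g y) = y"
    using orthogonal_transformation_surj[OF f] by (metis surjD)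
  have nf: "norm (f x) = norm x" for x
    using f by (rule orthogonal_transformation_norm)
  have add: "f (x + y) = f x + f y" "f (x - y) = f x - f y" for x y
    using lin by (simp_all add: linear_add linear_diff)
  have tr: "(\<integral>\<^sup>+x. h (x + c) \<partial>lborel) = (\<integral>\<^sup>+x. h x \<partial>lborel)"
    if [measurable]: "h \<in> borel_measurable borel" for h and c :: 'a
    by (subst (2) lborel_distr_plus[symmetric, of c]) (simp add: nn_integral_distr add.commute)
  have re: "(\<integral>\<^sup>+x. h (- x) \<partial>lborel) = (\<integral>\<^sup>+x. h x \<partial>lborel)"
    if [measurable]: "h \<in> borel_measurable borel" for h :: "'a \<Rightarrow> ennreal"
  proof -
    have "distr lborel borel uminus = (lborel :: 'a measure)"
      using lborel_affine[of "-1" "0 :: 'a"] by (simp add: density_1)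
    then have "(\<integral>\<^sup>+x. h x \<partial>lborel) = (\<integral>\<^sup>+x. h x \<partial>distr lborel borel uminus)"
      by (rule arg_cong[OF sym])
    also have "\<dots> = (\<integral>\<^sup>+x. h (- x) \<partial>lborel)"
      by (rule nn_integral_distr) simp_all
    finally show ?thesis ..
  qed
  fix A assume "A \<in> sets (distr lborel borel f)"
  then have [measurable]: "A \<in> sets borel" by simp
  define B where "B = ball (0::'a) 1"
  have [measurable]: "B \<in> sets borel" by (simp add: B_def)
  have B1: "(\<integral>\<^sup>+x. indicator B (y - f x) \<partial>lborel) = emeasure lborel B" for y
  proof -
    have "(indicator B (y - f x) :: ennreal) = indicator B (- (x + - g y))" for x
      using nf[of "x - g y"]
      by (simp add: B_def indicator_def add g norm_minus_commute)
    then have "(\<integral>\<^sup>+x. indicator B (y - f x) \<partial>lborel) = (\<integral>\<^sup>+x. indicator B (- (x + - g y)) \<partial>lborel)"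
      by presburger
    also have "\<dots> = (\<integral>\<^sup>+x. indicator B (- x) \<partial>lborel)"
      by (rule tr[where h = "\<lambda>x. indicator B (- x)"]) measurable
    also have "\<dots> = emeasure lborel B"
      by (subst re) simp_all
    finally show ?thesis .
  qed
  have "emeasure (distr lborel borel f) A * emeasure lborel B =
      (\<integral>\<^sup>+y. (\<integral>\<^sup>+x. indicator A (f x) \<partial>lborel) * indicator B y \<partial>lborel)"
  proof -
    have "emeasure (distr lborel borel f) A = (\<integral>\<^sup>+x. indicator A x \<partial>distr lborel borel f)"
      by simp
    also have "\<dots> = (\<integral>\<^sup>+x. indicator A (f x) \<partial>lborel)"
      by (rule nn_integral_distr) simp_all
    finally show ?thesis
      by (simp only:) (subst nn_integral_cmult, simp_all)
  qed
  also have "\<dots> = (\<integral>\<^sup>+y. (\<integral>\<^sup>+x. indicator A (f x + y) \<partial>lborel) * indicator B y \<partial>lborel)"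
  proof -
    have "(\<integral>\<^sup>+x. indicator A (f x) \<partial>lborel) = (\<integral>\<^sup>+x. (indicator A (f x + y) :: ennreal) \<partial>lborel)" for y
      using tr[where h = "\<lambda>x. indicator A (f x)" and c = "g y"] by (simp add: add g)
    then show ?thesis by presburger
  qed
  also have "\<dots> = (\<integral>\<^sup>+y. (\<integral>\<^sup>+x. indicator A (f x + y) * indicator B y \<partial>lborel) \<partial>lborel)"
    by (simp add: nn_integral_multc)
  also have "\<dots> = (\<integral>\<^sup>+x. (\<integral>\<^sup>+y. indicator A (f x + y) * indicator B y \<partial>lborel) \<partial>lborel)"
    by (rule lborel_pair.Fubini') measurable
  also have "\<dots> = (\<integral>\<^sup>+x. (\<integral>\<^sup>+y. indicator A y * indicator B (y - f x) \<partial>lborel) \<partial>lborel)"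
  proof -
    have "(\<integral>\<^sup>+y. indicator A (f x + y) * indicator B y \<partial>lborel) =
        (\<integral>\<^sup>+y. indicator A y * (indicator B (y - f x) :: ennreal) \<partial>lborel)" for x
      using tr[where h = "\<lambda>y. indicator A y * indicator B (y - f x)" and c = "f x"]
      by (simp add: add.commute)
    then show ?thesis by presburger
  qed
  also have "\<dots> = (\<integral>\<^sup>+y. (\<integral>\<^sup>+x. indicator A y * indicator B (y - f x) \<partial>lborel) \<partial>lborel)"
    by (rule lborel_pair.Fubini') measurable
  also have "\<dots> = emeasure lborel A * emeasure lborel B"
    by (simp add: nn_integral_cmult B1 nn_integral_multc)
  finally have *: "emeasure (distr lborel borel f) A * emeasure lborel B = emeasure lborel A * emeasure lborel B" .
  have "emeasure lborel B \<noteq> 0"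
    using content_ball_pos[of 1 "0::'a"] by (auto simp: B_def measure_def)
  moreover have "emeasure lborel B \<noteq> \<infinity>"
    unfolding B_def using emeasure_lborel_ball_finite[of "0::'a" 1] by auto
  ultimately show "emeasure (distr lborel borel f) A = emeasure lborel A"
    using * by (simp add: ennreal_mult_cancel_left mult.commute[of _ "emeasure lborel B"])
qed simp

lemma std_gaussian_distr_orthogonal:
  fixes f :: "'a::euclidean_space \<Rightarrow> 'a"
  assumes f: "orthogonal_transformation f"
  shows "distr std_gaussian borel f = std_gaussian"
proof -
  have "linear f"
    using f by (rule orthogonal_transformation_linear)
  then have [measurable]: "f \<in> borel_measurable borel"
    by (intro borel_measurable_continuous_onI linear_continuous_on) (simp add: linear_conv_bounded_linear)
  have "std_gaussian = density (distr lborel borel f)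
      (\<lambda>x. ennreal (exp (- (norm x)\<^sup>2 / 2) / sqrt (2 * pi) ^ DIM('a)))"
    by (simp add: std_gaussian_def lborel_distr_orthogonal[OF f])
  also have "\<dots> = distr (density lborel
      (\<lambda>x. ennreal (exp (- (norm (f x))\<^sup>2 / 2) / sqrt (2 * pi) ^ DIM('a)))) borel f"
    by (rule density_distr) measurable
  also have "\<dots> = distr std_gaussian borel f"
    by (simp add: std_gaussian_def orthogonal_transformation_norm[OF f])
  finally show ?thesis ..
qed

lemma measurable_sgn_closest_point:
  fixes L :: "'a::euclidean_space set"
  assumes "subspace L"
  shows "(\<lambda>x. sgn (closest_point L x)) \<in> borel_measurable borel"
proof -
  have [measurable]: "closest_point L \<in> borel_measurable borel"
    using assms subspace_0[OF assms]
    by (intro borel_measurable_continuous_onI continuous_on_closest_point)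
       (auto simp: subspace_imp_convex closed_subspace)
  show ?thesis
    unfolding sgn_div_norm by measurable
qed

lemma prob_space_uniform_sphere:
  assumes "subspace L"
  shows "prob_space (uniform_sphere L)"
  unfolding uniform_sphere_def
  using measurable_sgn_closest_point[OF assms] prob_space_std_gaussian
  by (intro prob_space.prob_space_distr) auto

lemma AE_uniform_sphere:
  fixes L :: "'a::euclidean_space set"
  assumes L: "subspace L" "L \<noteq> {0}"
  shows "AE z in uniform_sphere L. z \<in> L \<inter> sphere 0 1"
proof -
  have cl: "closed L" "convex L" "L \<noteq> {}"
    using L subspace_0[OF L(1)] by (auto simp: subspace_imp_convex closed_subspace)
  obtain a where a: "a \<in> L" "a \<noteq> 0"
    using L subspace_0 by blast
  have orth: "a \<bullet> x = 0" if "closest_point L x = 0" for x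
  proof -
    have "x \<bullet> v \<le> 0" if "v \<in> L" for v
      using closest_point_dot[OF cl(2,1) that, of x] \<open>closest_point L x = 0\<close> by simp
    from this[of a] this[of "- a"] show ?thesis
      using a L by (simp add: subspace_neg inner_commute)
  qed
  have "negligible {x. a \<bullet> x = 0}"
    using a by (intro negligible_hyperplane) auto
  then have "AE x in lborel. x \<notin> {x. a \<bullet> x = 0}"
    by (metis AE_completion_iff AE_not_in negligible_iff_null_sets)
  then have "AE x in std_gaussian. closest_point L x \<noteq> 0"
    unfolding std_gaussian_def by (subst AE_density) (auto elim!: eventually_mono dest: orth)
  then have "AE x in std_gaussian. sgn (closest_point L x) \<in> L \<inter> sphere 0 1"
  proof eventually_elim
    case (elim x)
    then show ?case
      using closest_point_in_set[OF cl(1,3), of x] L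
      by (simp add: sgn_div_norm subspace_scale)
  qed
  moreover have "{z \<in> space borel. z \<in> L \<inter> sphere 0 1} \<in> sets borel"
    using cl by simp
  ultimately show ?thesis
    unfolding uniform_sphere_def using measurable_sgn_closest_point[OF L(1)]
    by (subst AE_distr_iff) auto
qed

lemma uniform_sphere_invariant:
  fixes L :: "'a::euclidean_space set"
  assumes L: "subspace L" and f: "orthogonal_transformation f" and fL: "f ` L = L"
  shows "distr (uniform_sphere L) borel f = uniform_sphere L"
proof -
  have lin: "linear f"
    using f by (rule orthogonal_transformation_linear)
  then have [measurable]: "f \<in> borel_measurable borel"
    by (intro borel_measurable_continuous_onI linear_continuous_on) (simp add: linear_conv_bounded_linear)
  have cl: "closed L" "convex L" "L \<noteq> {}"
    using L subspace_0[OF L(1)] by (auto simp: subspace_imp_convex closed_subspace)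
  have df: "dist (f x) (f y) = dist x y" for x y
    using orthogonal_transformation_norm[OF f, of "x - y"] lin by (simp add: dist_norm linear_diff)
  have "f (closest_point L x) = closest_point L (f x)" for x
  proof (rule closest_point_unique[OF cl(2,1)])
    show "f (closest_point L x) \<in> L"
      using closest_point_in_set[OF cl(1,3)] fL by blast
    show "\<forall>z\<in>L. dist (f x) (f (closest_point L x)) \<le> dist (f x) z"
    proof
      fix z assume "z \<in> L"
      then obtain y where "y \<in> L" "z = f y" using fL by blast
      then show "dist (f x) (f (closest_point L x)) \<le> dist (f x) z"
        by (simp add: df closest_point_le[OF cl(1)])
    qed
  qed
  then have comm: "f (sgn (closest_point L x)) = sgn (closest_point L (f x))" for x
    using orthogonal_transformation_norm[OF f, of "closest_point L x"] lin
    by (simp add: sgn_div_norm linear_scale)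
  note [measurable] = measurable_sgn_closest_point[OF L]
  have "distr (uniform_sphere L) borel f = distr std_gaussian borel (\<lambda>x. f (sgn (closest_point L x)))"
    unfolding uniform_sphere_def by (subst distr_distr) (auto simp: comp_def)
  also have "\<dots> = distr (distr std_gaussian borel f) borel (\<lambda>x. sgn (closest_point L x))"
    by (subst distr_distr) (auto simp: comp_def comm)
  also have "\<dots> = uniform_sphere L"
    by (simp add: std_gaussian_distr_orthogonal[OF f] uniform_sphere_def)
  finally show ?thesis .
qed

section \<open>Faces, tangent and normal cones, conic intrinsic volumes\<close>

definition solid_angle :: "'a::euclidean_space set \<Rightarrow> real" where
  "solid_angle C = (if subspace C then 1 else measure (uniform_sphere (span C)) C)"

definition faces :: "nat \<Rightarrow> 'a::euclidean_space set \<Rightarrow> 'a set set" where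
  "faces j P = {F. F face_of P \<and> aff_dim F = int j}"

text \<open>The choice of the point \<open>f0\<close> is immaterial, see \<open>tangent_cone_eq\<close> below.\<close>
definition tangent_cone :: "'a::euclidean_space set \<Rightarrow> 'a set \<Rightarrow> 'a set" where
  "tangent_cone F P = {v. \<exists>f0\<in>rel_interior F. \<exists>\<epsilon>>0. f0 + \<epsilon> *\<^sub>R v \<in> P}"

lemma tangent_cone_eq:
  assumes P: "convex P" and FP: "F face_of P" and f0: "f0 \<in> rel_interior F"
  shows "tangent_cone F P = {v. \<exists>\<epsilon>>0. f0 + \<epsilon> *\<^sub>R v \<in> P}"
proof (intro equalityI subsetI)
  fix v assume "v \<in> tangent_cone F P"
  then obtain f1 \<epsilon> where f1: "f1 \<in> rel_interior F" and e: "\<epsilon> > 0" "f1 + \<epsilon> *\<^sub>R v \<in> P"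
    unfolding tangent_cone_def by blast
  have "convex F" "F \<subseteq> P"
    using FP by (auto simp: face_of_imp_convex face_of_imp_subset)
  have "f1 \<in> F"
    using f1 rel_interior_subset by blast
  have "F \<noteq> {}"
    using \<open>f1 \<in> F\<close> by blast
  then obtain t where t: "t > 1" "(1 - t) *\<^sub>R f1 + t *\<^sub>R f0 \<in> F"
    using convex_rel_interior_iff[OF \<open>convex F\<close>, of f0] f0 \<open>f1 \<in> F\<close> by blast
  define s where "s = 1 / t"
  have s: "0 < s" "s < 1" "s * t = 1"
    using t(1) by (auto simp: s_def)
  have "(1 - s) *\<^sub>R (f1 + \<epsilon> *\<^sub>R v) + s *\<^sub>R ((1 - t) *\<^sub>R f1 + t *\<^sub>R f0) \<in> P"
    by (rule convexD[OF P e(2) subsetD[OF \<open>F \<subseteq> P\<close> t(2)]]) (use s in auto)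
  also have "(1 - s) *\<^sub>R (f1 + \<epsilon> *\<^sub>R v) + s *\<^sub>R ((1 - t) *\<^sub>R f1 + t *\<^sub>R f0) =
      ((1 - s) + s * (1 - t)) *\<^sub>R f1 + (s * t) *\<^sub>R f0 + ((1 - s) * \<epsilon>) *\<^sub>R v"
    by (simp add: algebra_simps)
  also have "\<dots> = f0 + ((1 - s) * \<epsilon>) *\<^sub>R v"
    using s(3) by (simp add: algebra_simps)
  finally show "v \<in> {v. \<exists>\<epsilon>>0. f0 + \<epsilon> *\<^sub>R v \<in> P}"
    using s e(1) by (intro CollectI exI[of _ "(1 - s) * \<epsilon>"]) auto
qed (use f0 in \<open>auto simp: tangent_cone_def\<close>)

definition polar_cone :: "'a::euclidean_space set \<Rightarrow> 'a set" where
  "polar_cone C = {w. \<forall>u\<in>C. w \<bullet> u \<le> 0}"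

definition normal_cone :: "'a::euclidean_space set \<Rightarrow> 'a set \<Rightarrow> 'a set" where
  "normal_cone F P = polar_cone (tangent_cone F P)"

definition conic_intrinsic_volume :: "nat \<Rightarrow> 'a::euclidean_space set \<Rightarrow> real" where
  "conic_intrinsic_volume k C = (\<Sum>F\<in>faces k C. solid_angle F * solid_angle (normal_cone F C))"

section \<open>Random walks\<close>

definition walk :: "(nat \<Rightarrow> 'w \<Rightarrow> 'a::euclidean_space) \<Rightarrow> nat \<Rightarrow> 'w \<Rightarrow> 'a" where
  "walk \<xi> i \<omega> = (\<Sum>m=1..i. \<xi> m \<omega>)"

definition walk_hull :: "(nat \<Rightarrow> 'w \<Rightarrow> 'a::euclidean_space) \<Rightarrow> nat \<Rightarrow> 'w \<Rightarrow> 'a set" where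
  "walk_hull \<xi> n \<omega> = convex hull ((\<lambda>i. walk \<xi> i \<omega>) ` {0..n})"

definition exchangeable :: "'w measure \<Rightarrow> nat \<Rightarrow> (nat \<Rightarrow> 'w \<Rightarrow> 'a::euclidean_space) \<Rightarrow> bool" where
  "exchangeable M n \<xi> \<longleftrightarrow>
     (\<forall>\<pi>. \<pi> permutes {1..n} \<longrightarrow>
        distr M (Pi\<^sub>M {1..n} (\<lambda>_. borel)) (\<lambda>\<omega>. \<lambda>i\<in>{1..n}. \<xi> (\<pi> i) \<omega>) =
        distr M (Pi\<^sub>M {1..n} (\<lambda>_. borel)) (\<lambda>\<omega>. \<lambda>i\<in>{1..n}. \<xi> i \<omega>))"

text \<open>Linear dependence of a family; unlike \<^const>\<open>dependent\<close> of the set of values, it takes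
  repeated vectors into account.\<close>
definition dependent_family :: "'i set \<Rightarrow> ('i \<Rightarrow> 'a::real_vector) \<Rightarrow> bool" where
  "dependent_family I v \<longleftrightarrow> (\<exists>c. (\<exists>i\<in>I. c i \<noteq> 0) \<and> (\<Sum>i\<in>I. c i *\<^sub>R v i) = 0)"

definition general_position :: "'w measure \<Rightarrow> nat \<Rightarrow> (nat \<Rightarrow> 'w \<Rightarrow> 'a::euclidean_space) \<Rightarrow> bool" where
  "general_position M n \<xi> \<longleftrightarrow>
     (\<forall>I. I \<subseteq> {1..n} \<and> card I = DIM('a) \<longrightarrow>
        (AE \<omega> in M. \<not> dependent_family I (\<lambda>i. walk \<xi> i \<omega>)))"

section \<open>Stirling number products\<close>

text \<open>
  The product of \<^const>\<open>stirling\<close> \<open>(n + 1) m\<close> (first kind) and \<^const>\<open>Stirling\<close> \<open>m i\<close> (second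
  kind) for an integer \<open>m\<close>, read as \<open>0\<close> for \<open>m \<le> 0\<close>.
\<close>
definition stirling_product :: "nat \<Rightarrow> int \<Rightarrow> nat \<Rightarrow> real" where
  "stirling_product n m i =
     (if m \<le> 0 then 0 else real (stirling (n + 1) (nat m)) * real (Stirling (nat m) i))"

end

theory Submission imports Defs "HOL-Combinatorics.Multiset_Permutations" begin

text \<open>
  A Gaussian vector replaces the angles. If \<open>G\<close> is a face of a polyhedral cone \<open>C\<close>, then the
  projections of a standard Gaussian vector \<open>z\<close> to the linear hull of \<open>G\<close> and to its orthogonal
  complement are independent and symmetric, and so the product of the solid angles of \<open>G\<close> and of its normal cone is
  the probability of a single event, called the cell of \<open>G\<close>: the former projection lies in \<open>G\<close> and the
  negative of the latter in the normal cone (\<open>solid_angle_mult_cell\<close>). For the tangent cones of a convex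
  hull of points, the pairs of a face and of a face of its tangent cone are the pairs \<open>J \<subseteq> I\<close> of index
  sets of faces. In general position the index sets of faces of dimensions \<open>j\<close> and \<open>k < d\<close> have
  \<open>j + 1\<close> and \<open>k + 1\<close> elements, and all other pairs of sets of these sizes have null cells. Hence for \<open>k < d\<close> the
  angle sum of the hull is the sum of the Gaussian measures of the cells of all pairs \<open>J \<subseteq> I\<close> of sets
  of times with these numbers of elements (\<open>sum_faces_eq\<close>).

  By exchangeability the expectation may be averaged over all rearrangements of the increments, and
  this average is constant: for fixed increments and a fixed direction \<open>z\<close>, both generic, one can
  count the triples of a rearrangement, \<open>I\<close> and \<open>J\<close> whose cell contains \<open>z\<close> (\<open>count_cells\<close>). The set \<open>I\<close>
  cuts the rearranged walk into \<open>k\<close> blocks and two outer pieces. The span of the face depends on the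
  blocks only as sets, since it is spanned by their sums. Therefore the component of \<open>z\<close> orthogonal to
  the span defines a real walk in which each block is a bridge, and the cell condition says
  two things. First, this walk attains its minimum at the cut points: each bridge stays nonnegative,
  which by the cyclic lemma holds for \<open>(b - 1)!\<close> orderings of a block with \<open>b\<close> elements, and the
  remaining increments attain their minimum at the place where the outer pieces meet, which
  singles out one way to split each ordering of them. Together these counts sum up over all
  systems of disjoint blocks to a Stirling number of the first kind (\<open>sum_block_systems_cycles\<close>).
  Second, the coordinates of the projection of \<open>z\<close> with respect to the block sums, between two zeros,
  may increase only at the members of \<open>J\<close>; over all orders of the blocks, this contributes \<open>j!\<close> times a
  Stirling number of the second kind (\<open>sum_orderings_descents\<close>).

  For \<open>k = d\<close>, the only face of dimension \<open>d\<close> of a tangent cone is the cone itself. Its angle is an alternating sum of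
  the measures of the cells of its proper faces, the Gauss--Bonnet relation. This is proved by moving
  along a ray parallel to a generator: at each hyperplane that is met, the indicators that
  change come in pairs that cancel, namely those of the cells of \<open>I\<close> and of \<open>I\<close> with one generator added or
  removed, or those of the cell of a facet and of the cone itself (\<open>gauss_bonnet\<close>). The second form of the sum follows since the two
  triangles of Stirling numbers are, up to signs, inverse to each other.

  The angle sum also has to be measurable as a function of the walk, including walks in special
  position; for this purpose faces and tangent cones are described by index sets for arbitrary
  configurations of points (\<open>angle_sum_convex_hull\<close>).
\<close>

section \<open>Cutting a list into consecutive blocks\<close>

text \<open>The position in \<open>u @ concat bs @ v\<close> at which the block number \<open>l\<close> begins, counted from \<open>0\<close>;
  for \<open>l = length bs\<close> the end of the last block.\<close>
definition cut_pos :: "'a list \<Rightarrow> 'a list list \<Rightarrow> nat \<Rightarrow> nat" where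
  "cut_pos u bs l = length u + length (concat (take l bs))"

definition cuts :: "'a list \<Rightarrow> 'a list list \<Rightarrow> nat set" where
  "cuts u bs = cut_pos u bs ` {..length bs}"

definition decomps :: "nat \<Rightarrow> 'a list \<Rightarrow> ('a list \<times> 'a list list \<times> 'a list) set" where
  "decomps k xs = {(u, bs, v). u @ concat bs @ v = xs \<and> [] \<notin> set bs \<and> length bs = k}"

lemma cuts_Nil [simp]: "cuts u [] = {length u}"
  by (simp add: cuts_def cut_pos_def)

lemma cuts_Cons: "cuts u (b # bs) = insert (length u) (cuts (u @ b) bs)"
proof -
  have "cut_pos u (b # bs) ` Suc ` {..length bs} = cuts (u @ b) bs"
    by (auto simp: cuts_def cut_pos_def image_image add.assoc)
  moreover have "{..length (b # bs)} = insert 0 (Suc ` {..length bs})"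
    by (auto simp: atMost_Suc_eq_insert_0)
  ultimately show ?thesis
    unfolding cuts_def by (simp add: cut_pos_def)
qed

lemma cuts_ge: "x \<in> cuts u bs \<Longrightarrow> length u \<le> x"
  by (auto simp: cuts_def cut_pos_def)

lemma cuts_le: "x \<in> cuts u bs \<Longrightarrow> x \<le> length u + length (concat bs)"
proof -
  have "length (concat (take l bs)) \<le> length (concat bs)" for l
    by (metis append_take_drop_id concat_append length_append le_add1)
  then show "x \<in> cuts u bs \<Longrightarrow> ?thesis" by (auto simp: cuts_def cut_pos_def)
qed

lemma length_in_cuts: "length u \<in> cuts u bs"
  by (cases bs) (auto simp: cuts_Cons)

lemma cut_pos_less:
  assumes "[] \<notin> set bs" "l < m" "m \<le> length bs"
  shows "cut_pos u bs l < cut_pos u bs m"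
proof -
  have "take m bs = take l bs @ drop l (take m bs)"
    by (metis append_take_drop_id assms(2) less_imp_le_nat min.absorb1 take_take)
  moreover have "drop l (take m bs) \<noteq> []"
    using assms by simp
  then obtain b bs' where b: "drop l (take m bs) = b # bs'"
    by (cases "drop l (take m bs)") auto
  moreover have "b \<noteq> []"
    using assms(1) b by (metis in_set_dropD in_set_takeD list.set_intros(1))
  ultimately show ?thesis
    by (auto simp: cut_pos_def)
qed

lemma inj_on_cut_pos: "[] \<notin> set bs \<Longrightarrow> inj_on (cut_pos u bs) {..length bs}"
  by (rule inj_onI) (metis atMost_iff cut_pos_less less_irrefl nat_neq_iff)

lemma cuts_Cons_diff: "b \<noteq> [] \<Longrightarrow> cuts u (b # bs) - {length u} = cuts (u @ b) bs"
  using cuts_ge[of _ "u @ b" bs] by (force simp: cuts_Cons)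

lemma card_cuts: "[] \<notin> set bs \<Longrightarrow> card (cuts u bs) = Suc (length bs)"
  by (simp add: cuts_def card_image inj_on_cut_pos)

lemma finite_cuts [simp]: "finite (cuts u bs)"
  by (simp add: cuts_def)

lemma Min_cuts: "Min (cuts u bs) = length u"
  by (rule Min_eqI) (auto simp: cuts_ge length_in_cuts)

lemma decomps_inj:
  assumes "u @ concat bs @ v = u' @ concat bs' @ v'" "[] \<notin> set bs" "[] \<notin> set bs'"
    and "length bs = length bs'" "cuts u bs = cuts u' bs'"
  shows "u = u' \<and> bs = bs' \<and> v = v'"
  using assms(4,1-3,5)
proof (induction bs bs' arbitrary: u u' rule: list_induct2)
  case Nil
  then show ?case by simp
next
  case (Cons b bs b' bs')
  have len: "length u = length u'"
    using Cons.prems(4) by (metis Min_cuts)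
  then have u: "u = u'"
    using Cons.prems(1) by simp
  have "cuts (u @ b) bs = cuts (u' @ b') bs'"
    using Cons.prems cuts_Cons_diff[of b u bs] cuts_Cons_diff[of b' u' bs'] len by force
  then have "u @ b = u' @ b' \<and> bs = bs' \<and> v = v'"
    by (intro Cons.IH) (use Cons.prems in auto)
  then show ?case
    using u by simp
qed

lemma decomps_surj:
  assumes "I \<subseteq> {..length xs}" "card I = Suc k"
  shows "\<exists>(u, bs, v) \<in> decomps k xs. cuts u bs = I"
  using assms
proof (induction k arbitrary: I)
  case 0
  then obtain i where "I = {i}" by (auto simp: card_Suc_eq)
  with 0 show ?case
    by (intro bexI[of _ "(take i xs, [], drop i xs)"]) (auto simp: decomps_def)
next
  case (Suc k)
  have fin: "finite I" and ne: "I \<noteq> {}"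
    using Suc.prems by (auto simp: card_ge_0_finite)
  define m where "m = Min I"
  have m: "m \<in> I" using fin ne by (simp add: m_def)
  have "\<exists>(u, bs, v) \<in> decomps k xs. cuts u bs = I - {m}"
    by (rule Suc.IH) (use Suc.prems fin m in auto)
  then obtain u bs v where d: "u @ concat bs @ v = xs" "[] \<notin> set bs" "length bs = k"
      and c: "cuts u bs = I - {m}"
    by (auto simp: decomps_def)
  have "length u \<in> I - {m}"
    using c length_in_cuts by blast
  then have mu: "m < length u"
    using fin by (auto simp: m_def le_neq_trans)
  have "(take m u, drop m u # bs, v) \<in> decomps (Suc k) xs"
    using d mu by (simp add: decomps_def flip: append_assoc)
  moreover have "cuts (take m u) (drop m u # bs) = I"
    using mu m c by (simp add: cuts_Cons min_absorb2 insert_absorb)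
  ultimately show ?case by blast
qed

text \<open>Choosing \<open>k + 1\<close> positions among \<open>0, \<dots>, length xs\<close> is the same as cutting \<open>xs\<close> into an
  initial piece, \<open>k\<close> non-empty blocks and a final piece.\<close>
lemma bij_betw_cuts:
  "bij_betw (\<lambda>(u, bs, v). cuts u bs) (decomps k xs) {I. I \<subseteq> {..length xs} \<and> card I = Suc k}"
  unfolding bij_betw_def
proof (intro conjI)
  show "inj_on (\<lambda>(u, bs, v). cuts u bs) (decomps k xs)"
  proof (rule inj_onI)
    fix t t' :: "'a list \<times> 'a list list \<times> 'a list"
    assume "t \<in> decomps k xs" "t' \<in> decomps k xs" 
      and "(case t of (u, bs, v) \<Rightarrow> cuts u bs) = (case t' of (u, bs, v) \<Rightarrow> cuts u bs)"
    moreover obtain u bs v u' bs' v' where "t = (u, bs, v)" "t' = (u', bs', v')"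
      by (metis prod_cases3)
    ultimately show "t = t'"
      using decomps_inj[of u bs v u' bs' v'] by (auto simp: decomps_def)
  qed
  show "(\<lambda>(u, bs, v). cuts u bs) ` decomps k xs = {I. I \<subseteq> {..length xs} \<and> card I = Suc k}"
  proof (intro equalityI subsetI)
    fix I assume "I \<in> (\<lambda>(u, bs, v). cuts u bs) ` decomps k xs"
    then obtain u bs v where "(u, bs, v) \<in> decomps k xs" "I = cuts u bs" by auto
    then show "I \<in> {I. I \<subseteq> {..length xs} \<and> card I = Suc k}"
      using cuts_le[of _ u bs] by (fastforce simp: decomps_def card_cuts)
  next
    fix I assume "I \<in> {I. I \<subseteq> {..length xs} \<and> card I = Suc k}"
    then show "I \<in> (\<lambda>(u, bs, v). cuts u bs) ` decomps k xs"
      using decomps_surj[of I xs k] by force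
  qed
qed

section \<open>Systems of disjoint blocks\<close>

definition block_systems :: "'a set \<Rightarrow> nat \<Rightarrow> 'a set set set" where
  "block_systems A k = {\<B>. finite \<B> \<and> card \<B> = k \<and> disjoint \<B> \<and> {} \<notin> \<B> \<and> \<Union>\<B> \<subseteq> A}"

definition triples :: "'a set \<Rightarrow> nat \<Rightarrow> ('a list \<times> 'a list list \<times> 'a list) set" where
  "triples A k = {(u, bs, v). u @ concat bs @ v \<in> permutations_of_set A \<and> [] \<notin> set bs \<and> length bs = k}"

lemma finite_block_systems: "finite A \<Longrightarrow> finite (block_systems A k)"
  by (rule finite_subset[of _ "Pow (Pow A)"]) (auto simp: block_systems_def)

lemma block_systems_0 [simp]: "block_systems A 0 = {{}}"
  by (auto simp: block_systems_def)

lemma block_systems_empty [simp]: "block_systems {} (Suc k) = {}"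
proof -
  have "\<B> = {}" if "{} \<notin> \<B>" "\<Union>\<B> \<subseteq> {}" for \<B> :: "'a set set"
    using that by (metis Union_empty_conv all_not_in_conv subset_empty)
  then show ?thesis by (fastforce simp: block_systems_def)
qed

lemma block_systemsD:
  assumes "\<B> \<in> block_systems A k"
  shows "finite \<B>" "card \<B> = k" "\<And>B C. B \<in> \<B> \<Longrightarrow> C \<in> \<B> \<Longrightarrow> B \<noteq> C \<Longrightarrow> B \<inter> C = {}"
    "\<And>B. B \<in> \<B> \<Longrightarrow> B \<noteq> {}" "\<And>B. B \<in> \<B> \<Longrightarrow> B \<subseteq> A" "\<Union>\<B> \<subseteq> A"
  using assms by (auto simp: block_systems_def disjoint_def)

text \<open>The new point \<open>a\<close> lies in no block, forms a block of its own, or is added to an existing block.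
  Both Stirling recurrences below come from this case distinction.\<close>
lemma sum_block_systems_insert:
  fixes f :: "'a set set \<Rightarrow> nat"
  assumes A: "finite A" "a \<notin> A"
  shows "sum f (block_systems (insert a A) (Suc k)) =
    sum f (block_systems A (Suc k)) + (\<Sum>\<B>\<in>block_systems A k. f (insert {a} \<B>)) +
    (\<Sum>\<B>\<in>block_systems A (Suc k). \<Sum>B\<in>\<B>. f (insert (insert a B) (\<B> - {B})))"
proof -
  let ?S = "block_systems (insert a A) (Suc k)"
  let ?S2 = "{\<B>\<in>?S. {a} \<in> \<B>}" and ?S3 = "{\<B>\<in>?S. a \<in> \<Union>\<B> \<and> {a} \<notin> \<B>}"
  have fin: "finite ?S" by (rule finite_block_systems) (use A in auto)
  have "?S = (block_systems A (Suc k) \<union> ?S2) \<union> ?S3"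
    by (auto simp: block_systems_def)
  also have "sum f \<dots> = sum f (block_systems A (Suc k)) + sum f ?S2 + sum f ?S3"
  proof -
    have fin': "finite (block_systems A (Suc k))" "finite ?S2" "finite ?S3"
      using fin finite_block_systems[OF A(1)] by auto
    have dis: "block_systems A (Suc k) \<inter> ?S2 = {}" "(block_systems A (Suc k) \<union> ?S2) \<inter> ?S3 = {}"
      using A(2) by (auto simp: block_systems_def)
    show ?thesis
      unfolding sum.union_disjoint[OF finite_UnI[OF fin'(1,2)] fin'(3) dis(2)]
        sum.union_disjoint[OF fin'(1,2) dis(1)] ..
  qed
  also have "sum f ?S2 = (\<Sum>\<B>\<in>block_systems A k. f (insert {a} \<B>))"
  proof (rule sum.reindex_bij_witness[of _ "insert {a}" "\<lambda>\<B>. \<B> - {{a}}"])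
    fix \<B> assume B: "\<B> \<in> block_systems A k"
    then have a: "a \<notin> \<Union>\<B>" using A(2) by (auto simp: block_systems_def)
    then have notin: "{a} \<notin> \<B>" by blast
    then show "insert {a} \<B> - {{a}} = \<B>" by simp
    have "card (insert {a} \<B>) = Suc k" using block_systemsD(1,2)[OF B] notin by simp
    moreover have "disjoint (insert {a} \<B>)"
      using a block_systemsD(3)[OF B] unfolding disjoint_def by blast
    moreover have "\<Union>(insert {a} \<B>) \<subseteq> insert a A" "{} \<notin> insert {a} \<B>"
      using block_systemsD(4)[OF B, of "{}"] block_systemsD(6)[OF B] by auto
    ultimately show "insert {a} \<B> \<in> ?S2"
      using block_systemsD(1)[OF B] by (simp add: block_systems_def)
  next
    fix \<B> assume B: "\<B> \<in> ?S2"
    then show "insert {a} (\<B> - {{a}}) = \<B>" by (simp add: insert_absorb)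
    have "a \<notin> B" if "B \<in> \<B>" "B \<noteq> {a}" for B
      using block_systemsD(3)[of \<B> "insert a A" "Suc k" B "{a}"] B that by auto
    then have sub: "\<Union>(\<B> - {{a}}) \<subseteq> A"
      using block_systemsD(6)[of \<B> "insert a A" "Suc k"] B by blast
    have "finite (\<B> - {{a}})" "card (\<B> - {{a}}) = k" "disjoint (\<B> - {{a}})" "{} \<notin> \<B> - {{a}}"
      using B by (auto simp: block_systems_def disjoint_def)
    with sub show "\<B> - {{a}} \<in> block_systems A k"
      by (simp add: block_systems_def)
  qed (simp add: insert_absorb)
  also have "sum f ?S3 = (\<Sum>(\<B>, B)\<in>Sigma (block_systems A (Suc k)) (\<lambda>\<B>. \<B>). f (insert (insert a B) (\<B> - {B})))"
  proof (rule sum.reindex_bij_witness[of _ "\<lambda>(\<B>, B). insert (insert a B) (\<B> - {B})"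
        "\<lambda>\<B>. (let B = (THE B. B \<in> \<B> \<and> a \<in> B) in (insert (B - {a}) (\<B> - {B}), B - {a}))"])
    fix p assume p: "p \<in> Sigma (block_systems A (Suc k)) (\<lambda>\<B>. \<B>)"
    obtain \<B> B where pB: "p = (\<B>, B)" by force
    have B: "\<B> \<in> block_systems A (Suc k)" "B \<in> \<B>" using p pB by auto
    note D = block_systemsD[OF B(1)]
    have a: "\<And>C. C \<in> \<B> \<Longrightarrow> a \<notin> C" using D(5) A(2) by blast
    have notin: "insert a B \<notin> \<B>" using a by blast
    have the: "(THE C. C \<in> insert (insert a B) (\<B> - {B}) \<and> a \<in> C) = insert a B"
    proof (rule the_equality)
      show "C = insert a B" if "C \<in> insert (insert a B) (\<B> - {B}) \<and> a \<in> C" for C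
        using a[of C] that by auto
    qed simp
    have aB: "insert a B - {a} = B" using a[OF B(2)] by simp
    have rest: "insert (insert a B) (\<B> - {B}) - {insert a B} = \<B> - {B}" using notin by simp
    show "(let C = (THE C. C \<in> (case p of (\<B>, B) \<Rightarrow> insert (insert a B) (\<B> - {B})) \<and> a \<in> C)
           in (insert (C - {a}) ((case p of (\<B>, B) \<Rightarrow> insert (insert a B) (\<B> - {B})) - {C}), C - {a})) = p"
      unfolding pB split Let_def the aB rest using B(2) by (simp add: insert_absorb)
    have "card (insert (insert a B) (\<B> - {B})) = Suc k"
      using D(1,2) notin B(2) by (simp add: card_insert_if)
    moreover have "disjoint (insert (insert a B) (\<B> - {B}))"
    proof -
      have r: "insert a B \<inter> C = {}" if "C \<in> \<B> - {B}" for C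
        using D(3)[of B C] B(2) a[of C] that by auto
      have "X \<inter> Y = {}" if "X \<in> insert (insert a B) (\<B> - {B})" "Y \<in> insert (insert a B) (\<B> - {B})" "X \<noteq> Y" for X Y
        using that r[of X] r[of Y] D(3)[of X Y] by (metis Diff_iff inf_commute insert_iff)
      then show ?thesis unfolding disjoint_def by simp
    qed
    moreover have "{a} \<notin> insert (insert a B) (\<B> - {B})"
    proof -
      have "insert a B \<noteq> {a}" using a[OF B(2)] D(4)[OF B(2)] by auto
      moreover have "{a} \<notin> \<B>" using a[of "{a}"] by auto
      ultimately show ?thesis by auto
    qed
    moreover have "{} \<notin> insert (insert a B) (\<B> - {B})" "\<Union>(insert (insert a B) (\<B> - {B})) \<subseteq> insert a A"
      using D(4)[of "{}"] D(6) B(2) by auto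
    ultimately show "(case p of (\<B>, B) \<Rightarrow> insert (insert a B) (\<B> - {B})) \<in> ?S3"
      using D(1) unfolding pB by (simp add: block_systems_def)
  next
    fix \<B> assume B: "\<B> \<in> ?S3"
    then obtain B where aB: "B \<in> \<B>" "a \<in> B" by auto
    have BB: "\<B> \<in> block_systems (insert a A) (Suc k)" "{a} \<notin> \<B>" using B by auto
    note D = block_systemsD[OF BB(1)]
    have other: "\<And>C. C \<in> \<B> \<Longrightarrow> C \<noteq> B \<Longrightarrow> a \<notin> C" using D(3) aB by blast
    have the: "(THE C. C \<in> \<B> \<and> a \<in> C) = B"
    proof (rule the_equality)
      show "C = B" if "C \<in> \<B> \<and> a \<in> C" for C
        using other[of C] that by auto
    qed (use aB in simp)
    have ne: "B - {a} \<noteq> {}" 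
    proof
      assume "B - {a} = {}"
      then have "B = {a}" using aB(2) by auto
      then show False using aB(1) BB(2) by simp
    qed
    have notin: "B - {a} \<notin> \<B>"
    proof
      assume "B - {a} \<in> \<B>"
      moreover have "B \<noteq> B - {a}" using aB(2) by auto
      ultimately have "B \<inter> (B - {a}) = {}" by (rule D(3)[OF aB(1)])
      then show False using ne by auto
    qed
    have ins: "insert a (B - {a}) = B" using aB by auto
    have rest: "insert (B - {a}) (\<B> - {B}) - {B - {a}} = \<B> - {B}" using notin by simp
    show "(case (let C = (THE C. C \<in> \<B> \<and> a \<in> C) in (insert (C - {a}) (\<B> - {C}), C - {a})) of
            (\<B>, B) \<Rightarrow> insert (insert a B) (\<B> - {B})) = \<B>"
      unfolding the Let_def split ins rest using aB by (simp add: insert_absorb)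
    have "card (insert (B - {a}) (\<B> - {B})) = Suc k"
      using D(1,2) notin aB by (simp add: card_insert_if)
    moreover have "disjoint (insert (B - {a}) (\<B> - {B}))"
    proof -
      have r: "(B - {a}) \<inter> C = {}" if "C \<in> \<B> - {B}" for C
        using D(3)[of B C] aB(1) that by blast
      have "X \<inter> Y = {}" if "X \<in> insert (B - {a}) (\<B> - {B})" "Y \<in> insert (B - {a}) (\<B> - {B})" "X \<noteq> Y" for X Y
        using that r[of X] r[of Y] D(3)[of X Y] by (metis Diff_iff inf_commute insert_iff)
      then show ?thesis unfolding disjoint_def by simp
    qed
    moreover have "\<Union>(insert (B - {a}) (\<B> - {B})) \<subseteq> A"
    proof (rule Union_least)
      fix C assume "C \<in> insert (B - {a}) (\<B> - {B})"
      then consider "C = B - {a}" | "C \<in> \<B>" "C \<noteq> B" by (elim insertE DiffE) simp_all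
      then show "C \<subseteq> A"
      proof cases
        case 1
        then show ?thesis using D(5)[OF aB(1)] by (simp add: Diff_subset_conv)
      next
        case 2
        then show ?thesis using D(5)[OF 2(1)] other[OF 2] by (simp add: subset_insert)
      qed
    qed
    moreover have "{} \<notin> insert (B - {a}) (\<B> - {B})" using D(4) ne by (metis DiffD1 insertE)
    ultimately have "insert (B - {a}) (\<B> - {B}) \<in> block_systems A (Suc k)"
      using D(1) by (simp add: block_systems_def)
    then show "(let C = (THE C. C \<in> \<B> \<and> a \<in> C) in (insert (C - {a}) (\<B> - {C}), C - {a}))
        \<in> Sigma (block_systems A (Suc k)) (\<lambda>\<B>. \<B>)"
      unfolding the Let_def by simp
    show "(case let C = (THE C. C \<in> \<B> \<and> a \<in> C) in (insert (C - {a}) (\<B> - {C}), C - {a}) of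
          (\<B>, B) \<Rightarrow> f (insert (insert a B) (\<B> - {B}))) = f \<B>"
      unfolding the Let_def split ins rest using aB by (simp add: insert_absorb)
  qed
  also have "\<dots> = (\<Sum>\<B>\<in>block_systems A (Suc k). \<Sum>B\<in>\<B>. f (insert (insert a B) (\<B> - {B})))"
    using finite_block_systems[OF A(1)] by (subst sum.Sigma) (auto simp: block_systems_def)
  finally show ?thesis .
qed

text \<open>The points outside of the blocks, together with one additional point, form one more part,
  so that block systems become set partitions.\<close>
lemma card_block_systems:
  "finite A \<Longrightarrow> card (block_systems A k) = Stirling (Suc (card A)) (Suc k)"
proof (induction A arbitrary: k rule: finite_induct)
  case empty
  then show ?case by (cases k) auto
next
  case (insert a A)
  show ?case
  proof (cases k)
    case 0
    then show ?thesis by (simp del: Stirling.simps)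
  next
    case (Suc m)
    have "card (block_systems (insert a A) (Suc m)) = (\<Sum>\<B>\<in>block_systems (insert a A) (Suc m). 1)"
      by simp
    also have "\<dots> = card (block_systems A (Suc m)) + card (block_systems A m) +
      (\<Sum>\<B>\<in>block_systems A (Suc m). card \<B>)"
      by (subst sum_block_systems_insert[OF insert.hyps]) simp
    also have "(\<Sum>\<B>\<in>block_systems A (Suc m). card \<B>) = (\<Sum>\<B>\<in>block_systems A (Suc m). Suc m)"
      by (rule sum.cong) (auto simp: block_systems_def)
    finally show ?thesis
      using insert by (simp add: Suc)
  qed
qed

text \<open>Adjoining a point to the complement of the blocks turns a block system into a partition
  of a set with one more element, and the weight counts the ways to make each of its \<open>k + 1\<close>
  parts a cycle.\<close>
lemma sum_block_systems_cycles:
  "finite A \<Longrightarrow> (\<Sum>\<B>\<in>block_systems A k. fact (card (A - \<Union>\<B>)) * (\<Prod>B\<in>\<B>. fact (card B - 1)))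
     = stirling (Suc (card A)) (Suc k)"
proof (induction A arbitrary: k rule: finite_induct)
  case empty
  then show ?case by (cases k) auto
next
  case (insert a A)
  show ?case
  proof (cases k)
    case 0
    then show ?thesis using insert.hyps by (simp add: stirling_Suc_n_1 del: stirling.simps)
  next
    case (Suc m)
    define w where "w A \<B> = fact (card (A - \<Union>\<B>)) * (\<Prod>B\<in>\<B>. fact (card B - 1) :: nat)"
      for A :: "'a set" and \<B> :: "'a set set"
    have D: "finite B" "card B > 0" "a \<notin> B" if "\<B> \<in> block_systems A k" "B \<in> \<B>" for \<B> B k
    proof -
      show "finite B" using block_systemsD(5)[OF that] insert.hyps(1) finite_subset by blast
      then show "card B > 0" using block_systemsD(4)[OF that] by (simp add: card_gt_0_iff)
      show "a \<notin> B" using block_systemsD(5)[OF that] insert.hyps(2) by blast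
    qed
    have 1: "w (insert a A) \<B> = (card (A - \<Union>\<B>) + 1) * w A \<B>" if "\<B> \<in> block_systems A k" for \<B> k
    proof -
      have "insert a A - \<Union>\<B> = insert a (A - \<Union>\<B>)" using D(3)[OF that] by auto
      then show ?thesis using insert.hyps by (simp add: w_def algebra_simps)
    qed
    have 2: "w (insert a A) (insert {a} \<B>) = w A \<B>" if "\<B> \<in> block_systems A k" for \<B> k
    proof -
      have "insert a A - \<Union>(insert {a} \<B>) = A - \<Union>\<B>" "{a} \<notin> \<B>"
        using D(3)[OF that] insert.hyps(2) by auto
      then show ?thesis using block_systemsD(1)[OF that] by (simp add: w_def)
    qed
    have 3: "w (insert a A) (insert (insert a B) (\<B> - {B})) = card B * w A \<B>"
      if B: "\<B> \<in> block_systems A k" "B \<in> \<B>" for \<B> B k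
    proof -
      have u: "insert a A - \<Union>(insert (insert a B) (\<B> - {B})) = A - \<Union>\<B>"
        using D(3)[OF B(1)] B(2) insert.hyps(2) by auto
      have "insert a B \<notin> \<B> - {B}" using D(3)[OF B(1)] by blast
      then have "(\<Prod>C\<in>insert (insert a B) (\<B> - {B}). fact (card C - 1) :: nat) =
          fact (card B) * (\<Prod>C\<in>\<B> - {B}. fact (card C - 1))"
        using block_systemsD(1)[OF B(1)] D[OF B] by simp
      also have "fact (card B) = card B * (fact (card B - 1) :: nat)"
        using fact_reduce[OF D(2)[OF B], where 'a = nat] by simp
      also have "card B * fact (card B - 1) * (\<Prod>C\<in>\<B> - {B}. fact (card C - 1)) = card B * (\<Prod>C\<in>\<B>. fact (card C - 1))"
        using prod.remove[OF block_systemsD(1)[OF B(1)] B(2), of "\<lambda>C. fact (card C - 1) :: nat"]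
        by (simp only: mult.assoc)
      finally show ?thesis unfolding w_def u by (simp only: mult.left_commute)
    qed
    have sumc: "(\<Sum>B\<in>\<B>. card B) = card (\<Union>\<B>)" if "\<B> \<in> block_systems A k" for \<B> k
    proof -
      have "pairwise disjnt \<B>"
        using block_systemsD(3)[OF that] by (simp add: pairwise_def disjnt_def)
      then show ?thesis
        using D(1)[OF that] by (simp add: card_Union_disjoint)
    qed
    have tot: "card (A - \<Union>\<B>) + card (\<Union>\<B>) = card A" if "\<B> \<in> block_systems A k" for \<B> k
    proof -
      have sub: "\<Union>\<B> \<subseteq> A" by (rule block_systemsD(6)[OF that])
      have "finite (\<Union>\<B>)" using sub insert.hyps(1) by (rule finite_subset)
      then show ?thesis
        using card_mono[OF insert.hyps(1) sub] card_Diff_subset[of "\<Union>\<B>" A] sub by simp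
    qed
    have "(\<Sum>\<B>\<in>block_systems (insert a A) (Suc m). w (insert a A) \<B>)
      = (\<Sum>\<B>\<in>block_systems A (Suc m). (card (A - \<Union>\<B>) + 1) * w A \<B>) + (\<Sum>\<B>\<in>block_systems A m. w A \<B>)
        + (\<Sum>\<B>\<in>block_systems A (Suc m). \<Sum>B\<in>\<B>. card B * w A \<B>)"
    proof -
      have "(\<Sum>\<B>\<in>block_systems A (Suc m). w (insert a A) \<B>) = (\<Sum>\<B>\<in>block_systems A (Suc m). (card (A - \<Union>\<B>) + 1) * w A \<B>)"
        by (rule sum.cong[OF refl]) (rule 1)
      moreover have "(\<Sum>\<B>\<in>block_systems A m. w (insert a A) (insert {a} \<B>)) = (\<Sum>\<B>\<in>block_systems A m. w A \<B>)"
        by (rule sum.cong[OF refl]) (rule 2)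
      moreover have "(\<Sum>\<B>\<in>block_systems A (Suc m). \<Sum>B\<in>\<B>. w (insert a A) (insert (insert a B) (\<B> - {B})))
          = (\<Sum>\<B>\<in>block_systems A (Suc m). \<Sum>B\<in>\<B>. card B * w A \<B>)"
        by (intro sum.cong[OF refl]) (rule 3)
      ultimately show ?thesis
        unfolding sum_block_systems_insert[OF insert.hyps] by (simp only:)
    qed
    also have "\<dots> = (\<Sum>\<B>\<in>block_systems A (Suc m). (card (A - \<Union>\<B>) + 1 + card (\<Union>\<B>)) * w A \<B>)
        + (\<Sum>\<B>\<in>block_systems A m. w A \<B>)"
    proof -
      have "(\<Sum>\<B>\<in>block_systems A (Suc m). \<Sum>B\<in>\<B>. card B * w A \<B>)
          = (\<Sum>\<B>\<in>block_systems A (Suc m). card (\<Union>\<B>) * w A \<B>)"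
        unfolding sum_distrib_right[symmetric] by (rule sum.cong) (simp_all only: sumc)
      then show ?thesis
        by (simp only: add_mult_distrib sum.distrib add_ac)
    qed
    also have "(\<Sum>\<B>\<in>block_systems A (Suc m). (card (A - \<Union>\<B>) + 1 + card (\<Union>\<B>)) * w A \<B>)
      = (\<Sum>\<B>\<in>block_systems A (Suc m). Suc (card A) * w A \<B>)"
    proof (rule sum.cong[OF refl])
      fix \<B> assume "\<B> \<in> block_systems A (Suc m)"
      then have "card (A - \<Union>\<B>) + 1 + card (\<Union>\<B>) = Suc (card A)" using tot by simp
      then show "(card (A - \<Union>\<B>) + 1 + card (\<Union>\<B>)) * w A \<B> = Suc (card A) * w A \<B>" by (simp only:)
    qed
    also have "\<dots> = Suc (card A) * stirling (Suc (card A)) (Suc (Suc m))"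
      unfolding sum_distrib_left[of "Suc (card A)" "w A", symmetric] unfolding w_def insert.IH ..
    also have "(\<Sum>\<B>\<in>block_systems A m. w A \<B>) = stirling (Suc (card A)) (Suc m)"
      using insert.IH[of m] by (simp add: w_def)
    finally show ?thesis
      unfolding Suc w_def card_insert_disjoint[OF insert.hyps] stirling.simps(4)[of "Suc (card A)"] .
  qed
qed

section \<open>Regrouping the block decompositions of all orderings\<close>

lemma permutations_of_set_iff: "xs \<in> permutations_of_set A \<longleftrightarrow> set xs = A \<and> distinct xs"
  by (auto simp: permutations_of_set_def)

definition orderings :: "'a set list \<Rightarrow> 'a list list set" where
  "orderings Bs = {bs. list_all2 (\<lambda>b B. b \<in> permutations_of_set B) bs Bs}"

lemma orderings_Cons:
  "orderings (B # Bs) = (\<lambda>(b, bs). b # bs) ` (permutations_of_set B \<times> orderings Bs)"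
  by (auto simp: orderings_def list_all2_Cons2)

lemma map_set_orderings: "bs \<in> orderings Bs \<Longrightarrow> map set bs = Bs"
  unfolding orderings_def
  by (auto simp: list_all2_conv_all_nth permutations_of_set_iff intro!: nth_equalityI)

lemma finite_orderings [simp]: "finite (orderings Bs)"
  by (induction Bs) (auto simp: orderings_Cons, simp add: orderings_def)

lemma card_orderings_filter:
  "card {bs \<in> orderings Bs. \<forall>b\<in>set bs. Q b} = (\<Prod>B\<leftarrow>Bs. card {b \<in> permutations_of_set B. Q b})"
proof (induction Bs)
  case Nil
  have "{bs \<in> orderings []. \<forall>b\<in>set bs. Q b} = {[]}" by (auto simp: orderings_def)
  then show ?case by simp
next
  case (Cons B Bs)
  have "{bs \<in> orderings (B # Bs). \<forall>b\<in>set bs. Q b} =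
    (\<lambda>(b, bs). b # bs) ` ({b \<in> permutations_of_set B. Q b} \<times> {bs \<in> orderings Bs. \<forall>b\<in>set bs. Q b})"
    by (auto simp: orderings_Cons)
  moreover have "inj_on (\<lambda>(b, bs). b # bs) X" for X :: "('a list \<times> 'a list list) set"
    by (auto simp: inj_on_def)
  ultimately show ?case
    using Cons by (simp add: card_image card_cartesian_product)
qed

lemma finite_triples: "finite A \<Longrightarrow> finite (triples A k)"
proof -
  assume A: "finite A"
  have sub: "triples A k \<subseteq> (\<Union>xs\<in>permutations_of_set A. decomps k xs)"
    by (auto simp: triples_def decomps_def)
  have "finite (decomps k xs)" for xs :: "'a list"
    using bij_betw_finite[OF bij_betw_cuts[of k xs]] by simp
  then show ?thesis
    by (intro finite_subset[OF sub] finite_UN_I) auto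
qed

text \<open>Once the sets underlying the blocks are fixed, the outer pieces and the blocks can be ordered
  independently.\<close>
lemma triples_fiber:
  assumes "\<B> \<in> block_systems A k" "Bs \<in> permutations_of_set \<B>"
  shows "(u, bs, v) \<in> triples A k \<and> map set bs = Bs \<longleftrightarrow>
    u @ v \<in> permutations_of_set (A - \<Union>\<B>) \<and> bs \<in> orderings Bs"
proof -
  note D = block_systemsD[OF assms(1)]
  have Bs: "set Bs = \<B>" "distinct Bs" using assms(2) by (auto simp: permutations_of_set_iff)
  have len: "length Bs = k" using D(2) Bs distinct_card by fastforce
  have dc: "distinct (concat bs) \<longleftrightarrow> (\<forall>b\<in>set bs. distinct b)"
    if "map set bs = Bs"
  proof -
    have 1: "distinct bs" "\<And>b b'. b \<in> set bs \<Longrightarrow> b' \<in> set bs \<Longrightarrow> b \<noteq> b' \<Longrightarrow> set b \<inter> set b' = {}"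
    proof -
      show "distinct bs" using that Bs(2) distinct_map by blast
      have "inj_on set (set bs)" using that Bs(2) distinct_map by blast
      then show "set b \<inter> set b' = {}" if "b \<in> set bs" "b' \<in> set bs" "b \<noteq> b'" for b b'
        using D(3)[of "set b" "set b'"] that \<open>map set bs = Bs\<close> Bs(1)
        by (metis image_eqI inj_on_eq_iff list.set_map)
    qed
    have "[] \<notin> set bs" using that D(4) Bs(1) by force
    then have "removeAll [] bs = bs" by (simp add: removeAll_id)
    then show ?thesis
      using 1 by (auto simp: distinct_concat_iff)
  qed
  have sc: "set (concat bs) = \<Union>\<B>" if "map set bs = Bs"
    using that Bs(1) by (metis set_concat list.set_map)
  show ?thesis
  proof
    assume L: "(u, bs, v) \<in> triples A k \<and> map set bs = Bs"
    then have "list_all2 (\<lambda>b B. b \<in> permutations_of_set B) bs Bs"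
      using dc by (auto simp: list_all2_map2 list_all2_same triples_def permutations_of_set_iff)
    moreover have "u @ v \<in> permutations_of_set (A - \<Union>\<B>)"
      using L sc by (auto simp: triples_def permutations_of_set_iff)
    ultimately show "u @ v \<in> permutations_of_set (A - \<Union>\<B>) \<and> bs \<in> orderings Bs"
      by (simp add: orderings_def)
  next
    assume R: "u @ v \<in> permutations_of_set (A - \<Union>\<B>) \<and> bs \<in> orderings Bs"
    then have m: "map set bs = Bs" by (simp add: map_set_orderings)
    have "\<forall>b\<in>set bs. distinct b"
      using R by (auto simp: orderings_def list_all2_conv_all_nth permutations_of_set_iff in_set_conv_nth)
    then have "distinct (concat bs)" using dc[OF m] by simp
    moreover have "[] \<notin> set bs" using m D(4) Bs(1) by force
    moreover have "length bs = k" using m len by auto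
    ultimately have "(u, bs, v) \<in> triples A k"
      using R sc[OF m] D(6) by (auto simp: triples_def permutations_of_set_iff)
    then show "(u, bs, v) \<in> triples A k \<and> map set bs = Bs" using m by simp
  qed
qed

lemma triples_set_in_block_systems:
  assumes "finite A" "(u, bs, v) \<in> triples A k"
  shows "set (map set bs) \<in> block_systems A k" "distinct (map set bs)"
proof -
  have bs: "distinct (concat bs)" "[] \<notin> set bs" "length bs = k" "set (concat bs) \<subseteq> A"
    using assms by (auto simp: triples_def permutations_of_set_iff)
  have "removeAll [] bs = bs" using bs(2) by (simp add: removeAll_id)
  then have d: "distinct bs" "\<And>b b'. b \<in> set bs \<Longrightarrow> b' \<in> set bs \<Longrightarrow> b \<noteq> b' \<Longrightarrow> set b \<inter> set b' = {}"
    using bs(1) by (auto simp: distinct_concat_iff)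
  have ne: "set b \<noteq> {}" if "b \<in> set bs" for b using bs(2) that by auto
  have "inj_on set (set bs)"
    using d(2) ne by (intro inj_onI) (metis Int_absorb)
  then show dm: "distinct (map set bs)" using d(1) by (simp add: distinct_map)
  have "disjoint (set (map set bs))"
    unfolding disjoint_def using d(2) by auto
  then show "set (map set bs) \<in> block_systems A k"
    using bs ne distinct_card[OF dm] by (auto simp: block_systems_def)
qed

text \<open>If a condition on a decomposition is a conjunction of conditions on its pieces that depend
  on the other pieces only through their underlying sets, then the decompositions can be counted
  by choosing the block system first and ordering each block, and the blocks, afterwards.\<close>
lemma sum_triples:
  fixes h :: "'a set list \<Rightarrow> nat"
  assumes A: "finite A"
  shows "(\<Sum>(u, bs, v)\<in>triples A k. of_bool (Qo (set ` set bs) u v \<and> (\<forall>b\<in>set bs. Qi (set ` set bs) b)) * h (map set bs))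
    = (\<Sum>\<B>\<in>block_systems A k. card {(u, v). u @ v \<in> permutations_of_set (A - \<Union>\<B>) \<and> Qo \<B> u v} *
        (\<Prod>B\<in>\<B>. card {b \<in> permutations_of_set B. Qi \<B> b}) * (\<Sum>Bs\<in>permutations_of_set \<B>. h Bs))"
proof -
  define f where "f = (\<lambda>(u, bs, v). of_bool (Qo (set ` set bs) u v \<and> (\<forall>b\<in>set bs. Qi (set ` set bs) b)) * h (map set bs))"
  define S where "S = Sigma (block_systems A k) permutations_of_set"
  have finS: "finite S"
    unfolding S_def by (intro finite_SigmaI finite_block_systems A) auto
  define key where "key = (\<lambda>(u::'a list, bs :: 'a list list, v::'a list). (set (map set bs), map set bs))"
  have key: "key ` triples A k \<subseteq> S"
    using triples_set_in_block_systems[OF A] by (fastforce simp: key_def S_def permutations_of_set_iff)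
  have "sum f (triples A k) = (\<Sum>p\<in>S. sum f {t \<in> triples A k. key t = p})"
    using sum.group[OF finite_triples[OF A] finS key, of f] by simp
  also have "\<dots> = (\<Sum>(\<B>, Bs)\<in>S. card {(u, v). u @ v \<in> permutations_of_set (A - \<Union>\<B>) \<and> Qo \<B> u v} *
        (\<Prod>B\<in>\<B>. card {b \<in> permutations_of_set B. Qi \<B> b}) * h Bs)"
  proof (rule sum.cong[OF refl], clarify)
    fix \<B> Bs assume p: "(\<B>, Bs) \<in> S"
    then have B: "\<B> \<in> block_systems A k" "Bs \<in> permutations_of_set \<B>" by (auto simp: S_def)
    have sB: "set Bs = \<B>" "distinct Bs" using B(2) by (auto simp: permutations_of_set_iff)
    let ?O = "{(u, v). u @ v \<in> permutations_of_set (A - \<Union>\<B>) \<and> Qo \<B> u v}"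
    let ?I = "{bs \<in> orderings Bs. \<forall>b\<in>set bs. Qi \<B> b}"
    let ?F = "{t \<in> triples A k. key t = (\<B>, Bs)}"
    have mem: "(u, bs, v) \<in> ?F \<longleftrightarrow> u @ v \<in> permutations_of_set (A - \<Union>\<B>) \<and> bs \<in> orderings Bs" for u bs v
      using triples_fiber[OF B, of u bs v] sB by (auto simp: key_def)
    have setbs: "set ` set bs = \<B>" if "bs \<in> orderings Bs" for bs
      using map_set_orderings[OF that] sB(1) by (metis list.set_map)
    have finF: "finite ?F" using finite_triples[OF A] by simp
    have "sum f ?F = (\<Sum>t\<in>?F. if t \<in> (\<lambda>((u, v), bs). (u, bs, v)) ` (?O \<times> ?I) then h Bs else 0)"
    proof (rule sum.cong[OF refl])
      fix t assume t: "t \<in> ?F"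
      obtain u bs v where tt: "t = (u, bs, v)" by (metis prod_cases3)
      have m: "u @ v \<in> permutations_of_set (A - \<Union>\<B>)" "bs \<in> orderings Bs"
        using t mem unfolding tt by auto
      show "f t = (if t \<in> (\<lambda>((u, v), bs). (u, bs, v)) ` (?O \<times> ?I) then h Bs else 0)"
        using m by (auto simp: tt f_def setbs map_set_orderings image_iff)
    qed
    also have "\<dots> = (\<Sum>t\<in>?F \<inter> ((\<lambda>((u, v), bs). (u, bs, v)) ` (?O \<times> ?I)). h Bs)"
      using finF by (rule sum.inter_restrict[symmetric])
    also have "?F \<inter> ((\<lambda>((u, v), bs). (u, bs, v)) ` (?O \<times> ?I)) = (\<lambda>((u, v), bs). (u, bs, v)) ` (?O \<times> ?I)"
      by (rule Int_absorb1) (use mem in auto)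
    also have "(\<Sum>t\<in>\<dots>. h Bs) = card (?O \<times> ?I) * h Bs"
      by (simp add: card_image inj_on_def)
    also have "\<dots> = card ?O * (\<Prod>B\<in>\<B>. card {b \<in> permutations_of_set B. Qi \<B> b}) * h Bs"
      unfolding card_cartesian_product card_orderings_filter
      using prod.distinct_set_conv_list[OF sB(2), of "\<lambda>B. card {b \<in> permutations_of_set B. Qi \<B> b}"] sB(1)
      by simp
    finally show "sum f ?F = card ?O * (\<Prod>B\<in>\<B>. card {b \<in> permutations_of_set B. Qi \<B> b}) * h Bs" .
  qed
  also have "\<dots> = (\<Sum>\<B>\<in>block_systems A k. \<Sum>Bs\<in>permutations_of_set \<B>. card {(u, v). u @ v \<in> permutations_of_set (A - \<Union>\<B>) \<and> Qo \<B> u v} *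
        (\<Prod>B\<in>\<B>. card {b \<in> permutations_of_set B. Qi \<B> b}) * h Bs)"
    unfolding S_def using finite_block_systems[OF A]
    by (subst sum.Sigma) auto
  finally show ?thesis
    unfolding f_def sum_distrib_left .
qed

section \<open>Cyclic lemma for partial sums\<close>

definition psum :: "('a \<Rightarrow> real) \<Rightarrow> 'a list \<Rightarrow> nat \<Rightarrow> real" where
  "psum \<eta> xs i = (\<Sum>x\<leftarrow>take i xs. \<eta> x)"

lemma ex1_argmin:
  fixes s :: "'b \<Rightarrow> real"
  assumes "finite S" "S \<noteq> {}" "inj_on s S"
  shows "\<exists>!r. r \<in> S \<and> (\<forall>i\<in>S. s r \<le> s i)"
proof -
  have "Min (s ` S) \<in> s ` S" using assms by simp
  then obtain r where r: "r \<in> S" "s r = Min (s ` S)" by auto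
  then have "\<forall>i\<in>S. s r \<le> s i" using assms(1) by simp
  then show ?thesis
    using r(1) assms(3) by (metis dual_order.antisym inj_onD)
qed

lemma card_ex1: "\<exists>!x. P x \<Longrightarrow> card {x. P x} = 1"
  by (metis (mono_tags, lifting) Collect_cong card_1_singleton_iff is_singletonI singleton_conv One_nat_def)

lemma psum_diff:
  assumes "distinct xs" "i \<le> j" "j \<le> length xs"
  shows "psum \<eta> xs j - psum \<eta> xs i = sum \<eta> (set (drop i (take j xs)))"
proof -
  have "take j xs = take i xs @ drop i (take j xs)"
    by (metis append_take_drop_id assms(2) min.absorb1 take_take)
  then have "psum \<eta> xs j = psum \<eta> xs i + (\<Sum>x\<leftarrow>drop i (take j xs). \<eta> x)"
    unfolding psum_def by (metis map_append sum_list_append)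
  then show ?thesis
    using assms(1) by (simp add: sum_list_distinct_conv_sum_set)
qed

text \<open>Among the rotations of an ordering exactly one is nonnegative, namely the one that starts where the
  partial sums attain their minimum, which is unique by genericity. So one in \<open>card B\<close>
  orderings is nonnegative.\<close>
lemma card_block_orderings:
  assumes B: "finite B" "B \<noteq> {}" and tot: "sum \<eta> B = 0"
    and gen: "\<And>D. D \<subset> B \<Longrightarrow> D \<noteq> {} \<Longrightarrow> sum \<eta> D \<noteq> 0"
  shows "card {b \<in> permutations_of_set B. \<forall>i\<le>length b. 0 \<le> psum \<eta> b i} = fact (card B - 1)"
proof -
  define m where "m = card B"
  have m: "m > 0" using B by (simp add: m_def card_gt_0_iff)
  let ?P = "permutations_of_set B"
  define good where "good b \<longleftrightarrow> (\<forall>i\<le>length b. 0 \<le> psum \<eta> b i)" for b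
  have len: "length b = m" "distinct b" "set b = B" if "b \<in> ?P" for b
    using that distinct_card by (fastforce simp: permutations_of_set_iff m_def)+
  \<comment> \<open>Double counting of pairs of an ordering and a rotation that makes it nonnegative.\<close>
  have rot: "card {b \<in> ?P. good (rotate r b)} = card {b \<in> ?P. good b}" for r
  proof -
    have rP: "rotate r b \<in> ?P \<longleftrightarrow> b \<in> ?P" for b by (simp add: permutations_of_set_iff)
    have inj: "inj (rotate r :: 'a list \<Rightarrow> 'a list)"
      unfolding rotate_def by (rule inj_fn[OF inj_rotate1])
    have im: "rotate r ` ?P = ?P"
      using rP inj_on_subset[OF inj subset_UNIV] by (intro endo_inj_surj) auto
    have "rotate r ` {b \<in> ?P. good (rotate r b)} = {b \<in> ?P. good b}"
    proof (intro equalityI subsetI)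
      fix b assume b: "b \<in> {b \<in> ?P. good b}"
      then have "b \<in> rotate r ` ?P" unfolding im by simp
      then obtain c where "c \<in> ?P" "b = rotate r c" by (rule imageE)
      then show "b \<in> rotate r ` {b \<in> ?P. good (rotate r b)}" using b by simp
    qed (clarsimp simp: rP)
    then show ?thesis
      by (metis card_image inj inj_on_subset subset_UNIV)
  qed
  have one: "card {r \<in> {..<m}. good (rotate r b)} = 1" if b: "b \<in> ?P" for b
  proof -
    define s where "s = psum \<eta> b"
    have s0: "s 0 = 0" "s m = 0"
      using len[OF b] tot by (auto simp: s_def psum_def sum_list_distinct_conv_sum_set)
    have inj: "inj_on s {..<m}"
    proof (rule linorder_inj_onI')
      fix i j assume ij: "i \<in> {..<m}" "j \<in> {..<m}" "i < j"
      let ?D = "set (drop i (take j b))"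
      have "card ?D = j - i"
        using len[OF b] ij distinct_card[of "drop i (take j b)"] by simp
      then have "card ?D < card B" "?D \<noteq> {}" using ij by (auto simp: m_def)
      moreover have "?D \<subseteq> B"
        using len(3)[OF b] by (metis in_set_dropD in_set_takeD subsetI)
      ultimately have "sum \<eta> ?D \<noteq> 0" by (intro gen) auto
      then show "s i \<noteq> s j"
        using psum_diff[OF len(2)[OF b], of i j \<eta>] ij len(1)[OF b] by (simp add: s_def)
    qed
    have good: "good (rotate r b) \<longleftrightarrow> (\<forall>i\<in>{..<m}. s r \<le> s i)" if r: "r < m" for r
    proof -
      have rb: "rotate r b = drop r b @ take r b"
        using r len[OF b] by (simp add: rotate_drop_take)
      have 1: "psum \<eta> (rotate r b) i = s (r + i) - s r" if "i \<le> m - r" for i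
      proof -
        have "s (r + i) = s r + psum \<eta> (rotate r b) i"
          using that r len[OF b] by (simp add: s_def psum_def rb take_add)
        then show ?thesis by simp
      qed
      have 2: "psum \<eta> (rotate r b) i = s (i - (m - r)) - s r" if "m - r < i" "i \<le> m" for i
      proof -
        have "psum \<eta> (rotate r b) i = (\<Sum>x\<leftarrow>drop r b. \<eta> x) + s (i - (m - r))"
          using that r len[OF b] by (simp add: s_def psum_def rb min_def)
        moreover have "s m = s r + (\<Sum>x\<leftarrow>drop r b. \<eta> x)"
          using len(1)[OF b] by (simp add: s_def psum_def flip: sum_list_append map_append)
        ultimately show ?thesis using s0 by simp
      qed
      show ?thesis
      proof
        assume g: "good (rotate r b)"
        show "\<forall>i\<in>{..<m}. s r \<le> s i"
        proof
          fix i assume i: "i \<in> {..<m}"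
          show "s r \<le> s i"
          proof (cases "r \<le> i")
            case True
            then have "0 \<le> psum \<eta> (rotate r b) (i - r)" using g i len[OF b] by (auto simp: good_def)
            then show ?thesis using 1[of "i - r"] i True by simp
          next
            case False
            then have "0 \<le> psum \<eta> (rotate r b) (i + (m - r))" using g i r len[OF b] by (auto simp: good_def)
            then show ?thesis
              using 2[of "i + (m - r)"] 1[of "m - r"] False r s0 by (cases "i = 0") auto
          qed
        qed
      next
        assume a: "\<forall>i\<in>{..<m}. s r \<le> s i"
        then have a': "s r \<le> s i" if "i \<le> m" for i
          using a bspec[OF a, of 0] that s0 m by (cases "i = m") auto
        show "good (rotate r b)"
          unfolding good_def
        proof (intro allI impI)
          fix i assume "i \<le> length (rotate r b)"
          then have "i \<le> m" using len[OF b] by simp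
          then show "0 \<le> psum \<eta> (rotate r b) i"
            using 1[of i] 2[of i] a'[of "r + i"] a'[of "i - (m - r)"] r by (cases "i \<le> m - r") auto
        qed
      qed
    qed
    have "{r \<in> {..<m}. good (rotate r b)} = {r. r \<in> {..<m} \<and> (\<forall>i\<in>{..<m}. s r \<le> s i)}"
      using good by auto
    also have "card \<dots> = 1"
      by (intro card_ex1 ex1_argmin inj) (use m in auto)
    finally show ?thesis .
  qed
  have "m * card {b \<in> ?P. good b} = (\<Sum>r<m. card {b \<in> ?P. good (rotate r b)})"
    by (simp add: rot)
  also have "\<dots> = (\<Sum>r<m. \<Sum>b\<in>?P. of_bool (good (rotate r b)))"
    by (simp add: Int_def)
  also have "\<dots> = (\<Sum>b\<in>?P. \<Sum>r<m. of_bool (good (rotate r b)))"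
    by (rule sum.swap)
  also have "\<dots> = (\<Sum>b\<in>?P. 1)"
    by (rule sum.cong) (use one in \<open>simp_all add: Int_def\<close>)
  also have "\<dots> = fact m"
    using B by (simp add: m_def)
  finally have "m * card {b \<in> ?P. good b} = m * fact (m - 1)"
    using m by (simp add: fact_reduce)
  then show ?thesis
    using m by (simp add: good_def m_def)
qed

text \<open>The minimum of the partial sums is attained only once, so each ordering of \<open>D\<close> is cut in exactly one
  place.\<close>
lemma card_outer_orderings:
  assumes D: "finite D" and gen: "\<And>E. E \<subseteq> D \<Longrightarrow> E \<noteq> {} \<Longrightarrow> sum \<eta> E \<noteq> 0"
  shows "card {(u, v). u @ v \<in> permutations_of_set D \<and>
    (\<forall>i\<le>length (u @ v). psum \<eta> (u @ v) (length u) \<le> psum \<eta> (u @ v) i)} = fact (card D)"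
proof -
  let ?P = "permutations_of_set D"
  let ?S = "{(u, v). u @ v \<in> ?P \<and> (\<forall>i\<le>length (u @ v). psum \<eta> (u @ v) (length u) \<le> psum \<eta> (u @ v) i)}"
  have "bij_betw (\<lambda>(u, v). u @ v) ?S ?P"
  proof (rule bij_betw_imageI)
    have ex1: "\<exists>!r. r \<in> {..length xs} \<and> (\<forall>i\<in>{..length xs}. psum \<eta> xs r \<le> psum \<eta> xs i)" if xs: "xs \<in> ?P" for xs
    proof (rule ex1_argmin)
      show "inj_on (psum \<eta> xs) {..length xs}"
      proof (rule linorder_inj_onI')
        fix i j assume ij: "i \<in> {..length xs}" "j \<in> {..length xs}" "i < j"
        have "drop i (take j xs) \<noteq> []" using ij by simp
        moreover have "set (drop i (take j xs)) \<subseteq> D"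
          using xs by (metis in_set_dropD in_set_takeD permutations_of_set_iff subsetI)
        ultimately have "sum \<eta> (set (drop i (take j xs))) \<noteq> 0" by (intro gen) (auto simp del: drop_eq_Nil)
        then show "psum \<eta> xs i \<noteq> psum \<eta> xs j"
          using psum_diff[of xs i j \<eta>] ij xs by (auto simp: permutations_of_set_iff)
      qed
    qed auto
    show "inj_on (\<lambda>(u, v). u @ v) ?S"
    proof (rule inj_onI, clarify)
      fix u v u' v' :: "'a list"
      assume eq: "u @ v = u' @ v'" and P: "u @ v \<in> ?P"
        and m: "\<forall>i\<le>length (u @ v). psum \<eta> (u @ v) (length u) \<le> psum \<eta> (u @ v) i"
          "\<forall>i\<le>length (u' @ v'). psum \<eta> (u' @ v') (length u') \<le> psum \<eta> (u' @ v') i"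
      have "length u' \<le> length (u @ v)" using eq by simp
      then have "length u = length u'"
        using ex1[OF P] m unfolding eq[symmetric] by (auto simp: Ball_def)
      then show "u = u' \<and> v = v'" using eq by simp
    qed
    show "(\<lambda>(u, v). u @ v) ` ?S = ?P"
    proof (intro equalityI subsetI)
      fix xs assume xs: "xs \<in> ?P"
      obtain r where r: "r \<le> length xs" "\<forall>i\<in>{..length xs}. psum \<eta> xs r \<le> psum \<eta> xs i"
        using ex1[OF xs] by auto
      then show "xs \<in> (\<lambda>(u, v). u @ v) ` ?S"
        using xs by (intro image_eqI[of _ _ "(take r xs, drop r xs)"]) (auto simp: min_absorb2)
    qed auto
  qed
  then show ?thesis
    using bij_betw_same_card D by fastforce
qed

section \<open>Orderings with prescribed descents\<close>

lemma sum_decomps: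
  assumes "finite A"
  shows "(\<Sum>xs\<in>permutations_of_set A. \<Sum>t\<in>decomps k xs. f t) = (\<Sum>t\<in>triples A k. f t)"
proof -
  have fin: "finite (decomps k xs)" for xs :: "'a list"
    using bij_betw_finite[OF bij_betw_cuts[of k xs]] by simp
  have "triples A k = (\<Union>xs\<in>permutations_of_set A. decomps k xs)"
    by (auto simp: triples_def decomps_def)
  also have "sum f \<dots> = (\<Sum>xs\<in>permutations_of_set A. sum f (decomps k xs))"
    using assms fin by (intro sum.UNION_disjoint) (auto simp: decomps_def)
  finally show ?thesis ..
qed

definition decr :: "('a \<Rightarrow> real) \<Rightarrow> 'a list \<Rightarrow> bool" where
  "decr C xs \<longleftrightarrow> sorted_wrt (\<lambda>x y. C y \<le> C x) xs"

lemma ex1_decr: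
  assumes "finite D" "inj_on C D"
  shows "\<exists>!b. b \<in> permutations_of_set D \<and> decr C b"
proof -
  have uniq: "b = b'" if b: "b \<in> permutations_of_set D" "decr C b"
    and b': "b' \<in> permutations_of_set D" "decr C b'" for b b'
  proof -
    have "rev (map C b) = rev (map C b')"
    proof (rule sorted_distinct_set_unique)
      show "sorted (rev (map C b))" "sorted (rev (map C b'))"
        using b b' by (simp_all add: decr_def sorted_wrt_rev sorted_wrt_map)
      show "distinct (rev (map C b))" "distinct (rev (map C b'))"
        using b b' assms(2) by (simp_all add: permutations_of_set_iff distinct_map)
      show "set (rev (map C b)) = set (rev (map C b'))"
        using b b' by (simp add: permutations_of_set_iff)
    qed
    then have "map C b = map C b'" by simp
    then show "b = b'"
      using b b' assms(2) by (intro map_inj_on[of C]) (auto simp: permutations_of_set_iff)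
  qed
  obtain xs where xs: "set xs = D" "distinct xs"
    using finite_distinct_list[OF assms(1)] by blast
  have "decr C (rev (sort_key C xs))"
    using sorted_sort_key[of C xs] by (simp add: decr_def sorted_wrt_rev sorted_wrt_map)
  then have "rev (sort_key C xs) \<in> permutations_of_set D \<and> decr C (rev (sort_key C xs))"
    using xs by (simp add: permutations_of_set_iff)
  then show ?thesis using uniq by blast
qed

lemma card_decr:
  assumes "finite D" "inj_on C D"
  shows "card {b \<in> permutations_of_set D. decr C b} = 1"
  by (rule card_ex1[OF ex1_decr[OF assms]])

text \<open>The nonpositive elements in decreasing order, then the nonnegative ones: since no value is \<open>0\<close>, the
  signs decide which element belongs to which piece.\<close>
lemma card_decr_outer:
  assumes "finite D" "inj_on C D" "\<And>x. x \<in> D \<Longrightarrow> C x \<noteq> 0"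
  shows "card {(u, v). u @ v \<in> permutations_of_set D \<and> decr C u \<and> decr C v \<and>
     (\<forall>x\<in>set u. C x \<le> 0) \<and> (\<forall>x\<in>set v. 0 \<le> C x)} = 1"
proof -
  let ?N = "{x \<in> D. C x < 0}" and ?P = "{x \<in> D. 0 < C x}"
  have "{(u, v). u @ v \<in> permutations_of_set D \<and> decr C u \<and> decr C v \<and>
     (\<forall>x\<in>set u. C x \<le> 0) \<and> (\<forall>x\<in>set v. 0 \<le> C x)} =
     {u \<in> permutations_of_set ?N. decr C u} \<times> {v \<in> permutations_of_set ?P. decr C v}"
    using assms(3) by (fastforce simp: permutations_of_set_iff)
  then show ?thesis
    using card_decr[of ?N C] card_decr[of ?P C] assms
    by (simp add: card_cartesian_product inj_on_subset)
qed

text \<open>Positions in \<open>S\<close> are those where a new descending run may start.\<close>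
definition descends_off :: "nat set \<Rightarrow> real list \<Rightarrow> bool" where
  "descends_off S ws \<longleftrightarrow> (\<forall>l. Suc l < length ws \<longrightarrow> Suc l \<notin> S \<longrightarrow> ws ! Suc l \<le> ws ! l)"

lemma descends_off_sorted:
  assumes "\<And>l. 0 < l \<Longrightarrow> l < length ws \<Longrightarrow> l \<notin> S"
  shows "descends_off S ws \<longleftrightarrow> sorted_wrt (\<ge>) ws"
  using assms by (auto simp: descends_off_def sorted_wrt_iff_nth_Suc_transp)

lemma descends_off_append:
  assumes "xs \<noteq> []" "length xs \<in> S"
  shows "descends_off S (xs @ ys) \<longleftrightarrow> descends_off S xs \<and> descends_off {s. s + length xs \<in> S} ys"
proof
  assume L: "descends_off S (xs @ ys)"
  show "descends_off S xs \<and> descends_off {s. s + length xs \<in> S} ys"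
    unfolding descends_off_def
  proof (intro conjI allI impI)
    fix l assume "Suc l < length xs" "Suc l \<notin> S"
    then show "xs ! Suc l \<le> xs ! l"
      using L[unfolded descends_off_def, rule_format, of l] by (simp add: nth_append)
  next
    fix l assume "Suc l < length ys" "Suc l \<notin> {s. s + length xs \<in> S}"
    then show "ys ! Suc l \<le> ys ! l"
      using L[unfolded descends_off_def, rule_format, of "l + length xs"] by (simp add: nth_append)
  qed
next
  assume R: "descends_off S xs \<and> descends_off {s. s + length xs \<in> S} ys"
  show "descends_off S (xs @ ys)"
    unfolding descends_off_def
  proof (intro allI impI)
    fix l assume l: "Suc l < length (xs @ ys)" "Suc l \<notin> S"
    then consider "Suc l < length xs" | "length xs \<le> l"
      using assms(2) by (metis linorder_neqE_nat not_less_eq not_le)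
    then show "(xs @ ys) ! Suc l \<le> (xs @ ys) ! l"
    proof cases
      case 1
      then show ?thesis using R l by (simp add: descends_off_def nth_append)
    next
      case 2
      then have "Suc (l - length xs) < length ys" "Suc (l - length xs) \<notin> {s. s + length xs \<in> S}"
        using l by auto
      then have "ys ! Suc (l - length xs) \<le> ys ! (l - length xs)"
        using R unfolding descends_off_def by blast
      then show ?thesis using 2 by (simp add: nth_append Suc_diff_le)
    qed
  qed
qed

lemma cuts_shift: "{s. s + length p \<in> cuts (p @ u) qs} = cuts u qs"
  by (auto simp: cuts_def cut_pos_def image_iff)

lemma descends_off_concat:
  assumes "[] \<notin> set qs" "r \<noteq> []"
  shows "descends_off (cuts [] qs) (concat qs @ r) \<longleftrightarrow> (\<forall>q\<in>set qs. sorted_wrt (\<ge>) q) \<and> sorted_wrt (\<ge>) r"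
  using assms(1)
proof (induction qs)
  case Nil
  then show ?case by (simp add: descends_off_sorted)
next
  case (Cons q qs)
  have c: "cuts [] (q # qs) = insert 0 (cuts q qs)" by (simp add: cuts_Cons)
  have ins: "descends_off (insert 0 S) xs = descends_off S xs" for S xs
    by (simp add: descends_off_def)
  have "descends_off (cuts [] (q # qs)) (concat (q # qs) @ r) =
      descends_off (cuts q qs) (q @ (concat qs @ r))"
    unfolding c ins by simp
  also have "\<dots> \<longleftrightarrow> descends_off (cuts q qs) q \<and> descends_off (cuts [] qs) (concat qs @ r)"
    using Cons.prems cuts_shift[of q "[]" qs] by (subst descends_off_append) (auto simp: length_in_cuts)
  also have "descends_off (cuts q qs) q \<longleftrightarrow> sorted_wrt (\<ge>) q"
    using cuts_ge[of _ q qs] by (intro descends_off_sorted) fastforce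
  finally show ?case using Cons by auto
qed

text \<open>The coordinates \<open>C\<close> of the blocks, read along the cycle that is closed by the value \<open>0\<close>, may
  ascend only at the positions in \<open>J\<close>. So \<open>J\<close> cuts the cycle into descending pieces.\<close>
lemma descends_off_cuts:
  assumes "[] \<notin> set bs"
  shows "(\<forall>l\<le>length (u @ concat bs @ v). l \<notin> cuts u bs \<longrightarrow>
      (0 # map C (u @ concat bs @ v) @ [0]) ! Suc l \<le> (0 # map C (u @ concat bs @ v) @ [0]) ! l)
    \<longleftrightarrow> (decr C u \<and> decr C v \<and> (\<forall>x\<in>set u. C x \<le> 0) \<and> (\<forall>x\<in>set v. 0 \<le> C x)) \<and> (\<forall>b\<in>set bs. decr C b)"
proof -
  let ?ws = "0 # map C (u @ concat bs @ v) @ [0]"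
  let ?p = "0 # map C u" and ?qs = "map (map C) bs" and ?r = "map C v @ [0]"
  have ws: "?ws = ?p @ (concat ?qs @ ?r)"
    by (simp add: map_concat)
  have "cuts ?p ?qs = Suc ` cuts u bs"
    by (auto simp: cuts_def cut_pos_def image_image take_map simp flip: map_concat)
  then have "(\<forall>l\<le>length (u @ concat bs @ v). l \<notin> cuts u bs \<longrightarrow> ?ws ! Suc l \<le> ?ws ! l)
      \<longleftrightarrow> descends_off (cuts ?p ?qs) ?ws"
    by (auto simp: descends_off_def less_Suc_eq_le)
  also have "\<dots> \<longleftrightarrow> descends_off (cuts ?p ?qs) ?p \<and> descends_off (cuts [] ?qs) (concat ?qs @ ?r)"
    using cuts_shift[of ?p "[]" ?qs] unfolding ws
    by (subst descends_off_append) (auto simp: length_in_cuts simp del: length_map list.size)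
  also have "descends_off (cuts ?p ?qs) ?p \<longleftrightarrow> sorted_wrt (\<ge>) ?p"
    using cuts_ge[of _ ?p ?qs] by (intro descends_off_sorted) fastforce
  also have "descends_off (cuts [] ?qs) (concat ?qs @ ?r) \<longleftrightarrow> (\<forall>q\<in>set ?qs. sorted_wrt (\<ge>) q) \<and> sorted_wrt (\<ge>) ?r"
    using assms by (intro descends_off_concat) auto
  finally show ?thesis
    by (auto simp: decr_def sorted_wrt_append sorted_wrt_map)
qed

text \<open>The set \<open>J\<close> cuts an ordering of \<open>\<B>\<close> into \<open>j\<close> descending inner pieces and two outer ones. The
  underlying sets of the pieces determine their orderings, so that only the choice of a block
  system and the order of its \<open>j\<close> members remain.\<close>
lemma sum_orderings_descents:
  fixes C :: "'a \<Rightarrow> real"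
  assumes fin: "finite \<B>" and inj: "inj_on C \<B>" and nz: "\<And>B. B \<in> \<B> \<Longrightarrow> C B \<noteq> 0"
  shows "(\<Sum>Bs\<in>permutations_of_set \<B>. card {J. J \<subseteq> {..card \<B>} \<and> card J = Suc j \<and>
      (\<forall>l\<le>card \<B>. l \<notin> J \<longrightarrow> (0 # map C Bs @ [0]) ! Suc l \<le> (0 # map C Bs @ [0]) ! l)})
    = fact j * Stirling (Suc (card \<B>)) (Suc j)"
proof -
  define ok where "ok Bs J \<longleftrightarrow> (\<forall>l\<le>length Bs. l \<notin> J \<longrightarrow> (0 # map C Bs @ [0]) ! Suc l \<le> (0 # map C Bs @ [0]) ! l)"
    for Bs J
  define Qo where "Qo u v \<longleftrightarrow> decr C u \<and> decr C v \<and> (\<forall>x\<in>set u. C x \<le> 0) \<and> (\<forall>x\<in>set v. 0 \<le> C x)" for u v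
  have len: "length Bs = card \<B>" if "Bs \<in> permutations_of_set \<B>" for Bs
    using that distinct_card by (fastforce simp: permutations_of_set_iff)
  have "(\<Sum>Bs\<in>permutations_of_set \<B>. card {J. J \<subseteq> {..card \<B>} \<and> card J = Suc j \<and> ok Bs J})
    = (\<Sum>Bs\<in>permutations_of_set \<B>. \<Sum>J\<in>{J. J \<subseteq> {..length Bs} \<and> card J = Suc j}. of_bool (ok Bs J))"
    by (rule sum.cong) (auto simp: len Int_def conj_assoc)
  also have "\<dots> = (\<Sum>Bs\<in>permutations_of_set \<B>. \<Sum>(u, bs, v)\<in>decomps j Bs. of_bool (ok Bs (cuts u bs)))"
    by (intro sum.cong refl, subst sum.reindex_bij_betw[OF bij_betw_cuts, symmetric])
       (auto intro!: sum.cong)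
  also have "\<dots> = (\<Sum>Bs\<in>permutations_of_set \<B>. \<Sum>(u, bs, v)\<in>decomps j Bs. of_bool (Qo u v \<and> (\<forall>b\<in>set bs. decr C b)) * 1)"
  proof (intro sum.cong refl, clarify)
    fix Bs u v :: "'a list" and bs assume "(u, bs, v) \<in> decomps j Bs"
    then have d: "[] \<notin> set bs" "Bs = u @ concat bs @ v" by (auto simp: decomps_def)
    show "(of_bool (ok Bs (cuts u bs)) :: nat) = of_bool (Qo u v \<and> (\<forall>b\<in>set bs. decr C b)) * 1"
      using descends_off_cuts[OF d(1), of u v C] unfolding ok_def Qo_def d(2) by simp
  qed
  also have "\<dots> = (\<Sum>(u, bs, v)\<in>triples \<B> j. of_bool (Qo u v \<and> (\<forall>b\<in>set bs. decr C b)) * 1)"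
    by (rule sum_decomps[OF fin])
  also have "\<dots> = (\<Sum>\<C>\<in>block_systems \<B> j. card {(u, v). u @ v \<in> permutations_of_set (\<B> - \<Union>\<C>) \<and> Qo u v} *
        (\<Prod>D\<in>\<C>. card {b \<in> permutations_of_set D. decr C b}) * (\<Sum>Bs\<in>permutations_of_set \<C>. 1))"
    by (rule sum_triples[OF fin, where Qo = "\<lambda>_. Qo" and Qi = "\<lambda>_. decr C" and h = "\<lambda>_. 1"])
  also have "\<dots> = (\<Sum>\<C>\<in>block_systems \<B> j. fact j)"
  proof (rule sum.cong[OF refl])
    fix \<C> assume C: "\<C> \<in> block_systems \<B> j"
    have "card {(u, v). u @ v \<in> permutations_of_set (\<B> - \<Union>\<C>) \<and> Qo u v} = 1"
      unfolding Qo_def by (rule card_decr_outer) (use fin inj nz in \<open>auto intro: inj_on_subset\<close>)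
    moreover have "card {b \<in> permutations_of_set D. decr C b} = 1" if "D \<in> \<C>" for D
      by (rule card_decr) (use block_systemsD(5)[OF C that] fin inj in \<open>auto intro: inj_on_subset finite_subset\<close>)
    ultimately show "card {(u, v). u @ v \<in> permutations_of_set (\<B> - \<Union>\<C>) \<and> Qo u v} *
        (\<Prod>D\<in>\<C>. card {b \<in> permutations_of_set D. decr C b}) * (\<Sum>Bs\<in>permutations_of_set \<C>. 1) = fact j"
      using block_systemsD(1,2)[OF C] by simp
  qed
  also have "\<dots> = fact j * Stirling (Suc (card \<B>)) (Suc j)"
    using card_block_systems[OF fin, of j] by simp
  finally show ?thesis
    by (simp add: ok_def len cong: sum.cong)
qed

section \<open>Orthogonal projections and solid angles\<close>

lemma closest_point_subspaceI:
  fixes L :: "'a::euclidean_space set"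
  assumes L: "subspace L" and x: "x \<in> L" and orth: "\<And>v. v \<in> L \<Longrightarrow> (z - x) \<bullet> v = 0"
  shows "closest_point L z = x"
proof (rule closest_point_unique[symmetric])
  show "\<forall>y\<in>L. dist z x \<le> dist z y"
  proof
    fix y assume "y \<in> L"
    then have "(z - x) \<bullet> (x - y) = 0"
      using orth L x by (simp add: subspace_diff)
    then have "(norm (z - y))\<^sup>2 = (norm (z - x))\<^sup>2 + (norm (x - y))\<^sup>2"
      using norm_add_Pythagorean[of "z - x" "x - y"] by (simp add: orthogonal_def)
    then have "(norm (z - x))\<^sup>2 \<le> (norm (z - y))\<^sup>2" by simp
    then show "dist z x \<le> dist z y"
      by (simp add: dist_norm)
  qed
qed (use assms in \<open>auto simp: subspace_imp_convex closed_subspace\<close>)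

lemma closest_point_in_subspace:
  fixes L :: "'a::euclidean_space set"
  assumes "subspace L"
  shows "closest_point L z \<in> L"
  using assms subspace_0 by (intro closest_point_in_set closed_subspace) auto

lemma orthogonal_closest_point:
  fixes L :: "'a::euclidean_space set"
  assumes L: "subspace L" and v: "v \<in> L"
  shows "(z - closest_point L z) \<bullet> v = 0"
proof -
  have *: "(z - closest_point L z) \<bullet> w \<le> 0" if "w \<in> L" for w
    using closest_point_dot[of L "w + closest_point L z" z] L that closest_point_in_subspace[OF L, of z]
    by (simp add: closed_subspace subspace_imp_convex subspace_add)
  show ?thesis
    using *[of v] *[of "- v"] L v by (simp add: subspace_neg)
qed

lemma linear_closest_point:
  fixes L :: "'a::euclidean_space set"
  assumes L: "subspace L"
  shows "linear (closest_point L)"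
proof
  fix x y :: 'a and r :: real
  show "closest_point L (x + y) = closest_point L x + closest_point L y"
  proof (rule closest_point_subspaceI[OF L])
    show "(x + y - (closest_point L x + closest_point L y)) \<bullet> v = 0" if "v \<in> L" for v
      using orthogonal_closest_point[OF L that, of x] orthogonal_closest_point[OF L that, of y]
      by (simp add: algebra_simps)
  qed (use L in \<open>simp add: closest_point_in_subspace subspace_add\<close>)
  show "closest_point L (r *\<^sub>R x) = r *\<^sub>R closest_point L x"
  proof (rule closest_point_subspaceI[OF L])
    show "(r *\<^sub>R x - r *\<^sub>R closest_point L x) \<bullet> v = 0" if "v \<in> L" for v
      using orthogonal_closest_point[OF L that, of x]
      by (metis inner_scaleR_left mult_zero_right scaleR_right_diff_distrib)
  qed (use L in \<open>simp add: closest_point_in_subspace subspace_scale\<close>)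
qed

lemma measurable_closest_point [measurable (raw)]:
  fixes L :: "'a::euclidean_space set"
  assumes "subspace L"
  shows "closest_point L \<in> borel_measurable borel"
  by (intro borel_measurable_continuous_onI linear_continuous_on)
     (use linear_closest_point[OF assms] in \<open>simp add: linear_conv_bounded_linear\<close>)

lemma closest_point_orthogonal_complement:
  fixes L :: "'a::euclidean_space set"
  assumes L: "subspace L"
  shows "closest_point (L\<^sup>\<bottom>) z = z - closest_point L z"
proof (rule closest_point_subspaceI[OF subspace_orthogonal_comp])
  show "z - closest_point L z \<in> L\<^sup>\<bottom>"
    using orthogonal_closest_point[OF L] by (auto simp: orthogonal_comp_def orthogonal_def inner_commute)
  show "(z - (z - closest_point L z)) \<bullet> v = 0" if "v \<in> L\<^sup>\<bottom>" for v
    using that closest_point_in_subspace[OF L, of z]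
    by (auto simp: orthogonal_comp_def orthogonal_def inner_commute)
qed

lemma std_gaussian_prod:
  "(std_gaussian :: ('a::euclidean_space \<times> 'b::euclidean_space) measure)
    = std_gaussian \<Otimes>\<^sub>M std_gaussian"
proof -
  have "(std_gaussian :: 'a measure) \<Otimes>\<^sub>M (std_gaussian :: 'b measure) = density (lborel \<Otimes>\<^sub>M lborel)
     (\<lambda>(x, y). ennreal (exp (- (norm x)\<^sup>2 / 2) / sqrt (2 * pi) ^ DIM('a))
        * ennreal (exp (- (norm y)\<^sup>2 / 2) / sqrt (2 * pi) ^ DIM('b)))"
    unfolding std_gaussian_def
  proof (rule pair_measure_density)
    have "sigma_finite_measure (std_gaussian :: 'b measure)"
      by (rule prob_space_imp_sigma_finite[OF prob_space_std_gaussian])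
    then show "sigma_finite_measure (density (lborel :: 'b measure)
        (\<lambda>x. ennreal (exp (- (norm x)\<^sup>2 / 2) / sqrt (2 * pi) ^ DIM('b))))"
      by (simp add: std_gaussian_def)
  qed (auto intro: lborel.sigma_finite_measure_axioms)
  also have "(\<lambda>(x::'a, y::'b). ennreal (exp (- (norm x)\<^sup>2 / 2) / sqrt (2 * pi) ^ DIM('a))
        * ennreal (exp (- (norm y)\<^sup>2 / 2) / sqrt (2 * pi) ^ DIM('b))) =
     (\<lambda>x. ennreal (exp (- (norm x)\<^sup>2 / 2) / sqrt (2 * pi) ^ DIM('a \<times> 'b)))"
    by (auto simp: fun_eq_iff norm_Pair power_add ennreal_mult'' [symmetric] exp_add[symmetric] add_divide_distrib
        simp flip: exp_add)
  finally show ?thesis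
    by (simp add: std_gaussian_def lborel_prod)
qed

lemma std_gaussian_fst:
  assumes A: "A \<in> sets borel"
  shows "measure (std_gaussian :: ('a::euclidean_space \<times> 'b::euclidean_space) measure) (A \<times> UNIV)
    = measure (std_gaussian :: 'a measure) A"
proof -
  interpret A: prob_space "std_gaussian :: 'a measure" by (rule prob_space_std_gaussian)
  interpret B: prob_space "std_gaussian :: 'b measure" by (rule prob_space_std_gaussian)
  have "measure (std_gaussian \<Otimes>\<^sub>M std_gaussian) (A \<times> (UNIV :: 'b set))
      = measure std_gaussian A * measure (std_gaussian :: 'b measure) UNIV"
    using A by (simp add: measure_def B.emeasure_pair_measure_Times enn2real_mult)
  then show ?thesis
    using B.prob_space by (simp add: std_gaussian_prod) (simp add: std_gaussian_def)
qed

text \<open>Both \<open>closest_point L g\<close> and \<open>g - closest_point L g\<close> depend on orthogonal components of a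
  Gaussian vector \<open>g\<close>, hence are independent; and the second one is symmetric.  To see this
  without coordinates, swap the second components of two independent copies of \<open>g\<close> with
  a sign, which is an orthogonal transformation of the product space.\<close>
lemma std_gaussian_projections_indep:
  fixes L :: "'a::euclidean_space set"
  assumes L: "subspace L" and A [measurable]: "A \<in> sets borel" and B [measurable]: "B \<in> sets borel"
  shows "measure std_gaussian {z. closest_point L z \<in> A} *
         measure std_gaussian {z. z - closest_point L z \<in> B} =
         measure std_gaussian {z. closest_point L z \<in> A \<and> closest_point L z - z \<in> B}"
proof -
  let ?\<pi> = "closest_point L" and ?G = "std_gaussian :: 'a measure"
  interpret G: prob_space ?G by (rule prob_space_std_gaussian)
  note [measurable] = measurable_closest_point[OF L]
  define A' where "A' = {z. ?\<pi> z \<in> A}"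
  define B' where "B' = {z. z - ?\<pi> z \<in> B}"
  define D where "D = {z. ?\<pi> z \<in> A \<and> ?\<pi> z - z \<in> B}"
  have mA: "A' \<in> sets borel" "B' \<in> sets borel" "D \<in> sets borel"
    unfolding A'_def B'_def D_def by measurable
  \<comment> \<open>Exchange of the orthogonal parts of two independent copies, with a sign.\<close>
  define f :: "'a \<times> 'a \<Rightarrow> 'a \<times> 'a"
    where "f = (\<lambda>(z, y). (?\<pi> z - (y - ?\<pi> y), (z - ?\<pi> z) + ?\<pi> y))"
  have lin: "linear ?\<pi>" by (rule linear_closest_point[OF L])
  have linf: "linear f"
    by (rule linearI) (auto simp: f_def linear_add[OF lin] linear_scale[OF lin] algebra_simps)
  have in_out: "(u - ?\<pi> u) \<bullet> ?\<pi> v = 0" for u v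
    by (rule orthogonal_closest_point[OF L closest_point_in_subspace[OF L]])
  have nf: "norm (f p) = norm p" for p
  proof -
    obtain z y where p: "p = (z, y)" by force
    have split: "(norm (a + b))\<^sup>2 = (norm a)\<^sup>2 + (norm b)\<^sup>2" if "a \<bullet> b = 0" for a b :: 'a
      using norm_add_Pythagorean[of a b] that by (simp add: orthogonal_def)
    have z: "(norm z)\<^sup>2 = (norm (?\<pi> z))\<^sup>2 + (norm (z - ?\<pi> z))\<^sup>2" for z
      using split[of "?\<pi> z" "z - ?\<pi> z"] in_out[of z z] by (simp add: inner_commute)
    have 1: "(norm (?\<pi> z - (y - ?\<pi> y)))\<^sup>2 = (norm (?\<pi> z))\<^sup>2 + (norm (y - ?\<pi> y))\<^sup>2"
      using split[of "?\<pi> z" "- (y - ?\<pi> y)"] in_out[of y z]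
      norm_minus_commute[of y "?\<pi> y"]
      by (simp add: inner_diff_right inner_commute diff_diff_eq2 add_diff_eq)
    have 2: "(norm ((z - ?\<pi> z) + ?\<pi> y))\<^sup>2 = (norm (z - ?\<pi> z))\<^sup>2 + (norm (?\<pi> y))\<^sup>2"
      by (rule split) (rule in_out)
    show ?thesis
      unfolding p f_def by (simp add: norm_Pair 1 2 z[of z] z[of y])
  qed
  have orth: "orthogonal_transformation f"
    unfolding orthogonal_transformation using linf nf by blast
  have fm [measurable]: "f \<in> borel_measurable borel"
    by (intro borel_measurable_continuous_onI linear_continuous_on) (use linf in \<open>simp add: linear_conv_bounded_linear\<close>)
  have "f -` (D \<times> UNIV) = A' \<times> B'"
  proof -
    have "?\<pi> (?\<pi> z - (y - ?\<pi> y)) = ?\<pi> z" for z y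
      by (rule closest_point_subspaceI[OF L])
         (use orthogonal_closest_point[OF L, of _ y] L in \<open>auto simp: closest_point_in_subspace inner_diff_left\<close>)
    then show ?thesis
      by (auto simp: f_def D_def A'_def B'_def)
  qed
  then have "measure (distr std_gaussian borel f) (D \<times> UNIV) = measure std_gaussian (A' \<times> B')"
    using mA by (subst measure_distr) (auto simp: std_gaussian_def intro: borel_Times)
  then have "measure ?G D = measure (?G \<Otimes>\<^sub>M ?G) (A' \<times> B')"
    by (metis std_gaussian_distr_orthogonal[OF orth] std_gaussian_fst[OF mA(3)] std_gaussian_prod)
  also have "\<dots> = measure ?G A' * measure ?G B'"
    using mA by (simp add: measure_def G.emeasure_pair_measure_Times enn2real_mult)
  finally show ?thesis
    by (simp add: A'_def B'_def D_def)
qed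

text \<open>The direction of a Gaussian vector in a subspace is uniformly distributed on the sphere, and a
  cone contains a nonzero vector iff it contains its direction.\<close>
lemma solid_angle_cone:
  fixes C :: "'a::euclidean_space set"
  assumes C: "closed C" "0 \<in> C" and cone: "\<And>x c. x \<in> C \<Longrightarrow> 0 \<le> c \<Longrightarrow> c *\<^sub>R x \<in> C"
  shows "solid_angle C = measure std_gaussian {z. closest_point (span C) z \<in> C}"
proof (cases "subspace C")
  case True
  then have "{z. closest_point (span C) z \<in> C} = UNIV"
    using closest_point_in_subspace[OF True] by (auto simp: span_eq_iff[THEN iffD2])
  then show ?thesis
    using True prob_space_std_gaussian[where 'a = 'a, THEN prob_space.prob_space]
    by (simp add: solid_angle_def std_gaussian_def)
next
  case False
  have "sgn x \<in> C \<longleftrightarrow> x \<in> C" for x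
  proof
    assume "sgn x \<in> C"
    then have "norm x *\<^sub>R sgn x \<in> C" by (intro cone) auto
    then show "x \<in> C" by (simp add: sgn_div_norm) (cases "x = 0"; simp add: C)
  qed (auto simp: sgn_div_norm intro: cone)
  then show ?thesis
    using False C measurable_sgn_closest_point[of "span C"]
    by (simp add: solid_angle_def uniform_sphere_def measure_distr borel_closed vimage_def)
       (simp add: std_gaussian_def)
qed

section \<open>Faces of finitely generated cones\<close>

text \<open>The cone generated by the vectors \<open>v i\<close> with \<open>i \<in> E\<close> and the negatives of those with \<open>i \<in> J\<close>. It is
  a tangent cone of the cone that is generated by the vectors \<open>v i\<close> alone, and all its faces have the form
  \<open>fcone v I J\<close> with \<open>J \<subseteq> I\<close>.\<close>
definition fcone :: "('i \<Rightarrow> 'a::euclidean_space) \<Rightarrow> 'i set \<Rightarrow> 'i set \<Rightarrow> 'a set" where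
  "fcone v E J = {x. \<exists>c. (\<forall>i\<in>E - J. 0 \<le> c i) \<and> x = (\<Sum>i\<in>E. c i *\<^sub>R v i)}"

text \<open>The generators in \<open>I\<close> are exactly those on some supporting hyperplane through \<open>0\<close>.\<close>
definition exposed :: "('i \<Rightarrow> 'a::euclidean_space) \<Rightarrow> 'i set \<Rightarrow> 'i set \<Rightarrow> bool" where
  "exposed v E I \<longleftrightarrow> I \<subseteq> E \<and> (\<exists>w. (\<forall>i\<in>I. w \<bullet> v i = 0) \<and> (\<forall>i\<in>E - I. w \<bullet> v i < 0))"

text \<open>The vector \<open>\<Sum>l\<in>I. c l *\<^sub>R v l\<close> is the orthogonal projection of \<open>z\<close> to the span of the face, see
  \<open>cell_iff\<close>. This form, which avoids the projection, is a closed condition on \<open>v\<close>, \<open>z\<close> and \<open>c\<close>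
  together, from which measurability in \<open>v\<close> and \<open>z\<close> follows.\<close>
definition cell :: "('i \<Rightarrow> 'a::euclidean_space) \<Rightarrow> 'i set \<Rightarrow> 'i set \<Rightarrow> 'i set \<Rightarrow> 'a \<Rightarrow> bool" where
  "cell v E J I z \<longleftrightarrow> (\<exists>c. (\<forall>i\<in>I - J. 0 \<le> c i) \<and>
     (\<forall>i\<in>I. (z - (\<Sum>l\<in>I. c l *\<^sub>R v l)) \<bullet> v i = 0) \<and>
     (\<forall>i\<in>E. 0 \<le> (z - (\<Sum>l\<in>I. c l *\<^sub>R v l)) \<bullet> v i))"

lemma fconeI: "(\<And>i. i \<in> E \<Longrightarrow> i \<notin> J \<Longrightarrow> 0 \<le> c i) \<Longrightarrow> x = (\<Sum>i\<in>E. c i *\<^sub>R v i) \<Longrightarrow> x \<in> fcone v E J"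
  unfolding fcone_def by auto

lemma fconeE:
  assumes "x \<in> fcone v E J"
  obtains c where "\<And>i. i \<in> E \<Longrightarrow> i \<notin> J \<Longrightarrow> 0 \<le> c i" "x = (\<Sum>i\<in>E. c i *\<^sub>R v i)"
  using assms unfolding fcone_def by auto

lemma zero_in_fcone: "0 \<in> fcone v E J"
  by (rule fconeI[of _ _ "\<lambda>_. 0"]) auto

lemma fcone_add: "x \<in> fcone v E J \<Longrightarrow> y \<in> fcone v E J \<Longrightarrow> x + y \<in> fcone v E J"
proof (elim fconeE)
  fix c d assume "\<And>i. i \<in> E \<Longrightarrow> i \<notin> J \<Longrightarrow> 0 \<le> c i" "x = (\<Sum>i\<in>E. c i *\<^sub>R v i)"
    "\<And>i. i \<in> E \<Longrightarrow> i \<notin> J \<Longrightarrow> 0 \<le> d i" "y = (\<Sum>i\<in>E. d i *\<^sub>R v i)"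
  then show ?thesis
    by (intro fconeI[of _ _ "\<lambda>i. c i + d i"]) (auto simp: scaleR_add_left sum.distrib)
qed

lemma fcone_scale: "x \<in> fcone v E J \<Longrightarrow> 0 \<le> r \<Longrightarrow> r *\<^sub>R x \<in> fcone v E J"
proof (elim fconeE)
  fix c assume "0 \<le> r" "\<And>i. i \<in> E \<Longrightarrow> i \<notin> J \<Longrightarrow> 0 \<le> c i" "x = (\<Sum>i\<in>E. c i *\<^sub>R v i)"
  then show ?thesis
    by (intro fconeI[of _ _ "\<lambda>i. r * c i"]) (auto simp: scaleR_sum_right)
qed

lemma convex_fcone: "convex (fcone v E J)"
  unfolding convex_def by (auto intro!: fcone_add fcone_scale)

lemma gen_in_fcone: "finite E \<Longrightarrow> i \<in> E \<Longrightarrow> v i \<in> fcone v E J"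
  by (rule fconeI[of _ _ "\<lambda>l. if l = i then 1 else 0"]) (auto simp: if_distrib[of "\<lambda>c. c *\<^sub>R _"] cong: if_cong)

lemma neg_gen_in_fcone: "finite E \<Longrightarrow> i \<in> E \<Longrightarrow> i \<in> J \<Longrightarrow> - v i \<in> fcone v E J"
  by (rule fconeI[of _ _ "\<lambda>l. if l = i then - 1 else 0"]) (auto simp: if_distrib[of "\<lambda>c. c *\<^sub>R _"] cong: if_cong)

lemma span_fcone:
  assumes "finite E"
  shows "span (fcone v E J) = span (v ` E)"
proof (rule span_eq[THEN iffD2], intro conjI subsetI)
  fix x assume "x \<in> fcone v E J"
  then show "x \<in> span (v ` E)"
    by (elim fconeE) (auto intro!: span_sum span_scale intro: span_base)
next
  fix x assume "x \<in> v ` E"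
  then show "x \<in> span (fcone v E J)"
    using gen_in_fcone[OF assms] by (auto intro: span_base)
qed

lemma fcone_eq_hull:
  assumes E: "finite E" and J: "J \<subseteq> E"
  shows "fcone v E J = convex_cone hull (v ` E \<union> (\<lambda>i. - v i) ` J)"
proof
  let ?H = "convex_cone hull (v ` E \<union> (\<lambda>i. - v i) ` J)"
  have term_in: "c *\<^sub>R v i \<in> ?H" if "i \<in> E" "i \<notin> J \<Longrightarrow> 0 \<le> c" for i c
  proof (cases "0 \<le> c")
    case True
    then show ?thesis using that by (intro convex_cone_hull_mul hull_inc) auto
  next
    case False
    then have "(- c) *\<^sub>R (- v i) \<in> ?H" using that by (intro convex_cone_hull_mul hull_inc) auto
    then show ?thesis by simp
  qed
  have sum_in: "(\<Sum>i\<in>S. c i *\<^sub>R v i) \<in> ?H" if "finite S" "S \<subseteq> E" "\<And>i. i \<in> S \<Longrightarrow> i \<notin> J \<Longrightarrow> 0 \<le> c i" for S c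
    using that
    by (induction S rule: finite_induct)
       (auto simp: convex_cone_hull_contains_0 intro!: convex_cone_hull_add term_in)
  show "fcone v E J \<subseteq> ?H"
    by (rule subsetI, elim fconeE) (use sum_in[OF E] in auto)
  have "convex_cone (fcone v E J)"
    unfolding convex_cone_def conic_def using zero_in_fcone fcone_scale convex_fcone by fastforce
  moreover have "v ` E \<union> (\<lambda>i. - v i) ` J \<subseteq> fcone v E J"
    using gen_in_fcone[OF E] neg_gen_in_fcone[OF E] J by fastforce
  ultimately show "?H \<subseteq> fcone v E J"
    by (intro hull_minimal)
qed

lemma closed_fcone: "finite E \<Longrightarrow> J \<subseteq> E \<Longrightarrow> closed (fcone v E J)"
  unfolding fcone_eq_hull by (rule closed_convex_cone_hull) (auto intro: finite_subset)

lemma polyhedron_fcone: "finite E \<Longrightarrow> J \<subseteq> E \<Longrightarrow> polyhedron (fcone v E J)"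
  unfolding fcone_eq_hull by (rule polyhedron_convex_cone_hull) (auto intro: finite_subset)

lemma fcone_Int_hyperplane:
  assumes E: "finite E" "J \<subseteq> I" "I \<subseteq> E" and w': "\<forall>i\<in>I. w \<bullet> v i = 0" "\<forall>i\<in>E - I. w \<bullet> v i < 0"
  shows "fcone v I J = fcone v E J \<inter> {x. w \<bullet> x = 0}" "\<And>x. x \<in> fcone v E J \<Longrightarrow> w \<bullet> x \<le> 0"
proof -
  have w: "\<And>i. i \<in> I \<Longrightarrow> w \<bullet> v i = 0" "\<And>i. i \<in> E \<Longrightarrow> i \<notin> I \<Longrightarrow> w \<bullet> v i < 0"
    using w' by auto
  have terms: "c i * (w \<bullet> v i) \<le> 0" if "i \<in> E" "i \<notin> J \<Longrightarrow> 0 \<le> c i" for c i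
    using w(1)[of i] w(2)[of i] that E(2) by (cases "i \<in> I") (auto intro!: mult_nonneg_nonpos)
  show "w \<bullet> x \<le> 0" if "x \<in> fcone v E J" for x
    using that by (elim fconeE) (auto simp: inner_sum_right intro!: sum_nonpos terms)
  show "fcone v I J = fcone v E J \<inter> {x. w \<bullet> x = 0}"
  proof (intro equalityI subsetI)
    fix x assume "x \<in> fcone v I J"
    then obtain c where c: "\<And>i. i \<in> I \<Longrightarrow> i \<notin> J \<Longrightarrow> 0 \<le> c i" "x = (\<Sum>i\<in>I. c i *\<^sub>R v i)"
      unfolding fcone_def by auto
    have "x = (\<Sum>i\<in>E. (if i \<in> I then c i else 0) *\<^sub>R v i)"
      unfolding c(2) using E by (intro sum.mono_neutral_cong_left) auto
    then have "x \<in> fcone v E J" using c(1) by (intro fconeI[of _ _ "\<lambda>i. if i \<in> I then c i else 0"]) auto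
    then show "x \<in> fcone v E J \<inter> {x. w \<bullet> x = 0}"
      using w(1) by (auto simp: c(2) inner_sum_right)
  next
    fix x assume x: "x \<in> fcone v E J \<inter> {x. w \<bullet> x = 0}"
    then obtain c where c: "\<And>i. i \<in> E \<Longrightarrow> i \<notin> J \<Longrightarrow> 0 \<le> c i" "x = (\<Sum>i\<in>E. c i *\<^sub>R v i)"
      unfolding fcone_def by auto
    have "(\<Sum>i\<in>E. c i * (w \<bullet> v i)) = 0" using x c(2) by (simp add: inner_sum_right)
    then have z: "c i * (w \<bullet> v i) = 0" if "i \<in> E" for i
      using sum_nonneg_eq_0_iff[of E "\<lambda>i. - (c i * (w \<bullet> v i))"] E(1) terms[of _ c] c(1) that
      by (simp add: sum_negf)
    have "c i = 0" if "i \<in> E - I" for i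
      using z[of i] w(2)[of i] that by auto
    then have "x = (\<Sum>i\<in>I. c i *\<^sub>R v i)"
      unfolding c(2) using E by (intro sum.mono_neutral_right) auto
    then show "x \<in> fcone v I J" using c(1) E(3) by (intro fconeI[of _ _ c]) auto
  qed
qed

lemma fcone_face:
  assumes "finite E" "J \<subseteq> I" "exposed v E I"
  shows "fcone v I J face_of fcone v E J"
proof -
  obtain w where w: "I \<subseteq> E" "\<forall>i\<in>I. w \<bullet> v i = 0" "\<forall>i\<in>E - I. w \<bullet> v i < 0"
    using assms(3) unfolding exposed_def by auto
  note * = fcone_Int_hyperplane[OF assms(1,2) w]
  show ?thesis
    unfolding *(1) by (rule face_of_Int_supporting_hyperplane_le[OF convex_fcone *(2)])
qed

text \<open>A supporting functional of a cone vanishes on the face and, because of the negatives of generators,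
  on \<open>J\<close>. Take for \<open>I\<close> all the generators on which it vanishes.\<close>
lemma face_of_fcone:
  assumes E: "finite E" "J \<subseteq> E" and F: "F face_of fcone v E J" "F \<noteq> {}"
  shows "\<exists>I. J \<subseteq> I \<and> exposed v E I \<and> F = fcone v I J"
proof -
  let ?K = "fcone v E J"
  have "F exposed_face_of ?K"
    using exposed_face_of_polyhedron[OF polyhedron_fcone[OF E]] F(1) by blast
  then obtain a b where ab: "?K \<subseteq> {x. a \<bullet> x \<le> b}" "F = ?K \<inter> {x. a \<bullet> x = b}"
    unfolding exposed_face_of_def by auto
  have "b \<ge> 0" using ab(1) zero_in_fcone[of v E J] by auto
  moreover have "b \<le> 0"
  proof -
    obtain x where x: "x \<in> ?K" "a \<bullet> x = b" using F(2) ab(2) by auto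
    have "2 *\<^sub>R x \<in> ?K" using x(1) by (rule fcone_scale) simp
    then have "a \<bullet> (2 *\<^sub>R x) \<le> b" using ab(1) by auto
    then show ?thesis using x(2) by simp
  qed
  ultimately have b: "b = 0" by simp
  define I where "I = {i \<in> E. a \<bullet> v i = 0}"
  have le: "a \<bullet> v i \<le> 0" if "i \<in> E" for i
    using ab(1) gen_in_fcone[OF E(1) that, of v J] b by auto
  have "a \<bullet> v i = 0" if "i \<in> J" for i
  proof -
    have "- v i \<in> ?K" using that E by (intro neg_gen_in_fcone) auto
    then have "a \<bullet> (- v i) \<le> 0" using ab(1) b by auto
    then show ?thesis using le[of i] that E(2) by auto
  qed
  then have J: "J \<subseteq> I" using E(2) by (auto simp: I_def)
  have lt: "a \<bullet> v i < 0" if "i \<in> E" "i \<notin> I" for i using le[of i] that by (auto simp: I_def less_le)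
  have "exposed v E I"
    unfolding exposed_def using lt by (auto simp: I_def intro!: exI[of _ a])
  moreover have "F = fcone v I J"
    unfolding ab(2) b by (rule fcone_Int_hyperplane(1)[symmetric, OF E(1) J]) (use lt in \<open>auto simp: I_def\<close>)
  ultimately show ?thesis using J by auto
qed

lemma fcone_face_recover:
  assumes E: "finite E" "J \<subseteq> I" "exposed v E I"
  shows "I = {i \<in> E. v i \<in> fcone v I J}"
proof -
  obtain w where w: "I \<subseteq> E" "\<forall>i\<in>I. w \<bullet> v i = 0" "\<forall>i\<in>E - I. w \<bullet> v i < 0"
    using assms(3) unfolding exposed_def by auto
  show ?thesis
  proof (intro equalityI subsetI)
    fix i assume "i \<in> I"
    moreover have "finite I" using w(1) E(1) by (rule finite_subset)
    ultimately show "i \<in> {i \<in> E. v i \<in> fcone v I J}"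
      using gen_in_fcone[of I i v J] w(1) by auto
  next
    fix i assume i: "i \<in> {i \<in> E. v i \<in> fcone v I J}"
    then have "w \<bullet> v i = 0" using fcone_Int_hyperplane(1)[OF E(1,2) w] by simp
    then show "i \<in> I" using bspec[OF w(3), of i] i by (cases "i \<in> I") auto
  qed
qed

lemma faces_fcone:
  assumes E: "finite E" "J \<subseteq> E"
  shows "faces k (fcone v E J) = (\<lambda>I. fcone v I J) ` {I. J \<subseteq> I \<and> exposed v E I \<and> dim (v ` I) = k}"
proof -
  have ad: "aff_dim (fcone v I J) = int (dim (v ` I))" if "exposed v E I" for I
  proof -
    have "finite I" using that E(1) finite_subset unfolding exposed_def by auto
    then have "dim (fcone v I J) = dim (v ` I)" using span_fcone by (metis dim_span)
    then show ?thesis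
      using aff_dim_zero[of "fcone v I J"] zero_in_fcone[of v I J] by (simp add: hull_inc)
  qed
  have ne: "F \<noteq> {}" if "aff_dim F = int k" for F :: "'b set" using that by (auto simp: aff_dim_empty)
  show ?thesis
  proof (intro equalityI subsetI)
    fix F assume "F \<in> faces k (fcone v E J)"
    then have F: "F face_of fcone v E J" "aff_dim F = int k" by (auto simp: faces_def)
    obtain I where "J \<subseteq> I" "exposed v E I" "F = fcone v I J"
      using face_of_fcone[OF E F(1) ne[OF F(2)]] by auto
    then show "F \<in> (\<lambda>I. fcone v I J) ` {I. J \<subseteq> I \<and> exposed v E I \<and> dim (v ` I) = k}"
      using F(2) ad by auto
  next
    fix F assume "F \<in> (\<lambda>I. fcone v I J) ` {I. J \<subseteq> I \<and> exposed v E I \<and> dim (v ` I) = k}"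
    then show "F \<in> faces k (fcone v E J)"
      using fcone_face[OF E(1)] ad by (auto simp: faces_def)
  qed
qed

lemma inj_on_fcone:
  assumes E: "finite E"
  shows "inj_on (\<lambda>I. fcone v I J) {I. J \<subseteq> I \<and> exposed v E I \<and> dim (v ` I) = k}"
proof (rule inj_onI)
  fix I I' assume "I \<in> {I. J \<subseteq> I \<and> exposed v E I \<and> dim (v ` I) = k}"
    "I' \<in> {I. J \<subseteq> I \<and> exposed v E I \<and> dim (v ` I) = k}" and eq: "fcone v I J = fcone v I' J"
  then show "I = I'"
    using fcone_face_recover[OF E, of J I v] fcone_face_recover[OF E, of J I' v] by (simp add: eq)
qed

lemma normal_cone_fcone:
  assumes E: "finite E" "J \<subseteq> I" "I \<subseteq> E"
  shows "normal_cone (fcone v I J) (fcone v E J) = {w. (\<forall>i\<in>I. w \<bullet> v i = 0) \<and> (\<forall>i\<in>E. w \<bullet> v i \<le> 0)}"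
proof (intro equalityI subsetI)
  have I: "finite I" using E finite_subset by auto
  have sub: "fcone v I J \<subseteq> fcone v E J"
  proof (rule subsetI, elim fconeE)
    fix x c assume c: "\<And>i. i \<in> I \<Longrightarrow> i \<notin> J \<Longrightarrow> 0 \<le> c i" "x = (\<Sum>i\<in>I. c i *\<^sub>R v i)"
    have "x = (\<Sum>i\<in>E. (if i \<in> I then c i else 0) *\<^sub>R v i)"
      unfolding c(2) using E by (intro sum.mono_neutral_cong_left) auto
    then show "x \<in> fcone v E J" using c(1) by (intro fconeI[of _ _ "\<lambda>i. if i \<in> I then c i else 0"]) auto
  qed
  {
    fix w assume "w \<in> normal_cone (fcone v I J) (fcone v E J)"
    then have w: "w \<bullet> u \<le> 0" if "u \<in> tangent_cone (fcone v I J) (fcone v E J)" for u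
      using that by (simp add: normal_cone_def polar_cone_def)
    have "rel_interior (fcone v I J) \<noteq> {}"
      using zero_in_fcone[of v I J] rel_interior_eq_empty[OF convex_fcone, of v I J] by auto
    then obtain f0 where f0: "f0 \<in> rel_interior (fcone v I J)" by auto
    then have f0I: "f0 \<in> fcone v I J" using rel_interior_subset by auto
    have 1: "w \<bullet> v i \<le> 0" if "i \<in> E" for i
    proof (rule w)
      have "f0 + 1 *\<^sub>R v i \<in> fcone v E J"
        using f0I sub gen_in_fcone[OF E(1) that] by (auto intro: fcone_add)
      then show "v i \<in> tangent_cone (fcone v I J) (fcone v E J)"
        unfolding tangent_cone_def using f0 by (auto intro!: bexI[of _ f0] exI[of _ 1])
    qed
    have 2: "w \<bullet> v i = 0" if i: "i \<in> I" for i
    proof -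
      have "f0 + v i \<in> fcone v I J"
        using f0I gen_in_fcone[OF I i] by (auto intro: fcone_add)
      moreover have "fcone v I J \<noteq> {}" using zero_in_fcone by auto
      ultimately obtain e where e: "e > 1" "(1 - e) *\<^sub>R (f0 + v i) + e *\<^sub>R f0 \<in> fcone v I J"
        using convex_rel_interior_iff[OF convex_fcone, of v I J f0] f0 by auto
      have "(1 - e) *\<^sub>R (f0 + v i) + e *\<^sub>R f0 = f0 + (e - 1) *\<^sub>R (- v i)"
        by (simp add: algebra_simps)
      then have "f0 + (e - 1) *\<^sub>R (- v i) \<in> fcone v E J" using e(2) sub by auto
      then have "- v i \<in> tangent_cone (fcone v I J) (fcone v E J)"
        unfolding tangent_cone_def using f0 e(1) by (auto intro!: bexI[of _ f0] exI[of _ "e - 1"])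
      then have "w \<bullet> (- v i) \<le> 0" by (rule w)
      then show ?thesis using 1[of i] i E(3) by auto
    qed
    show "w \<in> {w. (\<forall>i\<in>I. w \<bullet> v i = 0) \<and> (\<forall>i\<in>E. w \<bullet> v i \<le> 0)}" using 1 2 by auto
  }
  {
    fix w assume w: "w \<in> {w. (\<forall>i\<in>I. w \<bullet> v i = 0) \<and> (\<forall>i\<in>E. w \<bullet> v i \<le> 0)}"
    have "w \<bullet> u \<le> 0" if u: "u \<in> tangent_cone (fcone v I J) (fcone v E J)" for u
    proof -
      obtain f0 e where f0: "f0 \<in> rel_interior (fcone v I J)" "e > 0" "f0 + e *\<^sub>R u \<in> fcone v E J"
        using u unfolding tangent_cone_def by blast
      have "f0 \<in> fcone v I J" using f0(1) rel_interior_subset by auto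
      then have z: "w \<bullet> f0 = 0" using w by (elim fconeE) (auto simp: inner_sum_right)
      have neg: "c i * (w \<bullet> v i) \<le> 0" if "i \<in> E" "i \<notin> J \<Longrightarrow> 0 \<le> c i" for c i
      proof (cases "i \<in> J")
        case True
        then have "w \<bullet> v i = 0" using w E(2) by auto
        then show ?thesis by simp
      next
        case False
        then show ?thesis using w that by (auto intro!: mult_nonneg_nonpos)
      qed
      have "w \<bullet> (f0 + e *\<^sub>R u) \<le> 0"
        using f0(3) by (elim fconeE) (auto simp: inner_sum_right intro!: sum_nonpos neg)
      then show ?thesis using z f0(2) by (simp add: inner_add_right mult_le_0_iff)
    qed
    then show "w \<in> normal_cone (fcone v I J) (fcone v E J)"
      by (auto simp: normal_cone_def polar_cone_def)
  }
qed

text \<open>A functional exposing \<open>I\<close> lies in the interior of the normal cone relative to the orthogonal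
  complement: a large multiple of it absorbs any vector of the complement.\<close>
lemma span_normal_cone_fcone:
  assumes E: "finite E" "J \<subseteq> I" and ex: "exposed v E I"
  shows "span (normal_cone (fcone v I J) (fcone v E J)) = (span (v ` I))\<^sup>\<bottom>"
proof -
  obtain w where w: "I \<subseteq> E" "\<And>i. i \<in> I \<Longrightarrow> w \<bullet> v i = 0" "\<And>i. i \<in> E \<Longrightarrow> i \<notin> I \<Longrightarrow> w \<bullet> v i < 0"
    using ex unfolding exposed_def by auto
  define N where "N = {w. (\<forall>i\<in>I. w \<bullet> v i = 0) \<and> (\<forall>i\<in>E. w \<bullet> v i \<le> 0)}"
  have comp: "x \<in> (span (v ` I))\<^sup>\<bottom> \<longleftrightarrow> (\<forall>i\<in>I. x \<bullet> v i = 0)" for x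
  proof -
    have "x \<in> (span (v ` I))\<^sup>\<bottom> \<longleftrightarrow> (\<forall>y\<in>span (v ` I). orthogonal x y)"
      by (simp add: orthogonal_comp_def orthogonal_commute[of x])
    also have "\<dots> \<longleftrightarrow> (\<forall>i\<in>I. x \<bullet> v i = 0)"
    proof
      assume x: "\<forall>i\<in>I. x \<bullet> v i = 0"
      show "\<forall>y\<in>span (v ` I). orthogonal x y"
      proof
        fix y assume "y \<in> span (v ` I)"
        then show "orthogonal x y"
          by (rule orthogonal_to_span) (use x in \<open>auto simp: orthogonal_def\<close>)
      qed
    qed (simp add: orthogonal_def span_base)
    finally show ?thesis .
  qed
  have "span N = (span (v ` I))\<^sup>\<bottom>"
  proof
    have "N \<subseteq> (span (v ` I))\<^sup>\<bottom>" using comp by (auto simp: N_def)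
    then show "span N \<subseteq> (span (v ` I))\<^sup>\<bottom>"
      by (intro span_minimal subspace_orthogonal_comp)
    show "(span (v ` I))\<^sup>\<bottom> \<subseteq> span N"
    proof
      fix x assume "x \<in> (span (v ` I))\<^sup>\<bottom>"
      then have x: "\<And>i. i \<in> I \<Longrightarrow> x \<bullet> v i = 0" using comp by auto
      define t where "t = (\<Sum>i\<in>E - I. \<bar>x \<bullet> v i\<bar> / - (w \<bullet> v i))"
      have pos: "0 \<le> \<bar>x \<bullet> v i\<bar> / - (w \<bullet> v i)" if "i \<in> E - I" for i
        using w(3)[of i] that by (auto simp: divide_nonneg_neg)
      have t: "\<bar>x \<bullet> v i\<bar> / - (w \<bullet> v i) \<le> t" if "i \<in> E - I" for i
        unfolding t_def by (rule member_le_sum) (use pos that E(1) in auto)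
      have "t *\<^sub>R w + x \<in> N"
      proof -
        have "t * (w \<bullet> v i) + x \<bullet> v i \<le> 0" if "i \<in> E" for i
        proof (cases "i \<in> I")
          case True then show ?thesis using x w(2) by simp
        next
          case False
          then have "\<bar>x \<bullet> v i\<bar> \<le> t * - (w \<bullet> v i)"
            using t[of i] w(3)[of i] that by (simp add: pos_divide_le_eq field_simps)
          then show ?thesis by simp
        qed
        then show ?thesis using x w by (auto simp: N_def inner_add_left)
      qed
      moreover have "w \<in> N"
      proof -
        have "w \<bullet> v i \<le> 0" if "i \<in> E" for i
          using w(2)[of i] w(3)[of i] that by (cases "i \<in> I") auto
        then show ?thesis using w(2) by (auto simp: N_def)
      qed
      ultimately have "(t *\<^sub>R w + x) - t *\<^sub>R w \<in> span N"
        by (intro span_diff span_scale span_base)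
      then show "x \<in> span N" by simp
    qed
  qed
  then show ?thesis
    unfolding N_def normal_cone_fcone[OF E(1,2) w(1)] .
qed

lemma cell_iff:
  assumes I: "finite I"
  shows "cell v E J I z \<longleftrightarrow> closest_point (span (v ` I)) z \<in> fcone v I J \<and>
     (\<forall>i\<in>E. 0 \<le> (z - closest_point (span (v ` I)) z) \<bullet> v i)"
proof
  let ?L = "span (v ` I)"
  assume "cell v E J I z"
  then obtain c where c: "\<forall>i\<in>I - J. 0 \<le> c i" "\<forall>i\<in>I. (z - (\<Sum>l\<in>I. c l *\<^sub>R v l)) \<bullet> v i = 0"
    "\<forall>i\<in>E. 0 \<le> (z - (\<Sum>l\<in>I. c l *\<^sub>R v l)) \<bullet> v i" unfolding cell_def by auto
  have "closest_point ?L z = (\<Sum>l\<in>I. c l *\<^sub>R v l)"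
  proof (rule closest_point_subspaceI)
    show "(z - (\<Sum>l\<in>I. c l *\<^sub>R v l)) \<bullet> y = 0" if "y \<in> ?L" for y
      using orthogonal_to_span[OF that, of "z - (\<Sum>l\<in>I. c l *\<^sub>R v l)"] c(2) by (auto simp: orthogonal_def)
  qed (auto intro!: span_sum span_scale intro: span_base)
  then show "closest_point ?L z \<in> fcone v I J \<and> (\<forall>i\<in>E. 0 \<le> (z - closest_point ?L z) \<bullet> v i)"
    using c by (auto intro: fconeI[of _ _ c])
next
  let ?L = "span (v ` I)"
  assume R: "closest_point ?L z \<in> fcone v I J \<and> (\<forall>i\<in>E. 0 \<le> (z - closest_point ?L z) \<bullet> v i)"
  then obtain c where c: "\<And>i. i \<in> I \<Longrightarrow> i \<notin> J \<Longrightarrow> 0 \<le> c i" "closest_point ?L z = (\<Sum>l\<in>I. c l *\<^sub>R v l)"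
    unfolding fcone_def by auto
  have "(z - closest_point ?L z) \<bullet> v i = 0" if "i \<in> I" for i
    by (rule orthogonal_closest_point) (use that in \<open>auto intro: span_base\<close>)
  then show "cell v E J I z"
    unfolding cell_def using R c by (intro exI[of _ c]) auto
qed

text \<open>This is where the two solid angles in a conic intrinsic volume become one probability.\<close>
lemma solid_angle_mult_cell:
  assumes E: "finite E" "J \<subseteq> I" and ex: "exposed v E I"
  shows "solid_angle (fcone v I J) * solid_angle (normal_cone (fcone v I J) (fcone v E J))
    = measure std_gaussian {z. cell v E J I z}"
proof -
  have IE: "I \<subseteq> E" using ex by (auto simp: exposed_def)
  then have I: "finite I" using E(1) finite_subset by auto
  let ?L = "span (v ` I)" and ?F = "fcone v I J"
  let ?N = "{w. (\<forall>i\<in>I. w \<bullet> v i = 0) \<and> (\<forall>i\<in>E. w \<bullet> v i \<le> 0)}"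
  note N = normal_cone_fcone[OF E IE, of v]
  have Neq: "?N = (\<Inter>i\<in>I. {w. v i \<bullet> w = 0}) \<inter> (\<Inter>i\<in>E. {w. v i \<bullet> w \<le> 0})"
    by (auto simp: inner_commute)
  have cN: "closed ?N"
    unfolding Neq by (intro closed_Int closed_INT ballI closed_hyperplane closed_halfspace_le)
  have cF: "closed ?F" by (rule closed_fcone[OF I E(2)])
  have 1: "solid_angle ?F = measure std_gaussian {z. closest_point ?L z \<in> ?F}"
    using solid_angle_cone[OF cF zero_in_fcone fcone_scale] by (simp add: span_fcone[OF I])
  have "solid_angle ?N = measure std_gaussian {z. closest_point (span ?N) z \<in> ?N}"
    by (rule solid_angle_cone[OF cN]) (auto intro: mult_nonneg_nonpos)
  also have "span ?N = ?L\<^sup>\<bottom>"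
    using span_normal_cone_fcone[OF E ex] unfolding N .
  finally have 2: "solid_angle ?N = measure std_gaussian {z. z - closest_point ?L z \<in> ?N}"
    unfolding closest_point_orthogonal_complement[OF subspace_span] .
  have "{z. closest_point ?L z \<in> ?F \<and> closest_point ?L z - z \<in> ?N} = {z. cell v E J I z}"
  proof (rule Collect_cong)
    fix z
    have "(closest_point ?L z - z) \<bullet> v i = 0" if "i \<in> I" for i
      using orthogonal_closest_point[of ?L "v i" z] that
      by (simp add: span_base inner_diff_left)
    then show "(closest_point ?L z \<in> ?F \<and> closest_point ?L z - z \<in> ?N) = cell v E J I z"
      unfolding cell_iff[OF I] by (auto simp: inner_diff_left)
  qed
  moreover have "?F \<in> sets borel" "?N \<in> sets borel"
    using cF cN by (auto intro: borel_closed)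
  ultimately show ?thesis
    using std_gaussian_projections_indep[of ?L ?F ?N] unfolding N 1 2 by simp
qed

lemma conic_intrinsic_volume_fcone:
  assumes E: "finite E" "J \<subseteq> E"
  shows "conic_intrinsic_volume k (fcone v E J) =
    (\<Sum>I\<in>{I. J \<subseteq> I \<and> exposed v E I \<and> dim (v ` I) = k}. measure std_gaussian {z. cell v E J I z})"
  unfolding conic_intrinsic_volume_def faces_fcone[OF E] sum.reindex[OF inj_on_fcone[OF E(1)]] o_def
  by (rule sum.cong[OF refl]) (use solid_angle_mult_cell[OF E(1)] in auto)

section \<open>Faces and tangent cones of polytopes\<close>

text \<open>A face of a convex hull is encoded by the set of all indices of points on it, which makes the
  encoding unique even if points coincide.\<close>
definition exposed_pts :: "('i \<Rightarrow> 'a::euclidean_space) \<Rightarrow> 'i set \<Rightarrow> 'i set \<Rightarrow> bool" where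
  "exposed_pts p E J \<longleftrightarrow> J \<subseteq> E \<and> J \<noteq> {} \<and> (\<exists>w b. (\<forall>i\<in>J. w \<bullet> p i = b) \<and> (\<forall>i\<in>E - J. w \<bullet> p i < b))"

lemma exposed_pts_iff:
  assumes "i0 \<in> J"
  shows "exposed_pts p E J \<longleftrightarrow> exposed (\<lambda>i. p i - p i0) E J"
proof
  assume "exposed_pts p E J"
  then obtain w b where w: "J \<subseteq> E" "\<forall>i\<in>J. w \<bullet> p i = b" "\<forall>i\<in>E - J. w \<bullet> p i < b"
    unfolding exposed_pts_def by blast
  then have "w \<bullet> p i0 = b" using assms by simp
  then show "exposed (\<lambda>i. p i - p i0) E J"
    unfolding exposed_def using w by (intro conjI exI[of _ w]) (auto simp: inner_diff_right)
next
  assume "exposed (\<lambda>i. p i - p i0) E J"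
  then obtain w where w: "J \<subseteq> E" "\<forall>i\<in>J. w \<bullet> (p i - p i0) = 0" "\<forall>i\<in>E - J. w \<bullet> (p i - p i0) < 0"
    unfolding exposed_def by blast
  have "\<forall>i\<in>J. w \<bullet> p i = w \<bullet> p i0" "\<forall>i\<in>E - J. w \<bullet> p i < w \<bullet> p i0"
    using w(2,3) by (simp_all add: inner_diff_right)
  moreover have "J \<noteq> {}" using assms by blast
  ultimately show "exposed_pts p E J"
    unfolding exposed_pts_def using w(1) by blast
qed

lemma convex_hull_image_explicit:
  fixes p :: "'i \<Rightarrow> 'a::real_vector"
  assumes "finite E"
  shows "convex hull (p ` E) = {x. \<exists>t. (\<forall>i\<in>E. 0 \<le> t i) \<and> sum t E = 1 \<and> x = (\<Sum>i\<in>E. t i *\<^sub>R p i)}"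
    (is "_ = ?R")
proof
  show "convex hull (p ` E) \<subseteq> ?R"
  proof (rule hull_minimal)
    show "p ` E \<subseteq> ?R"
    proof clarify
      fix i assume "i \<in> E"
      then show "\<exists>t. (\<forall>i\<in>E. 0 \<le> t i) \<and> sum t E = 1 \<and> p i = (\<Sum>i\<in>E. t i *\<^sub>R p i)"
        using assms by (intro exI[of _ "\<lambda>l. if l = i then 1 else 0"])
          (auto simp: if_distrib[of "\<lambda>c. c *\<^sub>R _"] cong: if_cong)
    qed
    show "convex ?R"
    proof (rule convexI)
      fix x y u w assume "x \<in> ?R" "y \<in> ?R" and uw: "0 \<le> (u::real)" "0 \<le> w" "u + w = 1"
      then obtain s t where st: "\<forall>i\<in>E. 0 \<le> s i" "sum s E = 1" "x = (\<Sum>i\<in>E. s i *\<^sub>R p i)"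
        "\<forall>i\<in>E. 0 \<le> t i" "sum t E = 1" "y = (\<Sum>i\<in>E. t i *\<^sub>R p i)" by auto
      show "u *\<^sub>R x + w *\<^sub>R y \<in> ?R"
        using st uw
        by (auto intro!: exI[of _ "\<lambda>i. u * s i + w * t i"]
            simp: sum.distrib scaleR_add_left scaleR_sum_right simp flip: sum_distrib_left)
    qed
  qed
  show "?R \<subseteq> convex hull (p ` E)"
  proof clarify
    fix t :: "'i \<Rightarrow> real" assume "\<forall>i\<in>E. 0 \<le> t i" "sum t E = 1"
    then show "(\<Sum>i\<in>E. t i *\<^sub>R p i) \<in> convex hull (p ` E)"
      using assms by (intro convex_sum) (auto intro: hull_inc)
  qed
qed

lemma convex_hull_Int_hyperplane:
  assumes E: "finite E" "J \<subseteq> E" and w': "\<forall>i\<in>J. w \<bullet> p i = b" "\<forall>i\<in>E - J. w \<bullet> p i < b"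
  shows "convex hull (p ` J) = (convex hull (p ` E)) \<inter> {x. w \<bullet> x = b}"
    and "\<And>x. x \<in> convex hull (p ` E) \<Longrightarrow> w \<bullet> x \<le> b"
proof -
  have w: "\<And>i. i \<in> J \<Longrightarrow> w \<bullet> p i = b" "\<And>i. i \<in> E \<Longrightarrow> i \<notin> J \<Longrightarrow> w \<bullet> p i < b"
    using w' by auto
  have fJ: "finite J" using E finite_subset by auto
  have le: "w \<bullet> p i \<le> b" if "i \<in> E" for i using w(1)[of i] w(2)[of i] that by (cases "i \<in> J") auto
  have dev: "b - w \<bullet> (\<Sum>i\<in>E. t i *\<^sub>R p i) = (\<Sum>i\<in>E. t i * (b - w \<bullet> p i))" if "sum t E = 1" for t
    using that by (simp add: inner_sum_right right_diff_distrib sum_subtractf flip: sum_distrib_right)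
  show "w \<bullet> x \<le> b" if x: "x \<in> convex hull (p ` E)" for x
  proof -
    obtain t where t: "\<forall>i\<in>E. 0 \<le> t i" "sum t E = 1" "x = (\<Sum>i\<in>E. t i *\<^sub>R p i)"
      using x unfolding convex_hull_image_explicit[OF E(1)] by auto
    have "0 \<le> (\<Sum>i\<in>E. t i * (b - w \<bullet> p i))" using t(1) le by (intro sum_nonneg) auto
    then show ?thesis using dev[OF t(2)] t(3) by simp
  qed
  show "convex hull (p ` J) = (convex hull (p ` E)) \<inter> {x. w \<bullet> x = b}"
  proof (intro equalityI subsetI)
    fix x assume x: "x \<in> convex hull (p ` J)"
    then obtain t where t: "\<forall>i\<in>J. 0 \<le> t i" "sum t J = 1" "x = (\<Sum>i\<in>J. t i *\<^sub>R p i)"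
      unfolding convex_hull_image_explicit[OF fJ] by auto
    have "w \<bullet> x = (\<Sum>i\<in>J. t i * b)" using w(1) by (simp add: t(3) inner_sum_right)
    also have "\<dots> = b" using t(2) by (simp flip: sum_distrib_right)
    finally show "x \<in> (convex hull (p ` E)) \<inter> {x. w \<bullet> x = b}"
      using hull_mono[of "p ` J" "p ` E"] E(2) x by auto
  next
    fix x assume x: "x \<in> (convex hull (p ` E)) \<inter> {x. w \<bullet> x = b}"
    then obtain t where t: "\<forall>i\<in>E. 0 \<le> t i" "sum t E = 1" "x = (\<Sum>i\<in>E. t i *\<^sub>R p i)"
      unfolding convex_hull_image_explicit[OF E(1)] by auto
    have "(\<Sum>i\<in>E. t i * (b - w \<bullet> p i)) = 0" using dev[OF t(2)] t(3) x by simp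
    then have z: "t i * (b - w \<bullet> p i) = 0" if "i \<in> E" for i
      using sum_nonneg_eq_0_iff[of E "\<lambda>i. t i * (b - w \<bullet> p i)"] E(1) t(1) le that by simp
    have t0: "t i = 0" if "i \<in> E - J" for i using z[of i] w(2)[of i] that by auto
    have "sum t E = sum t J"
      by (rule sum.mono_neutral_right) (use t0 E in auto)
    moreover have "(\<Sum>i\<in>E. t i *\<^sub>R p i) = (\<Sum>i\<in>J. t i *\<^sub>R p i)"
      by (rule sum.mono_neutral_right) (use t0 E in auto)
    ultimately have "sum t J = 1" "x = (\<Sum>i\<in>J. t i *\<^sub>R p i)"
      using t(2,3) by auto
    then show "x \<in> convex hull (p ` J)"
      unfolding convex_hull_image_explicit[OF fJ] using t(1) E(2) by auto
  qed
qed

lemma faces_convex_hull: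
  assumes E: "finite E"
  shows "faces j (convex hull (p ` E)) = (\<lambda>J. convex hull (p ` J)) ` {J. exposed_pts p E J \<and> aff_dim (p ` J) = int j}"
    and "inj_on (\<lambda>J. convex hull (p ` J)) {J. exposed_pts p E J}"
proof -
  let ?P = "convex hull (p ` E)"
  have poly: "polyhedron ?P" using E by (intro polytope_imp_polyhedron polytope_convex_hull) auto
  have face: "convex hull (p ` J) face_of ?P" and rec: "J = {i \<in> E. p i \<in> convex hull (p ` J)}"
    if J: "exposed_pts p E J" for J
  proof -
    obtain w b where w: "J \<subseteq> E" "\<forall>i\<in>J. w \<bullet> p i = b" "\<forall>i\<in>E - J. w \<bullet> p i < b"
      using J unfolding exposed_pts_def by blast
    note * = convex_hull_Int_hyperplane[OF E w]
    show "convex hull (p ` J) face_of ?P"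
      unfolding *(1) by (rule face_of_Int_supporting_hyperplane_le[OF convex_convex_hull *(2)])
    have "w \<bullet> p i = b" if "p i \<in> convex hull (p ` J)" for i
      using that unfolding *(1) by auto
    then show "J = {i \<in> E. p i \<in> convex hull (p ` J)}"
      using w by (fastforce intro: hull_inc)
  qed
  show "inj_on (\<lambda>J. convex hull (p ` J)) {J. exposed_pts p E J}"
    proof (rule inj_onI)
    fix J J' assume "J \<in> {J. exposed_pts p E J}" "J' \<in> {J. exposed_pts p E J}"
      and eq: "convex hull (p ` J) = convex hull (p ` J')"
    then show "J = J'" using rec[of J] rec[of J'] by (simp add: eq)
  qed
  show "faces j ?P = (\<lambda>J. convex hull (p ` J)) ` {J. exposed_pts p E J \<and> aff_dim (p ` J) = int j}"
  proof (intro equalityI subsetI)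
    fix F assume "F \<in> faces j ?P"
    then have F: "F face_of ?P" "aff_dim F = int j" by (auto simp: faces_def)
    have Fne: "F \<noteq> {}" using F(2) by (auto simp: aff_dim_empty)
    have "F exposed_face_of ?P" using exposed_face_of_polyhedron[OF poly] F(1) by blast
    then obtain a b where ab: "?P \<subseteq> {x. a \<bullet> x \<le> b}" "F = ?P \<inter> {x. a \<bullet> x = b}"
      unfolding exposed_face_of_def by auto
    define J where "J = {i \<in> E. a \<bullet> p i = b}"
    have le: "a \<bullet> p i \<le> b" if "i \<in> E" for i
    proof -
      have "p i \<in> ?P" using that by (intro hull_inc) auto
      then show ?thesis using ab(1) by auto
    qed
    have lt: "a \<bullet> p i < b" if "i \<in> E" "i \<notin> J" for i using le[of i] that by (auto simp: J_def less_le)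
    have FJ: "F = convex hull (p ` J)"
      unfolding ab(2) by (rule convex_hull_Int_hyperplane(1)[symmetric, OF E]) (use lt in \<open>auto simp: J_def\<close>)
    have "exposed_pts p E J"
      unfolding exposed_pts_def
      by (intro conjI exI[of _ a] exI[of _ b]) (use lt Fne FJ in \<open>auto simp: J_def\<close>)
    then show "F \<in> (\<lambda>J. convex hull (p ` J)) ` {J. exposed_pts p E J \<and> aff_dim (p ` J) = int j}"
      using FJ F(2) by (auto simp: aff_dim_convex_hull)
  next
    fix F assume "F \<in> (\<lambda>J. convex hull (p ` J)) ` {J. exposed_pts p E J \<and> aff_dim (p ` J) = int j}"
    then show "F \<in> faces j ?P" using face by (auto simp: faces_def aff_dim_convex_hull)
  qed
qed

text \<open>The points on the face itself may be approached from both sides, which is why their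
  differences from \<open>p i0\<close> generate lines.\<close>
lemma tangent_cone_convex_hull:
  assumes E: "finite E" "J \<subseteq> E" "i0 \<in> J"
  shows "tangent_cone (convex hull (p ` J)) (convex hull (p ` E)) = fcone (\<lambda>i. p i - p i0) E J"
proof (intro equalityI subsetI)
  let ?F = "convex hull (p ` J)" and ?P = "convex hull (p ` E)"
  have fJ: "finite J" using E finite_subset by auto
  fix x assume "x \<in> tangent_cone ?F ?P"
  then obtain f0 e where f0: "f0 \<in> rel_interior ?F" "e > 0" "f0 + e *\<^sub>R x \<in> ?P"
    unfolding tangent_cone_def by auto
  have "f0 \<in> ?F" using f0(1) rel_interior_subset by auto
  then obtain s where s: "sum s J = 1" "f0 = (\<Sum>i\<in>J. s i *\<^sub>R p i)"
    unfolding convex_hull_image_explicit[OF fJ] by auto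
  obtain t where t: "\<forall>i\<in>E. 0 \<le> t i" "sum t E = 1" "f0 + e *\<^sub>R x = (\<Sum>i\<in>E. t i *\<^sub>R p i)"
    using f0(3) unfolding convex_hull_image_explicit[OF E(1)] by auto
  define s' where "s' i = (if i \<in> J then s i else 0)" for i
  have s': "sum s' E = 1" "f0 = (\<Sum>i\<in>E. s' i *\<^sub>R p i)"
  proof -
    have "sum s' E = sum s J"
      by (rule sum.mono_neutral_cong_right) (use E in \<open>auto simp: s'_def\<close>)
    then show "sum s' E = 1" using s(1) by simp
    have "(\<Sum>i\<in>E. s' i *\<^sub>R p i) = (\<Sum>i\<in>J. s i *\<^sub>R p i)"
      by (rule sum.mono_neutral_cong_right) (use E in \<open>auto simp: s'_def\<close>)
    then show "f0 = (\<Sum>i\<in>E. s' i *\<^sub>R p i)" using s(2) by simp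
  qed
  have "x = (1 / e) *\<^sub>R ((\<Sum>i\<in>E. t i *\<^sub>R p i) - f0)"
    using f0(2) by (simp flip: t(3))
  also have "(\<Sum>i\<in>E. t i *\<^sub>R p i) - f0 = (\<Sum>i\<in>E. (t i - s' i) *\<^sub>R (p i - p i0))"
    using s' t(2) by (simp add: scaleR_right_diff_distrib scaleR_left_diff_distrib sum_subtractf flip: scaleR_sum_left)
  finally have x: "x = (\<Sum>i\<in>E. ((t i - s' i) / e) *\<^sub>R (p i - p i0))"
    by (simp add: scaleR_sum_right)
  show "x \<in> fcone (\<lambda>i. p i - p i0) E J"
    by (rule fconeI[OF _ x]) (use t(1) f0(2) in \<open>auto simp: s'_def\<close>)
next
  let ?F = "convex hull (p ` J)" and ?P = "convex hull (p ` E)"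
  have fJ: "finite J" using E finite_subset by auto
  fix x assume "x \<in> fcone (\<lambda>i. p i - p i0) E J"
  then obtain c where c: "\<And>i. i \<in> E \<Longrightarrow> i \<notin> J \<Longrightarrow> 0 \<le> c i" "x = (\<Sum>i\<in>E. c i *\<^sub>R (p i - p i0))"
    unfolding fcone_def by auto
  have Fne: "?F \<noteq> {}" using E(3) by auto
  then obtain f1 where f1: "f1 \<in> rel_interior ?F"
    using rel_interior_eq_empty[OF convex_convex_hull, of "p ` J"] by auto
  define m where "m = (\<Sum>i\<in>J. (1 / card J) *\<^sub>R p i)"
  have cJ: "card J > 0" using fJ E(3) by (auto simp: card_gt_0_iff)
  have mF: "m \<in> ?F"
    unfolding convex_hull_image_explicit[OF fJ] m_def using cJ by (auto intro!: exI[of _ "\<lambda>_. 1 / card J"])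
  obtain e where e: "e > 1" "(1 - e) *\<^sub>R m + e *\<^sub>R f1 \<in> ?F"
    using convex_rel_interior_iff[OF convex_convex_hull Fne, of f1] f1 mF by auto
  obtain s where s: "\<forall>i\<in>J. 0 \<le> s i" "sum s J = 1" "(1 - e) *\<^sub>R m + e *\<^sub>R f1 = (\<Sum>i\<in>J. s i *\<^sub>R p i)"
    using e(2) unfolding convex_hull_image_explicit[OF fJ] by auto
  define r where "r i = (1 / e) * s i + (1 - 1 / e) / card J" for i
  have f1r: "f1 = (\<Sum>i\<in>J. r i *\<^sub>R p i)"
  proof -
    have "(1 / e) *\<^sub>R ((1 - e) *\<^sub>R m + e *\<^sub>R f1) + (1 - 1 / e) *\<^sub>R m
        = ((1 - e) / e + (1 - 1 / e)) *\<^sub>R m + f1"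
      using e(1) by (simp add: scaleR_add_right scaleR_add_left)
    also have "(1 - e) / e + (1 - 1 / e) = 0" using e(1) by (simp add: field_simps)
    finally have "f1 = (1 / e) *\<^sub>R (\<Sum>i\<in>J. s i *\<^sub>R p i) + (1 - 1 / e) *\<^sub>R m"
      unfolding s(3) by simp
    then show ?thesis
      by (simp add: r_def m_def scaleR_add_left sum.distrib scaleR_sum_right)
  qed
  have rsum: "sum r J = 1"
    using s(2) cJ by (simp add: r_def sum.distrib flip: sum_distrib_left sum_divide_distrib)
  define \<delta> where "\<delta> = (1 - 1 / e) / card J"
  have \<delta>: "\<delta> > 0" using e(1) cJ by (simp add: \<delta>_def)
  have r\<delta>: "r i \<ge> \<delta>" if "i \<in> J" for i
    using s(1) that e(1) by (simp add: r_def \<delta>_def)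
  define c' where "c' i = c i - (if i = i0 then sum c E else 0)" for i
  have i0E: "i0 \<in> E" using E by auto
  have c'sum: "sum c' E = 0"
    using E(1) i0E by (simp add: c'_def sum_subtractf)
  have xc': "x = (\<Sum>i\<in>E. c' i *\<^sub>R p i)"
    using E(1) i0E unfolding c(2) c'_def
    by (simp add: scaleR_right_diff_distrib scaleR_left_diff_distrib sum_subtractf
        if_distrib[of "\<lambda>c. c *\<^sub>R _"] flip: scaleR_sum_left cong: if_cong)
  define M where "M = 1 + (\<Sum>i\<in>E. \<bar>c' i\<bar>)"
  have M: "M > 0" "\<bar>c' i\<bar> \<le> M" if "i \<in> E" for i
    using member_le_sum[of i E "\<lambda>i. \<bar>c' i\<bar>"] that E(1) by (auto simp: M_def intro!: add_pos_nonneg sum_nonneg)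
  define \<epsilon> where "\<epsilon> = \<delta> / M"
  have \<epsilon>: "\<epsilon> > 0" using \<delta> M(1)[OF i0E] by (simp add: \<epsilon>_def)
  define r' where "r' i = (if i \<in> J then r i else 0)" for i
  have r': "sum r' E = 1" "f1 = (\<Sum>i\<in>E. r' i *\<^sub>R p i)"
  proof -
    have "sum r' E = sum r J"
      by (rule sum.mono_neutral_cong_right) (use E in \<open>auto simp: r'_def\<close>)
    then show "sum r' E = 1" using rsum by simp
    have "(\<Sum>i\<in>E. r' i *\<^sub>R p i) = (\<Sum>i\<in>J. r i *\<^sub>R p i)"
      by (rule sum.mono_neutral_cong_right) (use E in \<open>auto simp: r'_def\<close>)
    then show "f1 = (\<Sum>i\<in>E. r' i *\<^sub>R p i)" using f1r by simp
  qed
  have "f1 + \<epsilon> *\<^sub>R x \<in> ?P"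
    unfolding convex_hull_image_explicit[OF E(1)]
  proof (intro CollectI exI[of _ "\<lambda>i. r' i + \<epsilon> * c' i"] conjI ballI)
    fix i assume i: "i \<in> E"
    show "0 \<le> r' i + \<epsilon> * c' i"
    proof (cases "i \<in> J")
      case True
      have "\<epsilon> * \<bar>c' i\<bar> \<le> \<epsilon> * M" using M(2)[OF i] \<epsilon> by simp
      also have "\<dots> = \<delta>" using M(1)[OF i] by (simp add: \<epsilon>_def)
      finally have "- (\<epsilon> * c' i) \<le> \<delta>" using \<epsilon> by (smt (verit) mult_left_mono mult_minus_right)
      then show ?thesis using r\<delta>[OF True] True by (simp add: r'_def)
    next
      case False
      then show ?thesis using c(1)[OF i False] E(3) \<epsilon> by (auto simp: r'_def c'_def)
    qed
  next
    show "(\<Sum>i\<in>E. r' i + \<epsilon> * c' i) = 1" using r'(1) c'sum by (simp add: sum.distrib flip: sum_distrib_left)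
    show "f1 + \<epsilon> *\<^sub>R x = (\<Sum>i\<in>E. (r' i + \<epsilon> * c' i) *\<^sub>R p i)"
      unfolding r'(2) xc' by (simp add: scaleR_add_left sum.distrib scaleR_sum_right)
  qed
  then show "x \<in> tangent_cone ?F ?P"
    unfolding tangent_cone_def using f1 \<epsilon> by auto
qed

text \<open>The angle sum of an arbitrary finite point configuration, degenerate or not.\<close>
lemma angle_sum_convex_hull:
  fixes p :: "nat \<Rightarrow> 'a::euclidean_space"
  assumes E: "finite E"
  shows "(\<Sum>F\<in>faces j (convex hull (p ` E)). conic_intrinsic_volume k (tangent_cone F (convex hull (p ` E)))) =
    (\<Sum>J\<in>{J. exposed_pts p E J \<and> aff_dim (p ` J) = int j}.
      \<Sum>I\<in>{I. J \<subseteq> I \<and> exposed_pts p E I \<and> aff_dim (p ` I) = int k}.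
        measure std_gaussian {z. cell (\<lambda>i. p i - p (Min J)) E J I z})"
proof -
  have inj: "inj_on (\<lambda>J. convex hull (p ` J)) {J. exposed_pts p E J \<and> aff_dim (p ` J) = int j}"
    by (rule inj_on_subset[OF faces_convex_hull(2)[OF E]]) auto
  show ?thesis
    unfolding faces_convex_hull(1)[OF E] sum.reindex[OF inj] o_def
  proof (rule sum.cong[OF refl])
    fix J assume "J \<in> {J. exposed_pts p E J \<and> aff_dim (p ` J) = int j}"
    then have J: "J \<subseteq> E" "J \<noteq> {}" by (auto simp: exposed_pts_def)
    have m: "Min J \<in> J" using J E finite_subset by (intro Min_in) auto
    have "{I. J \<subseteq> I \<and> exposed (\<lambda>i. p i - p (Min J)) E I \<and> dim ((\<lambda>i. p i - p (Min J)) ` I) = k}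
       = {I. J \<subseteq> I \<and> exposed_pts p E I \<and> aff_dim (p ` I) = int k}"
    proof (rule Collect_cong)
      fix I
      have "aff_dim (p ` I) = int (dim ((\<lambda>i. p i - p (Min J)) ` I))" if "J \<subseteq> I"
        using aff_dim_eq_dim_subtract[of "p (Min J)" "p ` I"] that m by (auto simp: hull_inc image_image)
      then show "(J \<subseteq> I \<and> exposed (\<lambda>i. p i - p (Min J)) E I \<and> dim ((\<lambda>i. p i - p (Min J)) ` I) = k) =
          (J \<subseteq> I \<and> exposed_pts p E I \<and> aff_dim (p ` I) = int k)"
        using exposed_pts_iff[of "Min J" I p E] m by auto
    qed
    then show "conic_intrinsic_volume k (tangent_cone (convex hull (p ` J)) (convex hull (p ` E))) =
      (\<Sum>I\<in>{I. J \<subseteq> I \<and> exposed_pts p E I \<and> aff_dim (p ` I) = int k}.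
        measure std_gaussian {z. cell (\<lambda>i. p i - p (Min J)) E J I z})"
      unfolding tangent_cone_convex_hull[OF E J(1) m] conic_intrinsic_volume_fcone[OF E J(1)] by simp
  qed
qed

section \<open>The Gauss--Bonnet relation for generic cones\<close>

text \<open>Independence of an indexed family, so that repeated vectors count as dependent.\<close>
definition indep :: "('i \<Rightarrow> 'a::euclidean_space) \<Rightarrow> 'i set \<Rightarrow> bool" where
  "indep v S \<longleftrightarrow> (\<forall>i\<in>S. v i \<notin> span (v ` (S - {i})))"

text \<open>A normal vector of the hyperplane at which the coefficient or, if \<open>i\<close> does not belong to the face, the
  inner product belonging to \<open>i\<close> changes sign in the condition for a cell.\<close>
definition wall :: "('i \<Rightarrow> 'a::euclidean_space) \<Rightarrow> 'i set \<Rightarrow> 'i \<Rightarrow> 'a" where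
  "wall v G i = v i - closest_point (span (v ` G)) (v i)"

lemma wall_orth: "l \<in> G \<Longrightarrow> v l \<bullet> wall v G i = 0"
  using orthogonal_closest_point[of "span (v ` G)" "v l" "v i"]
  by (simp add: wall_def span_base inner_commute)

lemma wall_orth_span: "x \<in> span (v ` G) \<Longrightarrow> x \<bullet> wall v G i = 0"
  using orthogonal_closest_point[of "span (v ` G)" x "v i"]
  by (simp add: wall_def inner_commute)

lemma wall_self: "v i \<bullet> wall v G i = wall v G i \<bullet> wall v G i"
proof -
  have "closest_point (span (v ` G)) (v i) \<bullet> wall v G i = 0"
    by (rule wall_orth_span) (rule closest_point_in_subspace[OF subspace_span])
  then show ?thesis by (metis diff_zero inner_diff_left wall_def)
qed

lemma wall_nonzero: "indep v S \<Longrightarrow> i \<in> S \<Longrightarrow> wall v (S - {i}) i \<noteq> 0"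
  using closest_point_in_subspace[of "span (v ` (S - {i}))" "v i"]
  by (auto simp: indep_def wall_def)

lemma wall_nonzero_insert: "indep v (insert i G) \<Longrightarrow> i \<notin> G \<Longrightarrow> wall v G i \<noteq> 0"
  using wall_nonzero[of v "insert i G" i] by simp

lemma indep_subset: "indep v S \<Longrightarrow> T \<subseteq> S \<Longrightarrow> indep v T"
proof -
  assume S: "indep v S" "T \<subseteq> S"
  have "span (v ` (T - {i})) \<subseteq> span (v ` (S - {i}))" for i
    using S(2) by (intro span_mono image_mono) auto
  then show ?thesis using S unfolding indep_def by blast
qed

lemma indep_dim:
  assumes "finite S" "indep v S"
  shows "dim (v ` S) = card S"
proof -
  have inj: "inj_on v S"
  proof (rule inj_onI, rule ccontr)
    fix i l assume il: "i \<in> S" "l \<in> S" "v i = v l" "i \<noteq> l"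
    then have "v i \<in> v ` (S - {i})" by auto
    then have "v i \<in> span (v ` (S - {i}))" by (rule span_base)
    then show False using assms(2) il(1) unfolding indep_def by blast
  qed
  have "independent (v ` S)"
    unfolding dependent_def
  proof clarify
    fix i assume i: "i \<in> S" "v i \<in> span (v ` S - {v i})"
    have "v ` S - {v i} \<subseteq> v ` (S - {i})" by auto
    then have "v i \<in> span (v ` (S - {i}))" using i(2) span_mono by blast
    then show False using assms(2) i(1) unfolding indep_def by blast
  qed
  then show ?thesis
    using inj by (simp add: dim_eq_card_independent card_image)
qed

lemma indep_span_UNIV:
  fixes v :: "'i \<Rightarrow> 'a::euclidean_space"
  assumes "finite S" "indep v S" "card S = DIM('a)"
  shows "span (v ` S) = UNIV"
  using indep_dim[OF assms(1,2)] assms(3) dim_eq_full by metis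

lemma span_image_explicit:
  fixes v :: "'i \<Rightarrow> 'a::euclidean_space"
  assumes "finite I" "x \<in> span (v ` I)"
  shows "\<exists>c. x = (\<Sum>l\<in>I. c l *\<^sub>R v l)"
proof -
  have "subspace (fcone v I I)"
    unfolding subspace_def
  proof (intro conjI ballI allI zero_in_fcone fcone_add)
    fix x r assume "x \<in> fcone v I I"
    then obtain c where "x = (\<Sum>i\<in>I. c i *\<^sub>R v i)" unfolding fcone_def by blast
    then show "r *\<^sub>R x \<in> fcone v I I"
      by (intro fconeI[of _ _ "\<lambda>i. r * c i"]) (auto simp: scaleR_sum_right)
  qed
  then have "span (v ` I) \<subseteq> fcone v I I"
    using gen_in_fcone[OF assms(1)] by (intro span_minimal) auto
  then show ?thesis using assms(2) unfolding fcone_def by blast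
qed

lemma inner_wall_outside:
  "i \<notin> I \<Longrightarrow> x \<bullet> wall v I i = (x - closest_point (span (v ` I)) x) \<bullet> v i"
proof -
  let ?p = "closest_point (span (v ` I))"
  have "?p x \<bullet> wall v I i = 0"
    by (rule wall_orth_span) (rule closest_point_in_subspace[OF subspace_span])
  moreover have "(x - ?p x) \<bullet> ?p (v i) = 0"
    by (rule orthogonal_closest_point[OF subspace_span closest_point_in_subspace[OF subspace_span]])
  ultimately show ?thesis
    by (simp add: wall_def inner_diff_left inner_diff_right)
qed

lemma inner_wall_inside:
  assumes "finite I" "i \<in> I" "closest_point (span (v ` I)) x = (\<Sum>l\<in>I. c l *\<^sub>R v l)"
  shows "x \<bullet> wall v (I - {i}) i = c i * (wall v (I - {i}) i \<bullet> wall v (I - {i}) i)"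
proof -
  let ?q = "wall v (I - {i}) i"
  have "?q \<in> span (v ` I)"
  proof -
    have "v ` (I - {i}) \<subseteq> v ` I" by auto
    then have "closest_point (span (v ` (I - {i}))) (v i) \<in> span (v ` I)"
      using closest_point_in_subspace[of "span (v ` (I - {i}))" "v i"] span_mono by blast
    then show ?thesis
      unfolding wall_def using assms(2) by (intro span_diff[OF span_base]) auto
  qed
  then have "(x - closest_point (span (v ` I)) x) \<bullet> ?q = 0"
    by (rule orthogonal_closest_point[OF subspace_span])
  then have "x \<bullet> ?q = (\<Sum>l\<in>I. c l *\<^sub>R v l) \<bullet> ?q"
    by (simp add: inner_diff_left assms(3))
  also have "\<dots> = (\<Sum>l\<in>I. c l * (v l \<bullet> ?q))"
    by (simp add: inner_sum_left)
  also have "\<dots> = c i * (v i \<bullet> ?q)"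
    using assms(1,2) by (subst sum.remove[of _ i]) (auto simp: wall_orth intro!: sum.neutral)
  finally show ?thesis by (simp add: wall_self)
qed

lemma projection_explicit:
  fixes v :: "'i \<Rightarrow> 'a::euclidean_space"
  assumes "finite I"
  shows "\<exists>c. closest_point (span (v ` I)) x = (\<Sum>l\<in>I. c l *\<^sub>R v l)"
  by (rule span_image_explicit[OF assms closest_point_in_subspace[OF subspace_span]])

lemma nonneg_mult_wall_iff:
  assumes "wall v G i \<noteq> 0"
  shows "0 \<le> c * (wall v G i \<bullet> wall v G i) \<longleftrightarrow> 0 \<le> c"
proof -
  have "0 < wall v G i \<bullet> wall v G i" using assms by simp
  then show ?thesis unfolding zero_le_mult_iff by linarith
qed

text \<open>In the generic case a cell is cut out by linear inequalities, one for each generator outside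
  of \<open>J\<close>, and the hyperplane belonging to \<open>i\<close> is the same for \<open>I\<close> and for \<open>I\<close> with \<open>i\<close>
  added or removed.\<close>
lemma cell_iff_walls:
  assumes E: "finite E" "J \<subseteq> I" "I \<subseteq> E" and ind: "indep v I"
  shows "cell v E J I z \<longleftrightarrow> (\<forall>i\<in>E - J. 0 \<le> z \<bullet> wall v (I - {i}) i)"
proof -
  have I: "finite I" using E finite_subset by blast
  let ?p = "closest_point (span (v ` I))"
  obtain c where c: "?p z = (\<Sum>l\<in>I. c l *\<^sub>R v l)" using projection_explicit[OF I] by blast
  have ins: "0 \<le> z \<bullet> wall v (I - {i}) i \<longleftrightarrow> 0 \<le> c i" if "i \<in> I" for i
    using inner_wall_inside[OF I that c] nonneg_mult_wall_iff[OF wall_nonzero[OF ind that]]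
    by simp
  have out: "z \<bullet> wall v (I - {i}) i = (z - ?p z) \<bullet> v i" if "i \<notin> I" for i
    using inner_wall_outside[OF that, of z v] that by simp
  have zero: "(z - ?p z) \<bullet> v i = 0" if "i \<in> I" for i
    by (rule orthogonal_closest_point[OF subspace_span]) (use that in \<open>auto intro: span_base\<close>)
  have uniq: "d i = c i" if d: "?p z = (\<Sum>l\<in>I. d l *\<^sub>R v l)" and i: "i \<in> I" for d i
    using inner_wall_inside[OF I i c] inner_wall_inside[OF I i d] wall_nonzero[OF ind i] by simp
  have "?p z \<in> fcone v I J \<longleftrightarrow> (\<forall>i\<in>I - J. 0 \<le> c i)"
  proof
    assume "?p z \<in> fcone v I J"
    then obtain d where "\<forall>i\<in>I - J. 0 \<le> d i" "?p z = (\<Sum>l\<in>I. d l *\<^sub>R v l)" unfolding fcone_def by blast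
    then show "\<forall>i\<in>I - J. 0 \<le> c i" using uniq[of d] by auto
  next
    assume "\<forall>i\<in>I - J. 0 \<le> c i"
    then show "?p z \<in> fcone v I J" unfolding fcone_def using c by blast
  qed
  also have "\<dots> \<longleftrightarrow> (\<forall>i\<in>I - J. 0 \<le> z \<bullet> wall v (I - {i}) i)"
    by (intro ball_cong refl) (simp add: ins)
  finally have 1: "?p z \<in> fcone v I J \<longleftrightarrow> (\<forall>i\<in>I - J. 0 \<le> z \<bullet> wall v (I - {i}) i)" .
  have 2: "(\<forall>i\<in>E. 0 \<le> (z - ?p z) \<bullet> v i) \<longleftrightarrow> (\<forall>i\<in>E - I. 0 \<le> z \<bullet> wall v (I - {i}) i)"
  proof
    assume "\<forall>i\<in>E. 0 \<le> (z - ?p z) \<bullet> v i"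
    then show "\<forall>i\<in>E - I. 0 \<le> z \<bullet> wall v (I - {i}) i" using out by simp
  next
    assume R: "\<forall>i\<in>E - I. 0 \<le> z \<bullet> wall v (I - {i}) i"
    show "\<forall>i\<in>E. 0 \<le> (z - ?p z) \<bullet> v i"
    proof
      fix i assume i: "i \<in> E"
      show "0 \<le> (z - ?p z) \<bullet> v i"
      proof (cases "i \<in> I")
        case True
        then show ?thesis by (simp only: zero)
      next
        case False
        then have "0 \<le> z \<bullet> wall v (I - {i}) i" using R i by blast
        then show ?thesis by (simp only: out[OF False])
      qed
    qed
  qed
  have "E - J = (I - J) \<union> (E - I)" using E by blast
  then show ?thesis
    unfolding cell_iff[OF I] 1 2 by (simp add: ball_Un)
qed

text \<open>On the hyperplane belonging to \<open>i\<close>, the projections to the spans with and without \<open>v i\<close> agree.\<close>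
lemma sgn_wall_eq:
  assumes I: "finite I" "i \<notin> I" "indep v (insert i I)" and x: "x \<bullet> wall v I i = 0" and i': "i' \<noteq> i"
  shows "sgn (x \<bullet> wall v (I - {i'}) i') = sgn (x \<bullet> wall v (insert i I - {i'}) i')"
proof -
  let ?p = "closest_point (span (v ` I))" and ?p' = "closest_point (span (v ` insert i I))"
  have out: "x \<bullet> wall v I i = (x - ?p x) \<bullet> v i" by (rule inner_wall_outside[OF I(2)])
  have zero: "(x - ?p x) \<bullet> v l = 0" if "l \<in> insert i I" for l
  proof (cases "l = i")
    case True then show ?thesis using out x by simp
  next
    case False
    then have "v l \<in> span (v ` I)" using that by (intro span_base) auto
    then show ?thesis by (rule orthogonal_closest_point[OF subspace_span])
  qed
  have eq: "?p' x = ?p x"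
  proof (rule closest_point_subspaceI[OF subspace_span])
    have "v ` I \<subseteq> v ` insert i I" by auto
    then show "?p x \<in> span (v ` insert i I)"
      using closest_point_in_subspace[of "span (v ` I)" x] span_mono by blast
    fix y assume "y \<in> span (v ` insert i I)"
    then have "orthogonal (x - ?p x) y"
      by (rule orthogonal_to_span) (use zero in \<open>auto simp: orthogonal_def\<close>)
    then show "(x - ?p x) \<bullet> y = 0" by (simp add: orthogonal_def)
  qed
  show ?thesis
  proof (cases "i' \<in> I")
    case False
    then have "I - {i'} = I" "insert i I - {i'} = insert i I" using i' by auto
    then show ?thesis
      using inner_wall_outside[OF False, of x v] inner_wall_outside[of i' "insert i I" x v] False i' eq
      by simp
  next
    case True
    obtain c where c: "?p x = (\<Sum>l\<in>I. c l *\<^sub>R v l)" using projection_explicit[OF I(1)] by blast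
    have c': "?p' x = (\<Sum>l\<in>insert i I. (if l = i then 0 else c l) *\<^sub>R v l)"
    proof -
      have "(\<Sum>l\<in>I. (if l = i then 0 else c l) *\<^sub>R v l) = (\<Sum>l\<in>I. c l *\<^sub>R v l)"
        by (rule sum.cong) (use I(2) in auto)
      then show ?thesis unfolding eq c using I by simp
    qed
    have ind: "indep v I" using indep_subset[OF I(3)] by blast
    have "wall v (I - {i'}) i' \<noteq> 0" by (rule wall_nonzero[OF ind True])
    moreover have "wall v (insert i I - {i'}) i' \<noteq> 0" by (rule wall_nonzero[OF I(3)]) (use True in simp)
    moreover have "x \<bullet> wall v (I - {i'}) i' = c i' * (wall v (I - {i'}) i' \<bullet> wall v (I - {i'}) i')"
      by (rule inner_wall_inside[OF I(1) True c])
    moreover have "x \<bullet> wall v (insert i I - {i'}) i' = (if i' = i then 0 else c i') *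
        (wall v (insert i I - {i'}) i' \<bullet> wall v (insert i I - {i'}) i')"
      by (rule inner_wall_inside[OF _ _ c']) (use I True in auto)
    ultimately show ?thesis using i' by (simp add: sgn_mult)
  qed
qed

lemma wall_hyperplane:
  fixes v :: "'i \<Rightarrow> 'a::euclidean_space"
  assumes I: "finite I" "i \<notin> I" "indep v (insert i I)" and card: "Suc (card I) = DIM('a)"
  shows "x \<bullet> wall v I i = 0 \<longleftrightarrow> x \<in> span (v ` I)"
proof
  assume x: "x \<bullet> wall v I i = 0"
  have "span (v ` insert i I) = UNIV"
    by (rule indep_span_UNIV) (use I card in auto)
  then have "x \<in> span (v ` insert i I)" by simp
  then obtain c where "x = (\<Sum>l\<in>insert i I. c l *\<^sub>R v l)"
    using span_image_explicit[of "insert i I" x v] I(1) by blast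
  then have c: "x = c i *\<^sub>R v i + (\<Sum>l\<in>I. c l *\<^sub>R v l)" using I by simp
  have s: "(\<Sum>l\<in>I. c l *\<^sub>R v l) \<in> span (v ` I)"
    by (auto intro!: span_sum span_scale intro: span_base)
  have "c i * (wall v I i \<bullet> wall v I i) = 0"
    using x wall_orth_span[OF s, of i] by (simp add: c inner_add_left wall_self)
  then have "c i = 0" using wall_nonzero_insert[OF I(3,2)] by simp
  then show "x \<in> span (v ` I)" using s c by simp
qed (rule wall_orth_span)

definition nonparallel :: "'a::real_vector \<Rightarrow> 'a \<Rightarrow> bool" where
  "nonparallel x y \<longleftrightarrow> (\<forall>r s. r *\<^sub>R x + s *\<^sub>R y = 0 \<longrightarrow> r = 0 \<and> s = 0)"

lemma nonparallel_sym: "nonparallel x y \<Longrightarrow> nonparallel y x"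
  unfolding nonparallel_def by (metis add.commute)

lemma nonparallel_walls_inside:
  assumes "i \<in> I" "i \<noteq> i'" "wall v (I - {i}) i \<noteq> 0" "wall v (I - {i'}) i' \<noteq> 0"
  shows "nonparallel (wall v (I - {i}) i) (wall v (I - {i'}) i')"
  unfolding nonparallel_def
proof (intro allI impI)
  fix r s assume eq: "r *\<^sub>R wall v (I - {i}) i + s *\<^sub>R wall v (I - {i'}) i' = 0"
  have "v i \<bullet> wall v (I - {i'}) i' = 0" using assms(1,2) by (intro wall_orth) auto
  then have "r * (wall v (I - {i}) i \<bullet> wall v (I - {i}) i) = 0"
    using arg_cong[OF eq, of "\<lambda>x. v i \<bullet> x"] by (simp add: inner_add_right wall_self)
  then have "r = 0" using assms(3) by simp
  then show "r = 0 \<and> s = 0" using eq assms(4) by simp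
qed

lemma nonparallel_walls_outside:
  assumes "finite I" "i \<notin> I" "i' \<notin> I" "i \<noteq> i'" "indep v (insert i' (insert i I))"
  shows "nonparallel (wall v I i) (wall v I i')"
  unfolding nonparallel_def
proof (intro allI impI)
  fix r s assume eq: "r *\<^sub>R wall v I i + s *\<^sub>R wall v I i' = 0"
  have notin: "v i' \<notin> span (v ` insert i I)"
  proof -
    have "insert i' (insert i I) - {i'} = insert i I" using assms by auto
    then show ?thesis using assms(5) unfolding indep_def by fastforce
  qed
  have in_span: "closest_point (span (v ` I)) x \<in> span (v ` insert i I)" for x
  proof -
    have "v ` I \<subseteq> v ` insert i I" by auto
    then show ?thesis using closest_point_in_subspace[of "span (v ` I)" x] span_mono by blast
  qed
  have s0: "s = 0"
  proof (rule ccontr)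
    assume s: "s \<noteq> 0"
    have "s *\<^sub>R v i' = s *\<^sub>R closest_point (span (v ` I)) (v i') - r *\<^sub>R (v i - closest_point (span (v ` I)) (v i))"
      using eq by (simp add: wall_def algebra_simps add_eq_0_iff)
    also have "\<dots> \<in> span (v ` insert i I)"
      by (intro span_diff span_scale in_span) (auto intro: span_base)
    finally have "(1 / s) *\<^sub>R (s *\<^sub>R v i') \<in> span (v ` insert i I)" by (rule span_scale)
    then show False using notin s by simp
  qed
  have "indep v (insert i I)" by (rule indep_subset[OF assms(5)]) auto
  then have "wall v I i \<noteq> 0" using assms(2) by (rule wall_nonzero_insert)
  then show "r = 0 \<and> s = 0" using eq s0 by simp
qed

text \<open>The value at a jump is unknown, but the punctured limits are locally constant in \<open>t0\<close>, and the line is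
  connected.\<close>
lemma eventually_const_imp_zero:
  fixes H :: "real \<Rightarrow> real"
  assumes loc: "\<And>t0. \<exists>c. \<forall>\<^sub>F t in at t0. H t = c" and bot: "\<forall>\<^sub>F t in at_bot. H t = 0"
    and t1: "\<forall>\<^sub>F t in at t1. H t = c1"
  shows "c1 = 0"
proof -
  have "\<forall>t0. \<exists>c. \<forall>\<^sub>F t in at t0. H t = c" using loc by blast
  then obtain g where g: "\<And>t0. \<forall>\<^sub>F t in at t0. H t = g t0" by metis
  have uniq: "c = d" if "\<forall>\<^sub>F t in at t0. H t = c" "\<forall>\<^sub>F t in at t0. H t = d" for t0 c d
  proof -
    have "\<forall>\<^sub>F t in at t0. c = d" using that by eventually_elim simp
    then show ?thesis by simp
  qed
  have "g constant_on UNIV"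
  proof (rule locally_constant_imp_constant)
    fix t0 :: real
    obtain e where e: "e > 0" "\<forall>t. t \<noteq> t0 \<and> dist t t0 < e \<longrightarrow> H t = g t0"
      using g[of t0] unfolding eventually_at by auto
    have gt: "g t = g t0" if t: "dist t t0 < e" for t
    proof (cases "t = t0")
      case False
      have "\<forall>\<^sub>F s in at t. s \<in> ball t0 e - {t0}"
        by (rule eventually_at_in_open') (use t False in \<open>auto simp: dist_commute\<close>)
      then have "\<forall>\<^sub>F s in at t. H s = g t0"
        by eventually_elim (use e in \<open>auto simp: dist_commute\<close>)
      then show ?thesis using uniq g by blast
    qed simp
    then show "\<exists>T. openin (top_of_set UNIV) T \<and> t0 \<in> T \<and> (\<forall>x\<in>T. g x = g t0)"
    proof (intro exI[of _ "ball t0 e"] conjI ballI)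
      show "g x = g t0" if "x \<in> ball t0 e" for x
        using gt[of x] that by (simp add: dist_commute)
    qed (use e(1) in simp_all)
  qed auto
  then obtain k where k: "\<And>t. g t = k" unfolding constant_on_def by auto
  obtain T where T: "\<forall>t\<le>T. H t = 0" using bot unfolding eventually_at_bot_linorder by auto
  have "\<forall>\<^sub>F s in at (T - 1). s \<in> {..<T}"
    by (rule eventually_at_in_open') auto
  then have "\<forall>\<^sub>F s in at (T - 1). H s = 0" by eventually_elim (use T in auto)
  then have "k = 0" using uniq g k by metis
  then show ?thesis using uniq[OF t1 g] k by simp
qed

section \<open>Crossing walls along a ray\<close>

text \<open>Besides general position, the cone is assumed to be pointed modulo the lines spanned by \<open>J\<close>,
  which is the exposedness of \<open>J\<close>, and to have full dimension.\<close>
locale generic_cone =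
  fixes v :: "'i \<Rightarrow> 'a::euclidean_space" and E J :: "'i set"
  assumes finE: "finite E" and JE: "J \<subseteq> E"
    and gp: "\<And>S. S \<subseteq> E \<Longrightarrow> card S \<le> DIM('a) \<Longrightarrow> indep v S"
    and cJ: "card J < DIM('a)" and cE: "DIM('a) \<le> card E"
    and exJ: "exposed v E J"
begin

definition cells :: "'i set set" where
  "cells = {I. J \<subseteq> I \<and> I \<subseteq> E \<and> card I < DIM('a)}"

definition K :: "'a set" where "K = fcone v E J"

definition active :: "'i set \<Rightarrow> 'a \<Rightarrow> bool" where
  "active I z \<longleftrightarrow> (\<forall>i\<in>E - J. 0 \<le> z \<bullet> wall v (I - {i}) i)"

definition walls :: "'a set" where
  "walls = (\<lambda>(I, i). wall v (I - {i}) i) ` (cells \<times> (E - J))"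

lemma finite_cells: "finite cells"
  by (rule finite_subset[of _ "Pow E"]) (use finE in \<open>auto simp: cells_def\<close>)

lemma finite_walls: "finite walls"
  unfolding walls_def using finite_cells finE by simp

lemma cellsD: "I \<in> cells \<Longrightarrow> finite I \<and> J \<subseteq> I \<and> I \<subseteq> E \<and> card I < DIM('a)"
  unfolding cells_def using finE finite_subset by blast

lemma indep_insert: "I \<in> cells \<Longrightarrow> i \<in> E \<Longrightarrow> indep v (insert i I)"
  using cellsD[of I] by (intro gp) (auto simp: card_insert_if)

lemma indep_cell: "I \<in> cells \<Longrightarrow> indep v I"
  using cellsD[of I] by (intro gp) auto

lemma active_iff_cell: "I \<in> cells \<Longrightarrow> active I z \<longleftrightarrow> cell v E J I z"
  unfolding active_def using cell_iff_walls[OF finE _ _ indep_cell] cellsD by metis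

lemma wall_in_walls: "I \<in> cells \<Longrightarrow> i \<in> E - J \<Longrightarrow> wall v (I - {i}) i \<in> walls"
  unfolding walls_def by (rule image_eqI[of _ _ "(I, i)"]) auto

lemma cell_wall_nonzero: "I \<in> cells \<Longrightarrow> i \<in> E - J \<Longrightarrow> wall v (I - {i}) i \<noteq> 0"
  using wall_nonzero[OF indep_insert, of I i i] by simp

lemma walls_nonzero: "q \<in> walls \<Longrightarrow> q \<noteq> 0"
  unfolding walls_def using cell_wall_nonzero by auto

lemma ex_generator: "I \<in> cells \<Longrightarrow> \<exists>i. i \<in> E - I"
  using cellsD[of I] cE by (metis DiffI card_subset_eq le_less_trans less_irrefl subset_antisym subsetI finE card_mono not_le)

lemma finite_card_bound:
  assumes "S \<subseteq> E" "w \<noteq> 0" "\<And>i. i \<in> S \<Longrightarrow> w \<bullet> v i = 0"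
  shows "card S < DIM('a)"
proof (rule ccontr)
  assume "\<not> card S < DIM('a)"
  then obtain T where T: "T \<subseteq> S" "card T = DIM('a)"
    by (metis not_less obtain_subset_with_card_n)
  have fT: "finite T" using T(1) assms(1) finE by (meson finite_subset)
  have "span (v ` T) = UNIV"
    by (rule indep_span_UNIV[OF fT gp T(2)]) (use T assms(1) in auto)
  then have "w \<in> span (v ` T)" by simp
  then have "orthogonal w w"
    by (rule orthogonal_to_span) (use assms(3) T(1) in \<open>auto simp: orthogonal_def\<close>)
  then show False using assms(2) by (simp add: orthogonal_def)
qed

lemma span_generators: "span (v ` E) = UNIV"
proof -
  obtain T where T: "T \<subseteq> E" "card T = DIM('a)" using cE by (metis obtain_subset_with_card_n)
  have "finite T" using T(1) finE by (rule finite_subset)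
  then have "span (v ` T) = UNIV" using T by (intro indep_span_UNIV gp) auto
  moreover have "span (v ` T) \<subseteq> span (v ` E)" using T(1) by (intro span_mono image_mono)
  ultimately show ?thesis by auto
qed

text \<open>A supporting hyperplane at a boundary point meets the cone in a proper face through this point, and
  general position bounds the number of generators on the hyperplane.\<close>
lemma K_boundary:
  assumes x: "x \<in> K" "x \<notin> interior K"
  shows "\<exists>S w. S \<in> cells \<and> x \<in> fcone v S J \<and> w \<noteq> 0 \<and> (\<forall>i\<in>S. w \<bullet> v i = 0) \<and> (\<forall>i\<in>E - S. w \<bullet> v i < 0)"
proof -
  have cK: "convex K" unfolding K_def by (rule convex_fcone)
  have "affine hull K = UNIV"
  proof -
    have "0 \<in> affine hull K" unfolding K_def using zero_in_fcone by (intro hull_inc)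
    then have "affine hull K = span K" by (rule affine_hull_span_0)
    then show ?thesis unfolding K_def span_fcone[OF finE] span_generators .
  qed
  then have xr: "x \<notin> rel_interior K" using x(2) rel_interior_interior by metis
  obtain a where a: "a \<noteq> 0" "\<And>y. y \<in> K \<Longrightarrow> a \<bullet> x \<le> a \<bullet> y" "\<And>y. y \<in> rel_interior K \<Longrightarrow> a \<bullet> x < a \<bullet> y"
    by (rule supporting_hyperplane_rel_boundary[OF cK x(1) xr]) (rule that)
  have "a \<bullet> x \<le> 0" using a(2)[of 0] zero_in_fcone[of v E J] by (simp add: K_def)
  moreover have "2 *\<^sub>R x \<in> K" using x(1) unfolding K_def by (rule fcone_scale) simp
  then have "0 \<le> a \<bullet> x" using a(2)[of "2 *\<^sub>R x"] by simp
  ultimately have ax: "a \<bullet> x = 0" by simp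
  define w where "w = - a"
  define S where "S = {i \<in> E. w \<bullet> v i = 0}"
  have le: "w \<bullet> v i \<le> 0" if "i \<in> E" for i
    using a(2)[of "v i"] gen_in_fcone[OF finE that, of v J] ax by (simp add: K_def w_def)
  have JS: "J \<subseteq> S"
  proof
    fix i assume i: "i \<in> J"
    then have "- v i \<in> K" unfolding K_def using JE by (intro neg_gen_in_fcone[OF finE]) auto
    then have "w \<bullet> v i \<ge> 0" using a(2)[of "- v i"] ax by (simp add: w_def)
    then show "i \<in> S" using le[of i] i JE by (auto simp: S_def)
  qed
  have w0: "\<forall>i\<in>S. w \<bullet> v i = 0" by (simp add: S_def)
  have wn: "\<forall>i\<in>E - S. w \<bullet> v i < 0"
  proof
    fix i assume "i \<in> E - S"
    then show "w \<bullet> v i < 0" using le[of i] by (simp add: S_def less_le)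
  qed
  have SE: "S \<subseteq> E" by (simp add: S_def)
  have "card S < DIM('a)"
    by (rule finite_card_bound[OF SE, of w]) (use a(1) in \<open>auto simp: w_def S_def\<close>)
  then have "S \<in> cells" using JS SE by (simp add: cells_def)
  moreover have "x \<in> fcone v S J"
    unfolding fcone_Int_hyperplane(1)[OF finE JS SE w0 wn] using x(1) ax by (simp add: K_def w_def)
  moreover have "w \<noteq> 0" using a(1) by (simp add: w_def)
  ultimately show ?thesis using w0 wn by blast
qed

text \<open>Along the line through \<open>z\<close> with direction \<open>a\<close> two different wall hyperplanes are never met at the
  same time, and \<open>z\<close> itself lies on none.\<close>
definition generic :: "'a \<Rightarrow> 'a \<Rightarrow> bool" where
  "generic a z \<longleftrightarrow> (\<forall>q\<in>walls. z \<bullet> q \<noteq> 0) \<and>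
    (\<forall>q1\<in>walls. \<forall>q2\<in>walls. nonparallel q1 q2 \<longrightarrow> (\<forall>t. \<not> ((z + t *\<^sub>R a) \<bullet> q1 = 0 \<and> (z + t *\<^sub>R a) \<bullet> q2 = 0)))"

definition zeros :: "'a \<Rightarrow> 'i set \<Rightarrow> 'i set" where
  "zeros x I = {i \<in> E - J. x \<bullet> wall v (I - {i}) i = 0}"

text \<open>Adds or removes the single index whose wall contains \<open>x\<close>. This is an involution of \<open>paired x\<close> that
  changes the parity of the number of elements.\<close>
definition flip :: "'a \<Rightarrow> 'i set \<Rightarrow> 'i set" where
  "flip x I = (let i = (THE i. i \<in> zeros x I) in if i \<in> I then I - {i} else insert i I)"

text \<open>The last condition says that the partner \<open>flip x I\<close> has fewer than \<open>DIM('a)\<close> elements.\<close>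
definition paired :: "'a \<Rightarrow> 'i set set" where
  "paired x = {I \<in> cells. \<exists>i. zeros x I = {i} \<and> (i \<in> I \<or> card I + 2 \<le> DIM('a))}"

lemma zeros_insert:
  assumes G: "G \<in> cells" "i \<in> E - J" "i \<notin> G" "x \<bullet> wall v G i = 0"
  shows "zeros x (insert i G) = zeros x G"
    and "i' \<noteq> i \<Longrightarrow> sgn (x \<bullet> wall v (insert i G - {i'}) i') = sgn (x \<bullet> wall v (G - {i'}) i')"
proof -
  have fG: "finite G" using cellsD[OF G(1)] by blast
  have ind: "indep v (insert i G)" using G by (intro indep_insert) auto
  show s: "sgn (x \<bullet> wall v (insert i G - {i'}) i') = sgn (x \<bullet> wall v (G - {i'}) i')" if "i' \<noteq> i" for i'
    by (rule sgn_wall_eq[OF fG G(3) ind G(4) that, symmetric])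
  have "x \<bullet> wall v (insert i G - {i'}) i' = 0 \<longleftrightarrow> x \<bullet> wall v (G - {i'}) i' = 0" for i'
  proof (cases "i' = i")
    case True
    then show ?thesis using G(3) by simp
  next
    case False
    then show ?thesis using s[OF False] sgn_zero_iff by metis
  qed
  then show "zeros x (insert i G) = zeros x G" by (simp add: zeros_def)
qed

lemma flip_paired:
  assumes I: "I \<in> paired x"
  shows "flip x I \<in> paired x" "flip x (flip x I) = I"
    and "(-1 :: real) ^ card (flip x I) = - ((-1) ^ card I)"
    and "\<exists>i G. zeros x I = {i} \<and> G \<in> cells \<and> i \<in> E - J \<and> i \<notin> G \<and> x \<bullet> wall v G i = 0 \<and> {I, flip x I} = {G, insert i G}"
proof -
  obtain i where i: "I \<in> cells" "zeros x I = {i}" "i \<in> I \<or> card I + 2 \<le> DIM('a)"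
    using I unfolding paired_def by blast
  have iz: "i \<in> E - J" "x \<bullet> wall v (I - {i}) i = 0"
    using i(2) unfolding zeros_def by auto
  have the: "(THE l. l \<in> {i}) = i" by simp
  note D = cellsD[OF i(1)]
  have flipI: "flip x I = (if i \<in> I then I - {i} else insert i I)"
    unfolding flip_def i(2) the Let_def ..
  define G where "G = I - {i}"
  have G: "G \<in> cells" "i \<notin> G" "x \<bullet> wall v G i = 0"
  proof -
    have "card G \<le> card I" using D by (simp add: G_def card_mono)
    moreover have "J \<subseteq> G" using D iz(1) by (simp add: G_def subset_Diff_insert)
    ultimately show "G \<in> cells" using D by (simp add: cells_def G_def) (meson Diff_subset subset_trans)
    show "i \<notin> G" "x \<bullet> wall v G i = 0" using iz by (simp_all add: G_def)
  qed
  have c2: "card G + 2 \<le> DIM('a)"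
  proof (cases "i \<in> I")
    case True
    then have "card G + 1 = card I" using D card_Suc_Diff1[of I i] by (simp add: G_def)
    then show ?thesis using D by linarith
  next
    case False
    then show ?thesis using i(3) by (simp add: G_def)
  qed
  have fG: "finite G" using D by (simp add: G_def)
  have insG: "insert i G \<in> cells"
  proof -
    have "card (insert i G) = Suc (card G)" using fG G(2) by simp
    then show ?thesis using cellsD[OF G(1)] iz(1) c2 by (simp add: cells_def subset_insertI2)
  qed
  have zG: "zeros x (insert i G) = zeros x G" by (rule zeros_insert(1)[OF G(1) iz(1) G(2,3)])
  have pair: "I = G \<and> flip x I = insert i G \<or> I = insert i G \<and> flip x I = G"
    unfolding flipI G_def by (simp add: insert_absorb)
  then have zz: "zeros x G = {i}" "zeros x (insert i G) = {i}" using i(2) zG by metis+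
  have pG: "G \<in> paired x" "insert i G \<in> paired x"
    unfolding paired_def using G(1) insG zz c2 by simp_all
  show "flip x I \<in> paired x" using pair pG by metis
  have "flip x G = insert i G" "flip x (insert i G) = G"
    unfolding flip_def zz the Let_def using G(2) by simp_all
  then show "flip x (flip x I) = I" using pair by metis
  have "card (insert i G) = Suc (card G)" using fG G(2) by simp
  then show "(-1 :: real) ^ card (flip x I) = - ((-1) ^ card I)" using pair by (elim disjE conjE) simp_all
  show "\<exists>i G. zeros x I = {i} \<and> G \<in> cells \<and> i \<in> E - J \<and> i \<notin> G \<and> x \<bullet> wall v G i = 0 \<and> {I, flip x I} = {G, insert i G}"
    by (rule exI[of _ i], rule exI[of _ G]) (use pair G iz(1) i(2) in \<open>simp add: doubleton_eq_iff\<close>)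
qed

lemma eventually_sign:
  fixes a z q :: 'a
  assumes "(z + t0 *\<^sub>R a) \<bullet> q \<noteq> 0"
  shows "\<forall>\<^sub>F t in at t0. sgn ((z + t *\<^sub>R a) \<bullet> q) = sgn ((z + t0 *\<^sub>R a) \<bullet> q)"
proof -
  have lim: "((\<lambda>t. (z + t *\<^sub>R a) \<bullet> q) \<longlongrightarrow> (z + t0 *\<^sub>R a) \<bullet> q) (at t0)"
    by (intro tendsto_intros)
  consider "(z + t0 *\<^sub>R a) \<bullet> q > 0" | "(z + t0 *\<^sub>R a) \<bullet> q < 0" using assms by linarith
  then show ?thesis
  proof cases
    case 1
    then have "\<forall>\<^sub>F t in at t0. (z + t *\<^sub>R a) \<bullet> q > 0" by (rule order_tendstoD(1)[OF lim])
    then show ?thesis by eventually_elim (use 1 in simp)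
  next
    case 2
    then have "\<forall>\<^sub>F t in at t0. (z + t *\<^sub>R a) \<bullet> q < 0" by (rule order_tendstoD(2)[OF lim])
    then show ?thesis by eventually_elim (use 2 in simp)
  qed
qed

lemma nonneg_sgn: "0 \<le> (x::real) \<longleftrightarrow> 0 \<le> sgn x"
  by (simp add: zero_le_sgn_iff)

lemma eventually_signs:
  assumes "I \<in> cells"
  shows "\<forall>\<^sub>F t in at t0. \<forall>i\<in>E - J - zeros (z + t0 *\<^sub>R a) I.
    sgn ((z + t *\<^sub>R a) \<bullet> wall v (I - {i}) i) = sgn ((z + t0 *\<^sub>R a) \<bullet> wall v (I - {i}) i)"
proof (rule eventually_ball_finite)
  show "finite (E - J - zeros (z + t0 *\<^sub>R a) I)" using finE by simp
  show "\<forall>i\<in>E - J - zeros (z + t0 *\<^sub>R a) I. \<forall>\<^sub>F t in at t0.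
    sgn ((z + t *\<^sub>R a) \<bullet> wall v (I - {i}) i) = sgn ((z + t0 *\<^sub>R a) \<bullet> wall v (I - {i}) i)"
  proof
    fix i assume "i \<in> E - J - zeros (z + t0 *\<^sub>R a) I"
    then have "(z + t0 *\<^sub>R a) \<bullet> wall v (I - {i}) i \<noteq> 0" by (auto simp: zeros_def)
    then show "\<forall>\<^sub>F t in at t0.
      sgn ((z + t *\<^sub>R a) \<bullet> wall v (I - {i}) i) = sgn ((z + t0 *\<^sub>R a) \<bullet> wall v (I - {i}) i)"
      by (rule eventually_sign)
  qed
qed

lemma eventually_active_regular:
  assumes I: "I \<in> cells" "zeros (z + t0 *\<^sub>R a) I = {}"
  shows "\<forall>\<^sub>F t in at t0. active I (z + t *\<^sub>R a) = active I (z + t0 *\<^sub>R a)"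
  using eventually_signs[OF I(1), of z t0 a]
proof eventually_elim
  case (elim t)
  then have "0 \<le> (z + t *\<^sub>R a) \<bullet> wall v (I - {i}) i \<longleftrightarrow> 0 \<le> (z + t0 *\<^sub>R a) \<bullet> wall v (I - {i}) i"
    if "i \<in> E - J" for i
    using that I(2) nonneg_sgn by (metis Diff_empty)
  then show ?case unfolding active_def by blast
qed

text \<open>The two cells share the wall that is crossed, and the signs at the other walls agree at the crossing
  point and hence nearby.\<close>
lemma eventually_active_flip:
  assumes I: "I \<in> paired (z + t0 *\<^sub>R a)"
  shows "\<forall>\<^sub>F t in at t0. active (flip (z + t0 *\<^sub>R a) I) (z + t *\<^sub>R a) = active I (z + t *\<^sub>R a)"
proof -
  let ?x = "z + t0 *\<^sub>R a"
  obtain i G where G: "zeros ?x I = {i}" "G \<in> cells" "i \<in> E - J" "i \<notin> G" "?x \<bullet> wall v G i = 0"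
    "{I, flip ?x I} = {G, insert i G}"
    using flip_paired(4)[OF I] by (elim exE conjE) (rule that)
  have pair: "I = G \<and> flip ?x I = insert i G \<or> I = insert i G \<and> flip ?x I = G"
    using G(6) by (simp add: doubleton_eq_iff)
  have zG: "zeros ?x (insert i G) = zeros ?x G" by (rule zeros_insert(1)[OF G(2-5)])
  have z1: "zeros ?x G = {i}" using pair G(1) zG by (elim disjE conjE) simp_all
  have "I \<in> cells" "flip ?x I \<in> cells" using I flip_paired(1)[OF I] unfolding paired_def by simp_all
  then have insG: "insert i G \<in> cells" using pair by (elim disjE conjE) simp_all
  have "\<forall>\<^sub>F t in at t0. active (insert i G) (z + t *\<^sub>R a) = active G (z + t *\<^sub>R a)"
    using eventually_signs[OF G(2), of z t0 a] eventually_signs[OF insG, of z t0 a]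
  proof eventually_elim
    case (elim t)
    have "0 \<le> (z + t *\<^sub>R a) \<bullet> wall v (insert i G - {l}) l \<longleftrightarrow> 0 \<le> (z + t *\<^sub>R a) \<bullet> wall v (G - {l}) l"
      if l: "l \<in> E - J" for l
    proof (cases "l = i")
      case True
      then show ?thesis using G(4) by simp
    next
      case False
      then have l': "l \<in> E - J - zeros ?x G" "l \<in> E - J - zeros ?x (insert i G)"
        using l z1 zG by simp_all
      have "sgn ((z + t *\<^sub>R a) \<bullet> wall v (insert i G - {l}) l) = sgn ((z + t *\<^sub>R a) \<bullet> wall v (G - {l}) l)"
        using bspec[OF elim(1) l'(1)] bspec[OF elim(2) l'(2)] zeros_insert(2)[OF G(2-5) False] by simp
      then show ?thesis using nonneg_sgn by metis
    qed
    then show ?case unfolding active_def by blast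
  qed
  then show ?thesis
    using pair by (elim disjE conjE; simp only:) (elim eventually_mono, simp)
qed

lemma eventually_sum_paired:
  "\<forall>\<^sub>F t in at t0. (\<Sum>I\<in>paired (z + t0 *\<^sub>R a). (-1) ^ card I * of_bool (active I (z + t *\<^sub>R a))) = (0::real)"
proof -
  let ?x = "z + t0 *\<^sub>R a"
  have fin: "finite (paired ?x)" unfolding paired_def using finite_cells by simp
  have "\<forall>\<^sub>F t in at t0. \<forall>I\<in>paired ?x. active (flip ?x I) (z + t *\<^sub>R a) = active I (z + t *\<^sub>R a)"
    by (rule eventually_ball_finite[OF fin]) (use eventually_active_flip in blast)
  then show ?thesis
  proof eventually_elim
    case (elim t)
    let ?f = "\<lambda>I. (-1) ^ card I * of_bool (active I (z + t *\<^sub>R a)) :: real"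
    have "sum ?f (paired ?x) = (\<Sum>I\<in>paired ?x. ?f (flip ?x I))"
      by (rule sum.reindex_bij_witness[of _ "flip ?x" "flip ?x"]) (simp_all add: flip_paired)
    also have "\<dots> = (\<Sum>I\<in>paired ?x. - ?f I)"
      by (rule sum.cong[OF refl]) (use elim in \<open>simp add: flip_paired(3)\<close>)
    finally show ?case by (simp add: sum_negf)
  qed
qed

end

section \<open>Vanishing of the alternating sum\<close>

lemma eventually_at_bot_affine_neg: "0 < b \<Longrightarrow> \<forall>\<^sub>F t in at_bot. c + t * b < (0::real)"
proof -
  assume b: "0 < b"
  have "c + t * b < 0" if "t \<le> - (\<bar>c\<bar> + 1) / b" for t
  proof -
    have "t * b \<le> - (\<bar>c\<bar> + 1)" using that b by (simp add: pos_le_divide_eq)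
    then show ?thesis by linarith
  qed
  then show ?thesis unfolding eventually_at_bot_linorder by blast
qed

lemma AE_std_gaussian_inner_nonzero:
  fixes q :: "'a::euclidean_space"
  assumes "q \<noteq> 0"
  shows "AE z in std_gaussian. z \<bullet> q \<noteq> 0"
proof -
  have "negligible {x. q \<bullet> x = 0}"
    using assms by (intro negligible_hyperplane) auto
  then have "AE x in lborel. x \<notin> {x. q \<bullet> x = 0}"
    by (metis AE_completion_iff AE_not_in negligible_iff_null_sets)
  then show ?thesis
    unfolding std_gaussian_def by (subst AE_density) (auto elim!: eventually_mono simp: inner_commute)
qed

lemma fcone_mono:
  assumes E: "finite E" "I \<subseteq> E"
  shows "fcone v I J \<subseteq> fcone v E J"
proof
  fix x assume "x \<in> fcone v I J"
  then obtain c where c: "\<forall>i\<in>I - J. 0 \<le> c i" "x = (\<Sum>i\<in>I. c i *\<^sub>R v i)" unfolding fcone_def by auto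
  have "x = (\<Sum>i\<in>E. (if i \<in> I then c i else 0) *\<^sub>R v i)"
    unfolding c(2) using E by (intro sum.mono_neutral_cong_left) auto
  then show "x \<in> fcone v E J" using c(1) by (intro fconeI[of _ _ "\<lambda>i. if i \<in> I then c i else 0"]) auto
qed

context generic_cone
begin

lemma span_fcone_iff:
  assumes I: "I \<in> cells" and y: "y \<in> span (v ` I)"
  shows "y \<in> fcone v I J \<longleftrightarrow> (\<forall>i\<in>I - J. 0 \<le> y \<bullet> wall v (I - {i}) i)"
proof -
  have fI: "finite I" using cellsD[OF I] by blast
  have p: "closest_point (span (v ` I)) y = y"
    by (rule closest_point_subspaceI[OF subspace_span y]) simp
  have iff: "0 \<le> y \<bullet> wall v (I - {i}) i \<longleftrightarrow> 0 \<le> c i"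
    if "y = (\<Sum>l\<in>I. c l *\<^sub>R v l)" "i \<in> I" for c i
    using inner_wall_inside[OF fI that(2), of v y c] nonneg_mult_wall_iff[OF wall_nonzero[OF indep_cell[OF I] that(2)], of "c i"]
      p that(1) by metis
  show ?thesis
  proof
    assume "y \<in> fcone v I J"
    then obtain c where c: "\<forall>i\<in>I - J. 0 \<le> c i" "y = (\<Sum>l\<in>I. c l *\<^sub>R v l)" unfolding fcone_def by auto
    then show "\<forall>i\<in>I - J. 0 \<le> y \<bullet> wall v (I - {i}) i" using iff[OF c(2)] by simp
  next
    assume R: "\<forall>i\<in>I - J. 0 \<le> y \<bullet> wall v (I - {i}) i"
    obtain c where c: "y = (\<Sum>l\<in>I. c l *\<^sub>R v l)" using span_image_explicit[OF fI y] by auto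
    then have "\<forall>i\<in>I - J. 0 \<le> c i" using R iff[OF c] by simp
    then show "y \<in> fcone v I J" unfolding fcone_def using c by auto
  qed
qed

lemma fcone_in_span: "finite S \<Longrightarrow> x \<in> fcone v S J \<Longrightarrow> x \<in> span (v ` S)"
  using span_fcone[of S v J] span_base[of x "fcone v S J"] by simp

lemma genericD:
  assumes "generic a z" "q1 \<in> walls" "q2 \<in> walls" "nonparallel q1 q2" "(z + t *\<^sub>R a) \<bullet> q1 = 0" "(z + t *\<^sub>R a) \<bullet> q2 = 0"
  shows False
  using assms unfolding generic_def by metis

text \<open>A point on a wall of \<open>I\<close> leaves \<open>I\<close> without a partner only if the hyperplane is the span of \<open>I\<close>
  itself, since then the partner would have \<open>DIM('a)\<close> generators.\<close>
lemma not_paired: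
  assumes g: "generic a z" and I: "I \<in> cells" "i \<in> zeros (z + t0 *\<^sub>R a) I" "I \<notin> paired (z + t0 *\<^sub>R a)"
  shows "Suc (card I) = DIM('a)" "i \<notin> I" "z + t0 *\<^sub>R a \<in> span (v ` I)"
proof -
  let ?x = "z + t0 *\<^sub>R a"
  note D = cellsD[OF I(1)]
  have i: "i \<in> E - J" "?x \<bullet> wall v (I - {i}) i = 0" using I(2) by (simp_all add: zeros_def)
  have both_out: "i \<notin> I \<and> l \<notin> I" if l: "l \<in> zeros ?x I" "l \<noteq> i" for l
  proof -
    have l': "l \<in> E - J" "?x \<bullet> wall v (I - {l}) l = 0" using l(1) by (simp_all add: zeros_def)
    note nz = cell_wall_nonzero[OF I(1) i(1)] cell_wall_nonzero[OF I(1) l'(1)]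
    have "\<not> nonparallel (wall v (I - {i}) i) (wall v (I - {l}) l)"
      using genericD[OF g wall_in_walls[OF I(1) i(1)] wall_in_walls[OF I(1) l'(1)] _ i(2) l'(2)] by blast
    then show ?thesis
      using nonparallel_walls_inside[of i I l v] nonparallel_walls_inside[of l I i v] l(2) nz nonparallel_sym by metis
  qed
  have main: "i \<notin> I \<and> Suc (card I) = DIM('a)"
  proof (cases "zeros ?x I = {i}")
    case True
    then have "\<not> (i \<in> I \<or> card I + 2 \<le> DIM('a))" using I(1,3) unfolding paired_def by blast
    then show ?thesis using D by linarith
  next
    case False
    then obtain l where l: "l \<in> zeros ?x I" "l \<noteq> i" using I(2) by blast
    have l': "l \<in> E - J" "?x \<bullet> wall v (I - {l}) l = 0" using l(1) by (simp_all add: zeros_def)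
    have out: "i \<notin> I" "l \<notin> I" using both_out[OF l] by simp_all
    have "\<not> card I + 2 \<le> DIM('a)"
    proof
      assume c2: "card I + 2 \<le> DIM('a)"
      have "indep v (insert l (insert i I))"
      proof (rule gp)
        show "insert l (insert i I) \<subseteq> E" using D i(1) l'(1) by simp
        show "card (insert l (insert i I)) \<le> DIM('a)" using D out l(2) c2 by simp
      qed
      then have "nonparallel (wall v I i) (wall v I l)"
        using D out l(2) by (intro nonparallel_walls_outside) auto
      moreover have "I - {i} = I" "I - {l} = I" using out by simp_all
      ultimately show False
        using genericD[OF g wall_in_walls[OF I(1) i(1)] wall_in_walls[OF I(1) l'(1)] _ i(2) l'(2)] by simp
    qed
    then show ?thesis using D out by linarith
  qed
  then show "Suc (card I) = DIM('a)" "i \<notin> I" by simp_all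
  have "I - {i} = I" using main by simp
  moreover have "indep v (insert i I)" by (rule indep_insert) (use I(1) i(1) in auto)
  ultimately show "?x \<in> span (v ` I)"
    using wall_hyperplane[of I i v ?x] D main i(2) by simp
qed

lemma facet_unique:
  assumes g: "generic a z" and I: "I \<in> cells" "Suc (card I) = DIM('a)" "z + t0 *\<^sub>R a \<in> span (v ` I)"
    and I': "I' \<in> cells" "Suc (card I') = DIM('a)" "z + t0 *\<^sub>R a \<in> span (v ` I')"
  shows "I = I'"
proof (rule ccontr)
  assume neq: "I \<noteq> I'"
  note D = cellsD[OF I(1)] and D' = cellsD[OF I'(1)]
  have "\<not> I' \<subseteq> I" using neq I(2) I'(2) card_subset_eq[of I I'] D by auto
  then obtain m where m: "m \<in> I'" "m \<notin> I" by auto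
  obtain i where i: "i \<in> E - I" using ex_generator[OF I(1)] by auto
  obtain i' where i': "i' \<in> E - I'" using ex_generator[OF I'(1)] by auto
  have ii: "I - {i} = I" "I' - {i'} = I'" "i \<in> E - J" "i' \<in> E - J" using i i' D D' by auto
  have q: "wall v I i \<in> walls" "wall v I' i' \<in> walls"
    using wall_in_walls[OF I(1) ii(3)] wall_in_walls[OF I'(1) ii(4)] ii by simp_all
  have "v m \<bullet> wall v I i \<noteq> 0"
  proof
    assume "v m \<bullet> wall v I i = 0"
    moreover have "indep v (insert i I)" by (rule indep_insert) (use I(1) i in auto)
    ultimately have "v m \<in> span (v ` I)" using wall_hyperplane[of I i v "v m"] D I(2) i by simp
    moreover have "indep v (insert m I)" by (rule indep_insert) (use I(1) m D' in auto)
    moreover have "insert m I - {m} = I" using m(2) by simp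
    ultimately show False unfolding indep_def by (metis insertI1)
  qed
  then have np: "nonparallel (wall v I i) (wall v I' i')"
    unfolding nonparallel_def
  proof (intro allI impI)
    fix r s assume nz: "v m \<bullet> wall v I i \<noteq> 0" and eq: "r *\<^sub>R wall v I i + s *\<^sub>R wall v I' i' = 0"
    have "r * (v m \<bullet> wall v I i) = 0"
      using arg_cong[OF eq, of "\<lambda>x. v m \<bullet> x"] wall_orth[OF m(1), of v i'] by (simp add: inner_add_right)
    then show "r = 0 \<and> s = 0" using nz eq walls_nonzero[OF q(2)] by simp
  qed
  show False
    by (rule genericD[OF g q np wall_orth_span[OF I(3)] wall_orth_span[OF I'(3)]])
qed

text \<open>A lower-dimensional span lies in two walls that are not parallel, which a generic line never meets
  simultaneously.\<close>
lemma boundary_card: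
  assumes g: "generic a z" and S: "S \<in> cells" "z + t0 *\<^sub>R a \<in> span (v ` S)"
  shows "Suc (card S) = DIM('a)"
proof (rule ccontr)
  note D = cellsD[OF S(1)]
  assume "Suc (card S) \<noteq> DIM('a)"
  then have c2: "card S + 2 \<le> DIM('a)" using D by linarith
  have "card (E - S) = card E - card S" using D finE by (intro card_Diff_subset) auto
  then have "2 \<le> card (E - S)" using c2 cE by linarith
  then obtain T where T: "T \<subseteq> E - S" "card T = 2" by (metis obtain_subset_with_card_n)
  then obtain i l where il: "i \<noteq> l" "i \<in> E - S" "l \<in> E - S" by (auto simp: card_2_iff)
  have ii: "S - {i} = S" "S - {l} = S" "i \<in> E - J" "l \<in> E - J" using il D by auto
  have "indep v (insert l (insert i S))"
  proof (rule gp)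
    show "insert l (insert i S) \<subseteq> E" using D il by simp
    show "card (insert l (insert i S)) \<le> DIM('a)" using D il c2 by simp
  qed
  then have np: "nonparallel (wall v S i) (wall v S l)"
    using D il by (intro nonparallel_walls_outside) auto
  have q: "wall v S i \<in> walls" "wall v S l \<in> walls"
    using wall_in_walls[OF S(1) ii(3)] wall_in_walls[OF S(1) ii(4)] ii by simp_all
  show False
    by (rule genericD[OF g q np wall_orth_span[OF S(2)] wall_orth_span[OF S(2)]])
qed

text \<open>The quantity whose vanishing is the Gauss--Bonnet relation before integration.\<close>
definition euler :: "'a \<Rightarrow> real" where
  "euler x = (-1) ^ DIM('a) * of_bool (x \<in> K) + (\<Sum>I\<in>cells. (-1) ^ card I * of_bool (active I x))"

lemma tendsto_ray: "((\<lambda>t. z + t *\<^sub>R a) \<longlongrightarrow> z + t0 *\<^sub>R a) (at t0)" for a z :: 'a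
  by (intro tendsto_intros)

lemma closed_K: "closed K"
  unfolding K_def by (rule closed_fcone[OF finE JE])

lemma eventually_K_regular:
  assumes "z + t0 *\<^sub>R a \<in> K \<Longrightarrow> z + t0 *\<^sub>R a \<in> interior K"
  shows "\<forall>\<^sub>F t in at t0. (z + t *\<^sub>R a \<in> K) = (z + t0 *\<^sub>R a \<in> K)"
proof (cases "z + t0 *\<^sub>R a \<in> K")
  case True
  have "\<forall>\<^sub>F t in at t0. z + t *\<^sub>R a \<in> interior K"
    by (rule topological_tendstoD[OF tendsto_ray]) (use assms True in auto)
  then show ?thesis by eventually_elim (use True interior_subset in auto)
next
  case False
  have "\<forall>\<^sub>F t in at t0. z + t *\<^sub>R a \<in> - K"
    by (rule topological_tendstoD[OF tendsto_ray]) (use closed_K False in auto)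
  then show ?thesis by eventually_elim (use False in auto)
qed

lemma eventually_neq: "\<forall>\<^sub>F t in at t0. t \<noteq> (t0::real)"
  by (simp add: eventually_at_filter)

text \<open>Crossing the hyperplane spanned by \<open>d - 1\<close> generators: either the point lies in a facet
  of the cone, and then near this point both the cell of the facet and the cone itself coincide with the
  same side of the hyperplane, or neither indicator jumps.\<close>
lemma eventually_const_facet:
  assumes g: "generic a z" and I: "I \<in> cells" "Suc (card I) = DIM('a)" "z + t0 *\<^sub>R a \<in> span (v ` I)"
  shows "\<exists>c. \<forall>\<^sub>F t in at t0.
    (-1) ^ DIM('a) * of_bool (z + t *\<^sub>R a \<in> K) + (-1) ^ card I * of_bool (active I (z + t *\<^sub>R a)) = (c :: real)"
proof -
  let ?x = "z + t0 *\<^sub>R a"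
  note D = cellsD[OF I(1)]
  obtain i1 where i1: "i1 \<in> E - I" using ex_generator[OF I(1)] by auto
  have i1': "i1 \<in> E - J" "I - {i1} = I" "i1 \<notin> I" "i1 \<in> E" using i1 D by auto
  define u where "u = wall v I i1"
  have uw: "u \<in> walls" using wall_in_walls[OF I(1) i1'(1)] i1'(2) by (simp add: u_def)
  have u0: "u \<noteq> 0" by (rule walls_nonzero[OF uw])
  then have uu: "u \<bullet> u > 0" by simp
  have ind1: "indep v (insert i1 I)" by (rule indep_insert[OF I(1) i1'(4)])
  have hyp: "y \<bullet> u = 0 \<longleftrightarrow> y \<in> span (v ` I)" for y
    unfolding u_def using D i1'(3) ind1 I(2) by (intro wall_hyperplane) auto
  have xu: "?x \<bullet> u = 0" using hyp I(3) by simp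
  have zu: "z \<bullet> u \<noteq> 0" using g uw unfolding generic_def by simp
  have au: "a \<bullet> u \<noteq> 0" using xu zu by (auto simp: inner_add_left)
  have ray: "(z + t *\<^sub>R a) \<bullet> u = (t - t0) * (a \<bullet> u)" for t
  proof -
    have "z \<bullet> u = - (t0 * (a \<bullet> u))" using xu by (simp add: inner_add_left)
    then show ?thesis by (simp add: inner_add_left left_diff_distrib)
  qed
  have multiple: "p = ((p \<bullet> u) / (u \<bullet> u)) *\<^sub>R u" if p: "\<And>y. y \<in> span (v ` I) \<Longrightarrow> y \<bullet> p = 0" for p
  proof -
    define y where "y = p - ((p \<bullet> u) / (u \<bullet> u)) *\<^sub>R u"
    have "y \<bullet> u = 0" using uu by (simp add: y_def inner_diff_left)
    then have ys: "y \<in> span (v ` I)" using hyp by simp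
    then have "y \<bullet> y = 0" using p[OF ys] \<open>y \<bullet> u = 0\<close> unfolding y_def[of] by (simp add: inner_diff_right)
    then show ?thesis by (simp add: y_def)
  qed
  have wall_u: "wall v I i = ((v i \<bullet> u) / (u \<bullet> u)) *\<^sub>R u" for i
  proof -
    have eq: "wall v I i = ((wall v I i \<bullet> u) / (u \<bullet> u)) *\<^sub>R u"
      by (rule multiple) (rule wall_orth_span)
    have "closest_point (span (v ` I)) (v i) \<bullet> u = 0"
      using hyp closest_point_in_subspace[OF subspace_span] by metis
    then have "wall v I i \<bullet> u = v i \<bullet> u" by (simp add: wall_def inner_diff_left)
    then show ?thesis using eq by simp
  qed
  have ray_wall: "(z + t *\<^sub>R a) \<bullet> wall v I i = ((v i \<bullet> u) / (u \<bullet> u)) * ((z + t *\<^sub>R a) \<bullet> u)" for i t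
    by (subst wall_u) simp
  have vu: "v i \<bullet> u \<noteq> 0" if "i \<in> E - I" for i
  proof -
    have "i \<in> E - J" "I - {i} = I" using that D by auto
    then have "wall v I i \<noteq> 0" using cell_wall_nonzero[OF I(1), of i] by simp
    then show ?thesis using wall_u[of i] by auto
  qed
  have i1z: "i1 \<in> zeros ?x I"
    using xu i1' unfolding zeros_def u_def by simp
  have inside_nz: "?x \<bullet> wall v (I - {i}) i \<noteq> 0" if i: "i \<in> I - J" for i
  proof
    assume z0: "?x \<bullet> wall v (I - {i}) i = 0"
    have iE: "i \<in> E - J" "i \<in> I" "i \<noteq> i1" using i D i1' by auto
    have np: "nonparallel (wall v (I - {i}) i) (wall v (I - {i1}) i1)"
      by (rule nonparallel_walls_inside[OF iE(2,3) cell_wall_nonzero[OF I(1) iE(1)] cell_wall_nonzero[OF I(1) i1'(1)]])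
    show False
      by (rule genericD[OF g wall_in_walls[OF I(1) iE(1)] wall_in_walls[OF I(1) i1'(1)] np z0])
         (use xu i1'(2) in \<open>simp add: u_def\<close>)
  qed
  have boundary: "\<exists>w. ?x \<in> fcone v I J \<and> w \<noteq> 0 \<and> (\<forall>i\<in>I. w \<bullet> v i = 0) \<and> (\<forall>i\<in>E - I. w \<bullet> v i < 0)"
    if xb: "?x \<in> K" "?x \<notin> interior K"
  proof -
    obtain S w where S: "S \<in> cells" "?x \<in> fcone v S J" "w \<noteq> 0" "\<forall>i\<in>S. w \<bullet> v i = 0" "\<forall>i\<in>E - S. w \<bullet> v i < 0"
      using K_boundary[OF xb] by (elim exE conjE) (rule that)
    have xS: "?x \<in> span (v ` S)" using fcone_in_span S(2) cellsD[OF S(1)] by metis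
    have "S = I"
      by (rule facet_unique[OF g S(1) boundary_card[OF g S(1) xS] xS I])
    then show ?thesis using S by blast
  qed
  have ev_in: "\<forall>\<^sub>F t in at t0. \<forall>i\<in>I - J. sgn ((z + t *\<^sub>R a) \<bullet> wall v (I - {i}) i) = sgn (?x \<bullet> wall v (I - {i}) i)"
  proof (rule eventually_ball_finite)
    show "finite (I - J)" using D by simp
    show "\<forall>i\<in>I - J. \<forall>\<^sub>F t in at t0. sgn ((z + t *\<^sub>R a) \<bullet> wall v (I - {i}) i) = sgn (?x \<bullet> wall v (I - {i}) i)"
      using eventually_sign inside_nz by simp
  qed
  have const: "\<exists>c. \<forall>\<^sub>F t in at t0. (-1) ^ DIM('a) * of_bool (z + t *\<^sub>R a \<in> K)
      + (-1) ^ card I * of_bool (active I (z + t *\<^sub>R a)) = (c :: real)"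
    if inactive: "\<forall>\<^sub>F t in at t0. \<not> active I (z + t *\<^sub>R a)" and int: "?x \<in> K \<Longrightarrow> ?x \<in> interior K"
  proof -
    have regular: "\<forall>\<^sub>F t in at t0. (z + t *\<^sub>R a \<in> K) = (?x \<in> K)"
      by (rule eventually_K_regular) (rule int)
    have "\<forall>\<^sub>F t in at t0. (-1) ^ DIM('a) * of_bool (z + t *\<^sub>R a \<in> K)
        + (-1) ^ card I * of_bool (active I (z + t *\<^sub>R a)) = ((-1) ^ DIM('a) * of_bool (?x \<in> K) :: real)"
      using inactive regular by eventually_elim simp
    then show ?thesis by (rule exI)
  qed
  have xfc: "?x \<in> fcone v I J \<longleftrightarrow> (\<forall>i\<in>I - J. 0 \<le> ?x \<bullet> wall v (I - {i}) i)"
    by (rule span_fcone_iff[OF I(1,3)])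
  show ?thesis
  proof (cases "\<forall>i\<in>I - J. 0 \<le> ?x \<bullet> wall v (I - {i}) i")
    case False
    then obtain i where i: "i \<in> I - J" "?x \<bullet> wall v (I - {i}) i < 0" by auto
    show ?thesis
    proof (rule const)
      show "\<forall>\<^sub>F t in at t0. \<not> active I (z + t *\<^sub>R a)"
        using ev_in
      proof eventually_elim
        case (elim t)
        then have "sgn ((z + t *\<^sub>R a) \<bullet> wall v (I - {i}) i) = -1" using i by simp
        then have "\<not> 0 \<le> (z + t *\<^sub>R a) \<bullet> wall v (I - {i}) i" by (simp add: sgn_1_neg)
        moreover have "i \<in> E - J" using i(1) D by auto
        ultimately show ?case unfolding active_def by blast
      qed
      show "?x \<in> interior K" if "?x \<in> K"
        using boundary[OF that] xfc False by blast
    qed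
  next
    case True
    have ev_pos: "\<forall>\<^sub>F t in at t0. \<forall>i\<in>I - J. 0 < (z + t *\<^sub>R a) \<bullet> wall v (I - {i}) i"
      using ev_in
    proof eventually_elim
      case (elim t)
      show ?case
      proof
        fix i assume i: "i \<in> I - J"
        have "sgn (?x \<bullet> wall v (I - {i}) i) = 1" using True i inside_nz[OF i] by (simp add: less_le)
        with bspec[OF elim i] have "sgn ((z + t *\<^sub>R a) \<bullet> wall v (I - {i}) i) = 1" by (rule trans)
        then show "0 < (z + t *\<^sub>R a) \<bullet> wall v (I - {i}) i" by (rule sgn_1_pos[THEN iffD1])
      qed
    qed
    show ?thesis
    proof (cases "\<exists>i\<in>E - I. \<exists>l\<in>E - I. v i \<bullet> u > 0 \<and> v l \<bullet> u < 0")
      case mixed: True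
      then obtain i l where il: "i \<in> E - I" "l \<in> E - I" "v i \<bullet> u > 0" "v l \<bullet> u < 0" by auto
      show ?thesis
      proof (rule const)
        show "\<forall>\<^sub>F t in at t0. \<not> active I (z + t *\<^sub>R a)"
          using eventually_neq
        proof eventually_elim
          case (elim t)
          have ii: "i \<in> E - J" "l \<in> E - J" "I - {i} = I" "I - {l} = I" using il D by auto
          show ?case
          proof
            assume act: "active I (z + t *\<^sub>R a)"
            have "0 \<le> (z + t *\<^sub>R a) \<bullet> wall v I i" "0 \<le> (z + t *\<^sub>R a) \<bullet> wall v I l"
              using bspec[OF act[unfolded active_def] ii(1)] bspec[OF act[unfolded active_def] ii(2)]
              unfolding ii(3,4) by this+
            then have "0 \<le> (z + t *\<^sub>R a) \<bullet> u" "(z + t *\<^sub>R a) \<bullet> u \<le> 0"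
              unfolding ray_wall using il(3,4) uu by (simp_all add: zero_le_mult_iff zero_le_divide_iff)
            then show False using ray[of t] elim au by simp
          qed
        qed
        show "?x \<in> interior K" if xK: "?x \<in> K"
        proof (rule ccontr)
          assume "?x \<notin> interior K"
          then obtain w where w: "w \<noteq> 0" "\<forall>i\<in>I. w \<bullet> v i = 0" "\<forall>i\<in>E - I. w \<bullet> v i < 0"
            using boundary[OF xK] by blast
          have "w = ((w \<bullet> u) / (u \<bullet> u)) *\<^sub>R u"
          proof (rule multiple)
            fix y assume "y \<in> span (v ` I)"
            then have "orthogonal w y" by (rule orthogonal_to_span) (use w(2) in \<open>auto simp: orthogonal_def\<close>)
            then show "y \<bullet> w = 0" by (simp add: orthogonal_def inner_commute)
          qed
          then obtain r where r: "w = r *\<^sub>R u" by blast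
          have "r * (v i \<bullet> u) < 0" "r * (v l \<bullet> u) < 0"
            using bspec[OF w(3) il(1)] bspec[OF w(3) il(2)] by (simp_all add: r inner_commute)
          then show False using il(3,4) by (auto simp: mult_less_0_iff)
        qed
      qed
    next
      case False
      define \<sigma> :: real where "\<sigma> = sgn (v i1 \<bullet> u)"
      have \<sigma>: "\<sigma> * \<sigma> = 1" using vu[OF i1] by (auto simp: \<sigma>_def sgn_if)
      have pos: "0 < \<sigma> * (v i \<bullet> u)" if i: "i \<in> E - I" for i
      proof -
        have "\<not> (v i \<bullet> u > 0 \<and> v i1 \<bullet> u < 0)" "\<not> (v i1 \<bullet> u > 0 \<and> v i \<bullet> u < 0)" using False i i1 by blast+
        then show ?thesis using vu[OF i] vu[OF i1] unfolding \<sigma>_def by (auto simp: sgn_if)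
      qed
      define s where "s t = \<sigma> * ((z + t *\<^sub>R a) \<bullet> u) / (\<sigma> * (v i1 \<bullet> u))" for t
      define lv where "lv t = z + t *\<^sub>R a - s t *\<^sub>R v i1" for t
      have s_tend: "(s \<longlongrightarrow> s t0) (at t0)"
        unfolding s_def by (intro tendsto_intros) (use pos[OF i1] in auto)
      have "s t0 = 0" using xu by (simp add: s_def)
      then have lv_tend: "(lv \<longlongrightarrow> ?x) (at t0)"
        using tendsto_diff[OF tendsto_ray tendsto_scaleR[OF s_tend tendsto_const], of z a "v i1"]
        unfolding lv_def by simp
      have ev_l: "\<forall>\<^sub>F t in at t0. \<forall>i\<in>I - J. 0 < lv t \<bullet> wall v (I - {i}) i"
      proof (rule eventually_ball_finite)
        show "finite (I - J)" using D by simp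
        show "\<forall>i\<in>I - J. \<forall>\<^sub>F t in at t0. 0 < lv t \<bullet> wall v (I - {i}) i"
        proof
          fix i assume i: "i \<in> I - J"
          have "0 < ?x \<bullet> wall v (I - {i}) i" using True i inside_nz[OF i] by (simp add: less_le)
          moreover have "((\<lambda>t. lv t \<bullet> wall v (I - {i}) i) \<longlongrightarrow> ?x \<bullet> wall v (I - {i}) i) (at t0)"
            by (intro tendsto_inner lv_tend tendsto_const)
          ultimately show "\<forall>\<^sub>F t in at t0. 0 < lv t \<bullet> wall v (I - {i}) i" by (metis order_tendstoD(1))
        qed
      qed
      have lv_span: "lv t \<in> span (v ` I)" for t
      proof -
        have "\<sigma> \<noteq> 0" "v i1 \<bullet> u \<noteq> 0" using pos[OF i1] by auto
        then have "lv t \<bullet> u = 0"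
          unfolding lv_def s_def by (simp add: inner_diff_left)
        then show ?thesis using hyp by simp
      qed
      have "\<forall>\<^sub>F t in at t0. (z + t *\<^sub>R a \<in> K) = active I (z + t *\<^sub>R a)"
        using ev_l ev_pos
      proof eventually_elim
        case (elim t)
        let ?y = "z + t *\<^sub>R a"
        have act: "active I ?y \<longleftrightarrow> 0 \<le> \<sigma> * (?y \<bullet> u)"
        proof
          assume act': "active I ?y"
          have "0 \<le> (v i1 \<bullet> u) / (u \<bullet> u) * (?y \<bullet> u)"
            using bspec[OF act'[unfolded active_def] i1'(1)] unfolding i1'(2) ray_wall .
          then have "0 \<le> (v i1 \<bullet> u) * (?y \<bullet> u)"
            using uu by (simp add: zero_le_divide_iff)
          then have "0 \<le> (\<sigma> * \<sigma>) * ((v i1 \<bullet> u) * (?y \<bullet> u))" by (simp add: \<sigma>)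
          then have "0 \<le> (\<sigma> * (v i1 \<bullet> u)) * (\<sigma> * (?y \<bullet> u))" by (simp only: mult_ac)
          then show "0 \<le> \<sigma> * (?y \<bullet> u)" using pos[OF i1] by (simp add: zero_le_mult_iff)
        next
          assume nn: "0 \<le> \<sigma> * (?y \<bullet> u)"
          show "active I ?y"
            unfolding active_def
          proof
            fix i assume i: "i \<in> E - J"
            show "0 \<le> ?y \<bullet> wall v (I - {i}) i"
            proof (cases "i \<in> I")
              case True
              then show ?thesis using bspec[OF elim(2), of i] i by simp
            next
              case False
              then have ii: "I - {i} = I" "i \<in> E - I" using i by auto
              have "?y \<bullet> wall v I i = (\<sigma> * \<sigma>) * (((v i \<bullet> u) / (u \<bullet> u)) * (?y \<bullet> u))"
                by (simp only: ray_wall \<sigma> mult_1_left)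
              also have "\<dots> = (\<sigma> * (v i \<bullet> u)) * (\<sigma> * (?y \<bullet> u)) / (u \<bullet> u)" by simp
              also have "\<dots> \<ge> 0" by (rule divide_nonneg_pos[OF mult_nonneg_nonneg[OF less_imp_le[OF pos[OF ii(2)]] nn] uu])
              finally show ?thesis unfolding ii(1) .
            qed
          qed
        qed
        have inK: "?y \<in> K \<longleftrightarrow> 0 \<le> \<sigma> * (?y \<bullet> u)"
        proof
          assume yK: "?y \<in> K"
          have h0: "\<forall>i\<in>I. (- (\<sigma> *\<^sub>R u)) \<bullet> v i = 0"
          proof
            fix i assume "i \<in> I"
            then have "v i \<bullet> u = 0" using hyp span_base[of "v i" "v ` I"] by simp
            then show "(- (\<sigma> *\<^sub>R u)) \<bullet> v i = 0" by (simp add: inner_commute)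
          qed
          have h1: "\<forall>i\<in>E - I. (- (\<sigma> *\<^sub>R u)) \<bullet> v i < 0"
            using pos by (simp add: inner_commute)
          have "J \<subseteq> I" "I \<subseteq> E" using D by simp_all
          from fcone_Int_hyperplane(2)[OF finE this h0 h1 yK[unfolded K_def]]
          show "0 \<le> \<sigma> * (?y \<bullet> u)" by (simp add: inner_commute)
        next
          assume nn: "0 \<le> \<sigma> * (?y \<bullet> u)"
          have "lv t \<in> fcone v I J"
            unfolding span_fcone_iff[OF I(1) lv_span] using elim(1) by (simp add: less_imp_le)
          then have "lv t \<in> K"
            using fcone_mono[OF finE, of I v J] D unfolding K_def by blast
          moreover have "0 \<le> s t" unfolding s_def by (rule divide_nonneg_pos[OF nn pos[OF i1]])
          ultimately have "lv t + s t *\<^sub>R v i1 \<in> K"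
            unfolding K_def by (intro fcone_add fcone_scale gen_in_fcone[OF finE i1'(4)])
          then show "?y \<in> K" by (simp add: lv_def)
        qed
        show ?case using act inK by simp
      qed
      then have "\<forall>\<^sub>F t in at t0. (-1) ^ DIM('a) * of_bool (z + t *\<^sub>R a \<in> K)
        + (-1) ^ card I * of_bool (active I (z + t *\<^sub>R a)) = (0 :: real)"
        by eventually_elim (simp flip: I(2))
      then show ?thesis by (rule exI)
    qed
  qed
qed

text \<open>At every time of the ray the paired cells cancel; of the other index sets at most one has a wall at the
  point, and it is treated together with the cone.\<close>
lemma eventually_const_euler:
  assumes g: "generic a z"
  shows "\<exists>c. \<forall>\<^sub>F t in at t0. euler (z + t *\<^sub>R a) = c"
proof -
  let ?x = "z + t0 *\<^sub>R a"
  let ?f = "\<lambda>t I. (-1) ^ card I * of_bool (active I (z + t *\<^sub>R a)) :: real"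
  define reg where "reg = {I \<in> cells. zeros ?x I = {}}"
  define C where "C = cells - reg - paired ?x"
  have fin: "finite reg" "finite C" "finite (paired ?x)"
    using finite_cells by (simp_all add: reg_def C_def paired_def)
  have "reg \<inter> paired ?x = {}" by (auto simp: reg_def paired_def)
  then have cells: "cells = (reg \<union> paired ?x) \<union> C" "(reg \<union> paired ?x) \<inter> C = {}" "reg \<inter> paired ?x = {}"
    by (auto simp: C_def reg_def paired_def)
  have split: "euler (z + t *\<^sub>R a) = sum (?f t) reg + sum (?f t) (paired ?x) +
      ((-1) ^ DIM('a) * of_bool (z + t *\<^sub>R a \<in> K) + sum (?f t) C)" for t
  proof -
    have "sum (?f t) cells = sum (?f t) reg + sum (?f t) (paired ?x) + sum (?f t) C"
      unfolding arg_cong[OF cells(1), of "sum (?f t)"] sum.union_disjoint[OF finite_UnI[OF fin(1,3)] fin(2) cells(2)]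
        sum.union_disjoint[OF fin(1,3) cells(3)] ..
    then show ?thesis unfolding euler_def by linarith
  qed
  have facet: "Suc (card I) = DIM('a) \<and> ?x \<in> span (v ` I)" if "I \<in> C" for I
  proof -
    have I: "I \<in> cells" "zeros ?x I \<noteq> {}" "I \<notin> paired ?x" using that by (auto simp: C_def reg_def)
    then obtain i where "i \<in> zeros ?x I" by auto
    then show ?thesis using not_paired[OF g I(1) _ I(3)] by metis
  qed
  have evC: "\<exists>c. \<forall>\<^sub>F t in at t0. (-1) ^ DIM('a) * of_bool (z + t *\<^sub>R a \<in> K) + sum (?f t) C = c"
  proof (cases "C = {}")
    case True
    have "?x \<in> interior K" if xK: "?x \<in> K"
    proof (rule ccontr)
      assume ni: "?x \<notin> interior K"
      obtain S where S: "S \<in> cells" "?x \<in> fcone v S J" using K_boundary[OF xK ni] by metis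
      have xS: "?x \<in> span (v ` S)" using fcone_in_span S(2) cellsD[OF S(1)] by metis
      have card: "Suc (card S) = DIM('a)" by (rule boundary_card[OF g S(1) xS])
      obtain i where i: "i \<in> E - S" using ex_generator[OF S(1)] by auto
      have "i \<in> zeros ?x S"
        using i cellsD[OF S(1)] wall_orth_span[OF xS, of i] unfolding zeros_def by auto
      moreover have "S \<notin> paired ?x"
        using calculation i card unfolding paired_def by auto
      ultimately have "S \<in> C" using S(1) by (auto simp: C_def reg_def)
      then show False using True by simp
    qed
    then have "\<forall>\<^sub>F t in at t0. (z + t *\<^sub>R a \<in> K) = (?x \<in> K)"
      by (rule eventually_K_regular)
    then have "\<forall>\<^sub>F t in at t0. (-1) ^ DIM('a) * of_bool (z + t *\<^sub>R a \<in> K) + sum (?f t) C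
        = (-1) ^ DIM('a) * of_bool (?x \<in> K)"
      unfolding True by eventually_elim simp
    then show ?thesis by (rule exI)
  next
    case False
    then obtain I where I: "I \<in> C" by auto
    have Ic: "I' \<in> cells" if "I' \<in> C" for I' using that by (simp add: C_def)
    have uniq: "I' = I" if "I' \<in> C" for I'
      by (rule facet_unique[OF g Ic[OF that] conjunct1[OF facet[OF that]] conjunct2[OF facet[OF that]]
          Ic[OF I] conjunct1[OF facet[OF I]] conjunct2[OF facet[OF I]]])
    have "C = {I}"
    proof (intro equalityI subsetI)
      fix I' assume "I' \<in> C"
      from uniq[OF this] show "I' \<in> {I}" by simp
    qed (simp add: I)
    then have "sum (?f t) C = ?f t I" for t by (simp only: sum.insert finite.emptyI empty_iff sum.empty add_0_right not_False_eq_True)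
    then show ?thesis
      using eventually_const_facet[OF g Ic[OF I] conjunct1[OF facet[OF I]] conjunct2[OF facet[OF I]]]
      by (simp only:)
  qed
  obtain c where c: "\<forall>\<^sub>F t in at t0. (-1) ^ DIM('a) * of_bool (z + t *\<^sub>R a \<in> K) + sum (?f t) C = c"
    using evC by (elim exE) (rule that)
  have reg: "\<forall>\<^sub>F t in at t0. \<forall>I\<in>reg. active I (z + t *\<^sub>R a) = active I ?x"
    by (rule eventually_ball_finite[OF fin(1)]) (use eventually_active_regular in \<open>simp add: reg_def\<close>)
  have "\<forall>\<^sub>F t in at t0. euler (z + t *\<^sub>R a) = sum (?f t0) reg + 0 + c"
    using reg c eventually_sum_paired[where z = z and ?t0.0 = t0 and a = a]
  proof eventually_elim
    case (elim t)
    have "sum (?f t) reg = sum (?f t0) reg" by (rule sum.cong[OF refl]) (use elim(1) in simp)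
    then show ?case unfolding split using elim(2,3) by simp
  qed
  then show ?thesis by blast
qed

text \<open>Far away in the direction opposite to a generator, the inequality belonging to this generator
  is violated for every cell, and so is the supporting inequality of the cone that exposes \<open>J\<close>.\<close>
lemma eventually_euler_at_bot:
  assumes a: "a0 \<in> E - J"
  shows "\<forall>\<^sub>F t in at_bot. euler (z + t *\<^sub>R v a0) = 0"
proof -
  have "\<forall>\<^sub>F t in at_bot. \<forall>I\<in>cells. \<not> active I (z + t *\<^sub>R v a0)"
  proof (rule eventually_ball_finite[OF finite_cells], rule ballI)
    fix I assume I: "I \<in> cells"
    let ?q = "wall v (I - {a0}) a0"
    have "0 < v a0 \<bullet> ?q" using cell_wall_nonzero[OF I a] by (simp add: wall_self)
    then have "\<forall>\<^sub>F t in at_bot. z \<bullet> ?q + t * (v a0 \<bullet> ?q) < 0" by (rule eventually_at_bot_affine_neg)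
    then show "\<forall>\<^sub>F t in at_bot. \<not> active I (z + t *\<^sub>R v a0)"
    proof eventually_elim
      case (elim t)
      then have "\<not> 0 \<le> (z + t *\<^sub>R v a0) \<bullet> ?q" by (simp add: inner_add_left)
      then show ?case using a unfolding active_def by blast
    qed
  qed
  moreover have "\<forall>\<^sub>F t in at_bot. z + t *\<^sub>R v a0 \<notin> K"
  proof -
    obtain w where w: "\<forall>i\<in>J. w \<bullet> v i = 0" "\<forall>i\<in>E - J. w \<bullet> v i < 0"
      using exJ unfolding exposed_def by auto
    have "0 < - (w \<bullet> v a0)" using w(2) a by simp
    then have "\<forall>\<^sub>F t in at_bot. - (w \<bullet> z) + t * - (w \<bullet> v a0) < 0" by (rule eventually_at_bot_affine_neg)
    then show ?thesis
    proof eventually_elim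
      case (elim t)
      then have "\<not> w \<bullet> (z + t *\<^sub>R v a0) \<le> 0" by (simp add: inner_add_right)
      then show ?case using fcone_Int_hyperplane(2)[OF finE subset_refl JE w] unfolding K_def by metis
    qed
  qed
  ultimately show ?thesis
    by eventually_elim (simp add: euler_def)
qed

lemma euler_eq_0:
  assumes a: "a0 \<in> E - J" and g: "generic (v a0) z"
  shows "euler z = 0"
proof (rule eventually_const_imp_zero[where H = "\<lambda>t. euler (z + t *\<^sub>R v a0)" and ?t1.0 = 0])
  show "\<exists>c. \<forall>\<^sub>F t in at t0. euler (z + t *\<^sub>R v a0) = c" for t0
    by (rule eventually_const_euler[OF g])
  show "\<forall>\<^sub>F t in at_bot. euler (z + t *\<^sub>R v a0) = 0"
    by (rule eventually_euler_at_bot[OF a])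
  have nz: "z \<bullet> q \<noteq> 0" if "q \<in> walls" for q using g that unfolding generic_def by simp
  have zeros: "zeros z I = {}" if "I \<in> cells" for I
    using nz wall_in_walls[OF that] unfolding zeros_def by auto
  have "z \<in> interior K" if zK: "z \<in> K"
  proof (rule ccontr)
    assume ni: "z \<notin> interior K"
    obtain S where S: "S \<in> cells" "z \<in> fcone v S J" using K_boundary[OF zK ni] by metis
    have zS: "z \<in> span (v ` S)" using fcone_in_span S(2) cellsD[OF S(1)] by metis
    obtain i where i: "i \<in> E - S" using ex_generator[OF S(1)] by auto
    have "i \<in> zeros z S"
      using i cellsD[OF S(1)] wall_orth_span[OF zS, of i] unfolding zeros_def by auto
    then show False using zeros[OF S(1)] by simp
  qed
  then have evK: "\<forall>\<^sub>F t in at 0. (z + t *\<^sub>R v a0 \<in> K) = (z \<in> K)"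
    using eventually_K_regular[of z 0 "v a0"] by simp
  have "\<forall>\<^sub>F t in at 0. \<forall>I\<in>cells. active I (z + t *\<^sub>R v a0) = active I z"
    by (rule eventually_ball_finite[OF finite_cells])
       (use eventually_active_regular[of _ z 0 "v a0"] zeros in simp)
  with evK show "\<forall>\<^sub>F t in at 0. euler (z + t *\<^sub>R v a0) = euler z"
  proof eventually_elim
    case (elim t)
    have "(\<Sum>I\<in>cells. (-1) ^ card I * of_bool (active I (z + t *\<^sub>R v a0)))
        = (\<Sum>I\<in>cells. (-1) ^ card I * of_bool (active I z) :: real)"
      by (rule sum.cong[OF refl]) (use elim(2) in simp)
    then show ?case unfolding euler_def using elim(1) by simp
  qed
qed

lemma AE_generic: "AE z in std_gaussian. generic a z"
proof -
  \<comment> \<open>If the line meets two walls at the same time, elimination of the time shows that \<open>z\<close> is orthogonal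
    to the vectors added here.\<close>
  define W where "W = walls \<union> {(a \<bullet> q2) *\<^sub>R q1 - (a \<bullet> q1) *\<^sub>R q2 | q1 q2. q1 \<in> walls \<and> q2 \<in> walls}"
  have "{(a \<bullet> q2) *\<^sub>R q1 - (a \<bullet> q1) *\<^sub>R q2 | q1 q2. q1 \<in> walls \<and> q2 \<in> walls}
      = (\<lambda>(q1, q2). (a \<bullet> q2) *\<^sub>R q1 - (a \<bullet> q1) *\<^sub>R q2) ` (walls \<times> walls)" by auto
  then have finW: "finite W" unfolding W_def using finite_walls by simp
  have "AE z in std_gaussian. \<forall>q\<in>W - {0}. z \<bullet> q \<noteq> 0"
    by (rule AE_finite_allI) (use finW AE_std_gaussian_inner_nonzero in auto)
  then show ?thesis
  proof eventually_elim
    case (elim z)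
    have nz: "z \<bullet> q \<noteq> 0" if "q \<in> walls" for q
    proof -
      have "q \<in> W - {0}" using that walls_nonzero[OF that] by (simp add: W_def)
      then show ?thesis using elim by simp
    qed
    have np: "False" if q: "q1 \<in> walls" "q2 \<in> walls" "nonparallel q1 q2"
      and t: "(z + t *\<^sub>R a) \<bullet> q1 = 0" "(z + t *\<^sub>R a) \<bullet> q2 = 0" for q1 q2 t
    proof -
      have z1: "z \<bullet> q1 = - (t * (a \<bullet> q1))" "z \<bullet> q2 = - (t * (a \<bullet> q2))"
        using t by (simp_all add: inner_add_left add_eq_0_iff)
      have "a \<bullet> q1 \<noteq> 0" using z1(1) nz[OF q(1)] by auto
      define y where "y = (a \<bullet> q2) *\<^sub>R q1 - (a \<bullet> q1) *\<^sub>R q2"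
      have "y \<noteq> 0"
      proof
        assume "y = 0"
        then have "(a \<bullet> q2) *\<^sub>R q1 + (- (a \<bullet> q1)) *\<^sub>R q2 = 0" by (simp add: y_def)
        from q(3)[unfolded nonparallel_def, rule_format, OF this] have "- (a \<bullet> q1) = 0" by (rule conjunct2)
        then show False using \<open>a \<bullet> q1 \<noteq> 0\<close> by simp
      qed
      moreover have "y \<in> W" unfolding W_def y_def using q(1,2) by blast
      ultimately have "z \<bullet> y \<noteq> 0" using elim by simp
      then show False by (simp add: y_def inner_diff_right z1)
    qed
    show ?case
      unfolding generic_def
    proof (intro conjI ballI impI allI notI)
      show False if "q \<in> walls" "z \<bullet> q = 0" for q using nz[OF that(1)] that(2) by simp
      show False if "q1 \<in> walls" "q2 \<in> walls" "nonparallel q1 q2"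
        "(z + t *\<^sub>R a) \<bullet> q1 = 0 \<and> (z + t *\<^sub>R a) \<bullet> q2 = 0" for q1 q2 t
        by (rule np[OF that(1-3) conjunct1[OF that(4)] conjunct2[OF that(4)]])
    qed
  qed
qed

lemma AE_gauss_bonnet:
  "AE z in std_gaussian. (-1) ^ DIM('a) * of_bool (z \<in> fcone v E J) +
     (\<Sum>I\<in>cells. (-1) ^ card I * of_bool (cell v E J I z)) = (0 :: real)"
proof -
  have "J \<noteq> E" using cJ cE by auto
  then obtain a0 where a0: "a0 \<in> E - J" using JE by auto
  show ?thesis
    using AE_generic[of "v a0"]
  proof eventually_elim
    case (elim z)
    have "(\<Sum>I\<in>cells. (-1) ^ card I * of_bool (cell v E J I z)) =
        (\<Sum>I\<in>cells. (-1) ^ card I * of_bool (active I z) :: real)"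
      by (rule sum.cong[OF refl]) (simp add: active_iff_cell)
    then show ?case using euler_eq_0[OF a0 elim] unfolding euler_def K_def by simp
  qed
qed

lemma measurable_cell: "I \<in> cells \<Longrightarrow> {z. cell v E J I z} \<in> sets borel"
proof -
  assume I: "I \<in> cells"
  have "{z. cell v E J I z} = (\<Inter>i\<in>E - J. {z. 0 \<le> wall v (I - {i}) i \<bullet> z})"
    using active_iff_cell[OF I] unfolding active_def by (auto simp: inner_commute)
  also have "closed \<dots>" by (intro closed_INT ballI closed_halfspace_ge[of 0, simplified])
  finally show ?thesis by (rule borel_closed)
qed

theorem gauss_bonnet:
  "measure std_gaussian (fcone v E J) =
     (\<Sum>I\<in>cells. (-1) ^ (DIM('a) - 1 - card I) * measure std_gaussian {z. cell v E J I z})"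
proof -
  interpret G: prob_space "std_gaussian :: 'a measure" by (rule prob_space_std_gaussian)
  have sp: "space (std_gaussian :: 'a measure) = UNIV" by (simp add: std_gaussian_def)
  have mK: "fcone v E J \<in> sets borel" by (rule borel_closed[OF closed_fcone[OF finE JE]])
  have iK: "integrable std_gaussian (\<lambda>z. of_bool (z \<in> fcone v E J) :: real)"
    and KK: "(\<integral>z. of_bool (z \<in> fcone v E J) \<partial>std_gaussian) = measure std_gaussian (fcone v E J)"
  proof -
    have eq: "(\<lambda>z. of_bool (z \<in> fcone v E J) :: real) = indicator (fcone v E J)"
      by (auto simp: fun_eq_iff indicator_def)
    show "integrable std_gaussian (\<lambda>z. of_bool (z \<in> fcone v E J) :: real)"
      "(\<integral>z. of_bool (z \<in> fcone v E J) \<partial>std_gaussian) = measure std_gaussian (fcone v E J)"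
      unfolding eq using mK sp by (simp_all add: G.emeasure_eq_measure)
  qed
  have iC: "integrable std_gaussian (\<lambda>z. of_bool (cell v E J I z) :: real)"
    and CC: "(\<integral>z. of_bool (cell v E J I z) \<partial>std_gaussian) = measure std_gaussian {z. cell v E J I z}"
    if "I \<in> cells" for I
  proof -
    have eq: "(\<lambda>z. of_bool (cell v E J I z) :: real) = indicator {z. cell v E J I z}"
      by (auto simp: fun_eq_iff indicator_def)
    show "integrable std_gaussian (\<lambda>z. of_bool (cell v E J I z) :: real)"
      "(\<integral>z. of_bool (cell v E J I z) \<partial>std_gaussian) = measure std_gaussian {z. cell v E J I z}"
      unfolding eq using measurable_cell[OF that] sp by (simp_all add: G.emeasure_eq_measure)
  qed
  have sgn: "(-1 :: real) ^ card I = - ((-1) ^ DIM('a) * (-1) ^ (DIM('a) - 1 - card I))" if "I \<in> cells" for I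
  proof -
    have "DIM('a) = Suc (card I + (DIM('a) - 1 - card I))" using cellsD[OF that] by linarith
    then have "(-1 :: real) ^ DIM('a) = - ((-1) ^ card I * (-1) ^ (DIM('a) - 1 - card I))"
      by (metis power_Suc power_add mult_minus1)
    then show ?thesis by simp
  qed
  have "0 = (\<integral>z. (-1) ^ DIM('a) * of_bool (z \<in> fcone v E J) +
     (\<Sum>I\<in>cells. (-1) ^ card I * of_bool (cell v E J I z)) \<partial>(std_gaussian :: 'a measure) :: real)"
    by (subst integral_eq_zero_AE[OF AE_gauss_bonnet]) simp
  also have "\<dots> = (-1) ^ DIM('a) * measure std_gaussian (fcone v E J) +
      (\<Sum>I\<in>cells. (-1) ^ card I * measure std_gaussian {z. cell v E J I z})"
    using iK iC by (simp add: KK CC)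
  also have "\<dots> = (-1) ^ DIM('a) * (measure std_gaussian (fcone v E J) -
      (\<Sum>I\<in>cells. (-1) ^ (DIM('a) - 1 - card I) * measure std_gaussian {z. cell v E J I z}))"
  proof -
    have "(\<Sum>I\<in>cells. (-1) ^ card I * measure std_gaussian {z. cell v E J I z}) =
      (\<Sum>I\<in>cells. - ((-1) ^ DIM('a) * ((-1) ^ (DIM('a) - 1 - card I) * measure std_gaussian {z. cell v E J I z})))"
      by (rule sum.cong[OF refl]) (simp only: sgn mult_minus_left mult.assoc)
    then show ?thesis by (simp add: right_diff_distrib sum_negf flip: sum_distrib_left)
  qed
  finally show ?thesis by simp
qed

end

section \<open>Measurability of the angle sums in the configuration\<close>

lemma closed_projection_compact:
  fixes A :: "('x::topological_space \<times> 'c::topological_space) set"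
  assumes "compact K" "closed A"
  shows "closed {x. \<exists>c\<in>K. (x, c) \<in> A}"
proof -
  have "open {x. \<forall>c\<in>K. (x, c) \<notin> A}"
  proof (subst open_subopen, clarify)
    fix x assume "\<forall>c\<in>K. (x, c) \<notin> A"
    then have "{x} \<times> K \<subseteq> - A" by auto
    then obtain X where X: "x \<in> X" "open X" "X \<times> K \<subseteq> - A"
      using Elementary_Topology.tube_lemma[OF assms(1), of "- A" x] assms(2) by auto
    then have "X \<subseteq> {x. \<forall>c\<in>K. (x, c) \<notin> A}" by (auto simp: subset_iff)
    then show "\<exists>T. open T \<and> x \<in> T \<and> T \<subseteq> {x. \<forall>c\<in>K. (x, c) \<notin> A}" using X by blast
  qed
  moreover have "- {x. \<exists>c\<in>K. (x, c) \<in> A} = {x. \<forall>c\<in>K. (x, c) \<notin> A}" by auto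
  ultimately show ?thesis by (simp add: closed_def)
qed

text \<open>Projections of Borel sets need not be Borel, but those of closed sets along a \<open>\<sigma>\<close>-compact
  factor are countable unions of closed sets.\<close>
lemma borel_projection:
  fixes Q :: "'x::topological_space \<Rightarrow> 'c::topological_space \<Rightarrow> bool" and K :: "nat \<Rightarrow> 'c set"
  assumes K: "\<And>N. compact (K N)" and Q: "closed {(x, c). Q x c}"
    and cover: "\<And>x c. Q x c \<Longrightarrow> \<exists>N. \<exists>c'\<in>K N. Q x c'"
  shows "{x. \<exists>c. Q x c} \<in> sets borel"
proof -
  have "{x. \<exists>c. Q x c} = (\<Union>N. {x. \<exists>c\<in>K N. (x, c) \<in> {(x, c). Q x c}})"
    using cover by auto
  also have "\<dots> \<in> sets borel"
    by (intro sets.countable_UN) (auto intro!: borel_closed closed_projection_compact K Q simp del: mem_Collect_eq)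
  finally show ?thesis .
qed

definition box_seq :: "nat \<Rightarrow> (nat \<Rightarrow> real) set" where
  "box_seq N = PiE UNIV (\<lambda>_. {- real N..real N})"

lemma compact_box_seq: "compact (box_seq N)"
proof -
  have "compactin (product_topology (\<lambda>_. euclidean) UNIV) (PiE UNIV (\<lambda>_::nat. {- real N..real N}))"
    unfolding compactin_PiE by simp
  then show ?thesis
    by (simp add: box_seq_def euclidean_product_topology)
qed

lemma box_seq_cover:
  assumes "finite I"
  shows "\<exists>N. (\<lambda>i. if i \<in> I then c i else 0) \<in> box_seq N"
proof -
  obtain N where N: "(\<Sum>i\<in>I. \<bar>c i\<bar>) \<le> real N" using real_arch_simple by blast
  have "\<bar>c i\<bar> \<le> real N" if "i \<in> I" for i
    using member_le_sum[of i I "\<lambda>i. \<bar>c i\<bar>"] that assms N by force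
  then have "(if i \<in> I then c i else 0) \<in> {- real N..real N}" for i
    by (cases "i \<in> I") (simp_all add: abs_le_iff minus_le_iff)
  then have "(\<lambda>i. if i \<in> I then c i else 0) \<in> box_seq N"
    unfolding box_seq_def PiE_UNIV_domain by (intro Pi_I)
  then show ?thesis by (rule exI)
qed

text \<open>Only finitely many coordinates of \<open>c\<close> matter, and the others can be set to \<open>0\<close> to stay in a compact
  box.\<close>
lemma borel_projection_seq:
  fixes Q :: "'x::topological_space \<Rightarrow> (nat \<Rightarrow> real) \<Rightarrow> bool"
  assumes "finite I" "closed {(x, c). Q x c}" and dep: "\<And>x c. Q x c \<Longrightarrow> Q x (\<lambda>i. if i \<in> I then c i else 0)"
  shows "{x. \<exists>c. Q x c} \<in> sets borel"
  by (rule borel_projection[where K = box_seq]) (use compact_box_seq assms(2) dep box_seq_cover[OF assms(1)] in blast)+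

lemma borel_projection_vec:
  fixes Q :: "'x::topological_space \<Rightarrow> 'c::euclidean_space \<Rightarrow> bool"
  assumes "closed {(x, c). Q x c}"
  shows "{x. \<exists>c. Q x c} \<in> sets borel"
proof (rule borel_projection[where K = "\<lambda>N. cball 0 (real N)"])
  fix x c assume Q: "Q x c"
  obtain N where "norm c \<le> real N" using real_arch_simple by blast
  then show "\<exists>N. \<exists>c'\<in>cball 0 (real N). Q x c'"
    using Q by (intro exI[of _ N] bexI[of _ c]) simp_all
qed (use assms in auto)

lemma continuous_on_coord [continuous_intros]:
  assumes "continuous_on S f"
  shows "continuous_on S (\<lambda>x. f x (i :: nat))"
  using assms by (rule continuous_on_product_then_coordinatewise)

lemma closed_Collect_Ball: "(\<And>i. i \<in> I \<Longrightarrow> closed {x. P i x}) \<Longrightarrow> closed {x. \<forall>i\<in>I. P i x}"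
proof -
  assume "\<And>i. i \<in> I \<Longrightarrow> closed {x. P i x}"
  then have "closed (\<Inter>i\<in>I. {x. P i x})" by blast
  also have "(\<Inter>i\<in>I. {x. P i x}) = {x. \<forall>i\<in>I. P i x}" by auto
  finally show ?thesis .
qed

lemma borel_exposed_pts:
  assumes E: "finite E"
  shows "{p :: nat \<Rightarrow> 'a::euclidean_space. exposed_pts p E J} \<in> sets borel"
proof (cases "J \<subseteq> E \<and> J \<noteq> {}")
  case False
  then have "{p :: nat \<Rightarrow> 'a. exposed_pts p E J} = {}" by (auto simp: exposed_pts_def)
  then show ?thesis by simp
next
  case True
  then obtain i0 where i0: "i0 \<in> J" by blast
  define Q where "Q p w \<longleftrightarrow> (\<forall>i\<in>J. w \<bullet> (p i - p i0) = 0) \<and> (\<forall>i\<in>E - J. w \<bullet> (p i - p i0) \<le> - 1)"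
    for p :: "nat \<Rightarrow> 'a" and w
  have "exposed_pts p E J \<longleftrightarrow> (\<exists>w. Q p w)" for p
  proof
    assume "exposed_pts p E J"
    then obtain w where w: "\<forall>i\<in>J. w \<bullet> (p i - p i0) = 0" "\<forall>i\<in>E - J. w \<bullet> (p i - p i0) < 0"
      unfolding exposed_pts_iff[OF i0] exposed_def by blast
    define r where "r = (\<Sum>i\<in>E - J. - (1 / (w \<bullet> (p i - p i0))))"
    have "(r *\<^sub>R w) \<bullet> (p i - p i0) \<le> - 1" if i: "i \<in> E - J" for i
    proof -
      have "- (1 / (w \<bullet> (p i - p i0))) \<le> r"
        unfolding r_def by (rule member_le_sum) (use w(2) i E in \<open>auto simp: divide_nonneg_neg less_imp_le\<close>)
      then have "r * (w \<bullet> (p i - p i0)) \<le> - (1 / (w \<bullet> (p i - p i0))) * (w \<bullet> (p i - p i0))"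
        using w(2) i by (intro mult_right_mono_neg) (auto simp: less_imp_le)
      also have "\<dots> = - 1" using bspec[OF w(2) i] by simp
      finally show ?thesis by simp
    qed
    then have "Q p (r *\<^sub>R w)" unfolding Q_def using w(1) by simp
    then show "\<exists>w. Q p w" by blast
  next
    assume "\<exists>w. Q p w"
    then obtain w where w: "\<forall>i\<in>J. w \<bullet> (p i - p i0) = 0" "\<forall>i\<in>E - J. w \<bullet> (p i - p i0) \<le> - 1"
      unfolding Q_def by blast
    have "\<forall>i\<in>E - J. w \<bullet> (p i - p i0) < 0"
    proof
      fix i assume "i \<in> E - J"
      from bspec[OF w(2) this] show "w \<bullet> (p i - p i0) < 0" by linarith
    qed
    then show "exposed_pts p E J"
      unfolding exposed_pts_iff[OF i0] exposed_def using w(1) True by blast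
  qed
  moreover have "closed {(p, w). Q p w}"
    unfolding Q_def split_def
    by (intro closed_Collect_conj closed_Collect_Ball closed_Collect_le closed_Collect_eq continuous_intros)
  then have "{p. \<exists>w. Q p w} \<in> sets borel" by (rule borel_projection_vec)
  ultimately show ?thesis by simp
qed

lemma borel_cell:
  fixes E :: "nat set"
  assumes "finite I"
  shows "{(p :: nat \<Rightarrow> 'a::euclidean_space, z). cell (\<lambda>i. p i - p i0) E J I z} \<in> sets borel"
proof -
  define Q where "Q x c \<longleftrightarrow> (\<forall>i\<in>I - J. 0 \<le> c i) \<and>
     (\<forall>i\<in>I. (snd x - (\<Sum>l\<in>I. c l *\<^sub>R (fst x l - fst x i0))) \<bullet> (fst x i - fst x i0) = 0) \<and>
     (\<forall>i\<in>E. 0 \<le> (snd x - (\<Sum>l\<in>I. c l *\<^sub>R (fst x l - fst x i0))) \<bullet> (fst x i - fst x i0))"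
    for x :: "(nat \<Rightarrow> 'a) \<times> 'a" and c :: "nat \<Rightarrow> real"
  have "closed {(x, c). Q x c}"
    unfolding Q_def split_def
    by (intro closed_Collect_conj closed_Collect_Ball closed_Collect_le closed_Collect_eq continuous_intros)
  moreover have "Q x (\<lambda>i. if i \<in> I then c i else 0)" if "Q x c" for x c
  proof -
    have "(\<Sum>l\<in>I. (if l \<in> I then c l else 0) *\<^sub>R (fst x l - fst x i0)) = (\<Sum>l\<in>I. c l *\<^sub>R (fst x l - fst x i0))"
      by (rule sum.cong) auto
    then show ?thesis using that unfolding Q_def by simp
  qed
  ultimately have "{x. \<exists>c. Q x c} \<in> sets borel" by (rule borel_projection_seq[OF assms])
  also have "{x. \<exists>c. Q x c} = {(p, z). cell (\<lambda>i. p i - p i0) E J I z}"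
    unfolding Q_def cell_def by auto
  finally show ?thesis .
qed

lemma indep_iff_no_relation:
  assumes "finite S"
  shows "indep v S \<longleftrightarrow> (\<forall>i\<in>S. \<not> (\<exists>c. v i = (\<Sum>l\<in>S - {i}. c l *\<^sub>R v l)))"
proof -
  have "v i \<in> span (v ` (S - {i})) \<longleftrightarrow> (\<exists>c. v i = (\<Sum>l\<in>S - {i}. c l *\<^sub>R v l))" for i
  proof
    assume "v i \<in> span (v ` (S - {i}))"
    then show "\<exists>c. v i = (\<Sum>l\<in>S - {i}. c l *\<^sub>R v l)" using assms by (intro span_image_explicit) auto
  next
    assume "\<exists>c. v i = (\<Sum>l\<in>S - {i}. c l *\<^sub>R v l)"
    then obtain c where "v i = (\<Sum>l\<in>S - {i}. c l *\<^sub>R v l)" by blast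
    moreover have "(\<Sum>l\<in>S - {i}. c l *\<^sub>R v l) \<in> span (v ` (S - {i}))"
      by (auto intro!: span_sum span_scale intro: span_base)
    ultimately show "v i \<in> span (v ` (S - {i}))" by simp
  qed
  then show ?thesis unfolding indep_def by simp
qed

lemma borel_indep:
  assumes "finite S"
  shows "{p :: nat \<Rightarrow> 'a::euclidean_space. indep (\<lambda>i. p i - p i0) S} \<in> sets borel"
proof -
  have "{p :: nat \<Rightarrow> 'a. \<exists>c. p i - p i0 = (\<Sum>l\<in>S - {i}. c l *\<^sub>R (p l - p i0))} \<in> sets borel" for i
  proof (rule borel_projection_seq[where I = "S - {i}"])
    show "closed {(p :: nat \<Rightarrow> 'a, c). p i - p i0 = (\<Sum>l\<in>S - {i}. c l *\<^sub>R (p l - p i0))}"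
      unfolding split_def by (intro closed_Collect_eq continuous_intros)
  next
    fix p :: "nat \<Rightarrow> 'a" and c :: "nat \<Rightarrow> real"
    have "(\<Sum>l\<in>S - {i}. (if l \<in> S - {i} then c l else 0) *\<^sub>R (p l - p i0)) = (\<Sum>l\<in>S - {i}. c l *\<^sub>R (p l - p i0))"
      by (rule sum.cong) auto
    moreover assume "p i - p i0 = (\<Sum>l\<in>S - {i}. c l *\<^sub>R (p l - p i0))"
    ultimately show "p i - p i0 = (\<Sum>l\<in>S - {i}. (if l \<in> S - {i} then c l else 0) *\<^sub>R (p l - p i0))"
      by (simp only:)
  qed (use assms in simp)
  then have "(\<Inter>i\<in>S. - {p :: nat \<Rightarrow> 'a. \<exists>c. p i - p i0 = (\<Sum>l\<in>S - {i}. c l *\<^sub>R (p l - p i0))}) \<inter> UNIV \<in> sets borel"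
    using assms by (cases "S = {}") (auto intro!: sets.finite_INT sets.Int borel_comp)
  also have "(\<Inter>i\<in>S. - {p :: nat \<Rightarrow> 'a. \<exists>c. p i - p i0 = (\<Sum>l\<in>S - {i}. c l *\<^sub>R (p l - p i0))}) \<inter> UNIV
      = {p. indep (\<lambda>i. p i - p i0) S}"
    unfolding indep_iff_no_relation[OF assms] by auto
  finally show ?thesis .
qed

lemma dim_ge_iff_indep:
  assumes "finite J"
  shows "m \<le> dim (v ` J) \<longleftrightarrow> (\<exists>S\<in>{S. S \<subseteq> J \<and> card S = m}. indep v S)"
proof
  assume m: "m \<le> dim (v ` J)"
  obtain B where B: "B \<subseteq> v ` J" "independent B" "card B = dim (v ` J)"
    using basis_exists[of "v ` J"] by metis
  have "finite B" using B(1) assms finite_surj by blast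
  then obtain B' where B': "B' \<subseteq> B" "card B' = m" using m B(3) by (metis obtain_subset_with_card_n)
  have "independent B'" using B(2) B'(1) independent_mono by blast
  obtain S where S: "S \<subseteq> J" "inj_on v S" "v ` S = B'"
    using B(1) B'(1) subset_image_inj[of B' v J] by auto
  have "indep v S"
    unfolding indep_def
  proof
    fix i assume i: "i \<in> S"
    have "v ` (S - {i}) = B' - {v i}" using S(2,3) i by (simp add: inj_on_image_set_diff[of v S])
    then show "v i \<notin> span (v ` (S - {i}))" using \<open>independent B'\<close> S(3) i unfolding dependent_def by auto
  qed
  moreover have "card S = m" using S B'(2) card_image by fastforce
  ultimately show "\<exists>S\<in>{S. S \<subseteq> J \<and> card S = m}. indep v S" using S(1) by auto
next
  assume "\<exists>S\<in>{S. S \<subseteq> J \<and> card S = m}. indep v S"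
  then obtain S where S: "S \<subseteq> J" "card S = m" "indep v S" by auto
  have "dim (v ` S) = m" using indep_dim[OF _ S(3)] S assms finite_subset by auto
  moreover have "dim (v ` S) \<le> dim (v ` J)" using S(1) by (intro dim_subset image_mono)
  ultimately show "m \<le> dim (v ` J)" by simp
qed

lemma borel_aff_dim:
  assumes "finite J"
  shows "{p :: nat \<Rightarrow> 'a::euclidean_space. aff_dim (p ` J) = int k} \<in> sets borel"
proof (cases "J = {}")
  case True
  then show ?thesis by (simp add: aff_dim_empty)
next
  case False
  then obtain i0 where i0: "i0 \<in> J" by auto
  have ge: "{p :: nat \<Rightarrow> 'a. m \<le> dim ((\<lambda>i. p i - p i0) ` J)} \<in> sets borel" for m
  proof -
    have "{p :: nat \<Rightarrow> 'a. m \<le> dim ((\<lambda>i. p i - p i0) ` J)}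
      = (\<Union>S\<in>{S. S \<subseteq> J \<and> card S = m}. {p. indep (\<lambda>i. p i - p i0) S})"
      unfolding dim_ge_iff_indep[OF assms] by auto
    also have "\<dots> \<in> sets borel"
      using assms finite_subset by (intro sets.finite_UN borel_indep) auto
    finally show ?thesis .
  qed
  have "{p :: nat \<Rightarrow> 'a. aff_dim (p ` J) = int k} =
    {p. k \<le> dim ((\<lambda>i. p i - p i0) ` J)} - {p. Suc k \<le> dim ((\<lambda>i. p i - p i0) ` J)}"
  proof -
    have "aff_dim (p ` J) = int (dim ((\<lambda>i. p i - p i0) ` J))" for p :: "nat \<Rightarrow> 'a"
      using aff_dim_eq_dim_subtract[of "p i0" "p ` J"] i0 by (simp add: hull_inc image_image)
    then show ?thesis by auto
  qed
  then show ?thesis using ge by auto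
qed

lemma measurable_cell_measure:
  fixes E :: "nat set"
  assumes "finite I"
  shows "(\<lambda>p :: nat \<Rightarrow> 'a::euclidean_space. measure std_gaussian {z. cell (\<lambda>i. p i - p i0) E J I z}) \<in> borel_measurable borel"
    and "{z. cell (\<lambda>i. p i - p i0 :: 'a) E J I z} \<in> sets borel"
proof -
  interpret G: prob_space "std_gaussian :: 'a measure" by (rule prob_space_std_gaussian)
  let ?Q = "{(p :: nat \<Rightarrow> 'a, z). cell (\<lambda>i. p i - p i0) E J I z}"
  have sets: "sets (borel \<Otimes>\<^sub>M (std_gaussian :: 'a measure)) = sets (borel :: ((nat \<Rightarrow> 'a) \<times> 'a) measure)"
    by (subst sets_pair_measure_cong[OF refl sets_std_gaussian]) (metis borel_prod)
  have Q: "?Q \<in> sets (borel \<Otimes>\<^sub>M (std_gaussian :: 'a measure))"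
    unfolding sets by (rule borel_cell[OF assms])
  have sec: "Pair p -` ?Q = {z. cell (\<lambda>i. p i - p i0) E J I z}" for p by auto
  show "(\<lambda>p. measure std_gaussian {z. cell (\<lambda>i. p i - p i0 :: 'a) E J I z}) \<in> borel_measurable borel"
    using G.measurable_emeasure_Pair[OF Q] unfolding sec measure_def by measurable
  show "{z. cell (\<lambda>i. p i - p i0) E J I z} \<in> sets borel"
    using sets_Pair1[OF Q, of p] unfolding sec by simp
qed

text \<open>The hull may be degenerate here. The family of index sets of faces takes finitely many values, each on a
  Borel set.\<close>
lemma measurable_angle_sum:
  fixes E :: "nat set"
  assumes E: "finite E"
  shows "(\<lambda>p :: nat \<Rightarrow> 'a::euclidean_space. \<Sum>F\<in>faces j (convex hull (p ` E)). conic_intrinsic_volume k (tangent_cone F (convex hull (p ` E))))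
    \<in> borel_measurable borel"
proof -
  let ?m = "\<lambda>(p :: nat \<Rightarrow> 'a) J I. measure std_gaussian {z. cell (\<lambda>i. p i - p (Min J)) E J I z}"
  have eq: "(\<Sum>F\<in>faces j (convex hull (p ` E)). conic_intrinsic_volume k (tangent_cone F (convex hull (p ` E)))) =
    (\<Sum>J\<in>Pow E. \<Sum>I\<in>Pow E. indicator {p. exposed_pts p E J} p * indicator {p. aff_dim (p ` J) = int j} p *
      (indicator {p. exposed_pts p E I} p * indicator {p. aff_dim (p ` I) = int k} p) * (of_bool (J \<subseteq> I) * ?m p J I))"
    (is "_ = ?R p") for p :: "nat \<Rightarrow> 'a"
  proof -
    let ?A = "{J. exposed_pts p E J \<and> aff_dim (p ` J) = int j}"
    let ?B = "\<lambda>J. {I. J \<subseteq> I \<and> exposed_pts p E I \<and> aff_dim (p ` I) = int k}"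
    have sub: "?A \<subseteq> Pow E" "\<And>J. ?B J \<subseteq> Pow E" by (auto simp: exposed_pts_def)
    have "(\<Sum>J\<in>?A. \<Sum>I\<in>?B J. ?m p J I) = (\<Sum>J\<in>Pow E. if J \<in> ?A then \<Sum>I\<in>Pow E. if I \<in> ?B J then ?m p J I else 0 else 0)"
    proof -
      have r: "sum g B = (\<Sum>I\<in>Pow E. if I \<in> B then g I else 0)" if "B \<subseteq> Pow E" for g :: "nat set \<Rightarrow> real" and B
        using sum.inter_restrict[of "Pow E" g B] that E by (simp add: Int_absorb1)
      show ?thesis unfolding r[OF sub(1)] r[OF sub(2)] ..
    qed
    also have "\<dots> = ?R p"
      by (intro sum.cong refl) (auto simp: indicator_def intro!: sum.cong)
    finally show ?thesis unfolding angle_sum_convex_hull[OF E] .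
  qed
  have [measurable]: "(\<lambda>p. ?m p J I) \<in> borel_measurable borel" if "I \<in> Pow E" for I J
    using that E finite_subset by (intro measurable_cell_measure) auto
  show ?thesis
    unfolding eq
    using E finite_subset
    by (intro borel_measurable_sum borel_measurable_times borel_measurable_indicator borel_exposed_pts[OF E] borel_aff_dim) auto
qed

section \<open>Cells of a walk\<close>

definition vsum :: "('i \<Rightarrow> 'a::real_vector) \<Rightarrow> 'i set \<Rightarrow> 'a" where
  "vsum x B = (\<Sum>m\<in>B. x m)"

definition walk_at :: "('i \<Rightarrow> 'a::real_vector) \<Rightarrow> 'i list \<Rightarrow> nat \<Rightarrow> 'a" where
  "walk_at x xs i = (\<Sum>m\<leftarrow>take i xs. x m)"

lemma fcone_reindex:
  assumes "inj_on f A" "B \<subseteq> A"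
  shows "fcone v (f ` A) (f ` B) = fcone (\<lambda>l. v (f l)) A B"
proof (intro equalityI subsetI)
  fix y assume "y \<in> fcone v (f ` A) (f ` B)"
  then obtain c where c: "\<forall>i\<in>f ` A - f ` B. 0 \<le> c i" "y = (\<Sum>i\<in>f ` A. c i *\<^sub>R v i)" unfolding fcone_def by auto
  have "y = (\<Sum>l\<in>A. c (f l) *\<^sub>R v (f l))" unfolding c(2) using sum.reindex[OF assms(1)] by (simp add: o_def)
  moreover have "0 \<le> c (f l)" if "l \<in> A" "l \<notin> B" for l
    using c(1) that assms by (metis DiffI image_eqI inj_on_image_mem_iff)
  ultimately show "y \<in> fcone (\<lambda>l. v (f l)) A B" by (intro fconeI[of _ _ "\<lambda>l. c (f l)"])
next
  fix y assume "y \<in> fcone (\<lambda>l. v (f l)) A B"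
  then obtain c where c: "\<forall>l\<in>A - B. 0 \<le> c l" "y = (\<Sum>l\<in>A. c l *\<^sub>R v (f l))" unfolding fcone_def by auto
  have inv: "inv_into A f (f l) = l" if "l \<in> A" for l using assms(1) that by (rule inv_into_f_f)
  have "(\<Sum>i\<in>f ` A. c (inv_into A f i) *\<^sub>R v i) = (\<Sum>l\<in>A. c l *\<^sub>R v (f l))"
    using sum.reindex[OF assms(1), of "\<lambda>i. c (inv_into A f i) *\<^sub>R v i"] inv by simp
  then have "y = (\<Sum>i\<in>f ` A. c (inv_into A f i) *\<^sub>R v i)" using c(2) by simp
  moreover have "0 \<le> c (inv_into A f i)" if i: "i \<in> f ` A" "i \<notin> f ` B" for i
  proof -
    obtain l where l: "l \<in> A" "i = f l" using i(1) by auto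
    then have "l \<notin> B" using i(2) by auto
    then show ?thesis using l c(1) inv by simp
  qed
  ultimately show "y \<in> fcone v (f ` A) (f ` B)" by (intro fconeI[of _ _ "\<lambda>i. c (inv_into A f i)"])
qed

lemma abel_sum:
  fixes q :: "nat \<Rightarrow> 'a::real_vector"
  shows "(\<Sum>l<k. W (Suc l) *\<^sub>R (q (Suc l) - q l)) = (\<Sum>l\<le>k. (W l - W (Suc l)) *\<^sub>R q l) + W (Suc k) *\<^sub>R q k - W 0 *\<^sub>R q 0"
  by (induction k) (simp_all add: algebra_simps)

text \<open>In the cone over the points \<open>q 0, \<dots>, q k\<close> of a path, coordinates with respect to the increments
  of the path are the partial sums of coordinates with respect to the points, so that
  nonnegativity becomes monotonicity.\<close>
lemma fcone_path_iff:
  fixes q :: "nat \<Rightarrow> 'a::real_vector"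
  assumes J: "l0 \<in> J" "J \<subseteq> {..k}"
    and uniq: "\<forall>W. y = (\<Sum>l<k. W (Suc l) *\<^sub>R (q (Suc l) - q l)) \<longrightarrow> (\<forall>l<k. W (Suc l) = w (Suc l))"
    and y: "y = (\<Sum>l<k. w (Suc l) *\<^sub>R (q (Suc l) - q l))" and w: "w 0 = 0" "w (Suc k) = (0 :: real)"
  shows "(\<exists>c. (\<forall>l\<in>{..k} - J. 0 \<le> c l) \<and> y = (\<Sum>l\<le>k. c l *\<^sub>R (q l - q l0))) \<longleftrightarrow>
    (\<forall>l\<le>k. l \<notin> J \<longrightarrow> w (Suc l) \<le> w l)"
proof
  assume "\<exists>c. (\<forall>l\<in>{..k} - J. 0 \<le> c l) \<and> y = (\<Sum>l\<le>k. c l *\<^sub>R (q l - q l0))"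
  then obtain c where c: "\<forall>l\<in>{..k} - J. 0 \<le> c l" "y = (\<Sum>l\<le>k. c l *\<^sub>R (q l - q l0))" by auto
  define c' where "c' l = c l - (if l = l0 then \<Sum>l\<le>k. c l else 0)" for l
  have l0: "l0 \<in> {..k}" using J by auto
  have c'sum: "(\<Sum>l\<le>k. c' l) = 0" using l0 by (simp add: c'_def sum_subtractf)
  have yc': "y = (\<Sum>l\<le>k. c' l *\<^sub>R q l)"
    using l0 unfolding c(2) c'_def
    by (simp add: scaleR_right_diff_distrib scaleR_left_diff_distrib sum_subtractf
        if_distrib[of "\<lambda>c. c *\<^sub>R _"] flip: scaleR_sum_left cong: if_cong)
  define W where "W l = - (\<Sum>m<l. c' m)" for l
  have "W (Suc k) = 0" using c'sum by (simp add: W_def lessThan_Suc_atMost)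
  then have W: "W 0 = 0" "W (Suc k) = 0" "\<And>l. W l - W (Suc l) = c' l"
    by (simp_all add: W_def)
  have "y = (\<Sum>l<k. W (Suc l) *\<^sub>R (q (Suc l) - q l))"
    unfolding abel_sum W yc' by simp
  then have eq: "\<forall>l<k. W (Suc l) = w (Suc l)" using uniq by blast
  have Ww: "W l = w l" if "l \<le> Suc k" for l
    using that eq W w by (cases l) (auto simp: le_less less_Suc_eq)
  show "\<forall>l\<le>k. l \<notin> J \<longrightarrow> w (Suc l) \<le> w l"
  proof (intro allI impI)
    fix l assume l: "l \<le> k" "l \<notin> J"
    then have "c' l = c l" "0 \<le> c l" using J c(1) by (auto simp: c'_def)
    then show "w (Suc l) \<le> w l" using W(3)[of l] Ww[of l] Ww[of "Suc l"] l by simp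
  qed
next
  assume R: "\<forall>l\<le>k. l \<notin> J \<longrightarrow> w (Suc l) \<le> w l"
  have "(\<Sum>l\<le>k. w l - w (Suc l)) = 0"
    using sum_telescope[of w k] w by (simp add: sum_subtractf)
  then have "(\<Sum>l\<le>k. (w l - w (Suc l)) *\<^sub>R (q l - q l0)) = (\<Sum>l\<le>k. (w l - w (Suc l)) *\<^sub>R q l)"
    by (simp add: scaleR_right_diff_distrib sum_subtractf flip: scaleR_sum_left)
  then have "y = (\<Sum>l\<le>k. (w l - w (Suc l)) *\<^sub>R (q l - q l0))"
    unfolding y abel_sum w by simp
  then show "\<exists>c. (\<forall>l\<in>{..k} - J. 0 \<le> c l) \<and> y = (\<Sum>l\<le>k. c l *\<^sub>R (q l - q l0))"
    using R by (intro exI[of _ "\<lambda>l. w l - w (Suc l)"]) auto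
qed

lemma psum_append_all:
  "(\<forall>i\<le>length (xs @ ys). P (psum \<eta> (xs @ ys) i)) \<longleftrightarrow>
    (\<forall>i\<le>length xs. P (psum \<eta> xs i)) \<and> (\<forall>i\<le>length ys. P (psum \<eta> xs (length xs) + psum \<eta> ys i))"
proof -
  have 1: "psum \<eta> (xs @ ys) i = psum \<eta> xs i" if "i \<le> length xs" for i
    using that by (simp add: psum_def)
  have 2: "psum \<eta> (xs @ ys) (length xs + i) = psum \<eta> xs (length xs) + psum \<eta> ys i" for i
    by (simp add: psum_def)
  show ?thesis
  proof
    assume L: "\<forall>i\<le>length (xs @ ys). P (psum \<eta> (xs @ ys) i)"
    show "(\<forall>i\<le>length xs. P (psum \<eta> xs i)) \<and> (\<forall>i\<le>length ys. P (psum \<eta> xs (length xs) + psum \<eta> ys i))"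
    proof (intro conjI allI impI)
      fix i assume "i \<le> length xs"
      then show "P (psum \<eta> xs i)" using L[rule_format, of i] 1[of i] by simp
    next
      fix i assume "i \<le> length ys"
      then show "P (psum \<eta> xs (length xs) + psum \<eta> ys i)" using L[rule_format, of "length xs + i"] 2[of i] by simp
    qed
  next
    assume R: "(\<forall>i\<le>length xs. P (psum \<eta> xs i)) \<and> (\<forall>i\<le>length ys. P (psum \<eta> xs (length xs) + psum \<eta> ys i))"
    show "\<forall>i\<le>length (xs @ ys). P (psum \<eta> (xs @ ys) i)"
    proof (intro allI impI)
      fix i assume i: "i \<le> length (xs @ ys)"
      show "P (psum \<eta> (xs @ ys) i)"
      proof (cases "i \<le> length xs")
        case True
        then show ?thesis using R 1[of i] by simp
      next
        case False
        then show ?thesis using R i 2[of "i - length xs"] by simp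
      qed
    qed
  qed
qed

lemma psum_length: "psum \<eta> xs (length xs) = (\<Sum>m\<leftarrow>xs. \<eta> m)"
  by (simp add: psum_def)

lemma psum_bridges:
  assumes "\<And>b. b \<in> set bs \<Longrightarrow> (\<Sum>m\<leftarrow>b. \<eta> m) = 0"
  shows "(\<forall>i\<le>length (concat bs @ v). P (s + psum \<eta> (concat bs @ v) i)) \<longleftrightarrow>
    (\<forall>b\<in>set bs. \<forall>i\<le>length b. P (s + psum \<eta> b i)) \<and> (\<forall>i\<le>length v. P (s + psum \<eta> v i))"
  using assms
proof (induction bs)
  case Nil
  then show ?case by simp
next
  case (Cons b bs)
  have z: "psum \<eta> b (length b) = 0" using Cons.prems[of b] by (simp add: psum_length)
  have IH: "(\<forall>i\<le>length (concat bs @ v). P (s + psum \<eta> (concat bs @ v) i)) \<longleftrightarrow>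
    (\<forall>b\<in>set bs. \<forall>i\<le>length b. P (s + psum \<eta> b i)) \<and> (\<forall>i\<le>length v. P (s + psum \<eta> v i))"
    by (rule Cons.IH) (use Cons.prems in simp)
  have "(\<forall>i\<le>length (b @ (concat bs @ v)). P (s + psum \<eta> (b @ (concat bs @ v)) i)) \<longleftrightarrow>
    (\<forall>i\<le>length b. P (s + psum \<eta> b i)) \<and> (\<forall>i\<le>length (concat bs @ v). P (s + psum \<eta> (concat bs @ v) i))"
    using psum_append_all[of b "concat bs @ v" "\<lambda>t. P (s + t)" \<eta>] unfolding z by simp
  then show ?case unfolding IH by simp
qed

lemma psum_cut_pos:
  assumes "\<And>b. b \<in> set bs \<Longrightarrow> (\<Sum>m\<leftarrow>b. \<eta> m) = 0" "l \<le> length bs"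
  shows "psum \<eta> (u @ concat bs @ v) (cut_pos u bs l) = (\<Sum>m\<leftarrow>u. \<eta> m)"
proof -
  have "(\<Sum>m\<leftarrow>concat (take l bs). \<eta> m) = 0"
    using assms(1) by (induction bs arbitrary: l) (auto simp: take_Cons split: nat.splits)
  moreover have "take (cut_pos u bs l) (u @ concat bs @ v) = u @ concat (take l bs)"
  proof -
    have "concat bs = concat (take l bs) @ concat (drop l bs)"
      by (metis append_take_drop_id concat_append)
    then show ?thesis by (simp add: cut_pos_def)
  qed
  ultimately show ?thesis by (simp add: psum_def)
qed

text \<open>Bridges return to the level at which they start. Hence they do not change the levels of the other
  pieces, and the minimum is attained at their ends iff they never go below their initial level.\<close>
lemma min_at_cuts_iff:
  assumes "\<And>b. b \<in> set bs \<Longrightarrow> (\<Sum>m\<leftarrow>b. \<eta> m) = 0" "l \<le> length bs"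
  shows "(\<forall>i\<le>length (u @ concat bs @ v). psum \<eta> (u @ concat bs @ v) (cut_pos u bs l) \<le> psum \<eta> (u @ concat bs @ v) i) \<longleftrightarrow>
    (\<forall>i\<le>length (u @ v). psum \<eta> (u @ v) (length u) \<le> psum \<eta> (u @ v) i) \<and> (\<forall>b\<in>set bs. \<forall>i\<le>length b. 0 \<le> psum \<eta> b i)"
proof -
  let ?s = "\<Sum>m\<leftarrow>u. \<eta> m"
  have s: "psum \<eta> (u @ v) (length u) = ?s" by (simp add: psum_def)
  have cut: "psum \<eta> (u @ concat bs @ v) (cut_pos u bs l) = ?s"
    by (rule psum_cut_pos) (use assms in simp_all)
  have br: "(\<forall>i\<le>length (concat bs @ v). ?s \<le> ?s + psum \<eta> (concat bs @ v) i) \<longleftrightarrow>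
    (\<forall>b\<in>set bs. \<forall>i\<le>length b. ?s \<le> ?s + psum \<eta> b i) \<and> (\<forall>i\<le>length v. ?s \<le> ?s + psum \<eta> v i)"
    by (rule psum_bridges) (use assms in simp)
  show ?thesis
    unfolding cut s psum_append_all[where xs = u and P = "\<lambda>t. ?s \<le> t"] psum_length br by auto
qed

section \<open>Counting the cells of all rearrangements of a walk\<close>

text \<open>The coordinate of the projection of \<open>z\<close> that belongs to the block sum of \<open>B\<close>.\<close>
definition coeff :: "('i \<Rightarrow> 'a::euclidean_space) \<Rightarrow> 'i set set \<Rightarrow> 'a \<Rightarrow> 'i set \<Rightarrow> real" where
  "coeff x \<B> z B = z \<bullet> wall (vsum x) (\<B> - {B}) B / (wall (vsum x) (\<B> - {B}) B \<bullet> wall (vsum x) (\<B> - {B}) B)"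

text \<open>The increments of the real walk that is traced by the component of \<open>z\<close> orthogonal to the block sums.\<close>
definition height :: "('i \<Rightarrow> 'a::euclidean_space) \<Rightarrow> 'i set set \<Rightarrow> 'a \<Rightarrow> 'i \<Rightarrow> real" where
  "height x \<B> z m = (z - closest_point (span (vsum x ` \<B>)) z) \<bullet> x m"

lemma sum_height: "finite D \<Longrightarrow> sum (height x \<B> z) D = (z - closest_point (span (vsum x ` \<B>)) z) \<bullet> vsum x D"
  by (simp add: height_def vsum_def inner_sum_right)

lemma walk_at_cut_pos:
  assumes "l \<le> length bs"
  shows "walk_at x (u @ concat bs @ v) (cut_pos u bs l) = (\<Sum>m\<leftarrow>u. x m) + (\<Sum>m\<leftarrow>concat (take l bs). x m)"
proof -
  have "concat bs = concat (take l bs) @ concat (drop l bs)"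
    by (metis append_take_drop_id concat_append)
  then have "take (cut_pos u bs l) (u @ concat bs @ v) = u @ concat (take l bs)" by (simp add: cut_pos_def)
  then show ?thesis by (simp add: walk_at_def)
qed

lemma walk_at_step:
  assumes d: "distinct (u @ concat bs @ v)" and l: "l < length bs"
  shows "walk_at x (u @ concat bs @ v) (cut_pos u bs (Suc l)) - walk_at x (u @ concat bs @ v) (cut_pos u bs l) = vsum x (set (bs ! l))"
proof -
  have "distinct (bs ! l)" using d l by (simp add: distinct_concat_iff)
  then have "(\<Sum>m\<leftarrow>bs ! l. x m) = vsum x (set (bs ! l))" by (simp add: vsum_def sum_list_distinct_conv_sum_set)
  then show ?thesis
    using l by (simp add: walk_at_cut_pos take_Suc_conv_app_nth)
qed

lemma span_walk_cuts:
  fixes x :: "'i \<Rightarrow> 'a::euclidean_space"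
  assumes d: "distinct (u @ concat bs @ v)" and l0: "l0 \<le> length bs"
  shows "span ((\<lambda>i. walk_at x (u @ concat bs @ v) i - walk_at x (u @ concat bs @ v) (cut_pos u bs l0)) ` cuts u bs)
    = span (vsum x ` set ` set bs)"
proof -
  define k where "k = length bs"
  define q where "q l = walk_at x (u @ concat bs @ v) (cut_pos u bs l)" for l
  let ?L = "span (vsum x ` set ` set bs)" and ?V = "(\<lambda>i. walk_at x (u @ concat bs @ v) i - q l0) ` cuts u bs"
  have qdiff: "q (Suc l) - q l = vsum x (set (bs ! l))" if "l < k" for l
    using walk_at_step[OF d, of l x] that by (simp add: q_def k_def)
  have in_B: "vsum x (set (bs ! l)) \<in> ?L" if "l < k" for l
    using that by (intro span_base imageI) (simp add: k_def)
  have q0: "q l - q 0 \<in> ?L" if "l \<le> k" for l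
    using that
  proof (induction l)
    case (Suc l)
    have "q (Suc l) - q 0 = vsum x (set (bs ! l)) + (q l - q 0)" using qdiff[of l] Suc.prems by (simp add: algebra_simps)
    also have "\<dots> \<in> ?L" using Suc in_B[of l] by (intro span_add) simp_all
    finally show ?case .
  qed (simp add: span_zero)
  have I: "cuts u bs = cut_pos u bs ` {..k}" by (simp add: cuts_def k_def)
  have mem: "q m - q l0 \<in> span ?V" if "m \<le> k" for m
    unfolding q_def[of m] I using that by (intro span_base imageI) simp
  have "span ?V = ?L"
  proof (rule span_eq[THEN iffD2], intro conjI subsetI)
    fix y assume "y \<in> ?V"
    then obtain l where l: "l \<le> k" "y = q l - q l0" unfolding I by (auto simp: q_def)
    have "y = (q l - q 0) - (q l0 - q 0)" using l(2) by simp
    also have "\<dots> \<in> ?L" by (rule span_diff[OF q0[OF l(1)] q0]) (use l0 in \<open>simp add: k_def\<close>)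
    finally show "y \<in> ?L" .
  next
    fix y assume "y \<in> vsum x ` set ` set bs"
    then obtain b where "b \<in> set bs" "y = vsum x (set b)" by auto
    then obtain l where l: "l < k" "y = vsum x (set (bs ! l))" unfolding k_def by (metis in_set_conv_nth)
    have "y = (q (Suc l) - q l0) - (q l - q l0)" using l qdiff by simp
    also have "\<dots> \<in> span ?V" using l(1) by (intro span_diff mem) simp_all
    finally show "y \<in> span ?V" .
  qed
  then show ?thesis by (simp add: q_def)
qed

text \<open>The orthogonal component of \<open>z\<close> yields the conditions on heights, with the minimum attained at the cut
  points, and the component in the span yields the condition on the coordinates.\<close>
lemma cell_walk_iff:
  fixes x :: "'i \<Rightarrow> 'a::euclidean_space"
  assumes d: "distinct (u @ concat bs @ v)" and ne: "[] \<notin> set bs"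
    and ind: "indep (vsum x) (set ` set bs)" and dist: "distinct (map set bs)"
    and J': "J' \<subseteq> {..length bs}" "J' \<noteq> {}"
  defines "xs \<equiv> u @ concat bs @ v" and "\<B> \<equiv> set ` set bs" and "J \<equiv> cut_pos u bs ` J'"
  shows "cell (\<lambda>i. walk_at x xs i - walk_at x xs (Min J)) {..length xs} J (cuts u bs) z \<longleftrightarrow>
    ((\<forall>i\<le>length (u @ v). psum (height x \<B> z) (u @ v) (length u) \<le> psum (height x \<B> z) (u @ v) i) \<and>
     (\<forall>b\<in>set bs. \<forall>i\<le>length b. 0 \<le> psum (height x \<B> z) b i)) \<and>
    (\<forall>l\<le>length bs. l \<notin> J' \<longrightarrow> (0 # map (coeff x \<B> z) (map set bs) @ [0]) ! Suc l \<le> (0 # map (coeff x \<B> z) (map set bs) @ [0]) ! l)"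
proof -
  define k where "k = length bs"
  let ?L = "span (vsum x ` \<B>)"
  let ?y = "closest_point ?L z"
  have fB: "finite \<B>" by (simp add: \<B>_def)
  have finJ: "finite J" "J \<noteq> {}" using J' finite_subset by (auto simp: J_def)
  then have "Min J \<in> J" by (rule Min_in)
  then obtain l0 where l0: "l0 \<in> J'" "Min J = cut_pos u bs l0" using J_def by (metis imageE)
  have l0k: "l0 \<le> k" using l0 J' by (auto simp: k_def)
  define q where "q l = walk_at x xs (cut_pos u bs l)" for l
  let ?Bs = "map set bs"
  have lenB: "length ?Bs = k" by (simp add: k_def)
  have qdiff: "q (Suc l) - q l = vsum x (?Bs ! l)" if "l < k" for l
    using walk_at_step[OF d, of l x] that by (simp add: q_def xs_def k_def)
  have in_B: "?Bs ! l \<in> \<B>" if "l < k" for l using that by (simp add: \<B>_def k_def)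
  have bij: "bij_betw ((!) ?Bs) {..<k} \<B>"
  proof -
    have "bij_betw ((!) ?Bs) {..<length ?Bs} (set ?Bs)" by (rule bij_betw_nth[OF dist refl refl])
    then show ?thesis by (simp add: k_def \<B>_def)
  qed
  have I: "cuts u bs = cut_pos u bs ` {..k}" by (simp add: cuts_def k_def)
  have injc: "inj_on (cut_pos u bs) {..k}" unfolding k_def by (rule inj_on_cut_pos[OF ne])
  let ?v = "\<lambda>i. walk_at x xs i - walk_at x xs (Min J)"
  have vq: "?v (cut_pos u bs l) = q l - q l0" for l by (simp add: q_def l0)
  have span_eq: "span (?v ` cuts u bs) = ?L"
    using span_walk_cuts[OF d, of l0 x] l0k unfolding xs_def \<B>_def l0(2) k_def by simp
  have bridge: "(\<Sum>m\<leftarrow>b. height x \<B> z m) = 0" if "b \<in> set bs" for b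
  proof -
    have "distinct b" using d that by (simp add: distinct_concat_iff)
    then have "(\<Sum>m\<leftarrow>b. height x \<B> z m) = (z - ?y) \<bullet> vsum x (set b)"
      by (simp add: sum_list_distinct_conv_sum_set sum_height)
    also have "\<dots> = 0"
      by (rule orthogonal_closest_point[OF subspace_span span_base]) (use that in \<open>simp add: \<B>_def\<close>)
    finally show ?thesis .
  qed
  have hpath: "(z - ?y) \<bullet> walk_at x xs i = psum (height x \<B> z) xs i" for i
  proof -
    have "(z - ?y) \<bullet> (\<Sum>m\<leftarrow>ys. x m) = (\<Sum>m\<leftarrow>ys. (z - ?y) \<bullet> x m)" for ys
      by (induction ys) (simp_all add: inner_add_right)
    then show ?thesis unfolding walk_at_def psum_def height_def .
  qed
  have part1: "(\<forall>i\<in>{..length xs}. 0 \<le> (z - ?y) \<bullet> ?v i) \<longleftrightarrow>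
    (\<forall>i\<le>length (u @ v). psum (height x \<B> z) (u @ v) (length u) \<le> psum (height x \<B> z) (u @ v) i) \<and>
     (\<forall>b\<in>set bs. \<forall>i\<le>length b. 0 \<le> psum (height x \<B> z) b i)"
  proof -
    have "(\<forall>i\<in>{..length xs}. 0 \<le> (z - ?y) \<bullet> ?v i) \<longleftrightarrow>
      (\<forall>i\<le>length xs. psum (height x \<B> z) xs (cut_pos u bs l0) \<le> psum (height x \<B> z) xs i)"
      by (simp only: inner_diff_right hpath l0(2) diff_ge_0_iff_ge atMost_iff Ball_def)
    also have "\<dots> \<longleftrightarrow> (\<forall>i\<le>length (u @ v). psum (height x \<B> z) (u @ v) (length u) \<le> psum (height x \<B> z) (u @ v) i) \<and>
     (\<forall>b\<in>set bs. \<forall>i\<le>length b. 0 \<le> psum (height x \<B> z) b i)"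
      unfolding xs_def by (rule min_at_cuts_iff[OF bridge]) (use l0k in \<open>simp_all add: k_def\<close>)
    finally show ?thesis .
  qed
  define w where "w l = (0 # map (coeff x \<B> z) ?Bs @ [0]) ! l" for l
  have w0: "w 0 = 0" "w (Suc k) = 0" by (simp_all add: w_def nth_append k_def)
  have wS: "w (Suc l) = coeff x \<B> z (?Bs ! l)" if "l < k" for l
    using that by (simp add: w_def nth_append k_def)
  have rep: "e B = coeff x \<B> z B" if e: "?y = (\<Sum>B\<in>\<B>. e B *\<^sub>R vsum x B)" and B: "B \<in> \<B>" for e B
    using inner_wall_inside[OF fB B e] wall_nonzero[OF ind[folded \<B>_def] B] by (simp add: coeff_def)
  have reindex: "(\<Sum>l<k. g (?Bs ! l) l) = (\<Sum>B\<in>\<B>. g B (inv_into {..<k} ((!) ?Bs) B))" for g :: "'i set \<Rightarrow> nat \<Rightarrow> 'a"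
  proof -
    have "(\<Sum>l<k. g (?Bs ! l) l) = (\<Sum>l<k. g (?Bs ! l) (inv_into {..<k} ((!) ?Bs) (?Bs ! l)))"
      by (rule sum.cong[OF refl]) (simp only: inv_into_f_f[OF bij_betw_imp_inj_on[OF bij]])
    also have "\<dots> = (\<Sum>B\<in>\<B>. g B (inv_into {..<k} ((!) ?Bs) B))"
      by (rule sum.reindex_bij_betw[OF bij])
    finally show ?thesis .
  qed
  have uniq: "\<forall>l<k. W (Suc l) = w (Suc l)" if W: "?y = (\<Sum>l<k. W (Suc l) *\<^sub>R (q (Suc l) - q l))" for W
  proof (intro allI impI)
    fix l assume l: "l < k"
    let ?e = "\<lambda>B. W (Suc (inv_into {..<k} ((!) ?Bs) B))"
    have "?y = (\<Sum>l<k. W (Suc l) *\<^sub>R vsum x (?Bs ! l))" unfolding W by (rule sum.cong) (simp_all add: qdiff)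
    also have "\<dots> = (\<Sum>B\<in>\<B>. ?e B *\<^sub>R vsum x B)" by (rule reindex[of "\<lambda>B l. W (Suc l) *\<^sub>R vsum x B"])
    finally have "?e (?Bs ! l) = coeff x \<B> z (?Bs ! l)" using in_B[OF l] by (rule rep)
    moreover have "inv_into {..<k} ((!) ?Bs) (?Bs ! l) = l"
      using l by (intro inv_into_f_f bij_betw_imp_inj_on[OF bij]) simp
    ultimately show "W (Suc l) = w (Suc l)" using wS[OF l] by simp
  qed
  have uniq': "\<forall>W. ?y = (\<Sum>l<k. W (Suc l) *\<^sub>R (q (Suc l) - q l)) \<longrightarrow> (\<forall>l<k. W (Suc l) = w (Suc l))"
  proof (intro allI impI)
    fix W l assume W: "?y = (\<Sum>l<k. W (Suc l) *\<^sub>R (q (Suc l) - q l))" and l: "l < k"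
    from uniq[OF W] l show "W (Suc l) = w (Suc l)" by simp
  qed
  have yw: "?y = (\<Sum>l<k. w (Suc l) *\<^sub>R (q (Suc l) - q l))"
  proof -
    obtain e where e: "?y = (\<Sum>B\<in>\<B>. e B *\<^sub>R vsum x B)" using projection_explicit[OF fB] by blast
    have "(\<Sum>l<k. w (Suc l) *\<^sub>R (q (Suc l) - q l)) = (\<Sum>l<k. coeff x \<B> z (?Bs ! l) *\<^sub>R vsum x (?Bs ! l))"
      by (rule sum.cong) (simp_all add: qdiff wS)
    also have "\<dots> = (\<Sum>B\<in>\<B>. coeff x \<B> z B *\<^sub>R vsum x B)"
      by (rule reindex[of "\<lambda>B l. coeff x \<B> z B *\<^sub>R vsum x B"])
    also have "\<dots> = (\<Sum>B\<in>\<B>. e B *\<^sub>R vsum x B)" by (rule sum.cong[OF refl]) (simp add: rep[OF e])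
    finally show ?thesis using e by simp
  qed
  have "?y \<in> fcone ?v (cuts u bs) J \<longleftrightarrow> ?y \<in> fcone (\<lambda>l. q l - q l0) {..k} J'"
    using fcone_reindex[OF injc, of J' ?v] J'(1) unfolding I J_def vq[unfolded J_def] by (simp add: k_def)
  also have "\<dots> \<longleftrightarrow> (\<forall>l\<le>k. l \<notin> J' \<longrightarrow> w (Suc l) \<le> w l)"
    unfolding fcone_def mem_Collect_eq
    by (rule fcone_path_iff[OF l0(1) _ uniq' yw w0]) (use J'(1) in \<open>simp_all add: k_def\<close>)
  finally have part2: "?y \<in> fcone ?v (cuts u bs) J \<longleftrightarrow> (\<forall>l\<le>k. l \<notin> J' \<longrightarrow> w (Suc l) \<le> w l)" .
  show ?thesis
    unfolding cell_iff[OF finite_cuts] span_eq part1 part2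
    unfolding w_def k_def by blast
qed

definition generic_increments :: "('i \<Rightarrow> 'a::euclidean_space) \<Rightarrow> 'i set \<Rightarrow> bool" where
  "generic_increments x A \<longleftrightarrow> (\<forall>k\<le>DIM('a). \<forall>\<B>\<in>block_systems A k. indep (vsum x) \<B>)"

text \<open>Either \<open>D\<close> is a further block, or \<open>D\<close> splits one of the blocks into two. In both cases this
  yields a block system with one more member, whose block sums are independent.\<close>
lemma vsum_notin_span:
  fixes x :: "'i \<Rightarrow> 'a::euclidean_space"
  assumes A: "finite A" and gen: "generic_increments x A" and B: "\<B> \<in> block_systems A k" "k < DIM('a)"
    and D: "D \<noteq> {}" "D \<subseteq> A - \<Union>\<B> \<or> (\<exists>B\<in>\<B>. D \<subset> B)"
  shows "vsum x D \<notin> span (vsum x ` \<B>)"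
proof -
  note BD = block_systemsD[OF B(1)]
  have ind: "indep (vsum x) \<C>" if "\<C> \<in> block_systems A (Suc k)" for \<C>
    using gen B(2) that unfolding generic_increments_def by (metis Suc_leI)
  show ?thesis
  proof (cases "D \<subseteq> A - \<Union>\<B>")
    case True
    have nin: "D \<notin> \<B>" using True D(1) by auto
    have "insert D \<B> \<in> block_systems A (Suc k)"
    proof -
      have "disjoint (insert D \<B>)"
      proof -
        have r: "D \<inter> B = {}" if "B \<in> \<B>" for B using True that by auto
        have "X \<inter> Y = {}" if "X \<in> insert D \<B>" "Y \<in> insert D \<B>" "X \<noteq> Y" for X Y
          using that r[of X] r[of Y] BD(3)[of X Y] by (metis inf_commute insert_iff)
        then show ?thesis unfolding disjoint_def by simp
      qed
      moreover have "{} \<notin> insert D \<B>" using D(1) BD(4) by (metis insertE)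
      moreover have "\<Union>(insert D \<B>) \<subseteq> A" using True BD(6) by auto
      ultimately show ?thesis using BD(1,2) nin by (simp add: block_systems_def)
    qed
    from ind[OF this] have "vsum x D \<notin> span (vsum x ` (insert D \<B> - {D}))" unfolding indep_def by blast
    then show ?thesis using nin by simp
  next
    case False
    then obtain B where Bm: "B \<in> \<B>" "D \<subset> B" using D(2) by auto
    let ?R = "\<B> - {B}" and ?D' = "B - D"
    let ?C = "insert D (insert ?D' ?R)"
    have fB: "finite B" using BD(5)[OF Bm(1)] A finite_subset by metis
    have D'ne: "?D' \<noteq> {}" using Bm(2) by auto
    have nD: "D \<notin> ?R" "?D' \<notin> ?R" "D \<noteq> ?D'"
    proof -
      have disj: "C \<inter> B = {}" if "C \<in> ?R" for C using BD(3)[of C B] that Bm(1) by simp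
      show "D \<notin> ?R"
      proof
        assume "D \<in> ?R"
        from disj[OF this] show False using D(1) Bm(2) by auto
      qed
      show "?D' \<notin> ?R"
      proof
        assume "?D' \<in> ?R"
        from disj[OF this] have "?D' = {}" by (simp add: Int_absorb2 Diff_subset)
        then show False using D'ne by simp
      qed
      show "D \<noteq> ?D'" using D(1) Bm(2) by auto
    qed
    have card: "card ?C = Suc k"
    proof -
      have "card ?R + 1 = k" using BD(1,2) Bm(1) card_Suc_Diff1[of \<B> B] by simp
      then show ?thesis using BD(1) nD by simp
    qed
    have sysC: "?C \<in> block_systems A (Suc k)"
    proof -
      have r1: "D \<inter> C = {}" "?D' \<inter> C = {}" if "C \<in> ?R" for C
        using BD(3)[of C B] that Bm by auto
      have r2: "D \<inter> ?D' = {}" by auto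
      have "X \<inter> Y = {}" if "X \<in> ?C" "Y \<in> ?C" "X \<noteq> Y" for X Y
        using that r1[of X] r1[of Y] r2 BD(3)[of X Y] by (metis Diff_iff inf_commute insert_iff)
      then have "disjoint ?C" unfolding disjoint_def by simp
      moreover have "{} \<notin> ?C" using D(1) D'ne BD(4) by (metis DiffD1 insertE)
      moreover have "\<Union>?C \<subseteq> A" using BD(6) Bm by auto
      ultimately show ?thesis using BD(1) card by (simp add: block_systems_def)
    qed
    have "finite ?C" using BD(1) by simp
    then have dimC: "dim (vsum x ` ?C) = Suc k" using indep_dim[OF _ ind[OF sysC]] unfolding card by blast
    show ?thesis
    proof
      assume Dspan: "vsum x D \<in> span (vsum x ` \<B>)"
      have "vsum x ?D' = vsum x B - vsum x D"
        unfolding vsum_def using fB Bm(2) by (simp add: sum_diff)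
      also have "\<dots> \<in> span (vsum x ` \<B>)" using Dspan Bm(1) by (intro span_diff) (auto intro: span_base)
      finally have "vsum x ` ?C \<subseteq> span (vsum x ` \<B>)"
        using Dspan by (auto intro: span_base)
      then have "dim (vsum x ` ?C) \<le> dim (span (vsum x ` \<B>))" by (rule dim_subset)
      also have "\<dots> \<le> card (vsum x ` \<B>)" unfolding dim_span using BD(1) by (intro dim_le_card') simp
      also have "\<dots> \<le> k" using card_image_le[OF BD(1)] BD(2) by metis
      finally show False using dimC by simp
    qed
  qed
qed

text \<open>No ties: partial sums of heights are different wherever they are compared, and so are the
  coordinates of the blocks and \<open>0\<close>.\<close>
definition generic_direction :: "('i \<Rightarrow> 'a::euclidean_space) \<Rightarrow> 'i set \<Rightarrow> 'i set set \<Rightarrow> 'a \<Rightarrow> bool" where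
  "generic_direction x A \<B> z \<longleftrightarrow>
    (\<forall>D\<in>Pow A. D \<noteq> {} \<and> (D \<subseteq> A - \<Union>\<B> \<or> (\<exists>B\<in>\<B>. D \<subset> B)) \<longrightarrow> sum (height x \<B> z) D \<noteq> 0) \<and>
    inj_on (coeff x \<B> z) \<B> \<and> (\<forall>B\<in>\<B>. coeff x \<B> z B \<noteq> 0)"

lemma AE_generic_direction:
  fixes x :: "'i \<Rightarrow> 'a::euclidean_space"
  assumes A: "finite A" and gen: "generic_increments x A" and B: "\<B> \<in> block_systems A k" "k < DIM('a)"
  shows "AE z in std_gaussian. generic_direction x A \<B> z"
proof -
  note BD = block_systemsD[OF B(1)]
  let ?L = "span (vsum x ` \<B>)"
  let ?w = "\<lambda>B. wall (vsum x) (\<B> - {B}) B"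
  let ?n = "\<lambda>B. (1 / (?w B \<bullet> ?w B)) *\<^sub>R ?w B"
  have ind: "indep (vsum x) \<B>" using gen B unfolding generic_increments_def by (metis less_imp_le)
  have wnz: "?w B \<noteq> 0" if "B \<in> \<B>" for B by (rule wall_nonzero[OF ind that])
  have coeff: "coeff x \<B> z B = z \<bullet> ?n B" for z B by (simp add: coeff_def)
  define V where "V = (\<lambda>D. vsum x D - closest_point ?L (vsum x D)) ` Pow A \<union> ?n ` \<B> \<union> (\<lambda>(B, C). ?n B - ?n C) ` (\<B> \<times> \<B>)"
  have "finite V" unfolding V_def using A BD(1) by simp
  then have "AE z in std_gaussian. \<forall>q\<in>V - {0}. z \<bullet> q \<noteq> 0"
    by (intro AE_finite_allI) (auto intro: AE_std_gaussian_inner_nonzero)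
  then show ?thesis
  proof eventually_elim
    case (elim z)
    have 1: "sum (height x \<B> z) D \<noteq> 0" if D: "D \<in> Pow A" "D \<noteq> {}" "D \<subseteq> A - \<Union>\<B> \<or> (\<exists>B\<in>\<B>. D \<subset> B)" for D
    proof -
      let ?q = "vsum x D - closest_point ?L (vsum x D)"
      have "?q \<noteq> 0"
        using vsum_notin_span[OF A gen B D(2,3)] closest_point_in_subspace[OF subspace_span, of "vsum x ` \<B>" "vsum x D"] by auto
      moreover have "?q \<in> V" unfolding V_def using D(1) by blast
      ultimately have nz: "z \<bullet> ?q \<noteq> 0" using elim by simp
      have fD: "finite D" using D(1) A finite_subset by auto
      have "(z - closest_point ?L z) \<bullet> closest_point ?L (vsum x D) = 0" for z
        by (rule orthogonal_closest_point[OF subspace_span closest_point_in_subspace[OF subspace_span]])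
      moreover have "closest_point ?L z \<bullet> ?q = 0"
        using orthogonal_closest_point[OF subspace_span closest_point_in_subspace[OF subspace_span], of "vsum x D" "vsum x ` \<B>" z]
        by (simp add: inner_commute)
      ultimately have "(z - closest_point ?L z) \<bullet> vsum x D = z \<bullet> ?q"
        by (simp add: inner_diff_left inner_diff_right)
      then show ?thesis using nz by (simp add: sum_height[OF fD])
    qed
    have 2: "coeff x \<B> z B \<noteq> 0" if "B \<in> \<B>" for B
    proof -
      have "?n B \<in> V - {0}" unfolding V_def using that wnz[OF that] by simp
      then show ?thesis using elim unfolding coeff by blast
    qed
    have 3: "inj_on (coeff x \<B> z) \<B>"
    proof (rule inj_onI, rule ccontr)
      fix B C assume BC: "B \<in> \<B>" "C \<in> \<B>" "coeff x \<B> z B = coeff x \<B> z C" "B \<noteq> C"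
      have np: "nonparallel (?w B) (?w C)" by (rule nonparallel_walls_inside[OF BC(1,4) wnz[OF BC(1)] wnz[OF BC(2)]])
      have "?n B - ?n C \<noteq> 0"
      proof
        assume "?n B - ?n C = 0"
        then have "(1 / (?w B \<bullet> ?w B)) *\<^sub>R ?w B + (- (1 / (?w C \<bullet> ?w C))) *\<^sub>R ?w C = 0" by simp
        from np[unfolded nonparallel_def, rule_format, OF this] show False using wnz[OF BC(1)] by simp
      qed
      moreover have "?n B - ?n C \<in> V"
      proof -
        have "(\<lambda>(B, C). ?n B - ?n C) (B, C) \<in> (\<lambda>(B, C). ?n B - ?n C) ` (\<B> \<times> \<B>)"
          using BC(1,2) by (intro imageI) simp
        then show ?thesis unfolding V_def by simp
      qed
      ultimately have "z \<bullet> (?n B - ?n C) \<noteq> 0" using elim by blast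
      then show False using BC(3) unfolding coeff by (simp add: inner_diff_right)
    qed
    show ?case unfolding generic_direction_def using 1 2 3 by simp
  qed
qed

text \<open>For generic increments and a generic direction \<open>z\<close>, the cutting of the rearranged walks by \<open>I\<close> is
  regrouped according to the block system that arises. For a fixed block system, the orderings inside of
  the blocks, the outer pieces, and the order of the blocks together with \<open>J\<close> are counted independently
  of each other.\<close>
lemma count_cells:
  fixes x :: "'i \<Rightarrow> 'a::euclidean_space"
  assumes A: "finite A" and gen: "generic_increments x A" and k: "k < DIM('a)"
    and z: "\<And>\<B>. \<B> \<in> block_systems A k \<Longrightarrow> generic_direction x A \<B> z"
  shows "(\<Sum>xs\<in>permutations_of_set A. \<Sum>I\<in>{I. I \<subseteq> {..card A} \<and> card I = Suc k}. \<Sum>J\<in>{J. J \<subseteq> I \<and> card J = Suc j}.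
      of_bool (cell (\<lambda>i. walk_at x xs i - walk_at x xs (Min J)) {..card A} J I z)) =
    fact j * Stirling (Suc k) (Suc j) * stirling (Suc (card A)) (Suc k)"
proof -
  define Qo where "Qo \<B> u v \<longleftrightarrow> (\<forall>i\<le>length (u @ v). psum (height x \<B> z) (u @ v) (length u) \<le> psum (height x \<B> z) (u @ v) i)" for \<B> u v
  define Qi where "Qi \<B> b \<longleftrightarrow> (\<forall>i\<le>length b. 0 \<le> psum (height x \<B> z) b i)" for \<B> b
  define dsc where "dsc C Bs J \<longleftrightarrow> (\<forall>l\<le>length Bs. l \<notin> J \<longrightarrow> (0 # map C Bs @ [0]) ! Suc l \<le> (0 # map C Bs @ [0]) ! l)"
    for C :: "'i set \<Rightarrow> real" and Bs J
  define h where "h Bs = card {J. J \<subseteq> {..length Bs} \<and> card J = Suc j \<and> dsc (coeff x (set Bs) z) Bs J}" for Bs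
  let ?cell = "\<lambda>xs J I. cell (\<lambda>i. walk_at x xs i - walk_at x xs (Min J)) {..card A} J I z"
  have inner: "(\<Sum>J\<in>{J. J \<subseteq> cuts u bs \<and> card J = Suc j}. of_bool (?cell xs J (cuts u bs))) =
      of_bool (Qo (set ` set bs) u v \<and> (\<forall>b\<in>set bs. Qi (set ` set bs) b)) * h (map set bs)"
    if xs: "xs \<in> permutations_of_set A" and d: "(u, bs, v) \<in> decomps k xs" for xs u bs v
  proof -
    have D: "xs = u @ concat bs @ v" "[] \<notin> set bs" "length bs = k" using d by (auto simp: decomps_def)
    have t: "(u, bs, v) \<in> triples A k" using xs D by (simp add: triples_def)
    have sys: "set ` set bs \<in> block_systems A k" and dist: "distinct (map set bs)"
      using triples_set_in_block_systems[OF A t] by simp_all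
    have ind: "indep (vsum x) (set ` set bs)"
      using gen sys k unfolding generic_increments_def by (metis less_imp_le)
    have dxs: "distinct (u @ concat bs @ v)" "length (u @ concat bs @ v) = card A"
      using xs distinct_card[of xs] unfolding D(1)[symmetric] permutations_of_set_iff by auto
    have injc: "inj_on (cut_pos u bs) {..k}" unfolding D(3)[symmetric] by (rule inj_on_cut_pos[OF D(2)])
    have cutsI: "cuts u bs = cut_pos u bs ` {..k}" by (simp add: cuts_def D(3))
    have bij: "bij_betw ((`) (cut_pos u bs)) {J'. J' \<subseteq> {..k} \<and> card J' = Suc j} {J. J \<subseteq> cuts u bs \<and> card J = Suc j}"
      unfolding bij_betw_def
    proof
      show "inj_on ((`) (cut_pos u bs)) {J'. J' \<subseteq> {..k} \<and> card J' = Suc j}"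
        using inj_on_image_Pow[OF injc] by (rule inj_on_subset) auto
      show "(`) (cut_pos u bs) ` {J'. J' \<subseteq> {..k} \<and> card J' = Suc j} = {J. J \<subseteq> cuts u bs \<and> card J = Suc j}"
      proof (intro equalityI subsetI)
        fix J assume "J \<in> (`) (cut_pos u bs) ` {J'. J' \<subseteq> {..k} \<and> card J' = Suc j}"
        then obtain J' where J': "J' \<subseteq> {..k}" "card J' = Suc j" "J = cut_pos u bs ` J'" by auto
        then show "J \<in> {J. J \<subseteq> cuts u bs \<and> card J = Suc j}"
          unfolding cutsI using card_image[OF inj_on_subset[OF injc J'(1)]] by auto
      next
        fix J assume "J \<in> {J. J \<subseteq> cuts u bs \<and> card J = Suc j}"
        then obtain J' where J': "J' \<subseteq> {..k}" "J = cut_pos u bs ` J'" "card J = Suc j"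
          unfolding cutsI by (auto simp: subset_image_iff)
        then show "J \<in> (`) (cut_pos u bs) ` {J'. J' \<subseteq> {..k} \<and> card J' = Suc j}"
          using card_image[OF inj_on_subset[OF injc J'(1)]] by auto
      qed
    qed
    have "(\<Sum>J\<in>{J. J \<subseteq> cuts u bs \<and> card J = Suc j}. of_bool (?cell xs J (cuts u bs)) :: nat) =
      (\<Sum>J'\<in>{J'. J' \<subseteq> {..k} \<and> card J' = Suc j}. of_bool (?cell xs (cut_pos u bs ` J') (cuts u bs)))"
      by (rule sum.reindex_bij_betw[OF bij, symmetric])
    also have "\<dots> = (\<Sum>J'\<in>{J'. J' \<subseteq> {..k} \<and> card J' = Suc j}.
        of_bool (Qo (set ` set bs) u v \<and> (\<forall>b\<in>set bs. Qi (set ` set bs) b)) * of_bool (dsc (coeff x (set ` set bs) z) (map set bs) J'))"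
    proof (rule sum.cong[OF refl])
      fix J' assume J': "J' \<in> {J'. J' \<subseteq> {..k} \<and> card J' = Suc j}"
      then have "J' \<subseteq> {..length bs}" "J' \<noteq> {}" using D(3) by auto
      from cell_walk_iff[OF dxs(1) D(2) ind dist this, of z]
      have "?cell xs (cut_pos u bs ` J') (cuts u bs) \<longleftrightarrow> (Qo (set ` set bs) u v \<and> (\<forall>b\<in>set bs. Qi (set ` set bs) b)) \<and>
          dsc (coeff x (set ` set bs) z) (map set bs) J'"
        unfolding dxs(2) D(1) Qo_def Qi_def dsc_def length_map .
      then show "of_bool (?cell xs (cut_pos u bs ` J') (cuts u bs)) =
        (of_bool (Qo (set ` set bs) u v \<and> (\<forall>b\<in>set bs. Qi (set ` set bs) b)) * of_bool (dsc (coeff x (set ` set bs) z) (map set bs) J') :: nat)"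
        by (simp only: of_bool_conj)
    qed
    also have "\<dots> = of_bool (Qo (set ` set bs) u v \<and> (\<forall>b\<in>set bs. Qi (set ` set bs) b)) * h (map set bs)"
    proof -
      have "(\<Sum>J'\<in>{J'. J' \<subseteq> {..k} \<and> card J' = Suc j}. of_bool (dsc (coeff x (set ` set bs) z) (map set bs) J') :: nat) = h (map set bs)"
        unfolding h_def by (simp add: D(3) Int_def conj_assoc)
      then show ?thesis by (simp only: sum_distrib_left[symmetric])
    qed
    finally show ?thesis .
  qed
  have len: "length xs = card A" if "xs \<in> permutations_of_set A" for xs
    using that distinct_card by (fastforce simp: permutations_of_set_iff)
  have "(\<Sum>xs\<in>permutations_of_set A. \<Sum>I\<in>{I. I \<subseteq> {..card A} \<and> card I = Suc k}. \<Sum>J\<in>{J. J \<subseteq> I \<and> card J = Suc j}. of_bool (?cell xs J I)) =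
    (\<Sum>xs\<in>permutations_of_set A. \<Sum>(u, bs, v)\<in>decomps k xs. of_bool (Qo (set ` set bs) u v \<and> (\<forall>b\<in>set bs. Qi (set ` set bs) b)) * h (map set bs))"
  proof (rule sum.cong[OF refl])
    fix xs assume xs: "xs \<in> permutations_of_set A"
    have "(\<Sum>I\<in>{I. I \<subseteq> {..card A} \<and> card I = Suc k}. \<Sum>J\<in>{J. J \<subseteq> I \<and> card J = Suc j}. of_bool (?cell xs J I) :: nat) =
      (\<Sum>t\<in>decomps k xs. \<Sum>J\<in>{J. J \<subseteq> (case t of (u, bs, v) \<Rightarrow> cuts u bs) \<and> card J = Suc j}. of_bool (?cell xs J (case t of (u, bs, v) \<Rightarrow> cuts u bs)))"
      using sum.reindex_bij_betw[OF bij_betw_cuts[of k xs], of "\<lambda>I. \<Sum>J\<in>{J. J \<subseteq> I \<and> card J = Suc j}. of_bool (?cell xs J I) :: nat"]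
      by (simp add: len[OF xs])
    also have "\<dots> = (\<Sum>(u, bs, v)\<in>decomps k xs. of_bool (Qo (set ` set bs) u v \<and> (\<forall>b\<in>set bs. Qi (set ` set bs) b)) * h (map set bs))"
      by (rule sum.cong[OF refl]) (use inner[OF xs] in \<open>simp add: split_paired_all\<close>)
    finally show "(\<Sum>I\<in>{I. I \<subseteq> {..card A} \<and> card I = Suc k}. \<Sum>J\<in>{J. J \<subseteq> I \<and> card J = Suc j}. of_bool (?cell xs J I)) =
      (\<Sum>(u, bs, v)\<in>decomps k xs. of_bool (Qo (set ` set bs) u v \<and> (\<forall>b\<in>set bs. Qi (set ` set bs) b)) * h (map set bs))" .
  qed
  also have "\<dots> = (\<Sum>(u, bs, v)\<in>triples A k. of_bool (Qo (set ` set bs) u v \<and> (\<forall>b\<in>set bs. Qi (set ` set bs) b)) * h (map set bs))"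
    by (rule sum_decomps[OF A])
  also have "\<dots> = (\<Sum>\<B>\<in>block_systems A k. card {(u, v). u @ v \<in> permutations_of_set (A - \<Union>\<B>) \<and> Qo \<B> u v} *
        (\<Prod>B\<in>\<B>. card {b \<in> permutations_of_set B. Qi \<B> b}) * (\<Sum>Bs\<in>permutations_of_set \<B>. h Bs))"
    by (rule sum_triples[OF A])
  also have "\<dots> = (\<Sum>\<B>\<in>block_systems A k. fact (card (A - \<Union>\<B>)) * (\<Prod>B\<in>\<B>. fact (card B - 1)) * (fact j * Stirling (Suc k) (Suc j)))"
  proof (rule sum.cong[OF refl])
    fix \<B> assume B: "\<B> \<in> block_systems A k"
    note BD = block_systemsD[OF B]
    have g: "sum (height x \<B> z) D \<noteq> 0" if "D \<subseteq> A" "D \<noteq> {}" "D \<subseteq> A - \<Union>\<B> \<or> (\<exists>B\<in>\<B>. D \<subset> B)" for D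
      using z[OF B] that unfolding generic_direction_def by simp
    have gi: "inj_on (coeff x \<B> z) \<B>" "\<And>B. B \<in> \<B> \<Longrightarrow> coeff x \<B> z B \<noteq> 0"
      using z[OF B] unfolding generic_direction_def by simp_all
    have 1: "card {(u, v). u @ v \<in> permutations_of_set (A - \<Union>\<B>) \<and> Qo \<B> u v} = fact (card (A - \<Union>\<B>))"
      unfolding Qo_def
    proof (rule card_outer_orderings)
      show "sum (height x \<B> z) E \<noteq> 0" if "E \<subseteq> A - \<Union>\<B>" "E \<noteq> {}" for E
        by (rule g) (use that in auto)
    qed (use A in simp)
    have 2: "card {b \<in> permutations_of_set B. Qi \<B> b} = fact (card B - 1)" if Bm: "B \<in> \<B>" for B
      unfolding Qi_def
    proof (rule card_block_orderings)
      have fB: "finite B" using BD(5)[OF Bm] A finite_subset by metis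
      then show "finite B" .
      show "B \<noteq> {}" by (rule BD(4)[OF Bm])
      show "sum (height x \<B> z) B = 0"
        unfolding sum_height[OF fB] by (rule orthogonal_closest_point[OF subspace_span span_base]) (use Bm in simp)
      show "sum (height x \<B> z) D \<noteq> 0" if "D \<subset> B" "D \<noteq> {}" for D
      proof (rule g)
        show "D \<subseteq> A" using that(1) BD(5)[OF Bm] by auto
        show "D \<subseteq> A - \<Union>\<B> \<or> (\<exists>B\<in>\<B>. D \<subset> B)" using that(1) Bm by auto
      qed (rule that(2))
    qed
    have 3: "(\<Sum>Bs\<in>permutations_of_set \<B>. h Bs) = fact j * Stirling (Suc k) (Suc j)"
    proof -
      have "(\<Sum>Bs\<in>permutations_of_set \<B>. h Bs) = (\<Sum>Bs\<in>permutations_of_set \<B>. card {J. J \<subseteq> {..card \<B>} \<and> card J = Suc j \<and>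
        (\<forall>l\<le>card \<B>. l \<notin> J \<longrightarrow> (0 # map (coeff x \<B> z) Bs @ [0]) ! Suc l \<le> (0 # map (coeff x \<B> z) Bs @ [0]) ! l)})"
      proof (rule sum.cong[OF refl])
        fix Bs assume "Bs \<in> permutations_of_set \<B>"
        then have "set Bs = \<B>" "length Bs = card \<B>" using distinct_card[of Bs] by (auto simp: permutations_of_set_iff)
        then show "h Bs = card {J. J \<subseteq> {..card \<B>} \<and> card J = Suc j \<and>
          (\<forall>l\<le>card \<B>. l \<notin> J \<longrightarrow> (0 # map (coeff x \<B> z) Bs @ [0]) ! Suc l \<le> (0 # map (coeff x \<B> z) Bs @ [0]) ! l)}"
          unfolding h_def dsc_def by simp
      qed
      also have "\<dots> = fact j * Stirling (Suc (card \<B>)) (Suc j)"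
        by (rule sum_orderings_descents[OF BD(1) gi])
      finally show ?thesis unfolding BD(2) .
    qed
    have p: "(\<Prod>B\<in>\<B>. card {b \<in> permutations_of_set B. Qi \<B> b}) = (\<Prod>B\<in>\<B>. fact (card B - 1))"
      by (rule prod.cong[OF refl]) (rule 2)
    show "card {(u, v). u @ v \<in> permutations_of_set (A - \<Union>\<B>) \<and> Qo \<B> u v} *
        (\<Prod>B\<in>\<B>. card {b \<in> permutations_of_set B. Qi \<B> b}) * (\<Sum>Bs\<in>permutations_of_set \<B>. h Bs) =
        fact (card (A - \<Union>\<B>)) * (\<Prod>B\<in>\<B>. fact (card B - 1)) * (fact j * Stirling (Suc k) (Suc j))"
      unfolding 1 3 p ..
  qed
  also have "\<dots> = stirling (Suc (card A)) (Suc k) * (fact j * Stirling (Suc k) (Suc j))"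
    unfolding sum_distrib_right[symmetric] sum_block_systems_cycles[OF A] ..
  finally show ?thesis by (simp only: mult_ac)
qed

section \<open>Angle sums of the hull of a generic walk\<close>

text \<open>Extended by \<open>0\<close> in order to make a walk a point of the space \<open>nat \<Rightarrow> 'a\<close> of configurations, on
  which angle sums are measurable.\<close>
definition pts :: "nat \<Rightarrow> (nat \<Rightarrow> 'a::real_vector) \<Rightarrow> nat \<Rightarrow> 'a" where
  "pts n x i = (if i \<le> n then \<Sum>m=1..i. x m else 0)"

text \<open>The angle sum of a hull in general position, without reference to its faces.\<close>
definition cell_sum :: "nat \<Rightarrow> nat \<Rightarrow> nat \<Rightarrow> (nat \<Rightarrow> 'a::euclidean_space) \<Rightarrow> real" where
  "cell_sum n j k p = (\<Sum>I\<in>{I. I \<subseteq> {..n} \<and> card I = Suc k}. \<Sum>J\<in>{J. J \<subseteq> I \<and> card J = Suc j}.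
     measure std_gaussian {z. cell (\<lambda>i. p i - p (Min J)) {..n} J I z})"

lemma cell_cong:
  assumes "\<And>i. i \<in> E \<Longrightarrow> v i = v' i" "I \<subseteq> E"
  shows "cell v E J I z = cell v' E J I z"
proof -
  have "(\<Sum>l\<in>I. c l *\<^sub>R v l) = (\<Sum>l\<in>I. c l *\<^sub>R v' l)" for c
    by (rule sum.cong) (use assms in auto)
  moreover have "\<forall>i\<in>I. v i = v' i" "\<forall>i\<in>E. v i = v' i" using assms by auto
  ultimately show ?thesis unfolding cell_def by simp
qed

lemma cell_sum_cong:
  assumes "\<And>i. i \<le> n \<Longrightarrow> p i = p' i"
  shows "cell_sum n j k p = cell_sum n j k p'"
  unfolding cell_sum_def
proof (intro sum.cong refl)
  fix I J assume I: "I \<in> {I. I \<subseteq> {..n} \<and> card I = Suc k}" and J: "J \<in> {J. J \<subseteq> I \<and> card J = Suc j}"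
  have "finite J" "J \<noteq> {}" using J by (auto intro: card_ge_0_finite)
  then have "Min J \<in> J" by (rule Min_in)
  then have m: "Min J \<le> n" using I J by auto
  have "cell (\<lambda>i. p i - p (Min J)) {..n} J I z = cell (\<lambda>i. p' i - p' (Min J)) {..n} J I z" for z
    by (rule cell_cong) (use assms m I in auto)
  then show "measure std_gaussian {z. cell (\<lambda>i. p i - p (Min J)) {..n} J I z} =
      measure std_gaussian {z. cell (\<lambda>i. p' i - p' (Min J)) {..n} J I z}" by simp
qed

lemma bij_betw_permutes_orderings:
  "bij_betw (\<lambda>\<pi>. map \<pi> [1..<Suc n]) {\<pi>. \<pi> permutes {1..n}} (permutations_of_set {1..n})"
proof -
  have inj: "inj_on (\<lambda>\<pi>. map \<pi> [1..<Suc n]) {\<pi>. \<pi> permutes {1..n}}"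
  proof (rule inj_onI, rule ext)
    fix \<pi> \<sigma> i assume p: "\<pi> \<in> {\<pi>. \<pi> permutes {1..n}}" "\<sigma> \<in> {\<pi>. \<pi> permutes {1..n}}"
      and eq: "map \<pi> [1..<Suc n] = map \<sigma> [1..<Suc n]"
    show "\<pi> i = \<sigma> i"
    proof (cases "i \<in> {1..n}")
      case True
      then have "i \<in> set [1..<Suc n]" by auto
      then show ?thesis using eq by (simp only: map_eq_conv)
    next
      case False
      then show ?thesis using p by (simp add: permutes_not_in)
    qed
  qed
  have sub: "(\<lambda>\<pi>. map \<pi> [1..<Suc n]) ` {\<pi>. \<pi> permutes {1..n}} \<subseteq> permutations_of_set {1..n}"
  proof clarify
    fix \<pi> :: "nat \<Rightarrow> nat" assume p: "\<pi> permutes {1..n}"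
    have "set (map \<pi> [1..<Suc n]) = {1..n}"
      using permutes_image[OF p] by (simp add: atLeastLessThanSuc_atLeastAtMost del: upt_Suc)
    moreover have "distinct (map \<pi> [1..<Suc n])"
      using permutes_inj_on[OF p] by (simp add: distinct_map del: upt_Suc)
    ultimately show "map \<pi> [1..<Suc n] \<in> permutations_of_set {1..n}" unfolding permutations_of_set_iff by blast
  qed
  have "card ((\<lambda>\<pi>. map \<pi> [1..<Suc n]) ` {\<pi>. \<pi> permutes {1..n}}) = card (permutations_of_set {1..n})"
    unfolding card_image[OF inj] using card_permutations[of "{1..n}" n] by simp
  then have "(\<lambda>\<pi>. map \<pi> [1..<Suc n]) ` {\<pi>. \<pi> permutes {1..n}} = permutations_of_set {1..n}"
    by (intro card_subset_eq finite_permutations_of_set sub)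
  with inj show ?thesis unfolding bij_betw_def by blast
qed

lemma walk_at_permuted:
  assumes "i \<le> n"
  shows "walk_at x (map \<pi> [1..<Suc n]) i = pts n (\<lambda>m. x (\<pi> m)) i"
proof -
  have "take i (map \<pi> [1..<Suc n]) = map \<pi> [1..<Suc i]" using assms by (simp add: take_map del: upt_Suc)
  then have "walk_at x (map \<pi> [1..<Suc n]) i = (\<Sum>m\<leftarrow>[1..<Suc i]. x (\<pi> m))" by (simp add: walk_at_def o_def del: upt_Suc)
  also have "\<dots> = (\<Sum>m=1..i. x (\<pi> m))"
    by (subst sum_list_distinct_conv_sum_set) (simp_all add: atLeastLessThanSuc_atLeastAtMost del: upt_Suc)
  finally show ?thesis using assms by (simp add: pts_def)
qed

text \<open>The count of cells for almost every direction, integrated over the direction.\<close>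
lemma sum_permuted_cells:
  fixes x :: "nat \<Rightarrow> 'a::euclidean_space"
  assumes gen: "generic_increments x {1..n}" and k: "k < DIM('a)"
  shows "(\<Sum>\<pi>\<in>{\<pi>. \<pi> permutes {1..n}}. cell_sum n j k (pts n (\<lambda>m. x (\<pi> m)))) =
    real (fact j * Stirling (Suc k) (Suc j) * stirling (Suc n) (Suc k))"
proof -
  interpret G: prob_space "std_gaussian :: 'a measure" by (rule prob_space_std_gaussian)
  let ?P = "permutations_of_set {1..n}" and ?I = "{I. I \<subseteq> {..n} \<and> card I = Suc k}" and ?J = "\<lambda>I. {J. J \<subseteq> I \<and> card J = Suc j}"
  let ?C = "\<lambda>xs J I. {z. cell (\<lambda>i. walk_at x xs i - walk_at x xs (Min J)) {..n} J I z}"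
  have mC: "?C xs J I \<in> sets borel" if "I \<in> ?I" for xs J I
    using that finite_subset by (intro measurable_cell_measure(2)) auto
  have sp: "space (std_gaussian :: 'a measure) = UNIV" by (simp add: std_gaussian_def)
  have "(\<Sum>\<pi>\<in>{\<pi>. \<pi> permutes {1..n}}. cell_sum n j k (pts n (\<lambda>m. x (\<pi> m)))) =
    (\<Sum>\<pi>\<in>{\<pi>. \<pi> permutes {1..n}}. cell_sum n j k (walk_at x (map \<pi> [1..<Suc n])))"
    by (intro sum.cong refl cell_sum_cong walk_at_permuted[symmetric])
  also have "\<dots> = (\<Sum>xs\<in>?P. cell_sum n j k (walk_at x xs))"
    by (rule sum.reindex_bij_betw[OF bij_betw_permutes_orderings])
  also have "\<dots> = (\<Sum>xs\<in>?P. \<Sum>I\<in>?I. \<Sum>J\<in>?J I. \<integral>z. indicator (?C xs J I) z \<partial>std_gaussian)"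
    unfolding cell_sum_def using mC sp by (intro sum.cong refl) simp
  also have "\<dots> = (\<integral>z. (\<Sum>xs\<in>?P. \<Sum>I\<in>?I. \<Sum>J\<in>?J I. indicator (?C xs J I) z) \<partial>std_gaussian)"
  proof -
    let ?f = "\<lambda>xs J I. indicator (?C xs J I) :: 'a \<Rightarrow> real"
    have int: "integrable std_gaussian (?f xs J I)" if "I \<in> ?I" for xs J I
      using mC[OF that] by (simp add: G.emeasure_eq_measure)
    have int1: "integrable std_gaussian (\<lambda>z. \<Sum>J\<in>?J I. ?f xs J I z)" if "I \<in> ?I" for xs I
      by (rule Bochner_Integration.integrable_sum) (rule int[OF that])
    have s1: "(\<integral>z. (\<Sum>J\<in>?J I. ?f xs J I z) \<partial>std_gaussian) = (\<Sum>J\<in>?J I. \<integral>z. ?f xs J I z \<partial>std_gaussian)"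
      if "I \<in> ?I" for xs I
      by (rule Bochner_Integration.integral_sum) (rule int[OF that])
    have s2: "(\<integral>z. (\<Sum>I\<in>?I. \<Sum>J\<in>?J I. ?f xs J I z) \<partial>std_gaussian) = (\<Sum>I\<in>?I. \<Sum>J\<in>?J I. \<integral>z. ?f xs J I z \<partial>std_gaussian)" for xs
    proof -
      have "(\<integral>z. (\<Sum>I\<in>?I. \<Sum>J\<in>?J I. ?f xs J I z) \<partial>std_gaussian) = (\<Sum>I\<in>?I. \<integral>z. (\<Sum>J\<in>?J I. ?f xs J I z) \<partial>std_gaussian)"
        by (rule Bochner_Integration.integral_sum) (rule int1)
      also have "\<dots> = (\<Sum>I\<in>?I. \<Sum>J\<in>?J I. \<integral>z. ?f xs J I z \<partial>std_gaussian)"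
        by (rule sum.cong[OF refl]) (rule s1)
      finally show ?thesis .
    qed
    have "(\<integral>z. (\<Sum>xs\<in>?P. \<Sum>I\<in>?I. \<Sum>J\<in>?J I. ?f xs J I z) \<partial>std_gaussian) = (\<Sum>xs\<in>?P. \<integral>z. (\<Sum>I\<in>?I. \<Sum>J\<in>?J I. ?f xs J I z) \<partial>std_gaussian)"
      by (rule Bochner_Integration.integral_sum) (rule Bochner_Integration.integrable_sum, rule int1)
    then show ?thesis unfolding s2 by (rule sym)
  qed
  also have "\<dots> = (\<integral>z. real (fact j * Stirling (Suc k) (Suc j) * stirling (Suc n) (Suc k)) \<partial>(std_gaussian :: 'a measure))"
  proof (rule integral_cong_AE)
    show "(\<lambda>z. \<Sum>xs\<in>?P. \<Sum>I\<in>?I. \<Sum>J\<in>?J I. indicator (?C xs J I) z :: real) \<in> borel_measurable (std_gaussian :: 'a measure)"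
    proof (intro borel_measurable_sum borel_measurable_indicator)
      fix xs I J assume "I \<in> ?I"
      then show "?C xs J I \<in> sets (std_gaussian :: 'a measure)" using mC[of I xs J] by simp
    qed
    have "AE z in std_gaussian. \<forall>\<B>\<in>block_systems {1..n} k. generic_direction x {1..n} \<B> z"
    proof (rule AE_finite_allI)
      show "finite (block_systems {1..n} k)" by (simp add: finite_block_systems)
      show "AE z in std_gaussian. generic_direction x {1..n} \<B> z" if "\<B> \<in> block_systems {1..n} k" for \<B>
        by (rule AE_generic_direction[OF _ gen that k]) simp
    qed
    then show "AE z in std_gaussian. (\<Sum>xs\<in>?P. \<Sum>I\<in>?I. \<Sum>J\<in>?J I. indicator (?C xs J I) z) =
        real (fact j * Stirling (Suc k) (Suc j) * stirling (Suc n) (Suc k))"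
    proof eventually_elim
      case (elim z)
      have "real (\<Sum>xs\<in>?P. \<Sum>I\<in>?I. \<Sum>J\<in>?J I. of_bool (z \<in> ?C xs J I)) =
        real (fact j * Stirling (Suc k) (Suc j) * stirling (Suc n) (Suc k))"
        using count_cells[OF _ gen k, of z j] elim by simp
      moreover have "real (of_bool (z \<in> ?C xs J I)) = indicator (?C xs J I) z" for xs J I
        by (simp add: indicator_def)
      ultimately show ?case by (simp only: of_nat_sum)
    qed
  qed simp
  also have "\<dots> = real (fact j * Stirling (Suc k) (Suc j) * stirling (Suc n) (Suc k))"
    using G.prob_space by simp
  finally show ?thesis .
qed

lemma indep_if_dim:
  assumes "finite S" "dim (v ` S) = card S"
  shows "indep v S"
  unfolding indep_def
proof (intro ballI notI)
  fix i assume i: "i \<in> S" "v i \<in> span (v ` (S - {i}))"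
  have "v ` S \<subseteq> span (v ` (S - {i}))"
  proof clarify
    fix l assume "l \<in> S"
    then show "v l \<in> span (v ` (S - {i}))" using i(2) by (cases "l = i") (auto intro: span_base)
  qed
  then have "dim (v ` S) \<le> dim (v ` (S - {i}))" by (metis dim_span dim_subset)
  also have "\<dots> \<le> card (v ` (S - {i}))" by (rule dim_le_card') (use assms in simp)
  also have "\<dots> \<le> card (S - {i})" by (rule card_image_le) (use assms in simp)
  also have "\<dots> < card S" using i(1) assms(1) by (intro psubset_card_mono) auto
  finally show False using assms(2) by simp
qed

lemma walk_at_upt: "i \<le> n \<Longrightarrow> walk_at x [1..<Suc n] i = pts n x i"
  using walk_at_permuted[of i n x id] by (simp del: upt_Suc)

lemma dim_insert_zero: "dim (insert 0 S) = dim S"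
  by (metis dim_span span_insert_0)

text \<open>The differences of walk positions have the same span as the sums over the blocks into which
  the positions cut the increments.\<close>
lemma indep_pts:
  fixes x :: "nat \<Rightarrow> 'a::euclidean_space"
  assumes gen: "generic_increments x {1..n}" and i0: "i0 \<le> n" and S: "S \<subseteq> {..n} - {i0}" "card S \<le> DIM('a)"
  shows "indep (\<lambda>i. pts n x i - pts n x i0) S"
proof (rule indep_if_dim)
  have fS: "finite S" using S(1) by (meson finite_Diff finite_atMost finite_subset)
  show "finite S" by (rule fS)
  let ?xs = "[1..<Suc n]" and ?v = "\<lambda>i. pts n x i - pts n x i0"
  have "i0 \<notin> S" using S(1) by auto
  then have "insert i0 S \<subseteq> {..length ?xs}" "card (insert i0 S) = Suc (card S)"
    using S(1) i0 fS by auto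
  then obtain u bs v where d: "u @ concat bs @ v = ?xs" "[] \<notin> set bs" "length bs = card S" "cuts u bs = insert i0 S"
    using decomps_surj[of "insert i0 S" ?xs "card S"] unfolding decomps_def by blast
  have "i0 \<in> cuts u bs" using d(4) by simp
  then obtain l0 where l0: "l0 \<le> length bs" "i0 = cut_pos u bs l0" unfolding cuts_def by auto
  have t: "(u, bs, v) \<in> triples {1..n} (card S)"
    unfolding triples_def mem_Collect_eq split d(1)
    using d(2,3) by (simp add: permutations_of_set_iff atLeastLessThanSuc_atLeastAtMost del: upt_Suc)
  have sys: "set (map set bs) \<in> block_systems {1..n} (card S)"
    by (rule triples_set_in_block_systems(1)[OF _ t]) simp
  then have ind: "indep (vsum x) (set ` set bs)"
    using gen S(2) unfolding generic_increments_def by simp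
  have "card (set ` set bs) = card S" using block_systemsD(2)[OF sys] by simp
  then have dimL: "dim (span (vsum x ` set ` set bs)) = card S"
    using indep_dim[OF _ ind] by simp
  have dist: "distinct (u @ concat bs @ v)" unfolding d(1) by (rule distinct_upt)
  have "?v ` insert i0 S = (\<lambda>i. walk_at x ?xs i - walk_at x ?xs i0) ` cuts u bs"
    unfolding d(4)
  proof (intro image_cong refl)
    fix i assume "i \<in> insert i0 S"
    then have "i \<le> n" using S(1) i0 by auto
    then show "?v i = walk_at x ?xs i - walk_at x ?xs i0" by (simp only: walk_at_upt i0)
  qed
  then have "dim (?v ` insert i0 S) = card S"
    using span_walk_cuts[OF dist l0(1), of x] dimL unfolding d(1) l0(2)[symmetric] by (metis dim_span)
  moreover have "dim (?v ` insert i0 S) = dim (?v ` S)"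
    by (simp add: dim_insert_zero)
  ultimately show "dim (?v ` S) = card S" by simp
qed

lemma sum_zero_index:
  fixes v :: "'i \<Rightarrow> 'a::real_vector"
  assumes "finite I" "v i0 = 0"
  shows "(\<Sum>l\<in>I. c l *\<^sub>R v l) = (\<Sum>l\<in>I - {i0}. c l *\<^sub>R v l)"
  using assms by (cases "i0 \<in> I") (simp_all add: sum.remove[of I i0])

lemma cell_remove_zero:
  assumes "finite I" "v i0 = 0" "i0 \<in> J"
  shows "cell v E J I z = cell v (E - {i0}) (J - {i0}) (I - {i0}) z"
proof -
  have "I - {i0} - (J - {i0}) = I - J" using assms(3) by auto
  moreover have "(\<forall>i\<in>I - {i0}. y \<bullet> v i = 0) \<longleftrightarrow> (\<forall>i\<in>I. y \<bullet> v i = 0)"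
    "(\<forall>i\<in>E - {i0}. 0 \<le> y \<bullet> v i) \<longleftrightarrow> (\<forall>i\<in>E. 0 \<le> y \<bullet> v i)" for y
  proof -
    have z: "y \<bullet> v i0 = 0" using assms(2) by simp
    show "(\<forall>i\<in>I - {i0}. y \<bullet> v i = 0) \<longleftrightarrow> (\<forall>i\<in>I. y \<bullet> v i = 0)"
      using z by (metis DiffD1 DiffI singletonD)
    show "(\<forall>i\<in>E - {i0}. 0 \<le> y \<bullet> v i) \<longleftrightarrow> (\<forall>i\<in>E. 0 \<le> y \<bullet> v i)"
      using z by (metis DiffD1 DiffI singletonD order_refl)
  qed
  ultimately show ?thesis
    unfolding cell_def sum_zero_index[of I v i0, OF assms(1,2)] by simp
qed

lemma fcone_remove_zero:
  assumes "finite E" "v i0 = 0" "i0 \<in> J"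
  shows "fcone v E J = fcone v (E - {i0}) (J - {i0})"
proof -
  have "E - {i0} - (J - {i0}) = E - J" using assms(3) by auto
  then show ?thesis unfolding fcone_def sum_zero_index[of E v i0, OF assms(1,2)] by simp
qed

text \<open>A cell of positive measure contains generic points, and the component normal to the span of
  the face at such a point exposes the face. A face of it that is spanned by fewer generators is
  exposed as well, since the generators are independent.\<close>
lemma exposed_of_generic_cell:
  fixes v :: "'i \<Rightarrow> 'a::euclidean_space"
  assumes E: "finite E" "J \<subseteq> I" "I \<subseteq> E" and ind: "indep v I" and indE: "\<And>i. i \<in> E - I \<Longrightarrow> indep v (insert i I)"
    and z: "cell v E J I z" "\<And>i. i \<in> E - J \<Longrightarrow> z \<bullet> wall v (I - {i}) i \<noteq> 0"
  shows "exposed v E I" "exposed v E J"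
proof -
  have fI: "finite I" using E finite_subset by auto
  let ?y = "z - closest_point (span (v ` I)) z"
  have y0: "?y \<bullet> v i = 0" if "i \<in> I" for i
    by (rule orthogonal_closest_point[OF subspace_span span_base]) (use that in simp)
  have ypos: "0 < ?y \<bullet> v i" if i: "i \<in> E - I" for i
  proof -
    have ii: "i \<in> E - J" "i \<notin> I" "I - {i} = I" using i E(2) by auto
    have "\<forall>i\<in>E - J. 0 \<le> z \<bullet> wall v (I - {i}) i" using z(1) unfolding cell_iff_walls[OF E ind] .
    from bspec[OF this ii(1)] z(2)[OF ii(1)] have "0 < z \<bullet> wall v I i" unfolding ii(3) by simp
    then show ?thesis unfolding inner_wall_outside[OF ii(2)] .
  qed
  have "\<forall>i\<in>I. (- ?y) \<bullet> v i = 0"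
    using y0 by (simp only: inner_minus_left neg_equal_0_iff_equal) simp
  moreover have "\<forall>i\<in>E - I. (- ?y) \<bullet> v i < 0"
    using ypos by (simp only: inner_minus_left neg_less_0_iff_less) simp
  ultimately show "exposed v E I"
    unfolding exposed_def using E(3) by blast
  \<comment> \<open>\<open>w\<close> is orthogonal to the generators in \<open>J\<close> and negative on those in \<open>I - J\<close>; a large multiple of
    \<open>?y\<close> corrects its signs outside of \<open>I\<close> without changing it on \<open>I\<close>.\<close>
  define w where "w = - (\<Sum>i\<in>I - J. wall v (I - {i}) i)"
  have wi: "w \<bullet> v l = (if l \<in> J then 0 else - (wall v (I - {l}) l \<bullet> wall v (I - {l}) l))" if l: "l \<in> I" for l
  proof -
    have "wall v (I - {i}) i \<bullet> v l = (if i = l then wall v (I - {l}) l \<bullet> wall v (I - {l}) l else 0)" for i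
      using wall_self[of v l "I - {l}"] wall_orth[of l "I - {i}" v i] l by (auto simp: inner_commute)
    then have "w \<bullet> v l = - (\<Sum>i\<in>I - J. if i = l then wall v (I - {l}) l \<bullet> wall v (I - {l}) l else 0)"
      by (simp add: w_def inner_sum_left)
    then show ?thesis using l fI by simp
  qed
  define t where "t = 1 + (\<Sum>i\<in>E - I. \<bar>w \<bullet> v i\<bar> / (?y \<bullet> v i))"
  have t: "\<bar>w \<bullet> v i\<bar> < t * (?y \<bullet> v i)" if i: "i \<in> E - I" for i
  proof -
    have "\<bar>w \<bullet> v i\<bar> / (?y \<bullet> v i) \<le> (\<Sum>i\<in>E - I. \<bar>w \<bullet> v i\<bar> / (?y \<bullet> v i))"
      by (rule member_le_sum[OF i]) (use ypos E(1) in \<open>auto simp: less_imp_le\<close>)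
    then have "\<bar>w \<bullet> v i\<bar> / (?y \<bullet> v i) < t" by (simp add: t_def)
    then show ?thesis using ypos[OF i] by (simp add: pos_divide_less_eq)
  qed
  have eq: "(w - t *\<^sub>R ?y) \<bullet> v i = w \<bullet> v i - t * (?y \<bullet> v i)" for i
    by (simp only: inner_diff_left inner_scaleR_left)
  have "\<forall>i\<in>J. (w - t *\<^sub>R ?y) \<bullet> v i = 0"
  proof
    fix i assume "i \<in> J"
    then show "(w - t *\<^sub>R ?y) \<bullet> v i = 0" using wi[of i] y0[of i] E(2) unfolding eq by auto
  qed
  moreover have "\<forall>i\<in>E - J. (w - t *\<^sub>R ?y) \<bullet> v i < 0"
  proof
    fix i assume i: "i \<in> E - J"
    show "(w - t *\<^sub>R ?y) \<bullet> v i < 0"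
    proof (cases "i \<in> I")
      case True
      have "0 < wall v (I - {i}) i \<bullet> wall v (I - {i}) i" using wall_nonzero[OF ind True] by simp
      then show ?thesis using wi[OF True] y0[OF True] i unfolding eq by simp
    next
      case False
      then have "i \<in> E - I" using i by simp
      from t[OF this] show ?thesis unfolding eq by linarith
    qed
  qed
  ultimately show "exposed v E J" unfolding exposed_def using E by blast
qed

lemma exposed_add_zero:
  assumes "v i0 = 0" "i0 \<in> I" "i0 \<in> E" "exposed v (E - {i0}) (I - {i0})"
  shows "exposed v E I"
proof -
  obtain w where w: "I - {i0} \<subseteq> E - {i0}" "\<forall>i\<in>I - {i0}. w \<bullet> v i = 0" "\<forall>i\<in>E - {i0} - (I - {i0}). w \<bullet> v i < 0"
    using assms(4) unfolding exposed_def by blast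
  have "I \<subseteq> E" using w(1) assms(3) by auto
  moreover have "\<forall>i\<in>I. w \<bullet> v i = 0"
    using w(2) assms(1) by (metis DiffI inner_zero_right singletonD)
  moreover have "E - {i0} - (I - {i0}) = E - I" using assms(2) by auto
  ultimately show ?thesis unfolding exposed_def using w(3) by metis
qed

lemma exposed_remove_zero:
  assumes "i0 \<in> I" "exposed v E I"
  shows "exposed v (E - {i0}) (I - {i0})"
proof -
  have "E - {i0} - (I - {i0}) = E - I" using assms(1) by auto
  then show ?thesis using assms(2) unfolding exposed_def by (metis DiffD1 Diff_mono subset_refl)
qed

locale generic_walk =
  fixes x :: "nat \<Rightarrow> 'a::euclidean_space" and n :: nat
  assumes gen: "generic_increments x {1..n}" and dim_le: "DIM('a) \<le> n"
begin

abbreviation "p \<equiv> pts n x"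

lemma card_aff_dim:
  assumes "I \<subseteq> {..n}" "card I = Suc k" "k \<le> DIM('a)"
  shows "aff_dim (p ` I) = int k"
proof -
  have fI: "finite I" using assms(1) finite_subset by auto
  obtain i0 where i0: "i0 \<in> I" using assms(2) by (metis card_eq_0_iff ex_in_conv nat.simps(3))
  have "indep (\<lambda>i. p i - p i0) (I - {i0})"
    by (rule indep_pts[OF gen]) (use assms i0 fI in auto)
  then have "dim ((\<lambda>i. p i - p i0) ` (I - {i0})) = k"
    using indep_dim[of "I - {i0}"] fI i0 assms(2) by simp
  moreover have "(\<lambda>i. p i - p i0) ` I = insert 0 ((\<lambda>i. p i - p i0) ` (I - {i0}))"
    using i0 by auto
  ultimately have "dim ((\<lambda>i. p i - p i0) ` I) = k" by (simp only: dim_insert_zero)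
  then show ?thesis
    using aff_dim_eq_dim_subtract[of "p i0" "p ` I"] i0 by (simp add: hull_inc image_image)
qed

lemma aff_dim_card:
  assumes "I \<subseteq> {..n}" "aff_dim (p ` I) = int k" "k < DIM('a)"
  shows "card I = Suc k"
proof -
  have fI: "finite I" using assms(1) finite_subset by auto
  have "card I \<noteq> 0"
  proof
    assume "card I = 0"
    then have "I = {}" using fI by simp
    then show False using assms(2) by (simp add: aff_dim_empty)
  qed
  then obtain m where m: "card I = Suc m" by (metis not0_implies_Suc)
  show ?thesis
  proof (cases "m \<le> DIM('a)")
    case True
    then show ?thesis using card_aff_dim[OF assms(1) m True] assms(2) m by simp
  next
    case False
    then obtain S where S: "S \<subseteq> I" "card S = Suc (DIM('a))" using m by (metis Suc_le_mono nat_le_linear obtain_subset_with_card_n)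
    have "aff_dim (p ` S) = int (DIM('a))" by (rule card_aff_dim) (use S assms(1) in auto)
    moreover have "aff_dim (p ` S) \<le> aff_dim (p ` I)" using S(1) by (intro aff_dim_subset image_mono)
    ultimately show ?thesis using assms(2,3) by simp
  qed
qed

text \<open>The cell conditions are formulated for all index sets, but only those of faces contribute.\<close>
lemma exposed_if_cell_nonnull:
  assumes I: "I \<subseteq> {..n}" "card I = Suc k" "k < DIM('a)" and J: "J \<subseteq> I" "i0 \<in> J"
    and pos: "measure std_gaussian {z. cell (\<lambda>i. p i - p i0) {..n} J I z} \<noteq> 0"
  shows "exposed_pts p {..n} I" "exposed_pts p {..n} J"
proof -
  let ?v = "\<lambda>i. p i - p i0" and ?E = "{..n} - {i0}" and ?I = "I - {i0}" and ?J = "J - {i0}"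
  have fI: "finite I" using I(1) finite_subset by auto
  have i0: "i0 \<in> I" "i0 \<in> {..n}" "i0 \<le> n" using I(1) J by auto
  have cI: "card ?I = k" using I(2) i0 fI by simp
  have sub: "finite ?E" "?J \<subseteq> ?I" "?I \<subseteq> ?E" using I(1) J by auto
  have ind: "indep ?v ?I" by (rule indep_pts[OF gen i0(3)]) (use sub cI I(3) in auto)
  have indi: "indep ?v (insert i ?I)" if "i \<in> ?E" for i
    by (rule indep_pts[OF gen i0(3)]) (use sub cI I(3) that fI in \<open>auto simp: card_insert_if\<close>)
  have rem: "cell ?v {..n} J I z = cell ?v ?E ?J ?I z" for z
    by (rule cell_remove_zero[OF fI _ J(2)]) simp
  have ae1: "AE z in std_gaussian. \<forall>i\<in>?E - ?J. z \<bullet> wall ?v (?I - {i}) i \<noteq> 0"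
  proof (rule AE_finite_allI)
    fix i assume i: "i \<in> ?E - ?J"
    have "insert i ?I - {i} = ?I - {i}" by auto
    then have "wall ?v (?I - {i}) i \<noteq> 0" using wall_nonzero[OF indi[of i], of i] i by auto
    then show "AE z in std_gaussian. z \<bullet> wall ?v (?I - {i}) i \<noteq> 0" by (rule AE_std_gaussian_inner_nonzero)
  qed simp
  have nae: "\<not> (AE z in std_gaussian. \<not> cell ?v ?E ?J ?I z)"
  proof
    assume ae: "AE z in std_gaussian. \<not> cell ?v ?E ?J ?I z"
    have "{z. cell ?v {..n} J I z} \<in> sets (std_gaussian :: 'a measure)"
      using measurable_cell_measure(2)[OF fI, of p i0 "{..n}" J] by simp
    moreover have "AE z in std_gaussian. z \<notin> {z. cell ?v {..n} J I z}" using ae unfolding rem by simp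
    ultimately have "{z. cell ?v {..n} J I z} \<in> null_sets (std_gaussian :: 'a measure)"
      by (simp only: AE_iff_null_sets)
    then have "emeasure std_gaussian {z. cell ?v {..n} J I z} = 0" by (rule null_setsD1)
    then show False using pos by (simp add: measure_def)
  qed
  have "\<exists>z. cell ?v ?E ?J ?I z \<and> (\<forall>i\<in>?E - ?J. z \<bullet> wall ?v (?I - {i}) i \<noteq> 0)"
  proof (rule ccontr)
    assume none: "\<not> ?thesis"
    have "AE z in std_gaussian. \<not> cell ?v ?E ?J ?I z"
      using ae1 by eventually_elim (use none in blast)
    with nae show False ..
  qed
  then obtain z where z: "cell ?v ?E ?J ?I z" "\<And>i. i \<in> ?E - ?J \<Longrightarrow> z \<bullet> wall ?v (?I - {i}) i \<noteq> 0" by auto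
  have gens: "exposed ?v ?E ?I \<and> exposed ?v ?E ?J"
  proof (rule conjI)
    show "exposed ?v ?E ?I"
      by (rule exposed_of_generic_cell(1)[where J = ?J and z = z, OF sub ind])
        (rule indi, blast, rule z(1), rule z(2), blast)
    show "exposed ?v ?E ?J"
      by (rule exposed_of_generic_cell(2)[where I = ?I and z = z, OF sub ind])
        (rule indi, blast, rule z(1), rule z(2), blast)
  qed
  have "exposed ?v ?E ?I" "exposed ?v ?E ?J"
    using gens by blast+
  then show "exposed_pts p {..n} I" "exposed_pts p {..n} J"
    using exposed_add_zero[of ?v i0] i0 J(2) by (simp_all add: exposed_pts_iff)
qed

definition angle_sum :: "nat \<Rightarrow> nat \<Rightarrow> real" where
  "angle_sum j k = (\<Sum>F\<in>faces j (convex hull (p ` {..n})). conic_intrinsic_volume k (tangent_cone F (convex hull (p ` {..n}))))"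

definition cell_mass :: "nat set \<Rightarrow> nat set \<Rightarrow> real" where
  "cell_mass J I = measure std_gaussian {z. cell (\<lambda>i. p i - p (Min J)) {..n} J I z}"

definition exposed_faces :: "nat \<Rightarrow> nat set set" where
  "exposed_faces j = {J. exposed_pts p {..n} J \<and> aff_dim (p ` J) = int j}"

lemma angle_sum_eq: "angle_sum j k = (\<Sum>J\<in>exposed_faces j. \<Sum>I\<in>{I. J \<subseteq> I \<and> I \<in> exposed_faces k}. cell_mass J I)"
  unfolding angle_sum_def exposed_faces_def cell_mass_def by (subst angle_sum_convex_hull) simp_all

lemma exposed_facesD: "J \<in> exposed_faces j \<Longrightarrow> j < DIM('a) \<Longrightarrow> J \<subseteq> {..n} \<and> card J = Suc j"
  using aff_dim_card unfolding exposed_faces_def exposed_pts_def by blast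

lemma cell_mass_zero:
  assumes "I \<subseteq> {..n}" "card I = Suc k" "k < DIM('a)" "J \<subseteq> I" "card J = Suc j"
  shows "I \<notin> exposed_faces k \<or> J \<notin> exposed_faces j \<Longrightarrow> cell_mass J I = 0"
proof (rule ccontr)
  assume a: "I \<notin> exposed_faces k \<or> J \<notin> exposed_faces j" "cell_mass J I \<noteq> 0"
  have "finite J" "J \<noteq> {}" using assms(5) by (auto intro: card_ge_0_finite)
  then have mJ: "Min J \<in> J" by (rule Min_in)
  have "card J \<le> card I" using assms(1,4) finite_subset by (intro card_mono) auto
  then have "j \<le> DIM('a)" "J \<subseteq> {..n}" using assms by auto
  then show False
    using a exposed_if_cell_nonnull[OF assms(1-4) mJ] card_aff_dim[OF assms(1,2)] card_aff_dim[OF _ assms(5)] assms(3)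
    unfolding cell_mass_def exposed_faces_def by auto
qed

lemma sum_faces_eq:
  assumes j: "j < DIM('a)" and k: "k < DIM('a)"
  shows "(\<Sum>J\<in>exposed_faces j. \<Sum>I\<in>{I. J \<subseteq> I \<and> I \<subseteq> {..n} \<and> card I = Suc k}. cell_mass J I) = cell_sum n j k p"
    and "angle_sum j k = cell_sum n j k p"
proof -
  let ?A = "{J. J \<subseteq> {..n} \<and> card J = Suc j}" and ?B = "\<lambda>J. {I. J \<subseteq> I \<and> I \<subseteq> {..n} \<and> card I = Suc k}"
  have fin: "finite ?A" "finite (?B J)" for J by auto
  have sub: "exposed_faces j \<subseteq> ?A" using exposed_facesD[OF _ j] by auto
  have "cell_sum n j k p = (\<Sum>I\<in>{I. I \<subseteq> {..n} \<and> card I = Suc k}. \<Sum>J\<in>{J. J \<in> ?A \<and> J \<subseteq> I}. cell_mass J I)"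
    unfolding cell_sum_def cell_mass_def by (intro sum.cong refl) auto
  also have "\<dots> = (\<Sum>J\<in>?A. \<Sum>I\<in>{I. I \<in> {I. I \<subseteq> {..n} \<and> card I = Suc k} \<and> J \<subseteq> I}. cell_mass J I)"
    by (rule sum.swap_restrict) auto
  also have "\<dots> = (\<Sum>J\<in>?A. \<Sum>I\<in>?B J. cell_mass J I)"
    by (intro sum.cong refl) auto
  also have "\<dots> = (\<Sum>J\<in>exposed_faces j. \<Sum>I\<in>?B J. cell_mass J I)"
    using cell_mass_zero[OF _ _ k] by (intro sum.mono_neutral_right fin sub ballI sum.neutral) auto
  finally show 1: "(\<Sum>J\<in>exposed_faces j. \<Sum>I\<in>?B J. cell_mass J I) = cell_sum n j k p" ..
  have "(\<Sum>J\<in>exposed_faces j. \<Sum>I\<in>{I. J \<subseteq> I \<and> I \<in> exposed_faces k}. cell_mass J I) = (\<Sum>J\<in>exposed_faces j. \<Sum>I\<in>?B J. cell_mass J I)"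
  proof (rule sum.cong[OF refl])
    fix J assume J: "J \<in> exposed_faces j"
    show "(\<Sum>I\<in>{I. J \<subseteq> I \<and> I \<in> exposed_faces k}. cell_mass J I) = (\<Sum>I\<in>?B J. cell_mass J I)"
      using exposed_facesD[OF _ k] exposed_facesD[OF J j] cell_mass_zero[OF _ _ k]
      by (intro sum.mono_neutral_left fin) auto
  qed
  then show "angle_sum j k = cell_sum n j k p" unfolding angle_sum_eq 1 .
qed

text \<open>A proper face lies in a hyperplane, so only the hull itself has full dimension.\<close>
lemma exposed_faces_full: "exposed_faces (DIM('a)) = {{..n}}"
proof -
  have full: "card {..n} = Suc n" by simp
  obtain S where S: "S \<subseteq> {..n}" "card S = Suc (DIM('a))" using dim_le full by (metis Suc_le_mono obtain_subset_with_card_n)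
  have "aff_dim (p ` S) \<le> aff_dim (p ` {..n})" using S(1) by (intro aff_dim_subset image_mono)
  then have ad: "aff_dim (p ` {..n}) = int (DIM('a))"
    using card_aff_dim[OF S] aff_dim_le_DIM[of "p ` {..n}"] by simp
  have "exposed_pts p {..n} {..n}"
    unfolding exposed_pts_def by (intro conjI exI[of _ 0] exI[of _ 0]) auto
  moreover have "I = {..n}" if "exposed_pts p {..n} I" "aff_dim (p ` I) = int (DIM('a))" for I
  proof (rule ccontr)
    assume neq: "I \<noteq> {..n}"
    obtain w b where w: "I \<subseteq> {..n}" "\<forall>i\<in>I. w \<bullet> p i = b" "\<forall>i\<in>{..n} - I. w \<bullet> p i < b" "I \<noteq> {}"
      using \<open>exposed_pts p {..n} I\<close> unfolding exposed_pts_def by blast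
    obtain i1 where i1: "i1 \<in> {..n} - I" using neq w(1) by blast
    obtain i0 where i0: "i0 \<in> I" using w(4) by blast
    have w0: "w \<noteq> 0" using w(2,3) i0 i1 by auto
    have "p ` I \<subseteq> {y. w \<bullet> y = b}" using w(2) by auto
    then have "aff_dim (p ` I) \<le> aff_dim {y. w \<bullet> y = b}" by (rule aff_dim_subset)
    then show False using \<open>aff_dim (p ` I) = int (DIM('a))\<close> aff_dim_hyperplane[OF w0, of b] by simp
  qed
  ultimately show ?thesis unfolding exposed_faces_def using ad by auto
qed

text \<open>The Gauss--Bonnet relation expresses the angle of the full-dimensional tangent cone through
  the cells of its proper faces.\<close>
lemma cell_mass_full:
  assumes J: "J \<in> exposed_faces j" and j: "j < DIM('a)"
  shows "cell_mass J {..n} = (\<Sum>k<DIM('a). (-1) ^ (DIM('a) - 1 - k) * (\<Sum>I\<in>{I. J \<subseteq> I \<and> I \<subseteq> {..n} \<and> card I = Suc k}. cell_mass J I))"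
proof -
  have JD: "J \<subseteq> {..n}" "card J = Suc j" using exposed_facesD[OF J j] by auto
  have fJ: "finite J" "J \<noteq> {}" using JD by (auto intro: card_ge_0_finite)
  define i0 where "i0 = Min J"
  have i0J: "i0 \<in> J" unfolding i0_def using fJ by (rule Min_in)
  have i0: "i0 \<in> {..n}" "i0 \<le> n" using i0J JD(1) by auto
  let ?v = "\<lambda>i. p i - p i0" and ?E = "{..n} - {i0}" and ?J = "J - {i0}"
  have mass: "cell_mass J I = measure std_gaussian {z. cell ?v {..n} J I z}" for I by (simp add: cell_mass_def i0_def)
  \<comment> \<open>The base point contributes the zero vector, which is left out to obtain independent generators.\<close>
  interpret C: generic_cone ?v ?E ?J
  proof
    show "?J \<subseteq> ?E" using JD(1) by auto
    show "indep ?v S" if "S \<subseteq> ?E" "card S \<le> DIM('a)" for S by (rule indep_pts[OF gen i0(2) that])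
    show "card ?J < DIM('a)" using JD(2) i0J fJ j by simp
    show "DIM('a) \<le> card ?E" using dim_le i0 by simp
    show "exposed ?v ?E ?J"
      using J unfolding exposed_faces_def by (intro exposed_remove_zero i0J) (simp add: exposed_pts_iff[OF i0J])
  qed simp
  have full: "span (?v ` {..n}) = UNIV"
    using C.span_generators span_mono[of "?v ` ?E" "?v ` {..n}"] by auto
  have "cell ?v {..n} J {..n} z \<longleftrightarrow> z \<in> fcone ?v {..n} J" for z
  proof -
    have "closest_point UNIV z = z" by (rule closest_point_self) simp
    then show ?thesis unfolding cell_iff[OF finite_atMost] full by simp
  qed
  then have "{z. cell ?v {..n} J {..n} z} = fcone ?v {..n} J" by blast
  then have "cell_mass J {..n} = measure std_gaussian (fcone ?v {..n} J)" unfolding mass by (rule arg_cong)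
  also have "fcone ?v {..n} J = fcone ?v ?E ?J" by (rule fcone_remove_zero[OF _ _ i0J]) simp_all
  also have "measure std_gaussian (fcone ?v ?E ?J) =
     (\<Sum>I\<in>C.cells. (-1) ^ (DIM('a) - 1 - card I) * measure std_gaussian {z. cell ?v ?E ?J I z})"
    by (rule C.gauss_bonnet)
  also have "\<dots> = (\<Sum>I\<in>{I. J \<subseteq> I \<and> I \<subseteq> {..n} \<and> card I - 1 < DIM('a)}. (-1) ^ (DIM('a) - 1 - (card I - 1)) * cell_mass J I)"
  proof (rule sum.reindex_bij_witness[of _ "\<lambda>I. I - {i0}" "insert i0"])
    fix I assume I: "I \<in> C.cells"
    then have I': "?J \<subseteq> I" "I \<subseteq> ?E" "card I < DIM('a)" "finite I" using C.cellsD[OF I] by simp_all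
    then have i0I: "i0 \<notin> I" by auto
    then show eq: "insert i0 I - {i0} = I" by simp
    have c: "card (insert i0 I) - 1 = card I" using i0I I'(4) by simp
    show "insert i0 I \<in> {I. J \<subseteq> I \<and> I \<subseteq> {..n} \<and> card I - 1 < DIM('a)}"
      using I' c i0(1) by auto
    have "cell ?v {..n} J (insert i0 I) z = cell ?v ?E ?J I z" for z
      using cell_remove_zero[of "insert i0 I" ?v i0 J "{..n}" z] I'(4) i0J unfolding eq by simp
    then have "{z. cell ?v {..n} J (insert i0 I) z} = {z. cell ?v ?E ?J I z}" by blast
    then show "(-1) ^ (DIM('a) - 1 - (card (insert i0 I) - 1)) * cell_mass J (insert i0 I) =
      (-1) ^ (DIM('a) - 1 - card I) * measure std_gaussian {z. cell ?v ?E ?J I z}"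
      unfolding c by (simp only: mass)
  next
    fix I assume I: "I \<in> {I. J \<subseteq> I \<and> I \<subseteq> {..n} \<and> card I - 1 < DIM('a)}"
    then have "i0 \<in> I" "finite I" using i0J finite_subset by auto
    then show "insert i0 (I - {i0}) = I" "I - {i0} \<in> C.cells"
      using I unfolding C.cells_def by auto
  qed
  also have "\<dots> = (\<Sum>k<DIM('a). \<Sum>I\<in>{I \<in> {I. J \<subseteq> I \<and> I \<subseteq> {..n} \<and> card I - 1 < DIM('a)}. card I - 1 = k}. (-1) ^ (DIM('a) - 1 - (card I - 1)) * cell_mass J I)"
    by (rule sum.group[symmetric]) auto
  also have "\<dots> = (\<Sum>k<DIM('a). (-1) ^ (DIM('a) - 1 - k) * (\<Sum>I\<in>{I. J \<subseteq> I \<and> I \<subseteq> {..n} \<and> card I = Suc k}. cell_mass J I))"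
  proof (rule sum.cong[OF refl])
    fix k assume k: "k \<in> {..<DIM('a)}"
    have "card I - 1 = k \<longleftrightarrow> card I = Suc k" if "J \<subseteq> I" "I \<subseteq> {..n}" for I
    proof -
      have "finite I" "I \<noteq> {}" using that fJ(2) finite_subset by auto
      then have "card I > 0" by (simp add: card_gt_0_iff)
      then show ?thesis by linarith
    qed
    then have eq: "{I \<in> {I. J \<subseteq> I \<and> I \<subseteq> {..n} \<and> card I - 1 < DIM('a)}. card I - 1 = k} = {I. J \<subseteq> I \<and> I \<subseteq> {..n} \<and> card I = Suc k}"
      using k by auto
    show "(\<Sum>I\<in>{I \<in> {I. J \<subseteq> I \<and> I \<subseteq> {..n} \<and> card I - 1 < DIM('a)}. card I - 1 = k}. (-1) ^ (DIM('a) - 1 - (card I - 1)) * cell_mass J I) =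
      (-1) ^ (DIM('a) - 1 - k) * (\<Sum>I\<in>{I. J \<subseteq> I \<and> I \<subseteq> {..n} \<and> card I = Suc k}. cell_mass J I)"
      unfolding eq sum_distrib_left by (rule sum.cong) auto
  qed
  finally show ?thesis .
qed

lemma angle_sum_full:
  assumes j: "j < DIM('a)"
  shows "angle_sum j (DIM('a)) = (\<Sum>k<DIM('a). (-1) ^ (DIM('a) - 1 - k) * cell_sum n j k p)"
proof -
  have "angle_sum j (DIM('a)) = (\<Sum>J\<in>exposed_faces j. cell_mass J {..n})"
    unfolding angle_sum_eq exposed_faces_full
  proof (rule sum.cong[OF refl])
    fix J assume "J \<in> exposed_faces j"
    then have "{I. J \<subseteq> I \<and> I \<in> {{..n}}} = {{..n}}" using exposed_facesD[OF _ j] by auto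
    then show "(\<Sum>I\<in>{I. J \<subseteq> I \<and> I \<in> {{..n}}}. cell_mass J I) = cell_mass J {..n}" by simp
  qed
  also have "\<dots> = (\<Sum>J\<in>exposed_faces j. \<Sum>k<DIM('a). (-1) ^ (DIM('a) - 1 - k) * (\<Sum>I\<in>{I. J \<subseteq> I \<and> I \<subseteq> {..n} \<and> card I = Suc k}. cell_mass J I))"
    by (rule sum.cong[OF refl]) (rule cell_mass_full[OF _ j])
  also have "\<dots> = (\<Sum>k<DIM('a). \<Sum>J\<in>exposed_faces j. (-1) ^ (DIM('a) - 1 - k) * (\<Sum>I\<in>{I. J \<subseteq> I \<and> I \<subseteq> {..n} \<and> card I = Suc k}. cell_mass J I))"
    by (rule sum.swap)
  also have "\<dots> = (\<Sum>k<DIM('a). (-1) ^ (DIM('a) - 1 - k) * cell_sum n j k p)"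
    by (rule sum.cong[OF refl]) (simp add: sum_faces_eq(1)[OF j, symmetric] sum_distrib_left)
  finally show ?thesis .
qed

end

section \<open>Random walks with exchangeable increments\<close>

lemma indep_if_not_dependent_family:
  assumes "finite S" "\<not> dependent_family S v"
  shows "indep v S"
  unfolding indep_iff_no_relation[OF assms(1)]
proof (intro ballI notI, elim exE)
  fix i c assume i: "i \<in> S" and c: "v i = (\<Sum>l\<in>S - {i}. c l *\<^sub>R v l)"
  have "(\<Sum>l\<in>S. (c(i := - 1)) l *\<^sub>R v l) = - v i + (\<Sum>l\<in>S - {i}. (c(i := - 1)) l *\<^sub>R v l)"
    using assms(1) i by (simp add: sum.remove)
  also have "(\<Sum>l\<in>S - {i}. (c(i := - 1)) l *\<^sub>R v l) = (\<Sum>l\<in>S - {i}. c l *\<^sub>R v l)"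
    by (rule sum.cong) auto
  also have "- v i + \<dots> = 0" by (simp add: c[symmetric])
  finally have "(\<Sum>l\<in>S. (c(i := - 1)) l *\<^sub>R v l) = 0" .
  moreover have "(c(i := - 1)) i \<noteq> 0" by simp
  ultimately show False using assms(2) i unfolding dependent_family_def by blast
qed

text \<open>A block system can be laid out along some rearranged walk so that its block sums are
  consecutive increments between cut points; the positions of the rearranged walk being independent,
  so are the block sums.\<close>
lemma generic_increments_if_rearranged:
  fixes x :: "nat \<Rightarrow> 'a::euclidean_space"
  assumes n: "DIM('a) \<le> n"
    and ind: "\<And>\<pi> I. \<pi> permutes {1..n} \<Longrightarrow> I \<subseteq> {1..n} \<Longrightarrow> card I = DIM('a) \<Longrightarrow>
      indep (\<lambda>i. pts n (\<lambda>m. x (\<pi> m)) i - pts n (\<lambda>m. x (\<pi> m)) 0) I"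
  shows "generic_increments x {1..n}"
  unfolding generic_increments_def
proof (intro allI impI ballI)
  fix k \<B> assume k: "k \<le> DIM('a)" and B: "\<B> \<in> block_systems {1..n} k"
  note BD = block_systemsD[OF B]
  obtain Bs where Bs: "set Bs = \<B>" "distinct Bs" using finite_distinct_list[OF BD(1)] by blast
  define bs where "bs = map sorted_list_of_set Bs"
  define v where "v = sorted_list_of_set ({1..n} - \<Union>\<B>)"
  have fB: "finite b" if "b \<in> \<B>" for b using BD(5)[OF that] finite_subset by blast
  have sb: "set (sorted_list_of_set b) = b" if "b \<in> set Bs" for b using fB that Bs(1) by simp
  have setbs: "set ` set bs = \<B>"
  proof -
    have "set ` set bs = (\<lambda>b. set (sorted_list_of_set b)) ` set Bs" by (simp add: bs_def image_image)
    also have "\<dots> = (\<lambda>b. b) ` set Bs" by (rule image_cong[OF refl]) (rule sb)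
    finally show ?thesis using Bs(1) by simp
  qed
  have U: "set (concat bs) = \<Union>\<B>" using setbs by (simp add: set_concat)
  have len: "length bs = k" using distinct_card[OF Bs(2)] Bs(1) BD(2) by (simp add: bs_def)
  have ne: "[] \<notin> set bs"
  proof
    assume "[] \<in> set bs"
    then have "{} \<in> set ` set bs" by force
    then show False using BD(4) setbs by blast
  qed
  have inj: "inj_on sorted_list_of_set (set Bs)"
    by (rule inj_on_inverseI[where g = set]) (rule sb)
  have dbs: "distinct (concat bs)"
  proof (rule distinct_concat)
    show "distinct bs" using inj Bs(2) by (simp add: bs_def distinct_map)
    show "distinct ys" if "ys \<in> set bs" for ys using that by (auto simp: bs_def)
    show "set ys \<inter> set zs = {}" if yz: "ys \<in> set bs" "zs \<in> set bs" "ys \<noteq> zs" for ys zs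
    proof -
      obtain b c where bc: "b \<in> set Bs" "ys = sorted_list_of_set b" "c \<in> set Bs" "zs = sorted_list_of_set c"
        using yz by (auto simp: bs_def)
      then have "b \<noteq> c" using yz(3) by blast
      then show ?thesis using BD(3)[of b c] bc sb Bs(1) by simp
    qed
  qed
  let ?xs = "concat bs @ v"
  have setv: "set v = {1..n} - \<Union>\<B>" "distinct v" by (simp_all add: v_def)
  have dxs: "distinct ?xs" using dbs setv U by auto
  have sxs: "set ?xs = {1..n}" using setv U BD(6) by auto
  have "?xs \<in> permutations_of_set {1..n}" unfolding permutations_of_set_iff using dxs sxs by blast
  then obtain \<pi> where \<pi>: "\<pi> permutes {1..n}" "?xs = map \<pi> [1..<Suc n]"
    using bij_betw_imp_surj_on[OF bij_betw_permutes_orderings[of n]] by (metis (no_types, lifting) imageE mem_Collect_eq)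
  let ?q = "\<lambda>i. pts n (\<lambda>m. x (\<pi> m)) i - pts n (\<lambda>m. x (\<pi> m)) 0"
  have lxs: "length ?xs = n" using \<pi>(2) by (simp del: upt_Suc)
  have "([], bs, v) \<in> decomps k ?xs" using ne len by (simp add: decomps_def)
  then have cuts: "cuts [] bs \<subseteq> {..n}" "card (cuts [] bs) = Suc k"
    using bij_betwE[OF bij_betw_cuts[of k ?xs]] lxs by fastforce+
  have z: "cut_pos [] bs 0 = 0" by (simp add: cut_pos_def)
  then have z0: "0 \<in> cuts [] bs" unfolding cuts_def by (metis atMost_iff image_eqI le0)
  have fc: "finite (cuts [] bs)" using cuts(1) finite_subset by blast
  define I0 where "I0 = cuts [] bs - {0}"
  have I0: "I0 \<subseteq> {1..n}" "card I0 = k" "finite I0"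
  proof -
    show "I0 \<subseteq> {1..n}"
    proof
      fix i assume "i \<in> I0"
      then have "i \<le> n" "i \<noteq> 0" using cuts(1) unfolding I0_def by auto
      then show "i \<in> {1..n}" by simp
    qed
    show "card I0 = k" "finite I0" using cuts(2) z0 fc unfolding I0_def by simp_all
  qed
  \<comment> \<open>General position speaks of exactly \<open>DIM('a)\<close> times, so the cut points are supplemented by others.\<close>
  have "card ({1..n} - I0) = n - k" using I0 by (simp add: card_Diff_subset)
  then have "DIM('a) - k \<le> card ({1..n} - I0)" using n by simp
  then obtain R where R: "R \<subseteq> {1..n} - I0" "card R = DIM('a) - k" "finite R"
    by (rule obtain_subset_with_card_n)
  have "card (I0 \<union> R) = card I0 + card R" by (rule card_Un_disjoint) (use I0 R in auto)
  then have "card (I0 \<union> R) = DIM('a)" using R(2) I0(2) k by simp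
  then have "indep ?q (I0 \<union> R)" using I0(1) R(1) by (intro ind \<pi>(1)) auto
  then have "indep ?q I0" by (rule indep_subset) blast
  then have dI0: "dim (?q ` I0) = k" using indep_dim[OF I0(3)] I0(2) by simp
  have "?q ` cuts [] bs = insert 0 (?q ` I0)" using z0 unfolding I0_def by auto
  then have dcuts: "dim (?q ` cuts [] bs) = k" using dI0 by (simp only: dim_insert_zero)
  have "(\<lambda>i. walk_at x ?xs i - walk_at x ?xs 0) ` cuts [] bs = ?q ` cuts [] bs"
  proof (rule image_cong[OF refl])
    fix i assume "i \<in> cuts [] bs"
    then have "i \<le> n" using cuts(1) by auto
    then show "walk_at x ?xs i - walk_at x ?xs 0 = ?q i" unfolding \<pi>(2) by (simp only: walk_at_permuted le0)
  qed
  then have "span (?q ` cuts [] bs) = span (vsum x ` \<B>)"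
    using span_walk_cuts[of "[]" bs v 0 x] dxs z setbs by simp
  then have "dim (vsum x ` \<B>) = k" using dcuts by (metis dim_span)
  then show "indep (vsum x) \<B>" using BD(1,2) by (intro indep_if_dim) simp_all
qed

lemma pts_restrict: "pts n (restrict x {1..n}) = pts n x"
  unfolding pts_def by (intro ext if_cong sum.cong refl) simp

lemma measurable_pts: "(\<lambda>x. pts n x) \<in> measurable (Pi\<^sub>M {1..n} (\<lambda>_. borel)) (borel :: (nat \<Rightarrow> 'a::euclidean_space) measure)"
proof (rule measurable_coordinatewise_then_product)
  fix i
  show "(\<lambda>x. pts n x i :: 'a) \<in> borel_measurable (Pi\<^sub>M {1..n} (\<lambda>_. borel))"
  proof (cases "i \<le> n")
    case True
    have "(\<lambda>x. \<Sum>m=1..i. x m :: 'a) \<in> borel_measurable (Pi\<^sub>M {1..n} (\<lambda>_. borel))"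
      by (intro borel_measurable_sum measurable_component_singleton) (use True in auto)
    then show ?thesis using True by (simp add: pts_def)
  qed (simp add: pts_def)
qed

lemma walk_hull_eq_pts: "walk_hull \<xi> n \<omega> = convex hull (pts n (\<lambda>m. \<xi> m \<omega>) ` {..n})"
proof -
  have "(\<lambda>i. walk \<xi> i \<omega>) ` {0..n} = pts n (\<lambda>m. \<xi> m \<omega>) ` {..n}"
    unfolding atLeast0AtMost by (rule image_cong[OF refl]) (simp add: walk_def pts_def)
  then show ?thesis by (simp add: walk_hull_def)
qed

locale exchangeable_walk = prob_space M for M :: "'w measure" +
  fixes \<xi> :: "nat \<Rightarrow> 'w \<Rightarrow> 'a::euclidean_space" and n :: nat
  assumes dim_le: "DIM('a) \<le> n"
    and meas: "\<And>i. i \<in> {1..n} \<Longrightarrow> \<xi> i \<in> borel_measurable M"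
    and exch: "exchangeable M n \<xi>"
    and gp: "general_position M n \<xi>"
begin

abbreviation W :: "(nat \<Rightarrow> nat) \<Rightarrow> 'w \<Rightarrow> nat \<Rightarrow> 'a" where
  "W \<pi> \<omega> \<equiv> pts n (\<lambda>m. \<xi> (\<pi> m) \<omega>)"

lemma measurable_increments:
  assumes "\<pi> permutes {1..n}"
  shows "(\<lambda>\<omega>. \<lambda>i\<in>{1..n}. \<xi> (\<pi> i) \<omega>) \<in> measurable M (Pi\<^sub>M {1..n} (\<lambda>_. borel))"
proof (rule measurable_restrict)
  fix i assume "i \<in> {1..n}"
  then have "\<pi> i \<in> {1..n}" using permutes_in_image[OF assms] by blast
  then show "(\<lambda>\<omega>. \<xi> (\<pi> i) \<omega>) \<in> borel_measurable M" using meas by simp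
qed

lemma measurable_W:
  assumes "\<pi> permutes {1..n}"
  shows "W \<pi> \<in> borel_measurable M"
  using measurable_compose[OF measurable_increments[OF assms] measurable_pts] by (simp only: pts_restrict)

text \<open>The walk is a measurable function of its increments, so exchangeability carries over to it.\<close>
lemma distr_W:
  assumes p: "\<pi> permutes {1..n}"
  shows "distr M borel (W \<pi>) = distr M borel (W id)"
proof -
  have 1: "distr M borel (W \<sigma>) = distr (distr M (Pi\<^sub>M {1..n} (\<lambda>_. borel)) (\<lambda>\<omega>. \<lambda>i\<in>{1..n}. \<xi> (\<sigma> i) \<omega>)) borel (pts n)"
    if "\<sigma> permutes {1..n}" for \<sigma>
    unfolding distr_distr[OF measurable_pts measurable_increments[OF that]] comp_def by (simp only: pts_restrict)
  show ?thesis
    unfolding 1[OF p] 1[OF permutes_id]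
    using exch p unfolding exchangeable_def by simp
qed

lemma AE_indep:
  assumes p: "\<pi> permutes {1..n}" and I: "I \<subseteq> {1..n}" "card I = DIM('a)"
  shows "AE \<omega> in M. indep (\<lambda>i. W \<pi> \<omega> i - W \<pi> \<omega> 0) I"
proof -
  let ?Q = "{q :: nat \<Rightarrow> 'a. indep (\<lambda>i. q i - q 0) I}"
  have fI: "finite I" using I(1) finite_subset by blast
  have mQ: "{q \<in> space borel. q \<in> ?Q} \<in> sets borel" using borel_indep[OF fI, of 0] by simp
  have "AE \<omega> in M. \<not> dependent_family I (\<lambda>i. walk \<xi> i \<omega>)"
    using gp I unfolding general_position_def by blast
  then have "AE \<omega> in M. W id \<omega> \<in> ?Q"
  proof eventually_elim
    case (elim \<omega>)
    have "(\<lambda>i. walk \<xi> i \<omega>) i = W id \<omega> i - W id \<omega> 0" if "i \<in> I" for i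
      using that I(1) by (auto simp: walk_def pts_def)
    then have "dependent_family I (\<lambda>i. walk \<xi> i \<omega>) = dependent_family I (\<lambda>i. W id \<omega> i - W id \<omega> 0)"
      unfolding dependent_family_def by (simp cong: sum.cong)
    then show ?case using elim indep_if_not_dependent_family[OF fI] by simp
  qed
  then have "AE q in distr M borel (W id). q \<in> ?Q"
    by (subst AE_distr_iff[OF measurable_W[OF permutes_id] mQ])
  then have "AE q in distr M borel (W \<pi>). q \<in> ?Q" by (simp only: distr_W[OF p])
  then have "AE \<omega> in M. W \<pi> \<omega> \<in> ?Q"
    by (subst (asm) AE_distr_iff[OF measurable_W[OF p] mQ])
  then show ?thesis unfolding mem_Collect_eq .
qed

lemma AE_generic: "AE \<omega> in M. generic_increments (\<lambda>m. \<xi> m \<omega>) {1..n}"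
proof -
  let ?\<Pi> = "{\<pi>. \<pi> permutes {1..n}}" and ?\<I> = "{I. I \<subseteq> {1..n} \<and> card I = DIM('a)}"
  have "AE \<omega> in M. \<forall>\<pi>\<in>?\<Pi>. \<forall>I\<in>?\<I>. indep (\<lambda>i. W \<pi> \<omega> i - W \<pi> \<omega> 0) I"
  proof (intro AE_finite_allI)
    fix \<pi> I assume "\<pi> \<in> ?\<Pi>" "I \<in> ?\<I>"
    then show "AE \<omega> in M. indep (\<lambda>i. W \<pi> \<omega> i - W \<pi> \<omega> 0) I"
      unfolding mem_Collect_eq by (elim conjE) (rule AE_indep)
  qed (simp_all add: finite_permutations)
  then show ?thesis
  proof eventually_elim
    case (elim \<omega>)
    show ?case by (rule generic_increments_if_rearranged[OF dim_le]) (use elim in blast)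
  qed
qed

lemma measurable_cell_sum: "(\<lambda>q :: nat \<Rightarrow> 'a. cell_sum n j k q) \<in> borel_measurable borel"
  unfolding cell_sum_def
proof (intro borel_measurable_sum measurable_cell_measure(1))
  fix I assume "I \<in> {I. I \<subseteq> {..n} \<and> card I = Suc k}"
  then show "finite I" using finite_subset by blast
qed

lemma integrable_cell_sum:
  assumes "\<pi> permutes {1..n}"
  shows "integrable M (\<lambda>\<omega>. cell_sum n j k (W \<pi> \<omega>))"
  unfolding cell_sum_def
proof (intro Bochner_Integration.integrable_sum)
  fix I J assume "I \<in> {I. I \<subseteq> {..n} \<and> card I = Suc k}"
  then have fI: "finite I" using finite_subset by blast
  show "integrable M (\<lambda>\<omega>. measure std_gaussian {z. cell (\<lambda>i. W \<pi> \<omega> i - W \<pi> \<omega> (Min J)) {..n} J I z})"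
  proof (rule integrable_const_bound[where B = 1])
    show "AE \<omega> in M. norm (measure std_gaussian {z. cell (\<lambda>i. W \<pi> \<omega> i - W \<pi> \<omega> (Min J)) {..n} J I z}) \<le> 1"
      by (simp add: prob_space.prob_le_1[OF prob_space_std_gaussian])
    show "(\<lambda>\<omega>. measure std_gaussian {z. cell (\<lambda>i. W \<pi> \<omega> i - W \<pi> \<omega> (Min J)) {..n} J I z}) \<in> borel_measurable M"
      by (rule measurable_compose[OF measurable_W[OF assms] measurable_cell_measure(1)[OF fI]])
  qed
qed

lemma expectation_cell_sum:
  assumes k: "k < DIM('a)"
  shows "expectation (\<lambda>\<omega>. cell_sum n j k (W id \<omega>)) =
    fact j / fact n * real (stirling (n + 1) (k + 1)) * real (Stirling (k + 1) (j + 1))"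
proof -
  let ?\<Pi> = "{\<pi>. \<pi> permutes {1..n}}" and ?c = "real (fact j * Stirling (Suc k) (Suc j) * stirling (Suc n) (Suc k))"
  have same: "expectation (\<lambda>\<omega>. cell_sum n j k (W \<pi> \<omega>)) = expectation (\<lambda>\<omega>. cell_sum n j k (W id \<omega>))"
    if p: "\<pi> permutes {1..n}" for \<pi>
    using integral_distr[OF measurable_W[OF p] measurable_cell_sum, of j k]
      integral_distr[OF measurable_W[OF permutes_id] measurable_cell_sum, of j k] distr_W[OF p] by simp
  have "fact n * expectation (\<lambda>\<omega>. cell_sum n j k (W id \<omega>)) = (\<Sum>\<pi>\<in>?\<Pi>. expectation (\<lambda>\<omega>. cell_sum n j k (W id \<omega>)))"
    using card_permutations[of "{1..n}" n] by simp
  also have "\<dots> = (\<Sum>\<pi>\<in>?\<Pi>. expectation (\<lambda>\<omega>. cell_sum n j k (W \<pi> \<omega>)))"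
    by (rule sum.cong[OF refl]) (simp add: same)
  also have "\<dots> = expectation (\<lambda>\<omega>. \<Sum>\<pi>\<in>?\<Pi>. cell_sum n j k (W \<pi> \<omega>))"
    by (rule Bochner_Integration.integral_sum[symmetric]) (simp add: integrable_cell_sum)
  also have "\<dots> = expectation (\<lambda>\<omega>. ?c)"
  proof (rule integral_cong_AE)
    show "(\<lambda>\<omega>. \<Sum>\<pi>\<in>?\<Pi>. cell_sum n j k (W \<pi> \<omega>)) \<in> borel_measurable M"
      by (intro borel_measurable_sum borel_measurable_integrable integrable_cell_sum) simp
    show "AE \<omega> in M. (\<Sum>\<pi>\<in>?\<Pi>. cell_sum n j k (W \<pi> \<omega>)) = ?c"
      using AE_generic by eventually_elim (rule sum_permuted_cells[OF _ k])
  qed simp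
  also have "\<dots> = ?c" by (simp add: prob_space)
  finally show ?thesis by (simp add: field_simps)
qed

definition hull_angles :: "nat \<Rightarrow> nat \<Rightarrow> 'w \<Rightarrow> real" where
  "hull_angles j k \<omega> = (\<Sum>F\<in>faces j (walk_hull \<xi> n \<omega>). conic_intrinsic_volume k (tangent_cone F (walk_hull \<xi> n \<omega>)))"

lemma measurable_hull_angles: "hull_angles j k \<in> borel_measurable M"
  unfolding hull_angles_def walk_hull_eq_pts
  using measurable_compose[OF measurable_W[OF permutes_id] measurable_angle_sum[of "{..n}" k j]] by simp

lemma hull_angles_eq: "hull_angles j k \<omega> = generic_walk.angle_sum (\<lambda>m. \<xi> m \<omega>) n j k"
  if "generic_increments (\<lambda>m. \<xi> m \<omega>) {1..n}"
proof -
  interpret generic_walk "\<lambda>m. \<xi> m \<omega>" n using that dim_le by unfold_locales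
  show ?thesis unfolding hull_angles_def angle_sum_def walk_hull_eq_pts ..
qed

lemma expectation_hull_angles:
  assumes j: "j < DIM('a)" and k: "k < DIM('a)"
  shows "expectation (hull_angles j k) =
    fact j / fact n * real (stirling (n + 1) (k + 1)) * real (Stirling (k + 1) (j + 1))"
proof -
  have "expectation (hull_angles j k) = expectation (\<lambda>\<omega>. cell_sum n j k (W id \<omega>))"
  proof (rule integral_cong_AE)
    show "AE \<omega> in M. hull_angles j k \<omega> = cell_sum n j k (W id \<omega>)"
      using AE_generic
    proof eventually_elim
      case (elim \<omega>)
      interpret generic_walk "\<lambda>m. \<xi> m \<omega>" n using elim dim_le by unfold_locales
      show ?case using hull_angles_eq[OF elim] sum_faces_eq(2)[OF j k] by simp
    qed
  qed (use measurable_hull_angles integrable_cell_sum[OF permutes_id] in \<open>auto intro: borel_measurable_integrable\<close>)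
  then show ?thesis using expectation_cell_sum[OF k] by simp
qed

lemma expectation_hull_angles_full:
  assumes j: "j < DIM('a)"
  shows "expectation (hull_angles j (DIM('a))) =
    fact j / fact n * (\<Sum>k<DIM('a). (-1) ^ (DIM('a) - 1 - k) * (real (stirling (n + 1) (k + 1)) * real (Stirling (k + 1) (j + 1))))"
proof -
  have int: "integrable M (\<lambda>\<omega>. (-1) ^ (DIM('a) - 1 - k) * cell_sum n j k (W id \<omega>))" for k
    by (intro integrable_mult_right integrable_cell_sum permutes_id)
  have "expectation (hull_angles j (DIM('a))) = expectation (\<lambda>\<omega>. \<Sum>k<DIM('a). (-1) ^ (DIM('a) - 1 - k) * cell_sum n j k (W id \<omega>))"
  proof (rule integral_cong_AE)
    show "AE \<omega> in M. hull_angles j (DIM('a)) \<omega> = (\<Sum>k<DIM('a). (-1) ^ (DIM('a) - 1 - k) * cell_sum n j k (W id \<omega>))"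
      using AE_generic
    proof eventually_elim
      case (elim \<omega>)
      interpret generic_walk "\<lambda>m. \<xi> m \<omega>" n using elim dim_le by unfold_locales
      show ?case using hull_angles_eq[OF elim] angle_sum_full[OF j] by simp
    qed
    show "(\<lambda>\<omega>. \<Sum>k<DIM('a). (-1) ^ (DIM('a) - 1 - k) * cell_sum n j k (W id \<omega>)) \<in> borel_measurable M"
      by (intro borel_measurable_integrable Bochner_Integration.integrable_sum int)
  qed (rule measurable_hull_angles)
  also have "\<dots> = (\<Sum>k<DIM('a). (-1) ^ (DIM('a) - 1 - k) * expectation (\<lambda>\<omega>. cell_sum n j k (W id \<omega>)))"
    using int by (simp add: Bochner_Integration.integral_sum)
  also have "\<dots> = fact j / fact n * (\<Sum>k<DIM('a). (-1) ^ (DIM('a) - 1 - k) * (real (stirling (n + 1) (k + 1)) * real (Stirling (k + 1) (j + 1))))"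
    unfolding sum_distrib_left
    by (intro sum.cong refl) (simp only: expectation_cell_sum lessThan_iff, simp)
  finally show ?thesis .
qed

end

section \<open>The alternating sums of Stirling products\<close>

text \<open>Up to signs the two triangles of Stirling numbers are inverse matrices.\<close>
lemma stirling_orthogonal:
  assumes "N \<noteq> i"
  shows "(\<Sum>m\<le>N. (-1) ^ m * (int (stirling N m) * int (Stirling m i))) = 0"
  using assms
proof (induction N arbitrary: i)
  case 0
  then show ?case by (cases i) simp_all
next
  case (Suc N)
  let ?T = "\<lambda>i. \<Sum>m\<le>N. (-1) ^ m * (int (stirling N m) * int (Stirling m i))"
  show ?case
  proof (cases i)
    case 0
    have "Stirling m 0 = 0" if "m \<noteq> 0" for m using that by (cases m) simp_all
    then have "(-1) ^ m * (int (stirling (Suc N) m) * int (Stirling m 0)) = 0" for m by (cases m) simp_all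
    then show ?thesis unfolding 0 by (intro sum.neutral ballI)
  next
    case (Suc i')
    \<comment> \<open>With \<open>T N i\<close> for the sum, the recurrences yield \<open>T (N + 1) i = (N - i) * T N i - T N (i - 1)\<close>.\<close>
    have shift: "int N * (\<Sum>m\<le>N. (-1) ^ Suc m * (int (stirling N (Suc m)) * int (Stirling (Suc m) i))) = int N * ?T i"
    proof -
      have "(\<Sum>m\<le>Suc N. (-1) ^ m * (int (stirling N m) * int (Stirling m i))) =
        int (stirling N 0) * int (Stirling 0 i) + (\<Sum>m\<le>N. (-1) ^ Suc m * (int (stirling N (Suc m)) * int (Stirling (Suc m) i)))"
        by (subst sum.atMost_Suc_shift) simp
      moreover have "int (Stirling 0 i) = 0" using Suc by simp
      moreover have "(\<Sum>m\<le>Suc N. (-1) ^ m * (int (stirling N m) * int (Stirling m i))) = ?T i" by simp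
      ultimately show ?thesis by simp
    qed
    have "(\<Sum>m\<le>Suc N. (-1) ^ m * (int (stirling (Suc N) m) * int (Stirling m i))) =
      (\<Sum>m\<le>N. (-1) ^ Suc m * (int (stirling (Suc N) (Suc m)) * int (Stirling (Suc m) i)))"
      by (subst sum.atMost_Suc_shift) simp
    also have "\<dots> = (\<Sum>m\<le>N. int N * ((-1) ^ Suc m * (int (stirling N (Suc m)) * int (Stirling (Suc m) i)))
        - int i * ((-1) ^ m * (int (stirling N m) * int (Stirling m i)))
        - (-1) ^ m * (int (stirling N m) * int (Stirling m i')))"
      by (rule sum.cong[OF refl]) (simp add: Suc algebra_simps)
    also have "\<dots> = int N * (\<Sum>m\<le>N. (-1) ^ Suc m * (int (stirling N (Suc m)) * int (Stirling (Suc m) i))) - int i * ?T i - ?T i'"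
      by (simp only: sum_subtractf sum_distrib_left)
    also have "\<dots> = (int N - int i) * ?T i - ?T i'" unfolding shift by (simp only: left_diff_distrib)
    also have "\<dots> = 0"
    proof -
      have "?T i' = 0" by (rule Suc.IH) (use Suc.prems Suc in simp)
      moreover have "(int N - int i) * ?T i = 0" using Suc.IH[of i] by (cases "N = i") simp_all
      ultimately show ?thesis by simp
    qed
    finally show ?thesis .
  qed
qed

lemma stirling_product_of_nat:
  "stirling_product n (int m) i = real (stirling (n + 1) m) * real (Stirling m i)"
  by (cases "m = 0") (simp_all add: stirling_product_def)

lemma infsum_stirling_product_below:
  "(\<Sum>\<^sub>\<infinity>s\<in>{0..}. (-1) ^ s * stirling_product n (int D - int s) i) =
    (\<Sum>k<D. (-1) ^ (D - 1 - k) * (real (stirling (n + 1) (k + 1)) * real (Stirling (k + 1) i)))"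
proof -
  have "(\<Sum>\<^sub>\<infinity>s\<in>{0..}. (-1) ^ s * stirling_product n (int D - int s) i) =
    (\<Sum>\<^sub>\<infinity>s\<in>{..<D}. (-1) ^ s * stirling_product n (int D - int s) i)"
    by (rule infsum_cong_neutral) (auto simp: stirling_product_def)
  also have "\<dots> = (\<Sum>s<D. (-1) ^ s * stirling_product n (int D - int s) i)" by simp
  also have "\<dots> = (\<Sum>k<D. (-1) ^ (D - 1 - k) * (real (stirling (n + 1) (k + 1)) * real (Stirling (k + 1) i)))"
  proof (rule sum.reindex_bij_witness[of _ "\<lambda>k. D - 1 - k" "\<lambda>s. D - 1 - s"])
    fix s assume s: "s \<in> {..<D}"
    then have eq: "int D - int s = int (D - 1 - s + 1)" "D - 1 - (D - 1 - s) = s" by auto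
    show "(-1) ^ (D - 1 - (D - 1 - s)) * (real (stirling (n + 1) (D - 1 - s + 1)) * real (Stirling (D - 1 - s + 1) i)) =
      (-1) ^ s * stirling_product n (int D - int s) i" by (simp only: eq stirling_product_of_nat)
  qed auto
  finally show ?thesis .
qed

text \<open>The difference of the two sides is, up to sign, the orthogonality relation.\<close>
lemma infsum_stirling_product_above:
  assumes "n + 1 \<noteq> i"
  shows "(\<Sum>\<^sub>\<infinity>s\<in>{1..}. (-1) ^ (s + 1) * stirling_product n (int D + int s) i) =
    (\<Sum>k<D. (-1) ^ (D - 1 - k) * (real (stirling (n + 1) (k + 1)) * real (Stirling (k + 1) i)))"
proof -
  define a where "a m = real (stirling (n + 1) m) * real (Stirling m i)" for m
  have sp: "stirling_product n (int m) i = a m" for m by (simp only: stirling_product_of_nat a_def)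
  have a0: "a m = 0" if "n + 1 < m" for m using that by (simp add: a_def del: stirling.simps)
  have a00: "a 0 = 0" by (simp add: a_def)
  have "(\<Sum>\<^sub>\<infinity>s\<in>{1..}. (-1) ^ (s + 1) * stirling_product n (int D + int s) i) =
    (\<Sum>\<^sub>\<infinity>s\<in>{1..}. (-1) ^ (s + 1) * a (D + s))"
    by (simp only: of_nat_add[symmetric] sp)
  also have "\<dots> = (\<Sum>\<^sub>\<infinity>s\<in>{1..n + 1}. (-1) ^ (s + 1) * a (D + s))"
    by (rule infsum_cong_neutral) (auto simp: a0)
  also have "\<dots> = (\<Sum>s=1..n + 1. (-1) ^ (s + 1) * a (D + s))" by simp
  finally have above: "(\<Sum>\<^sub>\<infinity>s\<in>{1..}. (-1) ^ (s + 1) * stirling_product n (int D + int s) i) = (\<Sum>s=1..n + 1. (-1) ^ (s + 1) * a (D + s))" .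
  have "(\<Sum>m\<le>n + 1. (-1) ^ m * a m) = real_of_int (\<Sum>m\<le>n + 1. (-1) ^ m * (int (stirling (n + 1) m) * int (Stirling m i)))"
    by (simp only: a_def of_int_sum of_int_mult of_int_power of_int_minus of_int_1 of_int_of_nat_eq)
  also have "\<dots> = 0" unfolding stirling_orthogonal[OF assms] by simp
  finally have "0 = (\<Sum>m\<le>n + 1. (-1) ^ m * a m)" by simp
  also have "\<dots> = (\<Sum>m\<in>{..D + (n + 1)}. (-1) ^ m * a m)"
    by (rule sum.mono_neutral_left) (auto simp: a0)
  also have "{..D + (n + 1)} = {..D} \<union> {D + 1..D + (n + 1)}" by auto
  also have "(\<Sum>m\<in>{..D} \<union> {D + 1..D + (n + 1)}. (-1) ^ m * a m) = (\<Sum>m\<le>D. (-1) ^ m * a m) + (\<Sum>m=D + 1..D + (n + 1). (-1) ^ m * a m)"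
    by (rule sum.union_disjoint) auto
  also have "(\<Sum>m\<le>D. (-1) ^ m * a m) = (-1) ^ D * (\<Sum>k<D. (-1) ^ (D - 1 - k) * a (k + 1))"
  proof -
    have "(\<Sum>m\<le>D. (-1) ^ m * a m) = (\<Sum>k<D. (-1) ^ Suc k * a (Suc k))"
      using a00 by (cases D) (simp_all add: sum.atMost_Suc_shift lessThan_Suc_atMost del: sum.atMost_Suc)
    also have "\<dots> = (\<Sum>k<D. (-1) ^ D * ((-1) ^ (D - 1 - k) * a (k + 1)))"
    proof (rule sum.cong[OF refl])
      fix k assume "k \<in> {..<D}"
      then have "D + (D - 1 - k) = Suc k + 2 * (D - 1 - k)" by auto
      then have sg: "(-1 :: real) ^ D * (-1) ^ (D - 1 - k) = (-1) ^ Suc k"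
        by (simp only: power_add[symmetric]) (simp add: power_add power_mult)
      then show "(-1) ^ Suc k * a (Suc k) = (-1) ^ D * ((-1) ^ (D - 1 - k) * a (k + 1))"
        by (simp only: mult.assoc[symmetric] sg Suc_eq_plus1)
    qed
    finally show ?thesis by (simp only: sum_distrib_left)
  qed
  also have "(\<Sum>m=D + 1..D + (n + 1). (-1) ^ m * a m) = - ((-1) ^ D * (\<Sum>s=1..n + 1. (-1) ^ (s + 1) * a (D + s)))"
  proof -
    have "(\<Sum>m=D + 1..D + (n + 1). (-1) ^ m * a m) = (\<Sum>s=1..n + 1. (-1) ^ (D + s) * a (D + s))"
      by (rule sum.reindex_bij_witness[of _ "\<lambda>s. D + s" "\<lambda>m. m - D"]) auto
    then show ?thesis by (simp add: sum_distrib_left sum_negf[symmetric] power_add mult.assoc del: sum.cl_ivl_Suc)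
  qed
  finally have "(-1) ^ D * ((\<Sum>k<D. (-1) ^ (D - 1 - k) * a (k + 1)) - (\<Sum>s=1..n + 1. (-1) ^ (s + 1) * a (D + s))) = 0"
    by (simp only: right_diff_distrib)
  then have "(\<Sum>k<D. (-1) ^ (D - 1 - k) * a (k + 1)) = (\<Sum>s=1..n + 1. (-1) ^ (s + 1) * a (D + s))" by simp
  then show ?thesis unfolding above by (simp only: a_def)
qed

theorem theorem4p12:
  fixes M :: "'w measure" and \<xi> :: "nat \<Rightarrow> 'w \<Rightarrow> real ^ 'd" and n :: nat
  assumes "prob_space M"
    and "CARD('d) \<le> n"
    and "\<And>i. i \<in> {1..n} \<Longrightarrow> \<xi> i \<in> borel_measurable M"
    and "exchangeable M n \<xi>"
    and "general_position M n \<xi>"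
  shows "(\<forall>j<CARD('d). \<forall>k\<in>{j..<CARD('d)}.
            prob_space.expectation M
              (\<lambda>\<omega>. \<Sum>F\<in>faces j (walk_hull \<xi> n \<omega>).
                      conic_intrinsic_volume k (tangent_cone F (walk_hull \<xi> n \<omega>)))
            = fact j / fact n * real (stirling (n + 1) (k + 1)) * real (Stirling (k + 1) (j + 1)))
       \<and> (\<forall>j<CARD('d).
            prob_space.expectation M
              (\<lambda>\<omega>. \<Sum>F\<in>faces j (walk_hull \<xi> n \<omega>).
                      conic_intrinsic_volume (CARD('d)) (tangent_cone F (walk_hull \<xi> n \<omega>)))
            = fact j / fact n *
                (\<Sum>\<^sub>\<infinity>s\<in>{0..}. (-1) ^ s * stirling_product n (int (CARD('d)) - int s) (j + 1))
          \<and> fact j / fact n *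
                (\<Sum>\<^sub>\<infinity>s\<in>{0..}. (-1) ^ s * stirling_product n (int (CARD('d)) - int s) (j + 1))
            = fact j / fact n *
                (\<Sum>\<^sub>\<infinity>s\<in>{1..}. (-1) ^ (s + 1) * stirling_product n (int (CARD('d)) + int s) (j + 1)))"
proof -
  interpret prob_space M by (rule assms(1))
  have D: "DIM(real ^ 'd) = CARD('d)" by simp
  interpret exchangeable_walk M \<xi> n
    by unfold_locales (use assms in simp_all)
  show ?thesis
  proof (intro conjI allI impI ballI)
    fix j k assume "j < CARD('d)" "k \<in> {j..<CARD('d)}"
    then show "expectation (\<lambda>\<omega>. \<Sum>F\<in>faces j (walk_hull \<xi> n \<omega>).
          conic_intrinsic_volume k (tangent_cone F (walk_hull \<xi> n \<omega>)))
        = fact j / fact n * real (stirling (n + 1) (k + 1)) * real (Stirling (k + 1) (j + 1))"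
      using expectation_hull_angles[of j k] unfolding D hull_angles_def[abs_def] by simp
  next
    fix j assume j: "j < CARD('d)"
    show "expectation (\<lambda>\<omega>. \<Sum>F\<in>faces j (walk_hull \<xi> n \<omega>).
          conic_intrinsic_volume (CARD('d)) (tangent_cone F (walk_hull \<xi> n \<omega>)))
        = fact j / fact n * (\<Sum>\<^sub>\<infinity>s\<in>{0..}. (-1) ^ s * stirling_product n (int (CARD('d)) - int s) (j + 1))"
      using expectation_hull_angles_full[of j] j unfolding D hull_angles_def[abs_def] infsum_stirling_product_below by simp
    have "n + 1 \<noteq> j + 1" using j assms(2) by simp
    from infsum_stirling_product_above[OF this, of "CARD('d)"]
    show "fact j / fact n * (\<Sum>\<^sub>\<infinity>s\<in>{0..}. (-1) ^ s * stirling_product n (int (CARD('d)) - int s) (j + 1))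
        = fact j / fact n * (\<Sum>\<^sub>\<infinity>s\<in>{1..}. (-1) ^ (s + 1) * stirling_product n (int (CARD('d)) + int s) (j + 1))"
      unfolding infsum_stirling_product_below by (simp only:)
  qed
qed

end
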